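(* In the setting described in the context, the inclusion process $\{\eta_N(t)\}_{t\ge0}$ is metastable in the following sense. (1) For any $x\in\mathscr{V}$, the laws $\mathbf{Q}^N_{\xi^x_N}$ of the order process converge weakly (in the Skorokhod topology on $D([0,\infty);\mathscr{V}_{\mathfrak{d}})$) to $\mathbf{Q}_x$ as $N\to\infty$. (2) For each $x\in\mathscr{V}$ and $T>0$, $$\lim_{N\to\infty}\mathrm{E}^{\mathbb{Q}^N_{\xi^x_N}}\Big[\int_0^T\mathbf{1}\{\eta_N(t)\notin\mathcal{E}_N\}\,\mathrm{d}t\Big]=0.$$
   Context: $\mathscr{G}=(\mathscr{V},\mathscr{E})$ is a countably infinite (or finite) connected graph that is uniformly locally finite: $\sup_{x\in\mathscr{V}}|\mathscr{N}_x|<\infty$, where $\mathscr{N}_x:=\{y\in\mathscr{V}:\{x,y\}\in\mathscr{E}\}$. Symmetric edge weights $(c_{xy})_{x,y\in\mathscr{V}}$ and site weights $(\alpha_x)_{x\in\mathscr{V}}$ are given with: $c_{xy}>0$ if and only if $\{x,y\}\in\mathscr{E}$ (and $c_{xy}=0$ otherwise); $\alpha_x>0$ for all $x$; $\sup_x\alpha_x<\infty$, $\inf_x\alpha_x>0$, $\sup_{x,y}c_{xy}<\infty$. With $\mathbb{N}=\{0,1,2,\dots\}$, let $\Omega_N:=\{\eta\in\mathbb{N}^{\mathscr{V}}:\sum_{x\in\mathscr{V}}\eta_x=N\}$ (discrete topology). Let $\epsilon_N>0$ satisfy $\lim_{N\to\infty}\epsilon_N N\log N=0$. The inclusion process $\{\eta_N(t)\}_{t\ge0}$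 is the continuous-time Markov chain on $\Omega_N$ with generator $$\mathscr{L}_NF(\eta)=\sum_{x,y\in\mathscr{V}}c_{xy}\,\eta_x\,(\alpha_y+\epsilon_N^{-1}\eta_y)\,\big(F(\eta-\delta_x+\delta_y)-F(\eta)\big),$$ where $\delta_z(w)=\mathbf{1}\{z=w\}$. $\mathbb{Q}^N_\eta$ is its law started at $\eta\in\Omega_N$, and $\mathrm{E}^Q$ denotes expectation under $Q$. For $x\in\mathscr{V}$, $\xi^x_N\in\Omega_N$ is the configuration with $(\xi^x_N)_x=N$ and $(\xi^x_N)_y=0$ for $y\ne x$. Set $\mathcal{E}^x_N:=\{\xi^x_N\}$ and $\mathcal{E}_N:=\bigcup_{x\in\mathscr{V}}\mathcal{E}^x_N$. Trace and order processes: $T_N(t):=\int_0^t\mathbf{1}\{\eta_N(s)\in\mathcal{E}_N\}\,\mathrm{d}s$, $S_N(t):=\sup\{s\ge0:T_N(s)\le t\}\in[0,\infty]$; with $\mathfrak{d}$ a cemetery point, $\eta^{\mathrm{tr}}_N(t):=\eta_N(S_N(t))$ if $S_N(t)<\infty$ and $\eta_N^{\mathrm{tr}}(t):=\mathfrak{d}$ otherwise. Let $\mathscr{V}_{\mathfrak{d}}:=\mathscr{V}\cup\{\mathfrak{d}\}$ (discrete), $\Phi_N(\xi^x_N):=x$, $\Phi_N(\mathfrak{d}):=\mathfrak{d}$, $Y_N(t):=\Phi_N(\eta^{\mathrm{tr}}_N(t))$. $\mathbf{Q}^N_\eta$ is the law of $\{Y_N(t)\}_{t\ge0}$ on $D([0,\infty);\mathscr{V}_{\mathfrak{d}})$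 when $\eta_N$ starts from $\eta$. Limit chain: $\{\mathbf{y}(t)\}_{t\ge0}$ is the weighted random walk with generator $\mathfrak{L}$ acting on $C_0(\mathscr{V}_{\mathfrak{d}})$ by $\mathfrak{L}f(x)=\sum_{y\in\mathscr{V}}c_{xy}\alpha_y(f(y)-f(x))$ for $x\in\mathscr{V}$ and $\mathfrak{L}f(\mathfrak{d})=0$. $\mathbf{Q}_x$ is its law on $D([0,\infty);\mathscr{V}_{\mathfrak{d}})$ started at $x\in\mathscr{V}$. *)

theory Defs
  imports "HOL-Probability.Probability" "HOL-Probability.Discrete_Topology"
begin

section \<open>Skorokhod space and weak convergence\<close>

definition cadlag :: "(real \<Rightarrow> 'a::topological_space) \<Rightarrow> bool" where
  "cadlag f \<longleftrightarrow> (\<forall>t\<ge>0. continuous (at_right t) f) \<and> (\<forall>t>0. \<exists>l. (f \<longlongrightarrow> l) (at_left t))"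

lemma cadlag_restrict_const: "cadlag (restrict (\<lambda>_. a) {0..})"
  unfolding cadlag_def
proof (intro conjI allI impI)
  fix t :: real assume t: "0 \<le> t"
  have "((\<lambda>_. a) \<longlongrightarrow> a) (at_right t)" by simp
  moreover have "eventually (\<lambda>s. (\<lambda>_. a) s = restrict (\<lambda>_. a) {0..} s) (at_right t)"
    using t by (auto simp: eventually_at_filter)
  ultimately have "(restrict (\<lambda>_. a) {0..} \<longlongrightarrow> a) (at_right t)"
    by (rule Lim_transform_eventually)
  then show "continuous (at_right t) (restrict (\<lambda>_. a) {0..})"
    using t by (simp add: continuous_within)
next
  fix t :: real assume t: "0 < t"
  have "((\<lambda>_. a) \<longlongrightarrow> a) (at_left t)" by simp
  moreover have "eventually (\<lambda>s. (\<lambda>_. a) s = restrict (\<lambda>_. a) {0..} s) (at_left t)"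
    using eventually_at_left_real[OF t] by eventually_elim auto
  ultimately have "(restrict (\<lambda>_. a) {0..} \<longlongrightarrow> a) (at_left t)"
    by (rule Lim_transform_eventually)
  then show "\<exists>l. (restrict (\<lambda>_. a) {0..} \<longlongrightarrow> l) (at_left t)" ..
qed

text \<open>The space \<open>D([0,\<infinity>); 'a)\<close>; paths carry no information at negative times.\<close>

typedef (overloaded) 'a skorokhod =
  "{f :: real \<Rightarrow> 'a::topological_space. cadlag f \<and> f \<in> extensional {0..}}"
  morphisms path_at Abs_skorokhod
  using cadlag_restrict_const by blast

text \<open>
  Functions that are not cadlag on \<open>[0,\<infinity>)\<close> are sent to a fixed path. This is needed because
  the order process below is cadlag only almost surely: if the total time spent in the condensed
  configurations is finite but these are visited infinitely often, the left limit at the time of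
  absorption in the cemetery may fail to exist.
\<close>

definition skorokhod_of :: "(real \<Rightarrow> 'a::topological_space) \<Rightarrow> 'a skorokhod" where
  "skorokhod_of f =
     Abs_skorokhod (restrict (if cadlag f then f else (\<lambda>_. undefined)) {0..})"

definition time_changes :: "(real \<Rightarrow> real) set" where
  "time_changes = {l. strict_mono_on {0..} l \<and> l ` {0..} = {0..}}"

definition skorokhod_nbhd :: "'a::metric_space skorokhod \<Rightarrow> real \<Rightarrow> real \<Rightarrow> 'a skorokhod set" where
  "skorokhod_nbhd f T e =
     {g. \<exists>l\<in>time_changes. \<forall>t\<in>{0..T}. \<bar>l t - t\<bar> < e \<and> dist (path_at g t) (path_at f (l t)) < e}"

text \<open>
  The Skorokhod (J1) topology: the sets \<open>skorokhod_nbhd f T e\<close> form a neighbourhood base at \<open>f\<close>.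
  The corresponding convergence \<open>g\<^sub>n \<rightarrow> f\<close> is the usual one: for every \<open>T\<close> there are time changes
  \<open>l\<^sub>n\<close> with \<open>sup\<^bsub>t \<le> T\<^esub> \<bar>l\<^sub>n(t) - t\<bar> \<rightarrow> 0\<close> and \<open>sup\<^bsub>t \<le> T\<^esub> dist (g\<^sub>n(t)) (f(l\<^sub>n(t))) \<rightarrow> 0\<close>
  (Ethier and Kurtz, Markov Processes, Proposition 3.5.3(c)).
\<close>

instantiation skorokhod :: (metric_space) topological_space
begin

definition open_skorokhod :: "'a skorokhod set \<Rightarrow> bool" where
  "open_skorokhod U \<longleftrightarrow> (\<forall>f\<in>U. \<exists>T>0. \<exists>e>0. skorokhod_nbhd f T e \<subseteq> U)"

instance
proof
  show "open (UNIV :: 'a skorokhod set)"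
    unfolding open_skorokhod_def using zero_less_one by blast
next
  fix U V :: "'a skorokhod set"
  assume U: "open U" and V: "open V"
  show "open (U \<inter> V)"
    unfolding open_skorokhod_def
  proof
    fix f assume "f \<in> U \<inter> V"
    then obtain T e T' e' where *: "0 < T" "0 < e" "skorokhod_nbhd f T e \<subseteq> U"
        "0 < T'" "0 < e'" "skorokhod_nbhd f T' e' \<subseteq> V"
      using U V unfolding open_skorokhod_def by (metis IntE)
    have "skorokhod_nbhd f (max T T') (min e e') \<subseteq> skorokhod_nbhd f T e \<inter> skorokhod_nbhd f T' e'"
      unfolding skorokhod_nbhd_def by fastforce
    moreover have "0 < max T T'" "0 < min e e'" using * by auto
    ultimately show "\<exists>T>0. \<exists>e>0. skorokhod_nbhd f T e \<subseteq> U \<inter> V"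
      using * by (meson Int_mono order_trans)
  qed
next
  fix K :: "'a skorokhod set set"
  assume "\<forall>U\<in>K. open U"
  then show "open (\<Union>K)"
    unfolding open_skorokhod_def by (metis Union_iff Sup_upper order_trans)
qed

end

definition weakly_converges ::
    "(nat \<Rightarrow> 'a::topological_space measure) \<Rightarrow> 'a measure \<Rightarrow> bool" where
  "weakly_converges \<mu> \<nu> \<longleftrightarrow>
     (\<forall>f :: 'a \<Rightarrow> real. continuous_on UNIV f \<and> bounded (range f) \<longrightarrow>
        (\<lambda>n. \<integral>z. f z \<partial>\<mu> n) \<longlonglongrightarrow> (\<integral>z. f z \<partial>\<nu>))"


section \<open>Continuous-time Markov chains on a countable discrete state space\<close>

text \<open>\<open>C\<^sub>0(S)\<close> for discrete \<open>S\<close>, where the compact sets are the finite ones.\<close>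

definition C0 :: "'s set \<Rightarrow> ('s \<Rightarrow> real) set" where
  "C0 S = {f. \<forall>e>0. finite {x\<in>S. e \<le> \<bar>f x\<bar>}}"

definition markov_semigroup :: "'s set \<Rightarrow> (real \<Rightarrow> 's \<Rightarrow> 's pmf) \<Rightarrow> bool" where
  "markov_semigroup S P \<longleftrightarrow>
     (\<forall>t\<ge>0. \<forall>x\<in>S. set_pmf (P t x) \<subseteq> S) \<and>
     (\<forall>x\<in>S. P 0 x = return_pmf x) \<and>
     (\<forall>s\<ge>0. \<forall>t\<ge>0. \<forall>x\<in>S. P (s + t) x = bind_pmf (P s x) (P t))"

definition has_generator ::
    "'s set \<Rightarrow> (real \<Rightarrow> 's \<Rightarrow> 's pmf) \<Rightarrow> (('s \<Rightarrow> real) \<Rightarrow> 's \<Rightarrow> real) \<Rightarrow> bool" where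
  "has_generator S P L \<longleftrightarrow>
     (\<forall>f\<in>C0 S. uniform_limit S
        (\<lambda>t x. (measure_pmf.expectation (P t x) f - f x) / t) (\<lambda>x. L f x) (at_right 0))"

definition past :: "'w measure \<Rightarrow> 's set \<Rightarrow> (real \<Rightarrow> 'w \<Rightarrow> 's) \<Rightarrow> real \<Rightarrow> 'w set set" where
  "past M S X s =
     sigma_sets (space M) {X u -` {z} \<inter> space M | u z. 0 \<le> u \<and> u \<le> s \<and> z \<in> S}"

text \<open>
  \<open>X\<close> is a realisation, on the probability space \<open>M\<close>, of the Markov chain on \<open>S\<close> with generator
  \<open>L\<close> started at \<open>x\<^sub>0\<close>. The law of \<open>X\<close> is determined by this whenever \<open>L\<close> is a bounded operator
  on \<open>C\<^sub>0(S)\<close>, as is the case for both generators below.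
\<close>

definition markov_chain ::
    "'w measure \<Rightarrow> 's set \<Rightarrow> (('s \<Rightarrow> real) \<Rightarrow> 's \<Rightarrow> real) \<Rightarrow> (real \<Rightarrow> 'w \<Rightarrow> 's) \<Rightarrow> 's \<Rightarrow> bool" where
  "markov_chain M S L X x\<^sub>0 \<longleftrightarrow>
     prob_space M \<and>
     (\<forall>t\<ge>0. X t \<in> measurable M (count_space S)) \<and>
     (\<forall>\<omega>\<in>space M. cadlag (\<lambda>t. discrete (X t \<omega>))) \<and>
     (AE \<omega> in M. X 0 \<omega> = x\<^sub>0) \<and>
     (\<exists>P. markov_semigroup S P \<and> has_generator S P L \<and>
        (\<forall>s\<ge>0. \<forall>t\<ge>0. \<forall>A\<in>past M S X s. \<forall>x\<in>S. \<forall>y\<in>S.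
           measure M {\<omega>\<in>A. X s \<omega> = x \<and> X (s + t) \<omega> = y}
             = measure M {\<omega>\<in>A. X s \<omega> = x} * pmf (P t x) y))"

definition path_law :: "'w measure \<Rightarrow> (real \<Rightarrow> 'w \<Rightarrow> 's) \<Rightarrow> 's discrete skorokhod measure" where
  "path_law M X = distr M borel (\<lambda>\<omega>. skorokhod_of (\<lambda>t. discrete (X t \<omega>)))"


section \<open>Weighted graphs\<close>

text \<open>
  The vertex set is the whole (countable) type. Edges are unordered pairs; loops are not excluded,
  but they contribute nothing to either generator.
\<close>

definition nbrs :: "'v set set \<Rightarrow> 'v \<Rightarrow> 'v set" where
  "nbrs E x = {y. {x, y} \<in> E}"

definition connected_graph :: "'v set set \<Rightarrow> bool" where
  "connected_graph E \<longleftrightarrow> E \<subseteq> {{x, y} | x y. True} \<and> (\<forall>x y. (x, y) \<in> {(a, b). {a, b} \<in> E}\<^sup>*)"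

definition uniformly_locally_finite :: "'v set set \<Rightarrow> bool" where
  "uniformly_locally_finite E \<longleftrightarrow> (\<exists>d. \<forall>x. finite (nbrs E x) \<and> card (nbrs E x) \<le> d)"

definition admissible_weights ::
    "'v set set \<Rightarrow> ('v \<Rightarrow> 'v \<Rightarrow> real) \<Rightarrow> ('v \<Rightarrow> real) \<Rightarrow> bool" where
  "admissible_weights E c \<alpha> \<longleftrightarrow>
     (\<forall>x y. c x y = c y x) \<and>
     (\<forall>x y. if {x, y} \<in> E then c x y > 0 else c x y = 0) \<and>
     bdd_above (range (\<lambda>(x, y). c x y)) \<and>
     (\<forall>x. \<alpha> x > 0) \<and> bdd_above (range \<alpha>) \<and> (INF x. \<alpha> x) > 0"


section \<open>The inclusion process\<close>

definition configurations :: "nat \<Rightarrow> ('v \<Rightarrow> nat) set" where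
  "configurations N = {\<eta>. finite {x. \<eta> x \<noteq> 0} \<and> (\<Sum>x | \<eta> x \<noteq> 0. \<eta> x) = N}"

text \<open>\<open>\<eta> - \<delta>\<^sub>x + \<delta>\<^sub>y\<close>; the truncated subtraction only matters for \<open>\<eta> x = 0\<close>, where the rate is 0.\<close>

definition move :: "('v \<Rightarrow> nat) \<Rightarrow> 'v \<Rightarrow> 'v \<Rightarrow> 'v \<Rightarrow> nat" where
  "move \<eta> x y = (\<lambda>w. \<eta> w - of_bool (w = x) + of_bool (w = y))"

text \<open>For \<open>\<eta>\<close> with finite support only finitely many terms of the sum are nonzero.\<close>

definition inclusion_generator ::
    "('v \<Rightarrow> 'v \<Rightarrow> real) \<Rightarrow> ('v \<Rightarrow> real) \<Rightarrow> real \<Rightarrow> (('v \<Rightarrow> nat) \<Rightarrow> real) \<Rightarrow> ('v \<Rightarrow> nat) \<Rightarrow> real" where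
  "inclusion_generator c \<alpha> \<epsilon> F \<eta> =
     (\<Sum>\<^sub>\<infinity>(x, y)\<in>UNIV. c x y * real (\<eta> x) * (\<alpha> y + real (\<eta> y) / \<epsilon>) * (F (move \<eta> x y) - F \<eta>))"

definition condensate :: "nat \<Rightarrow> 'v \<Rightarrow> 'v \<Rightarrow> nat" where
  "condensate N x = (\<lambda>y. if y = x then N else 0)"

definition condensates :: "nat \<Rightarrow> ('v \<Rightarrow> nat) set" where
  "condensates N = range (condensate N)"


section \<open>Trace and order processes\<close>

text \<open>
  The functions below act on a single trajectory \<open>\<eta>\<close>. The cemetery point is \<open>None\<close>.
\<close>

definition occupation_time :: "nat \<Rightarrow> (real \<Rightarrow> 'v \<Rightarrow> nat) \<Rightarrow> real \<Rightarrow> real" where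
  "occupation_time N \<eta> t = (LINT s:{0..t}|lborel. indicator (condensates N) (\<eta> s))"

definition inverse_occupation_time :: "nat \<Rightarrow> (real \<Rightarrow> 'v \<Rightarrow> nat) \<Rightarrow> real \<Rightarrow> ereal" where
  "inverse_occupation_time N \<eta> t = (SUP s\<in>{s. 0 \<le> s \<and> occupation_time N \<eta> s \<le> t}. ereal s)"

definition trace_process :: "nat \<Rightarrow> (real \<Rightarrow> 'v \<Rightarrow> nat) \<Rightarrow> real \<Rightarrow> ('v \<Rightarrow> nat) option" where
  "trace_process N \<eta> t =
     (if inverse_occupation_time N \<eta> t < \<infinity>
      then Some (\<eta> (real_of_ereal (inverse_occupation_time N \<eta> t))) else None)"

text \<open>
  \<open>\<Phi>\<^sub>N\<close>, for \<open>N > 0\<close>. By right continuity the trace process takes values in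
  \<open>Some ` condensates N \<union> {None}\<close> only, so the value on other configurations is irrelevant.
\<close>

definition condensate_site :: "nat \<Rightarrow> ('v \<Rightarrow> nat) option \<Rightarrow> 'v option" where
  "condensate_site N = map_option (\<lambda>\<zeta>. THE x. \<zeta> = condensate N x)"

definition order_process :: "nat \<Rightarrow> (real \<Rightarrow> 'v \<Rightarrow> nat) \<Rightarrow> real \<Rightarrow> 'v option" where
  "order_process N \<eta> t = condensate_site N (trace_process N \<eta> t)"


section \<open>The limiting chain\<close>

definition limit_generator ::
    "('v \<Rightarrow> 'v \<Rightarrow> real) \<Rightarrow> ('v \<Rightarrow> real) \<Rightarrow> ('v option \<Rightarrow> real) \<Rightarrow> 'v option \<Rightarrow> real" where
  "limit_generator c \<alpha> f z =
     (case z of None \<Rightarrow> 0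
      | Some x \<Rightarrow> (\<Sum>\<^sub>\<infinity>y. c x y * \<alpha> y * (f (Some y) - f (Some x))))"

end

theory Submission
  imports Defs
begin

text \<open>
  On linear functions \<open>\<eta> \<mapsto> \<Sum>\<^sub>a k\<^sub>a \<eta>\<^sub>a\<close> the interaction cancels, so the mean fraction of particles at \<open>y\<close>,
  started from the condensate at \<open>x\<close>, is exactly the transition probability of the limit chain. A
  quadratic supersolution, in which the attraction \<open>c\<^sub>a\<^sub>b / \<epsilon>\<close> appears as damping, shows that at a fixed time
  the process is not condensed with probability \<open>O(\<epsilon> N)\<close> only. This gives part (2), and since on condensed
  configurations the fraction of particles at \<open>y\<close> is an indicator, also the convergence of the finite-dimensional
  distributions. The mass outside a site grows in mean at most linearly, uniformly in \<open>N\<close>; hence two changes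
  of condensate within time \<open>h\<close> have probability \<open>O(h\<^sup>2)\<close>. Up to an event of small probability the order
  process is therefore Skorokhod-close to the step path through its values on a grid, whose law converges,
  and this yields the lower bound for open sets in the portmanteau theorem.
\<close>

section \<open>Markov chains with bounded rates\<close>

text \<open>The obstacle is that for the particle system the total jump rate is bounded only by a
  quantity of order N^2 / \<epsilon>, so an estimate that has to survive the limit must avoid this
  bound. It serves qualitatively: the generator is a bounded operator for fixed \<open>N\<close>,
  the semigroup has Taylor expansions with error C h^2, and differential inequalities in time become
  Euler schemes whose total error n C h^2 vanishes with the mesh h = T / n. The constants that
  remain are \<open>Q\<close>, which bounds the rates of the limit chain, and \<open>A\<close>; both
  come from uniform local finiteness and the bounds on the weights. Path estimates are made for the
  particle system on dyadic time grids and carried to real times by right continuity. The order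
  process runs on the clock that counts condensed time; this clock lags behind real time by the time
  spent outside, which a Skorokhod time change absorbs. The lower bound for an open set involves
  only finitely many strings of grid values, chosen from the limit chain before \<open>N\<close>, so
  convergence of transition probabilities over one grid step can be inserted term by term.\<close>

locale bounded_chain =
  fixes S :: "'s set" and P :: "real \<Rightarrow> 's \<Rightarrow> 's pmf" and L :: "('s \<Rightarrow> real) \<Rightarrow> 's \<Rightarrow> real"
    and I :: "'s \<Rightarrow> 'i set" and r :: "'s \<Rightarrow> 'i \<Rightarrow> real" and m :: "'s \<Rightarrow> 'i \<Rightarrow> 's" and R :: real
  assumes countable_states: "countable S"
    and semigroup: "markov_semigroup S P"
    and generator: "has_generator S P L"
    and L_eq: "\<And>f z. z \<in> S \<Longrightarrow> L f z = (\<Sum>i\<in>I z. r z i * (f (m z i) - f z))"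
    and r_nonneg: "\<And>z i. z \<in> S \<Longrightarrow> i \<in> I z \<Longrightarrow> 0 \<le> r z i"
    and m_in: "\<And>z i. z \<in> S \<Longrightarrow> i \<in> I z \<Longrightarrow> m z i \<in> S"
    and r_bound: "\<And>z. z \<in> S \<Longrightarrow> (\<Sum>i\<in>I z. r z i) \<le> R"
    and R_nonneg: "0 \<le> R"
begin

section \<open>The semigroup acting on functions bounded on \<open>S\<close>\<close>

definition sg :: "real \<Rightarrow> ('s \<Rightarrow> real) \<Rightarrow> 's \<Rightarrow> real" where
  "sg t f z = measure_pmf.expectation (P t z) f"

lemma set_pmf_P: "0 \<le> t \<Longrightarrow> z \<in> S \<Longrightarrow> set_pmf (P t z) \<subseteq> S"
  and P_0: "z \<in> S \<Longrightarrow> P 0 z = return_pmf z"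
  and P_add: "0 \<le> s \<Longrightarrow> 0 \<le> t \<Longrightarrow> z \<in> S \<Longrightarrow> P (s + t) z = bind_pmf (P s z) (P t)"
  using semigroup unfolding markov_semigroup_def by auto

lemma AE_P: "0 \<le> t \<Longrightarrow> z \<in> S \<Longrightarrow> AE w in measure_pmf (P t z). w \<in> S"
  using set_pmf_P by (auto simp: AE_measure_pmf_iff)

lemma integrable_P:
  fixes f :: "'s \<Rightarrow> real"
  assumes "0 \<le> t" "z \<in> S" "\<And>w. w \<in> S \<Longrightarrow> \<bar>f w\<bar> \<le> B"
  shows "integrable (measure_pmf (P t z)) f"
  by (rule measure_pmf.integrable_const_bound[where B=B])
     (use AE_P[OF assms(1,2)] assms(3) in \<open>auto elim!: eventually_mono\<close>)

lemma sg_cong: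
  assumes "0 \<le> t" "z \<in> S" "\<And>w. w \<in> S \<Longrightarrow> f w = g w"
  shows "sg t f z = sg t g z"
  unfolding sg_def
  by (rule integral_cong_AE) (use AE_P[OF assms(1,2)] assms(3) in \<open>auto elim!: eventually_mono\<close>)

lemma sg_mono:
  assumes "0 \<le> t" "z \<in> S" "\<And>w. w \<in> S \<Longrightarrow> \<bar>f w\<bar> \<le> B" "\<And>w. w \<in> S \<Longrightarrow> \<bar>g w\<bar> \<le> B'"
    "\<And>w. w \<in> S \<Longrightarrow> f w \<le> g w"
  shows "sg t f z \<le> sg t g z"
  unfolding sg_def
  by (rule integral_mono_AE)
     (use integrable_P[OF assms(1,2)] assms(3-5) AE_P[OF assms(1,2)] in \<open>auto elim!: eventually_mono\<close>)

lemma sg_const [simp]: "sg t (\<lambda>_. a) z = a"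
  by (simp add: sg_def)

lemma sg_add:
  assumes "0 \<le> t" "z \<in> S" "\<And>w. w \<in> S \<Longrightarrow> \<bar>f w\<bar> \<le> B" "\<And>w. w \<in> S \<Longrightarrow> \<bar>g w\<bar> \<le> B'"
  shows "sg t (\<lambda>w. f w + g w) z = sg t f z + sg t g z"
  unfolding sg_def using assms by (intro Bochner_Integration.integral_add integrable_P)

lemma sg_diff:
  assumes "0 \<le> t" "z \<in> S" "\<And>w. w \<in> S \<Longrightarrow> \<bar>f w\<bar> \<le> B" "\<And>w. w \<in> S \<Longrightarrow> \<bar>g w\<bar> \<le> B'"
  shows "sg t (\<lambda>w. f w - g w) z = sg t f z - sg t g z"
  unfolding sg_def using assms by (intro Bochner_Integration.integral_diff integrable_P)

lemma sg_cmult: "sg t (\<lambda>w. a * f w) z = a * sg t f z"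
  unfolding sg_def by simp

lemma sg_bound:
  assumes "0 \<le> t" "z \<in> S" "\<And>w. w \<in> S \<Longrightarrow> \<bar>f w\<bar> \<le> B"
  shows "\<bar>sg t f z\<bar> \<le> B"
proof -
  have "0 \<le> B" using assms(2,3) abs_ge_zero order_trans by blast
  have "sg t f z \<le> sg t (\<lambda>_. B) z" "sg t (\<lambda>_. - B) z \<le> sg t f z"
    using assms \<open>0 \<le> B\<close> by (intro sg_mono[where B=B and B'=B]; force simp: abs_le_iff)+
  then show ?thesis by simp
qed

lemma sg_0: "z \<in> S \<Longrightarrow> sg 0 f z = f z"
  by (simp add: sg_def P_0)

lemma sg_semigroup:
  assumes "0 \<le> s" "0 \<le> t" "z \<in> S" and B: "\<And>w. w \<in> S \<Longrightarrow> \<bar>f w\<bar> \<le> B"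
  shows "sg (s + t) f z = sg s (sg t f) z"
proof -
  \<comment> \<open>\<open>f\<close> is bounded only on \<open>S\<close>, while integration against
    a bind asks for a bound on the whole type. Cutting off outside \<open>S\<close> changes no
    expectation, because the transition laws live on \<open>S\<close>.\<close>
  define g where "g = (\<lambda>w. if w \<in> S then f w else 0)"
  have "0 \<le> B" using assms(3,4) abs_ge_zero order_trans by blast
  then have gB: "\<bar>g w\<bar> \<le> B" for w using B by (auto simp: g_def)
  have "sg (s + t) f z = sg (s + t) g z"
    using assms by (intro sg_cong) (auto simp: g_def)
  also have "\<dots> = (\<integral>w. measure_pmf.expectation (P t w) g \<partial>measure_pmf (P s z))"
    unfolding sg_def P_add[OF assms(1-3)] measure_pmf_bind
    by (rule integral_bind[where K = "count_space UNIV" and B = B and B' = 1])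
       (use gB measurable_measure_pmf[of "P t"] in \<open>auto simp: measure_pmf.emeasure_space_1 measure_pmf.finite_measure_axioms\<close>)
  also have "\<dots> = sg s (sg t g) z" by (simp add: sg_def[abs_def])
  also have "\<dots> = sg s (sg t f) z"
    using assms by (intro sg_cong) (auto simp: g_def intro!: sg_cong)
  finally show ?thesis .
qed

text \<open>A jump changes \<open>f\<close> by at most \<open>2 * B\<close>, and the rates add up to
  at most \<open>R\<close>. By \<open>L_eq\<close> this makes \<open>L\<close> bounded on all
  functions bounded on \<open>S\<close>, not only on \<open>C0 S\<close>.\<close>

lemma L_bound:
  assumes "z \<in> S" "\<And>w. w \<in> S \<Longrightarrow> \<bar>f w\<bar> \<le> B"
  shows "\<bar>L f z\<bar> \<le> 2 * R * B"
proof -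
  have B: "0 \<le> B" using assms abs_ge_zero order_trans by blast
  have "\<bar>L f z\<bar> \<le> (\<Sum>i\<in>I z. r z i * (2 * B))"
    unfolding L_eq[OF assms(1)]
  proof (rule order_trans[OF sum_abs], rule sum_mono)
    fix i assume i: "i \<in> I z"
    have "\<bar>f (m z i) - f z\<bar> \<le> 2 * B"
      using assms(2)[OF m_in[OF assms(1) i]] assms(2)[OF assms(1)] by linarith
    then show "\<bar>r z i * (f (m z i) - f z)\<bar> \<le> r z i * (2 * B)"
      using r_nonneg[OF assms(1) i] by (simp add: abs_mult mult_left_mono)
  qed
  also have "\<dots> = (\<Sum>i\<in>I z. r z i) * (2 * B)" by (simp add: sum_distrib_right)
  also have "\<dots> \<le> R * (2 * B)" using r_bound[OF assms(1)] B by (intro mult_right_mono) auto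
  finally show ?thesis by simp
qed

section \<open>From \<open>C0 S\<close> to bounded functions, and small-time expansions\<close>

lemma sg_bounded_lim:
  assumes "0 \<le> t" "z \<in> S" "\<And>n w. w \<in> S \<Longrightarrow> \<bar>f n w\<bar> \<le> B"
    "\<And>w. w \<in> S \<Longrightarrow> (\<lambda>n. f n w) \<longlonglongrightarrow> g w"
  shows "(\<lambda>n. sg t (f n) z) \<longlonglongrightarrow> sg t g z"
  unfolding sg_def
  by (rule integral_dominated_convergence[where w = "\<lambda>_. B"])
     (use AE_P[OF assms(1,2)] assms(3-4) in \<open>auto elim!: eventually_mono\<close>)

lemma L_lim:
  assumes "z \<in> S" "\<And>w. w \<in> S \<Longrightarrow> (\<lambda>n. f n w) \<longlonglongrightarrow> g w"
  shows "(\<lambda>n. L (f n) z) \<longlonglongrightarrow> L g z"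
  unfolding L_eq[OF assms(1)]
  using assms m_in by (intro tendsto_sum tendsto_mult tendsto_diff tendsto_const) auto

lemma finite_support_approx:
  obtains F :: "nat \<Rightarrow> 's set" where "\<And>n. finite (F n)"
    "\<And>f w. w \<in> S \<Longrightarrow> (\<lambda>n. f w * indicator (F n) w) \<longlonglongrightarrow> (f w :: real)"
proof (cases "S = {}")
  case True
  then show ?thesis using that[of "\<lambda>_. {}"] by auto
next
  case False
  define F where "F n = from_nat_into S ` {..n}" for n
  have "(\<lambda>n. f w * indicator (F n) w) \<longlonglongrightarrow> (f w :: real)" if w: "w \<in> S" for f w
  proof (rule tendsto_eventually)
    have "w = from_nat_into S (to_nat_on S w)" using countable_states w by simp
    then have "w \<in> F n" if "to_nat_on S w \<le> n" for n using that unfolding F_def by blast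
    then show "\<forall>\<^sub>F n in sequentially. f w * indicator (F n) w = f w"
      by (intro eventually_sequentiallyI[of "to_nat_on S w"]) simp
  qed
  then show ?thesis using that[of F] by (auto simp: F_def)
qed

lemma C0_finite: "finite F \<Longrightarrow> (\<lambda>w. f w * indicator F w) \<in> C0 S"
  unfolding C0_def by (auto intro!: finite_subset[of _ F] simp: indicator_def split: if_splits)

lemma generator_step:
  assumes "f \<in> C0 S" "0 < e"
  obtains d where "0 < d" "\<And>h z. 0 < h \<Longrightarrow> h < d \<Longrightarrow> z \<in> S \<Longrightarrow> \<bar>sg h f z - f z - h * L f z\<bar> \<le> h * e"
proof -
  have "\<forall>\<^sub>F t in at_right 0. \<forall>z\<in>S. dist ((sg t f z - f z) / t) (L f z) < e"
    using generator assms unfolding has_generator_def uniform_limit_iff sg_def by blast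
  then obtain d where d: "0 < d"
    "\<And>h z. 0 < h \<Longrightarrow> h < d \<Longrightarrow> z \<in> S \<Longrightarrow> dist ((sg h f z - f z) / h) (L f z) < e"
    by (auto simp: eventually_at_right_field)
  have "\<bar>sg h f z - f z - h * L f z\<bar> \<le> h * e" if "0 < h" "h < d" "z \<in> S" for h z
  proof -
    have "\<bar>sg h f z - f z - h * L f z\<bar> = h * dist ((sg h f z - f z) / h) (L f z)"
      using that(1) by (simp add: dist_real_def abs_mult_pos' field_simps)
    also have "\<dots> \<le> h * e" using d(2)[OF that] that(1) by (intro mult_left_mono) auto
    finally show ?thesis .
  qed
  then show ?thesis using d(1) that by blast
qed

lemma sg_telescope:
  assumes "0 \<le> h" "z \<in> S" "\<And>w. w \<in> S \<Longrightarrow> \<bar>f w\<bar> \<le> B"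
  shows "sg (real n * h) f z - f z = (\<Sum>k<n. sg (real k * h) (\<lambda>w. sg h f w - f w) z)"
proof (induction n)
  case 0
  then show ?case using assms by (simp add: sg_0)
next
  case (Suc n)
  have "sg (real (Suc n) * h) f z = sg (real n * h) (sg h f) z"
    using sg_semigroup[of "real n * h" h z f B] assms by (simp add: algebra_simps)
  also have "\<dots> - sg (real n * h) f z = sg (real n * h) (\<lambda>w. sg h f w - f w) z"
    using assms by (subst sg_diff[where B = B and B' = B]) (auto intro!: sg_bound)
  finally show ?case using Suc by simp
qed

text \<open>Summing the small-time expansion over \<open>n\<close> pieces of \<open>[0, t]\<close>, using its uniformity on \<open>S\<close>.\<close>

lemma sg_increment_C0:
  assumes "f \<in> C0 S" "\<And>w. w \<in> S \<Longrightarrow> \<bar>f w\<bar> \<le> B" "0 \<le> t" "z \<in> S"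
    and K: "\<And>s. 0 \<le> s \<Longrightarrow> s \<le> t \<Longrightarrow> \<bar>sg s (L f) z - a\<bar> \<le> K"
  shows "\<bar>sg t f z - f z - t * a\<bar> \<le> t * K"
proof (cases "t = 0")
  case True
  then show ?thesis using assms by (simp add: sg_0)
next
  case False
  then have t: "0 < t" using assms by simp
  show ?thesis
  proof (rule field_le_epsilon)
    fix e' :: real assume "0 < e'"
    \<comment> \<open>Each piece of length \<open>h\<close> contributes a generator error
      \<open>h * e\<close>; over the whole of [0, t] these add up to
      \<open>t * e = e'\<close>.\<close>
    define e where "e = e' / t"
    have e: "0 < e" using \<open>0 < e'\<close> t by (simp add: e_def)
    obtain d where d: "0 < d" "\<And>h z. 0 < h \<Longrightarrow> h < d \<Longrightarrow> z \<in> S \<Longrightarrow> \<bar>sg h f z - f z - h * L f z\<bar> \<le> h * e"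
      using generator_step[OF assms(1) e] by blast
    obtain n where n: "t / d < real n" using reals_Archimedean2 by blast
    then have "0 < n" using t d(1) by (metis divide_pos_pos gr0I of_nat_0 order_less_imp_not_less)
    define h where "h = t / real n"
    have h: "0 < h" "h < d" using n t d(1) \<open>0 < n\<close> by (auto simp: h_def field_simps)
    have tn: "t = real n * h" using \<open>0 < n\<close> by (simp add: h_def)
    have LB: "\<And>w. w \<in> S \<Longrightarrow> \<bar>L f w\<bar> \<le> 2 * R * B" using assms L_bound by blast
    have "\<bar>sg (real k * h) (\<lambda>w. sg h f w - f w) z - h * a\<bar> \<le> h * (K + e)" if "k < n" for k
    proof -
      define s where "s = real k * h"
      have s: "0 \<le> s" "s \<le> t" using that h by (auto simp: s_def tn intro!: mult_right_mono)
      have g: "\<bar>sg h f w - f w - h * L f w\<bar> \<le> h * e" if "w \<in> S" for w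
        using d(2) h that by blast
      have hL: "\<bar>h * L f w\<bar> \<le> h * (2 * R * B)" if "w \<in> S" for w
        using LB[OF that] h by (simp add: abs_mult)
      have b: "\<bar>sg h f w - f w\<bar> \<le> h * e + h * (2 * R * B)" if "w \<in> S" for w
        using g[OF that] hL[OF that] by linarith
      have "sg s (\<lambda>w. sg h f w - f w) z - h * sg s (L f) z = sg s (\<lambda>w. sg h f w - f w - h * L f w) z"
        using s assms(4) b hL by (subst sg_diff[where B' = "h * (2 * R * B)"]) (auto simp: sg_cmult)
      then have "\<bar>sg s (\<lambda>w. sg h f w - f w) z - h * sg s (L f) z\<bar> \<le> h * e"
        using sg_bound[OF s(1) assms(4) g] by simp
      moreover have "\<bar>h * sg s (L f) z - h * a\<bar> \<le> h * K"
        using K[OF s] h by (simp add: abs_mult mult_left_mono flip: right_diff_distrib)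
      ultimately show ?thesis unfolding s_def by (simp add: algebra_simps)
    qed
    then have "\<bar>\<Sum>k<n. sg (real k * h) (\<lambda>w. sg h f w - f w) z - h * a\<bar> \<le> (\<Sum>k<n. h * (K + e))"
      by (intro order_trans[OF sum_abs] sum_mono) auto
    also have "\<dots> = t * (K + e)" by (simp add: tn)
    also have "(\<Sum>k<n. sg (real k * h) (\<lambda>w. sg h f w - f w) z - h * a) = sg t f z - f z - t * a"
      unfolding sum_subtractf tn using sg_telescope[of h z f B n] h assms by simp
    finally show "\<bar>sg t f z - f z - t * a\<bar> \<le> t * K + e'"
      using t by (simp add: e_def algebra_simps)
  qed
qed

text \<open>The case \<open>a = 0\<close> of \<open>sg_increment_C0\<close>, where \<open>K\<close>
  is the operator bound \<open>2 * R * B\<close> of \<open>L\<close>; truncation to finite supports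
  then reaches all bounded functions.\<close>

lemma sg_increment:
  assumes "\<And>w. w \<in> S \<Longrightarrow> \<bar>f w\<bar> \<le> B" "0 \<le> t" "z \<in> S"
  shows "\<bar>sg t f z - f z\<bar> \<le> 2 * R * B * t"
proof -
  have B: "0 \<le> B" using assms abs_ge_zero order_trans by blast
  obtain F :: "nat \<Rightarrow> 's set" where F: "\<And>n. finite (F n)"
    "\<And>f w. w \<in> S \<Longrightarrow> (\<lambda>n. f w * indicator (F n) w) \<longlonglongrightarrow> (f w :: real)"
    using finite_support_approx by blast
  define g where "g n w = f w * indicator (F n) w" for n w
  have gB: "\<bar>g n w\<bar> \<le> B" if "w \<in> S" for n w
    using assms(1)[OF that] B by (auto simp: g_def indicator_def)
  have "\<bar>sg t (g n) z - g n z - t * 0\<bar> \<le> t * (2 * R * B)" for n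
  proof (rule sg_increment_C0[where B = B])
    show "g n \<in> C0 S" unfolding g_def using C0_finite[OF F(1)] .
    show "\<bar>sg s (L (g n)) z - 0\<bar> \<le> 2 * R * B" if "0 \<le> s" "s \<le> t" for s
      using sg_bound[OF that(1) assms(3) L_bound[OF _ gB]] by simp
  qed (use gB assms in auto)
  moreover have "(\<lambda>n. \<bar>sg t (g n) z - g n z - t * 0\<bar>) \<longlonglongrightarrow> \<bar>sg t f z - f z - t * 0\<bar>"
    using F(2) assms gB by (intro tendsto_intros sg_bounded_lim[where B = B]) (auto simp: g_def)
  ultimately have "\<bar>sg t f z - f z - t * 0\<bar> \<le> t * (2 * R * B)"
    by (intro tendsto_upperbound) auto
  then show ?thesis by (simp add: mult_ac)
qed

text \<open>The case \<open>a = L f z\<close> of \<open>sg_increment_C0\<close>. The drift of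
  \<open>sg s (L f) z\<close> away from \<open>L f z\<close> is bounded by
  \<open>sg_increment\<close> applied to \<open>L f\<close>, which is itself bounded by
  \<open>2 * R * B\<close>; hence the constant \<open>4 * R\<^sup>2 * B\<close>.\<close>

lemma sg_taylor:
  assumes "\<And>w. w \<in> S \<Longrightarrow> \<bar>f w\<bar> \<le> B" "0 \<le> t" "z \<in> S"
  shows "\<bar>sg t f z - f z - t * L f z\<bar> \<le> 4 * R\<^sup>2 * B * t\<^sup>2"
proof -
  have B: "0 \<le> B" using assms abs_ge_zero order_trans by blast
  obtain F :: "nat \<Rightarrow> 's set" where F: "\<And>n. finite (F n)"
    "\<And>f w. w \<in> S \<Longrightarrow> (\<lambda>n. f w * indicator (F n) w) \<longlonglongrightarrow> (f w :: real)"
    using finite_support_approx by blast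
  define g where "g n w = f w * indicator (F n) w" for n w
  have gB: "\<bar>g n w\<bar> \<le> B" if "w \<in> S" for n w
    using assms(1)[OF that] B by (auto simp: g_def indicator_def)
  have "\<bar>sg t (g n) z - g n z - t * L (g n) z\<bar> \<le> t * (2 * R * (2 * R * B) * t)" for n
  proof (rule sg_increment_C0[where B = B])
    show "g n \<in> C0 S" unfolding g_def using C0_finite[OF F(1)] .
    show "\<bar>sg s (L (g n)) z - L (g n) z\<bar> \<le> 2 * R * (2 * R * B) * t" if "0 \<le> s" "s \<le> t" for s
    proof -
      have "\<bar>sg s (L (g n)) z - L (g n) z\<bar> \<le> 2 * R * (2 * R * B) * s"
        by (rule sg_increment) (use L_bound gB that assms in auto)
      also have "\<dots> \<le> 2 * R * (2 * R * B) * t"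
        using that R_nonneg B by (intro mult_left_mono) auto
      finally show ?thesis .
    qed
  qed (use gB assms in auto)
  moreover have "(\<lambda>n. \<bar>sg t (g n) z - g n z - t * L (g n) z\<bar>) \<longlonglongrightarrow> \<bar>sg t f z - f z - t * L f z\<bar>"
    using F(2) assms gB by (intro tendsto_intros sg_bounded_lim[where B = B] L_lim) (auto simp: g_def)
  ultimately have "\<bar>sg t f z - f z - t * L f z\<bar> \<le> t * (2 * R * (2 * R * B) * t)"
    by (intro tendsto_upperbound) auto
  then show ?thesis by (simp add: power2_eq_square mult_ac)
qed

lemma sg_taylor_at:
  assumes "\<And>w. w \<in> S \<Longrightarrow> \<bar>f w\<bar> \<le> B" "0 \<le> s" "0 \<le> t" "z \<in> S"
  shows "\<bar>sg (s + t) f z - sg s f z - t * sg s (L f) z\<bar> \<le> 4 * R\<^sup>2 * B * t\<^sup>2"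
proof -
  have b1: "\<bar>sg t f w\<bar> \<le> B" if "w \<in> S" for w using sg_bound assms that by blast
  have b2: "\<bar>t * L f w\<bar> \<le> t * (2 * R * B)" if "w \<in> S" for w
    using L_bound[OF that assms(1)] assms(3) by (simp add: abs_mult mult_left_mono)
  have b3: "\<bar>sg t f w - f w\<bar> \<le> B + B" if "w \<in> S" for w
    using b1[OF that] assms(1)[OF that] by linarith
  have "sg (s + t) f z - sg s f z - t * sg s (L f) z = sg s (\<lambda>w. sg t f w - f w - t * L f w) z"
    using sg_semigroup[OF assms(2-4,1)] sg_diff[OF assms(2,4) b3 b2] sg_diff[OF assms(2,4) b1 assms(1)]
    by (simp add: sg_cmult)
  then show ?thesis using sg_bound[OF assms(2,4) sg_taylor[OF assms(1,3)]] by simp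
qed

text \<open>Comparison principle: along s from 0 to T the quantity \<open>sg s (F (T - s)) x\<close>
  increases at rate at most \<open>K\<close>. Over one step of length \<open>h\<close>, the Taylor
  bound and the assumption on \<open>L\<close> turn \<open>sg h (F u)\<close> into at most
  \<open>F (u + h)\<close> plus \<open>K * h\<close> plus an error of order h^2. \<open>F'\<close>
  plays the part of the time derivative of \<open>F\<close> and enters only through a one-sided
  first-order bound, so \<open>C\<close> may be as large as it likes: the summed quadratic errors
  vanish with the mesh.\<close>

lemma sg_supersolution:
  assumes B: "\<And>u z. 0 \<le> u \<Longrightarrow> u \<le> T \<Longrightarrow> z \<in> S \<Longrightarrow> \<bar>F u z\<bar> \<le> B"
    and F': "\<And>u h z. 0 \<le> u \<Longrightarrow> 0 \<le> h \<Longrightarrow> u + h \<le> T \<Longrightarrow> z \<in> S \<Longrightarrow> F u z + h * F' u z \<le> F (u + h) z + C * h\<^sup>2"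
    and L: "\<And>u z. 0 \<le> u \<Longrightarrow> u \<le> T \<Longrightarrow> z \<in> S \<Longrightarrow> L (F u) z \<le> F' u z + K"
    and "0 \<le> T" "x \<in> S"
  shows "sg T (F 0) x \<le> F T x + K * T"
proof -
  define D where "D = 4 * R\<^sup>2 * B + C"
  have "sg T (F 0) x - F T x - K * T \<le> D * T\<^sup>2 * (1 / real (Suc n))" for n
  proof -
    define h where "h = T / real (Suc n)"
    have h: "0 \<le> h" and T: "real (Suc n) * h = T" using assms by (auto simp: h_def)
    have "sg (real k * h) (F (real (Suc n - k) * h)) x \<le> F T x + real k * (K * h + D * h\<^sup>2)"
      if "k \<le> Suc n" for k
      using that
    proof (induction k)
      case 0
      then show ?case using assms(5) T by (simp add: sg_0)
    next
      case (Suc k)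
      define s where "s = real k * h"
      define u where "u = real (n - k) * h"
      have k: "Suc n - k = Suc (n - k)" using Suc by simp
      have uh: "real (Suc n - k) * h = u + h" unfolding k u_def by (simp add: algebra_simps)
      have s: "0 \<le> s" and u: "0 \<le> u" using h by (auto simp: s_def u_def)
      have "u + h \<le> real (Suc n) * h"
        unfolding uh[symmetric] using h by (intro mult_right_mono) auto
      then have uT: "u + h \<le> T" "u \<le> T" using T h by auto
      have step: "sg h (F u) z \<le> F (u + h) z + (K * h + D * h\<^sup>2)" if z: "z \<in> S" for z
      proof -
        have "sg h (F u) z \<le> F u z + h * L (F u) z + 4 * R\<^sup>2 * B * h\<^sup>2"
          using sg_taylor[of "F u", OF B[OF u uT(2)] h z] by linarith
        also have "h * L (F u) z \<le> h * (F' u z + K)"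
          using L[OF u uT(2) z] h by (rule mult_left_mono)
        finally have "sg h (F u) z \<le> F u z + h * (F' u z + K) + 4 * R\<^sup>2 * B * h\<^sup>2" by simp
        then show ?thesis using F'[OF u h uT(1) z] by (simp add: D_def algebra_simps)
      qed
      have B1: "\<And>z. z \<in> S \<Longrightarrow> \<bar>F (u + h) z\<bar> \<le> B" "\<And>z. z \<in> S \<Longrightarrow> \<bar>sg h (F u) z\<bar> \<le> B"
        using B[of "u + h"] u h uT sg_bound[OF h _ B[OF u uT(2)]] by auto
      have B2: "\<bar>F (u + h) z + (K * h + D * h\<^sup>2)\<bar> \<le> B + \<bar>K * h + D * h\<^sup>2\<bar>" if "z \<in> S" for z
        using B1[OF that] by linarith
      have "sg (real (Suc k) * h) (F (real (Suc n - Suc k) * h)) x = sg (s + h) (F u) x"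
        by (simp add: s_def u_def algebra_simps)
      also have "\<dots> = sg s (sg h (F u)) x"
        using sg_semigroup[OF s h assms(5) B[OF u uT(2)]] .
      also have "\<dots> \<le> sg s (\<lambda>z. F (u + h) z + (K * h + D * h\<^sup>2)) x"
        using s assms(5) B1 B2 step by (intro sg_mono[where B' = "B + \<bar>K * h + D * h\<^sup>2\<bar>"]) auto
      also have "\<dots> = sg s (F (u + h)) x + (K * h + D * h\<^sup>2)"
        using s assms(5) B1 by (subst sg_add[where B' = "\<bar>K * h + D * h\<^sup>2\<bar>"]) auto
      also have "\<dots> \<le> F T x + real (Suc k) * (K * h + D * h\<^sup>2)"
        using Suc uh unfolding s_def by (simp add: algebra_simps)
      finally show ?case .
    qed
    note bound = this
    have "real (Suc n) * (K * h + D * h\<^sup>2) = K * (real (Suc n) * h) + D * (real (Suc n) * h * h)"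
      by (simp add: power2_eq_square algebra_simps)
    then have "sg T (F 0) x \<le> F T x + K * T + D * (T * h)"
      using bound[of "Suc n"] unfolding T by simp
    also have "T * h = T\<^sup>2 * (1 / real (Suc n))" by (simp add: h_def power2_eq_square)
    finally show ?thesis by (simp add: algebra_simps)
  qed
  moreover have "(\<lambda>n. D * T\<^sup>2 * (1 / real (Suc n))) \<longlonglongrightarrow> D * T\<^sup>2 * 0"
    using LIMSEQ_inverse_real_of_nat by (intro tendsto_intros) (simp add: inverse_eq_divide)
  ultimately have "sg T (F 0) x - F T x - K * T \<le> D * T\<^sup>2 * 0"
    by (intro tendsto_lowerbound[where F = sequentially]) auto
  then show ?thesis by simp
qed

lemma sg_le_of_L_le:
  assumes "\<And>w. w \<in> S \<Longrightarrow> \<bar>f w\<bar> \<le> B" "\<And>w. w \<in> S \<Longrightarrow> L f w \<le> K" "0 \<le> t" "z \<in> S"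
  shows "sg t f z \<le> f z + K * t"
  using sg_supersolution[of t "\<lambda>_. f" B "\<lambda>_ _. 0" 0 K z] assms by simp

end

section \<open>Configurations and the action of the generator\<close>

locale site_weights =
  fixes c :: "'v::countable \<Rightarrow> 'v \<Rightarrow> real" and \<alpha> :: "'v \<Rightarrow> real" and d :: nat and cm am :: real
  assumes c_sym: "\<And>x y. c x y = c y x"
    and c_nonneg: "\<And>x y. 0 \<le> c x y" and c_le: "\<And>x y. c x y \<le> cm"
    and \<alpha>_nonneg: "\<And>x. 0 \<le> \<alpha> x" and \<alpha>_le: "\<And>x. \<alpha> x \<le> am"
    and finite_nb: "\<And>x. finite {y. c x y \<noteq> 0}" and card_nb: "\<And>x. card {y. c x y \<noteq> 0} \<le> d"
begin

definition nb :: "'v \<Rightarrow> 'v set" where "nb x = {y. c x y \<noteq> 0}"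
text \<open>\<open>A\<close> bounds the sum of \<alpha> over a neighbourhood, and \<open>Q\<close>
  the total jump rate of the limit chain out of a site. Neither involves \<open>N\<close> or
  \<epsilon>.\<close>

definition A :: real where "A = real d * am"
definition Q :: real where "Q = real d * cm * am"

lemma cm_nonneg: "0 \<le> cm" and am_nonneg: "0 \<le> am"
  using order_trans[OF c_nonneg c_le] order_trans[OF \<alpha>_nonneg \<alpha>_le] .

lemma A_nonneg: "0 \<le> A" and Q_nonneg: "0 \<le> Q"
  using cm_nonneg am_nonneg by (auto simp: A_def Q_def)

lemma finite_nb': "finite (nb x)" and card_nb': "card (nb x) \<le> d" and c_nb: "y \<notin> nb x \<Longrightarrow> c x y = 0"
  using finite_nb card_nb by (simp_all add: nb_def)

lemma sum_nb_le:
  assumes "\<And>y. 0 \<le> f y" "\<And>y. f y \<le> a"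
  shows "(\<Sum>y\<in>nb x. f y) \<le> real d * a"
proof -
  have "(\<Sum>y\<in>nb x. f y) \<le> real (card (nb x)) * a"
    using assms by (intro sum_bounded_above) auto
  also have "\<dots> \<le> real d * a"
    using card_nb'[of x] order_trans[OF assms] by (intro mult_right_mono) auto
  finally show ?thesis .
qed

lemma sum_c_le_nb:
  assumes "finite B" "\<And>y. 0 \<le> f y"
  shows "(\<Sum>y\<in>B. c x y * f y) \<le> (\<Sum>y\<in>nb x. c x y * f y)"
proof -
  have "(\<Sum>y\<in>B. c x y * f y) = (\<Sum>y\<in>B \<inter> nb x. c x y * f y)"
    using assms c_nb by (intro sum.mono_neutral_right) auto
  also have "\<dots> \<le> (\<Sum>y\<in>nb x. c x y * f y)"
    using assms c_nonneg finite_nb' by (intro sum_mono2) auto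
  finally show ?thesis .
qed

lemma sum_\<alpha>_le: "(\<Sum>y\<in>nb x. \<alpha> y) \<le> A"
  unfolding A_def using \<alpha>_nonneg \<alpha>_le by (rule sum_nb_le)

lemma sum_c\<alpha>_le: "(\<Sum>y\<in>nb x. c x y * \<alpha> y) \<le> Q" and sum_c\<alpha>_le': "(\<Sum>y\<in>nb x. c x y * \<alpha> x) \<le> Q"
  unfolding Q_def mult.assoc
  by (rule sum_nb_le; intro mult_nonneg_nonneg mult_mono c_nonneg c_le \<alpha>_nonneg \<alpha>_le cm_nonneg)+

lemma sum_c\<alpha>_le_B: "finite B \<Longrightarrow> (\<Sum>y\<in>B. c x y * \<alpha> y) \<le> Q"
  by (rule order_trans[OF sum_c_le_nb sum_c\<alpha>_le]) (simp_all add: \<alpha>_nonneg)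

end

section \<open>Configurations with finite support, and linear and quadratic functions of
  them\<close>

definition supp :: "('v \<Rightarrow> nat) \<Rightarrow> 'v set" where "supp \<eta> = {x. \<eta> x \<noteq> 0}"

lemma finite_supp: "\<eta> \<in> configurations N \<Longrightarrow> finite (supp \<eta>)"
  by (simp add: configurations_def supp_def)

lemma sum_configuration:
  assumes "\<eta> \<in> configurations N" "finite B" "supp \<eta> \<subseteq> B"
  shows "(\<Sum>x\<in>B. real (\<eta> x)) = real N"
proof -
  have "(\<Sum>x\<in>B. real (\<eta> x)) = (\<Sum>x\<in>supp \<eta>. real (\<eta> x))"
    using assms by (intro sum.mono_neutral_right) (auto simp: supp_def)
  then show ?thesis using assms(1) by (simp add: configurations_def supp_def flip: of_nat_sum)
qed

lemma configuration_le: "\<eta> \<in> configurations N \<Longrightarrow> \<eta> x \<le> N"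
  using sum_configuration[of \<eta> N "insert x (supp \<eta>)", OF _ _ subset_insertI]
    member_le_sum[of x "insert x (supp \<eta>)" "\<lambda>x. real (\<eta> x)"] finite_supp[of \<eta> N] by simp

lemma configurationI:
  assumes "finite B" "supp \<eta> \<subseteq> B" "(\<Sum>x\<in>B. real (\<eta> x)) = real N"
  shows "\<eta> \<in> configurations N"
proof -
  have "finite (supp \<eta>)" using assms finite_subset by blast
  moreover have "(\<Sum>x\<in>B. real (\<eta> x)) = (\<Sum>x\<in>supp \<eta>. real (\<eta> x))"
    using assms by (intro sum.mono_neutral_right) (auto simp: supp_def)
  ultimately show ?thesis using assms(3) unfolding configurations_def supp_def
    by (simp flip: of_nat_sum)
qed

lemma move_real:
  assumes "0 < \<eta> x"
  shows "real (move \<eta> x y w) = real (\<eta> w) + of_bool (w = y) - of_bool (w = x)"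
  using assms by (auto simp: move_def)

lemma supp_move: "supp (move \<eta> x y) \<subseteq> insert y (supp \<eta>)"
  by (auto simp: supp_def move_def)

lemma sum_of_bool_mult:
  assumes "finite B" "y \<in> B"
  shows "(\<Sum>a\<in>B. f a * of_bool (a = y)) = (f y :: real)" "(\<Sum>a\<in>B. of_bool (a = y) * f a) = (f y :: real)"
  using assms by (auto simp: of_bool_def if_distrib if_distribR cong: if_cong)

lemma move_in_configurations:
  assumes "\<eta> \<in> configurations N" "0 < \<eta> x"
  shows "move \<eta> x y \<in> configurations N"
proof (rule configurationI)
  let ?B = "insert y (supp \<eta>)"
  show B: "finite ?B" using finite_supp[OF assms(1)] by simp
  show "supp (move \<eta> x y) \<subseteq> ?B" by (rule supp_move)
  have "x \<in> ?B" using assms(2) by (simp add: supp_def)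
  then have "(\<Sum>w\<in>?B. real (move \<eta> x y w)) = (\<Sum>w\<in>?B. real (\<eta> w)) + 1 - 1"
    unfolding move_real[of \<eta> x, OF assms(2)] sum_subtractf sum.distrib
    using B sum_of_bool_mult(1)[of ?B _ "\<lambda>_. 1"] by simp
  then show "(\<Sum>w\<in>?B. real (move \<eta> x y w)) = real N"
    using sum_configuration[OF assms(1) B] by auto
qed

text \<open>A configuration of finite support is encoded by an association list, and lists over a
  countable type are countable.\<close>

lemma countable_configurations: "countable (configurations N :: ('v::countable \<Rightarrow> nat) set)"
proof -
  have "configurations N \<subseteq> range (\<lambda>(xs::('v \<times> nat) list) v. case map_of xs v of None \<Rightarrow> 0 | Some n \<Rightarrow> n)"
  proof
    fix \<eta> :: "'v \<Rightarrow> nat" assume "\<eta> \<in> configurations N"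
    then have "finite (supp \<eta>)" by (rule finite_supp)
    then obtain vs where vs: "set vs = supp \<eta>" using finite_list by blast
    have "\<eta> = (\<lambda>v. case map_of (map (\<lambda>v. (v, \<eta> v)) vs) v of None \<Rightarrow> 0 | Some n \<Rightarrow> n)"
    proof
      fix v show "\<eta> v = (case map_of (map (\<lambda>v. (v, \<eta> v)) vs) v of None \<Rightarrow> 0 | Some n \<Rightarrow> n)"
        using vs by (cases "v \<in> set vs") (auto simp: map_of_map_restrict restrict_map_def supp_def)
    qed
    then show "\<eta> \<in> range (\<lambda>(xs::('v \<times> nat) list) v. case map_of xs v of None \<Rightarrow> 0 | Some n \<Rightarrow> n)"
      by blast
  qed
  then show ?thesis by (rule countable_subset) simp
qed

lemma condensate_in_configurations: "condensate N x \<in> configurations N"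
  by (rule configurationI[of "{x}"]) (auto simp: supp_def condensate_def)

definition lin :: "('v \<Rightarrow> real) \<Rightarrow> ('v \<Rightarrow> nat) \<Rightarrow> real" where
  "lin k \<eta> = (\<Sum>a\<in>supp \<eta>. k a * real (\<eta> a))"

text \<open>Ordered pairs are summed, so an unordered pair of sites counts twice; this is the source
  of the factors 2 in \<open>quad_move\<close>.\<close>

definition quad :: "('v \<Rightarrow> 'v \<Rightarrow> real) \<Rightarrow> ('v \<Rightarrow> nat) \<Rightarrow> real" where
  "quad \<theta> \<eta> = (\<Sum>a\<in>supp \<eta>. \<Sum>b\<in>supp \<eta>. \<theta> a b * real (\<eta> a) * real (\<eta> b))"

lemma lin_superset:
  assumes "finite B" "supp \<eta> \<subseteq> B" shows "lin k \<eta> = (\<Sum>a\<in>B. k a * real (\<eta> a))"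
  unfolding lin_def using assms by (intro sum.mono_neutral_left) (auto simp: supp_def)

lemma quad_superset:
  assumes "finite B" "supp \<eta> \<subseteq> B"
  shows "quad \<theta> \<eta> = (\<Sum>a\<in>B. \<Sum>b\<in>B. \<theta> a b * real (\<eta> a) * real (\<eta> b))"
proof -
  have "quad \<theta> \<eta> = (\<Sum>a\<in>supp \<eta>. \<Sum>b\<in>B. \<theta> a b * real (\<eta> a) * real (\<eta> b))"
    unfolding quad_def using assms by (intro sum.cong refl sum.mono_neutral_left) (auto simp: supp_def)
  also have "\<dots> = (\<Sum>a\<in>B. \<Sum>b\<in>B. \<theta> a b * real (\<eta> a) * real (\<eta> b))"
    using assms by (intro sum.mono_neutral_left) (auto simp: supp_def)
  finally show ?thesis .
qed

lemma lin_mono: "(\<And>a. k a \<le> k' a) \<Longrightarrow> lin k \<eta> \<le> lin k' \<eta>"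
  unfolding lin_def by (intro sum_mono mult_right_mono) auto

lemma quad_mono: "(\<And>a b. \<theta> a b \<le> \<theta>' a b) \<Longrightarrow> quad \<theta> \<eta> \<le> quad \<theta>' \<eta>"
  unfolding quad_def by (intro sum_mono mult_right_mono) auto

lemma lin_add: "lin (\<lambda>a. k a + k' a) \<eta> = lin k \<eta> + lin k' \<eta>"
  unfolding lin_def by (simp add: distrib_right sum.distrib)

lemma lin_cmult: "lin (\<lambda>a. t * k a) \<eta> = t * lin k \<eta>"
  unfolding lin_def by (simp add: sum_distrib_left mult.assoc)

lemma quad_add: "quad (\<lambda>a b. \<theta> a b + \<theta>' a b) \<eta> = quad \<theta> \<eta> + quad \<theta>' \<eta>"
  unfolding quad_def by (simp add: distrib_right sum.distrib)

lemma quad_cmult: "quad (\<lambda>a b. t * \<theta> a b) \<eta> = t * quad \<theta> \<eta>"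
  unfolding quad_def by (simp add: sum_distrib_left mult.assoc)

lemma lin_const: "\<eta> \<in> configurations N \<Longrightarrow> lin (\<lambda>_. k) \<eta> = k * real N"
  using sum_configuration[of \<eta> N "supp \<eta>"] finite_supp[of \<eta> N]
  by (simp add: lin_def flip: sum_distrib_left)

lemma quad_const: "\<eta> \<in> configurations N \<Longrightarrow> quad (\<lambda>_ _. k) \<eta> = k * (real N)\<^sup>2"
  using sum_configuration[of \<eta> N "supp \<eta>"] finite_supp[of \<eta> N]
  by (simp add: quad_def power2_eq_square mult.assoc flip: sum_distrib_left sum_distrib_right)

lemma lin_delta: "\<eta> \<in> configurations N \<Longrightarrow> lin (\<lambda>a. of_bool (a = y)) \<eta> = real (\<eta> y)"
  by (subst lin_superset[of "insert y (supp \<eta>)"]) (auto simp: finite_supp of_bool_def if_distrib if_distribR cong: if_cong)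

lemma lin_condensate: "lin k (condensate N x) = k x * real N"
  by (subst lin_superset[of "{x}"]) (auto simp: supp_def condensate_def)

lemma quad_condensate: "quad \<theta> (condensate N x) = \<theta> x x * (real N)\<^sup>2"
  by (subst quad_superset[of "{x}"]) (auto simp: supp_def condensate_def power2_eq_square)

lemma lin_move:
  assumes "finite B" "supp \<eta> \<subseteq> B" "x \<in> B" "y \<in> B" "0 < \<eta> x"
  shows "lin k (move \<eta> x y) - lin k \<eta> = k y - k x"
proof -
  have "supp (move \<eta> x y) \<subseteq> B" by (rule order_trans[OF supp_move]) (simp add: assms)
  then have "lin k (move \<eta> x y) = (\<Sum>a\<in>B. k a * (real (\<eta> a) + of_bool (a = y) - of_bool (a = x)))"
    using lin_superset[OF assms(1)] move_real[of \<eta> x, OF assms(5)] by simp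
  also have "\<dots> = lin k \<eta> + k y - k x"
    unfolding lin_superset[OF assms(1,2)] distrib_left right_diff_distrib sum.distrib sum_subtractf
      sum_of_bool_mult[OF assms(1,3)] sum_of_bool_mult[OF assms(1,4)] ..
  finally show ?thesis by simp
qed

text \<open>With D = \<delta>_y - \<delta>_x, the new value is the quadratic form at \<eta> + D. The
  two mixed sums agree by symmetry of \<theta>, and the form evaluated at D is -2 \<theta>(x, y)
  because the diagonal vanishes.\<close>

lemma quad_move:
  assumes "finite B" "supp \<eta> \<subseteq> B" "x \<in> B" "y \<in> B" "0 < \<eta> x"
    and sym: "\<And>a b. \<theta> a b = \<theta> b a" and diag: "\<And>a. \<theta> a a = 0"
  shows "quad \<theta> (move \<eta> x y) - quad \<theta> \<eta>
    = 2 * (\<Sum>b\<in>B. \<theta> y b * real (\<eta> b)) - 2 * (\<Sum>b\<in>B. \<theta> x b * real (\<eta> b)) - 2 * \<theta> x y"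
proof -
  define e where "e = (\<lambda>a. real (\<eta> a))"
  define D where "D = (\<lambda>w. of_bool (w = y) - of_bool (w = x) :: real)"
  have supp': "supp (move \<eta> x y) \<subseteq> B" by (rule order_trans[OF supp_move]) (simp add: assms)
  have D: "(\<Sum>a\<in>B. f a * D a) = f y - f x" for f
    unfolding D_def right_diff_distrib sum_subtractf
      sum_of_bool_mult[OF assms(1,3)] sum_of_bool_mult[OF assms(1,4)] ..
  have m: "real (move \<eta> x y a) = e a + D a" for a
    using move_real[of \<eta> x, OF assms(5)] by (simp add: e_def D_def)
  have "quad \<theta> (move \<eta> x y) = (\<Sum>a\<in>B. \<Sum>b\<in>B. \<theta> a b * e a * e b) + (\<Sum>a\<in>B. \<Sum>b\<in>B. \<theta> a b * e a * D b)
     + (\<Sum>a\<in>B. \<Sum>b\<in>B. \<theta> a b * D a * e b) + (\<Sum>a\<in>B. \<Sum>b\<in>B. \<theta> a b * D a * D b)"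
    unfolding quad_superset[OF assms(1) supp'] m sum.distrib[symmetric]
    by (intro sum.cong refl) (simp add: algebra_simps)
  also have "(\<Sum>a\<in>B. \<Sum>b\<in>B. \<theta> a b * e a * D b) = (\<Sum>a\<in>B. \<Sum>b\<in>B. \<theta> a b * D a * e b)"
    by (subst sum.swap) (simp add: sym[of _ "_"] mult_ac)
  also have "(\<Sum>a\<in>B. \<Sum>b\<in>B. \<theta> a b * D a * e b) = (\<Sum>b\<in>B. \<theta> y b * e b) - (\<Sum>b\<in>B. \<theta> x b * e b)"
  proof -
    have "(\<Sum>a\<in>B. \<Sum>b\<in>B. \<theta> a b * D a * e b) = (\<Sum>a\<in>B. (\<Sum>b\<in>B. \<theta> a b * e b) * D a)"
      unfolding sum_distrib_right by (intro sum.cong refl) (simp add: mult_ac)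
    then show ?thesis by (simp add: D)
  qed
  also have "(\<Sum>a\<in>B. \<Sum>b\<in>B. \<theta> a b * D a * D b) = - 2 * \<theta> x y"
    unfolding D[of "\<lambda>b. \<theta> _ b * D _"] using sym[of x y] D[of "\<lambda>a. \<theta> a y - \<theta> a x"]
    by (simp add: D diag left_diff_distrib)
  also have "(\<Sum>a\<in>B. \<Sum>b\<in>B. \<theta> a b * e a * e b) = quad \<theta> \<eta>"
    using quad_superset[OF assms(1,2)] by (simp add: e_def)
  finally show ?thesis by (simp add: e_def)
qed

section \<open>The inclusion generator as a finite sum and its action on linear and quadratic
  functions\<close>

context site_weights
begin

text \<open>The jumps of nonzero rate start at an occupied site and end at a neighbour. Indexing by
  these finitely many pairs puts the infinite sum in \<open>inclusion_generator\<close> into the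
  form required by \<open>bounded_chain\<close>.\<close>

definition inclusion_pairs :: "('v \<Rightarrow> nat) \<Rightarrow> ('v \<times> 'v) set" where
  "inclusion_pairs \<eta> = Sigma (supp \<eta>) nb"

definition inclusion_rate :: "real \<Rightarrow> ('v \<Rightarrow> nat) \<Rightarrow> 'v \<times> 'v \<Rightarrow> real" where
  "inclusion_rate \<epsilon> \<eta> = (\<lambda>(x, y). c x y * real (\<eta> x) * (\<alpha> y + real (\<eta> y) / \<epsilon>))"

lemma finite_inclusion_pairs: "\<eta> \<in> configurations N \<Longrightarrow> finite (inclusion_pairs \<eta>)"
  unfolding inclusion_pairs_def by (intro finite_SigmaI finite_nb' finite_supp)

lemma inclusion_generator_eq:
  assumes "\<eta> \<in> configurations N"
  shows "inclusion_generator c \<alpha> \<epsilon> F \<eta>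
    = (\<Sum>i\<in>inclusion_pairs \<eta>. inclusion_rate \<epsilon> \<eta> i * (F (case i of (x, y) \<Rightarrow> move \<eta> x y) - F \<eta>))"
proof -
  have "inclusion_generator c \<alpha> \<epsilon> F \<eta>
    = (\<Sum>\<^sub>\<infinity>i\<in>inclusion_pairs \<eta>. inclusion_rate \<epsilon> \<eta> i * (F (case i of (x, y) \<Rightarrow> move \<eta> x y) - F \<eta>))"
    unfolding inclusion_generator_def
    by (rule infsum_cong_neutral)
       (auto simp: inclusion_pairs_def inclusion_rate_def supp_def nb_def)
  then show ?thesis using finite_inclusion_pairs[OF assms] by (simp add: infsum_finite)
qed

lemma inclusion_generator_superset:
  assumes "\<eta> \<in> configurations N" "finite B" "supp \<eta> \<subseteq> B" "(\<Union>x\<in>supp \<eta>. nb x) \<subseteq> B"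
  shows "inclusion_generator c \<alpha> \<epsilon> F \<eta>
    = (\<Sum>x\<in>B. \<Sum>y\<in>B. c x y * real (\<eta> x) * (\<alpha> y + real (\<eta> y) / \<epsilon>) * (F (move \<eta> x y) - F \<eta>))"
proof -
  have "inclusion_pairs \<eta> \<subseteq> B \<times> B" using assms by (auto simp: inclusion_pairs_def)
  then have "inclusion_generator c \<alpha> \<epsilon> F \<eta>
     = (\<Sum>i\<in>B \<times> B. inclusion_rate \<epsilon> \<eta> i * (F (case i of (x, y) \<Rightarrow> move \<eta> x y) - F \<eta>))"
    unfolding inclusion_generator_eq[OF assms(1)] using assms(2)
    by (intro sum.mono_neutral_left) (auto simp: inclusion_pairs_def inclusion_rate_def supp_def nb_def)
  then show ?thesis by (simp add: sum.cartesian_product inclusion_rate_def split_beta)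
qed

definition closure_set :: "('v \<Rightarrow> nat) \<Rightarrow> 'v set" where
  "closure_set \<eta> = supp \<eta> \<union> (\<Union>x\<in>supp \<eta>. nb x)"

lemma closure_set:
  assumes "\<eta> \<in> configurations N"
  shows "finite (closure_set \<eta>)" "supp \<eta> \<subseteq> closure_set \<eta>" "(\<Union>x\<in>supp \<eta>. nb x) \<subseteq> closure_set \<eta>"
  unfolding closure_set_def using finite_supp[OF assms] finite_nb' by simp_all

text \<open>Exchanging \<open>x\<close> and \<open>y\<close> preserves the weight c(x,y) \<eta>_x
  \<eta>_y / \<epsilon> and reverses the sign of the difference. In \<open>generator_quad_le\<close>
  the same cancellation removes the first-order part of the attraction from quadratic
  functions.\<close>

lemma antisym_sum:
  "(\<Sum>x\<in>B. \<Sum>y\<in>B. c x y * real (\<eta> x) * (real (\<eta> y) / \<epsilon>) * (f y - f x)) = (0::real)"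
proof -
  let ?S = "\<lambda>g. (\<Sum>x\<in>B. \<Sum>y\<in>B. c x y * real (\<eta> x) * (real (\<eta> y) / \<epsilon>) * g x y)"
  have "?S (\<lambda>x y. f y) = ?S (\<lambda>x y. f x)"
  proof (subst sum.swap, intro sum.cong refl)
    fix x y show "c y x * real (\<eta> y) * (real (\<eta> x) / \<epsilon>) * f x = c x y * real (\<eta> x) * (real (\<eta> y) / \<epsilon>) * f x"
      using c_sym[of x y] by simp
  qed
  then show ?thesis unfolding right_diff_distrib sum_subtractf by simp
qed

text \<open>The interaction term is antisymmetric in the two sites, so it does not act on linear functions.\<close>

lemma generator_lin:
  assumes \<eta>: "\<eta> \<in> configurations N" and B: "finite B" "supp \<eta> \<subseteq> B" "(\<Union>x\<in>supp \<eta>. nb x) \<subseteq> B"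
  shows "inclusion_generator c \<alpha> \<epsilon> (lin k) \<eta> = (\<Sum>x\<in>B. \<Sum>y\<in>B. c x y * real (\<eta> x) * \<alpha> y * (k y - k x))"
proof -
  have "inclusion_generator c \<alpha> \<epsilon> (lin k) \<eta>
     = (\<Sum>x\<in>B. \<Sum>y\<in>B. c x y * real (\<eta> x) * (\<alpha> y + real (\<eta> y) / \<epsilon>) * (k y - k x))"
    unfolding inclusion_generator_superset[OF \<eta> B]
  proof (intro sum.cong refl)
    fix x y assume "x \<in> B" "y \<in> B"
    then show "c x y * real (\<eta> x) * (\<alpha> y + real (\<eta> y) / \<epsilon>) * (lin k (move \<eta> x y) - lin k \<eta>)
       = c x y * real (\<eta> x) * (\<alpha> y + real (\<eta> y) / \<epsilon>) * (k y - k x)"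
      using lin_move[OF B(1,2), of x y k] by (cases "\<eta> x = 0") simp_all
  qed
  also have "\<dots> = (\<Sum>x\<in>B. \<Sum>y\<in>B. c x y * real (\<eta> x) * \<alpha> y * (k y - k x))
     + (\<Sum>x\<in>B. \<Sum>y\<in>B. c x y * real (\<eta> x) * (real (\<eta> y) / \<epsilon>) * (k y - k x))"
    by (simp only: distrib_left distrib_right sum.distrib)
  finally show ?thesis using antisym_sum[of \<eta> \<epsilon> k B] by simp
qed

text \<open>Gain minus loss at \<open>y\<close>. The right-hand side is linear in the occupations of
  \<open>y\<close> and its neighbours, so the mean occupations obey a closed system of
  equations.\<close>

lemma generator_lin_delta:
  assumes \<eta>: "\<eta> \<in> configurations N"
  shows "inclusion_generator c \<alpha> \<epsilon> (lin (\<lambda>a. of_bool (a = y))) \<eta>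
    = (\<Sum>z\<in>nb y. c y z * (\<alpha> y * real (\<eta> z) - \<alpha> z * real (\<eta> y)))"
proof -
  define B where "B = insert y (nb y \<union> closure_set \<eta>)"
  have B: "finite B" "supp \<eta> \<subseteq> B" "(\<Union>x\<in>supp \<eta>. nb x) \<subseteq> B" and y: "y \<in> B" and nb: "nb y \<subseteq> B"
    using closure_set[OF \<eta>] finite_nb' by (auto simp: B_def)
  have "inclusion_generator c \<alpha> \<epsilon> (lin (\<lambda>a. of_bool (a = y))) \<eta>
     = (\<Sum>x\<in>B. \<Sum>z\<in>B. c x z * real (\<eta> x) * \<alpha> z * of_bool (z = y))
       - (\<Sum>x\<in>B. (\<Sum>z\<in>B. c x z * real (\<eta> x) * \<alpha> z) * of_bool (x = y))"
    unfolding generator_lin[OF \<eta> B] right_diff_distrib sum_subtractf sum_distrib_right ..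
  also have "\<dots> = (\<Sum>z\<in>B. c z y * real (\<eta> z) * \<alpha> y) - (\<Sum>z\<in>B. c y z * real (\<eta> y) * \<alpha> z)"
    unfolding sum_of_bool_mult[OF B(1) y] ..
  also have "\<dots> = (\<Sum>z\<in>B. c y z * (\<alpha> y * real (\<eta> z) - \<alpha> z * real (\<eta> y)))"
    unfolding sum_subtractf[symmetric]
  proof (intro sum.cong refl)
    fix z show "c z y * real (\<eta> z) * \<alpha> y - c y z * real (\<eta> y) * \<alpha> z
      = c y z * (\<alpha> y * real (\<eta> z) - \<alpha> z * real (\<eta> y))"
      unfolding c_sym[of z y] by (simp add: algebra_simps)
  qed
  also have "\<dots> = (\<Sum>z\<in>nb y. c y z * (\<alpha> y * real (\<eta> z) - \<alpha> z * real (\<eta> y)))"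
    using B(1) nb c_nb by (intro sum.mono_neutral_right) auto
  finally show ?thesis .
qed

text \<open>A jump from \<open>x\<close> to \<open>y\<close> changes \<open>quad\<close> by 2 p(y) -
  2 p(x) - 2 \<theta>(x,y), where \<open>p\<close> is the linear form of \<theta>. Under the
  attraction the difference of \<open>p\<close> cancels by antisymmetry and only the damping by
  \<theta>(x,y) survives. Under the \<alpha>-part, \<open>p y\<close> is split into the particles at
  \<open>x\<close>, which feed the linear term on the right, and all others, which form off-diagonal
  pairs with \<open>x\<close>.\<close>

lemma generator_quad_le:
  assumes \<eta>: "\<eta> \<in> configurations N" and \<epsilon>: "0 < \<epsilon>"
    and sym: "\<And>a b. \<theta> a b = \<theta> b a" and diag: "\<And>a. \<theta> a a = 0" and nonneg: "\<And>a b. 0 \<le> \<theta> a b"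
    and W: "\<And>a b. \<theta> a b \<le> W"
  shows "inclusion_generator c \<alpha> \<epsilon> (quad \<theta>) \<eta>
    \<le> quad (\<lambda>a b. if a = b then 0 else 2 * Q * W - 2 * c a b / \<epsilon> * \<theta> a b) \<eta>
      + 2 * real N * lin (\<lambda>a. \<Sum>b\<in>nb a. c a b * (\<alpha> b * \<theta> a b)) \<eta>"
proof -
  define B where "B = closure_set \<eta>"
  note B = closure_set[OF \<eta>, folded B_def]
  define e where "e = (\<lambda>a. real (\<eta> a))"
  have e: "0 \<le> e a" "e a \<le> real N" for a
    using configuration_le[OF \<eta>, of a] by (simp_all add: e_def)
  define Sm where "Sm x = (\<Sum>b\<in>B - {x}. e b)" for x
  define Kn where "Kn x = (\<Sum>b\<in>nb x. c x b * (\<alpha> b * \<theta> x b))" for x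
  define p where "p a = (\<Sum>b\<in>B. \<theta> a b * e b)" for a
  have mv: "quad \<theta> (move \<eta> x y) - quad \<theta> \<eta> = (2 * p y - 2 * p x) - 2 * \<theta> x y"
    if "x \<in> B" "y \<in> B" "0 < \<eta> x" for x y
    unfolding p_def e_def by (rule quad_move[OF B(1,2) that sym diag])
  have "inclusion_generator c \<alpha> \<epsilon> (quad \<theta>) \<eta>
     = (\<Sum>x\<in>B. \<Sum>y\<in>B. c x y * e x * (\<alpha> y + e y / \<epsilon>) * ((2 * p y - 2 * p x) - 2 * \<theta> x y))"
    unfolding inclusion_generator_superset[OF \<eta> B]
  proof (intro sum.cong refl)
    fix x y assume "x \<in> B" "y \<in> B"
    then show "c x y * real (\<eta> x) * (\<alpha> y + real (\<eta> y) / \<epsilon>) * (quad \<theta> (move \<eta> x y) - quad \<theta> \<eta>)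
       = c x y * e x * (\<alpha> y + e y / \<epsilon>) * ((2 * p y - 2 * p x) - 2 * \<theta> x y)"
      using mv[of x y] by (cases "\<eta> x = 0") (simp_all add: e_def)
  qed
  \<comment> \<open>The first double sum is of the form treated by \<open>antisym_sum\<close> and
    vanishes; the attraction remains only through the term with \<theta>(x,y).\<close>
  also have "\<dots> = (\<Sum>x\<in>B. \<Sum>y\<in>B. c x y * e x * (e y / \<epsilon>) * (2 * p y - 2 * p x))
     + (\<Sum>x\<in>B. \<Sum>y\<in>B. c x y * e x * \<alpha> y * (2 * p y - 2 * p x - 2 * \<theta> x y)
          - 2 * c x y / \<epsilon> * \<theta> x y * e x * e y)"
    unfolding sum.distrib[symmetric] by (intro sum.cong refl) (simp add: algebra_simps)
  finally have 1: "inclusion_generator c \<alpha> \<epsilon> (quad \<theta>) \<eta>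
     = (\<Sum>x\<in>B. \<Sum>y\<in>B. c x y * e x * \<alpha> y * (2 * p y - 2 * p x - 2 * \<theta> x y)
          - 2 * c x y / \<epsilon> * \<theta> x y * e x * e y)"
    using antisym_sum[of \<eta> \<epsilon> "\<lambda>x. 2 * p x" B] by (simp add: e_def)
  have 2: "(\<Sum>x\<in>B. \<Sum>y\<in>B. c x y * e x * \<alpha> y * (2 * p y - 2 * p x - 2 * \<theta> x y)
          - 2 * c x y / \<epsilon> * \<theta> x y * e x * e y)
     \<le> (\<Sum>x\<in>B. 2 * Q * W * e x * Sm x + 2 * real N * (e x * Kn x)
          - (\<Sum>y\<in>B. 2 * c x y / \<epsilon> * \<theta> x y * e x * e y))"
    unfolding sum_subtractf
  proof (intro diff_right_mono sum_mono)
    fix x assume x: "x \<in> B"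
    have "0 \<le> W" using order_trans[OF nonneg W] .
    have "0 \<le> Sm x" unfolding Sm_def using e by (intro sum_nonneg)
    have p_nonneg: "0 \<le> p x" unfolding p_def using e nonneg by (intro sum_nonneg) auto
    have "c x y * e x * \<alpha> y * (2 * p y - 2 * p x - 2 * \<theta> x y)
        \<le> c x y * \<alpha> y * (2 * W * e x * Sm x) + 2 * real N * e x * (c x y * (\<alpha> y * \<theta> x y))" for y
    proof -
      \<comment> \<open>The particles at \<open>x\<close> are kept apart with their exact weight
        \<theta>(x,y): near a condensate e(x) is of order \<open>N\<close>, and replacing \<theta>
        by \<open>W\<close> here would lose the smallness of c(x,y) \<theta>(x,y).\<close>
      have "p y = \<theta> y x * e x + (\<Sum>b\<in>B - {x}. \<theta> y b * e b)"
        unfolding p_def using B(1) x by (rule sum.remove)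
      also have "(\<Sum>b\<in>B - {x}. \<theta> y b * e b) \<le> (\<Sum>b\<in>B - {x}. W * e b)"
        using e W by (intro sum_mono mult_right_mono) auto
      finally have "p y \<le> \<theta> x y * e x + W * Sm x"
        using sym[of x y] by (simp add: Sm_def sum_distrib_left)
      then have 1: "2 * p y - 2 * p x - 2 * \<theta> x y \<le> 2 * (W * Sm x) + 2 * (\<theta> x y * (e x - 1))"
        using p_nonneg by (simp add: algebra_simps)
      have "e x * (2 * p y - 2 * p x - 2 * \<theta> x y)
         \<le> e x * (2 * (W * Sm x)) + e x * (2 * (\<theta> x y * (e x - 1)))"
        using mult_left_mono[OF 1 e(1)[of x]] by (simp add: distrib_left)
      also have "e x * (2 * (\<theta> x y * (e x - 1))) \<le> e x * (2 * (\<theta> x y * real N))"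
        using e(1,2)[of x] nonneg by (intro mult_left_mono) auto
      finally have "c x y * \<alpha> y * (e x * (2 * p y - 2 * p x - 2 * \<theta> x y))
        \<le> c x y * \<alpha> y * (e x * (2 * (W * Sm x)) + e x * (2 * (\<theta> x y * real N)))"
        using c_nonneg \<alpha>_nonneg by (intro mult_left_mono) auto
      then show ?thesis by (simp add: algebra_simps)
    qed
    then have "(\<Sum>y\<in>B. c x y * e x * \<alpha> y * (2 * p y - 2 * p x - 2 * \<theta> x y))
       \<le> (\<Sum>y\<in>B. c x y * \<alpha> y * (2 * W * e x * Sm x) + 2 * real N * e x * (c x y * (\<alpha> y * \<theta> x y)))"
      by (rule sum_mono)
    also have "\<dots> = (\<Sum>y\<in>B. c x y * \<alpha> y) * (2 * W * e x * Sm x)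
       + 2 * real N * e x * (\<Sum>y\<in>B. c x y * (\<alpha> y * \<theta> x y))"
      unfolding sum.distrib sum_distrib_right[of "\<lambda>y. c x y * \<alpha> y"] sum_distrib_left[of "2 * real N * e x"] ..
    also have "\<dots> \<le> Q * (2 * W * e x * Sm x) + 2 * real N * e x * Kn x"
    proof (rule add_mono)
      show "(\<Sum>y\<in>B. c x y * \<alpha> y) * (2 * W * e x * Sm x) \<le> Q * (2 * W * e x * Sm x)"
        using sum_c\<alpha>_le_B[OF B(1)] \<open>0 \<le> W\<close> \<open>0 \<le> Sm x\<close> e(1)[of x] by (intro mult_right_mono) simp_all
      have "(\<Sum>y\<in>B. c x y * (\<alpha> y * \<theta> x y)) \<le> Kn x"
        unfolding Kn_def using \<alpha>_nonneg nonneg by (intro sum_c_le_nb[OF B(1)]) simp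
      then show "2 * real N * e x * (\<Sum>y\<in>B. c x y * (\<alpha> y * \<theta> x y)) \<le> 2 * real N * e x * Kn x"
        using e(1)[of x] by (intro mult_left_mono) simp_all
    qed
    finally show "(\<Sum>y\<in>B. c x y * e x * \<alpha> y * (2 * p y - 2 * p x - 2 * \<theta> x y))
       \<le> 2 * Q * W * e x * Sm x + 2 * real N * (e x * Kn x)"
      by (simp add: mult_ac)
  qed
  have 3: "(\<Sum>x\<in>B. 2 * Q * W * e x * Sm x + 2 * real N * (e x * Kn x)
          - (\<Sum>y\<in>B. 2 * c x y / \<epsilon> * \<theta> x y * e x * e y))
      = quad (\<lambda>a b. if a = b then 0 else 2 * Q * W - 2 * c a b / \<epsilon> * \<theta> a b) \<eta>
      + 2 * real N * lin (\<lambda>a. \<Sum>b\<in>nb a. c a b * (\<alpha> b * \<theta> a b)) \<eta>"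
  proof -
    have "2 * Q * W * e x * Sm x - (\<Sum>y\<in>B. 2 * c x y / \<epsilon> * \<theta> x y * e x * e y)
       = (\<Sum>b\<in>B. (if x = b then 0 else 2 * Q * W - 2 * c x b / \<epsilon> * \<theta> x b) * e x * e b)" if x: "x \<in> B" for x
    proof -
      have "2 * Q * W * e x * Sm x = (\<Sum>b\<in>B. if x = b then 0 else 2 * Q * W * e x * e b)"
        unfolding Sm_def sum_distrib_left using B(1) by (intro sum.mono_neutral_cong_left) auto
      then show ?thesis
        by (simp only: sum_subtractf[symmetric]) (intro sum.cong refl, auto simp: diag left_diff_distrib)
    qed
    then have "quad (\<lambda>a b. if a = b then 0 else 2 * Q * W - 2 * c a b / \<epsilon> * \<theta> a b) \<eta>
       = (\<Sum>x\<in>B. 2 * Q * W * e x * Sm x - (\<Sum>y\<in>B. 2 * c x y / \<epsilon> * \<theta> x y * e x * e y))"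
      unfolding quad_superset[OF B(1,2)] by (intro sum.cong refl) (simp add: e_def)
    moreover have "2 * real N * lin (\<lambda>a. \<Sum>b\<in>nb a. c a b * (\<alpha> b * \<theta> a b)) \<eta>
       = (\<Sum>x\<in>B. 2 * real N * (e x * Kn x))"
      unfolding lin_superset[OF B(1,2)] sum_distrib_left[of "2 * real N"] by (intro sum.cong refl) (simp add: e_def Kn_def)
    ultimately show ?thesis unfolding sum_subtractf sum.distrib by simp
  qed
  show ?thesis unfolding 1 using 2 unfolding 3 .
qed

end

section \<open>Probability of a non-condensed configuration\<close>

lemma exp_minus_le_quadratic:
  assumes "0 \<le> (y::real)" shows "exp (- y) \<le> 1 - y + y\<^sup>2"
proof -
  have "exp (- y) \<le> 1 / (1 + y)"
    using exp_ge_add_one_self[of y] assms by (simp add: exp_minus inverse_eq_divide frac_le)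
  also have "\<dots> \<le> 1 - y + y\<^sup>2"
  proof -
    have "1 \<le> (1 - y + y\<^sup>2) * (1 + y)" using assms by (simp add: power2_eq_square algebra_simps)
    then show ?thesis using assms by (simp add: divide_le_eq)
  qed
  finally show ?thesis .
qed

lemma exp_tangent_le: "exp (p * u) + h * (p * exp (p * u)) \<le> exp (p * (u + h :: real))"
proof -
  have "exp (p * u) * (1 + p * h) \<le> exp (p * u) * exp (p * h)"
    using exp_ge_add_one_self[of "p * h"] by (intro mult_left_mono) (auto simp: add.commute)
  then show ?thesis by (simp add: exp_add algebra_simps)
qed

lemma condensates_iff:
  assumes \<eta>: "\<eta> \<in> configurations N" and "0 < N"
  shows "\<eta> \<in> condensates N \<longleftrightarrow> (\<exists>a. \<eta> a = N)"
proof
  assume "\<exists>a. \<eta> a = N"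
  then obtain a where a: "\<eta> a = N" by blast
  have B: "finite (insert a (supp \<eta>))" using finite_supp[OF \<eta>] by simp
  have "(\<Sum>x\<in>insert a (supp \<eta>) - {a}. real (\<eta> x)) = 0"
    using sum_configuration[OF \<eta> B] sum.remove[OF B, of a "\<lambda>x. real (\<eta> x)"] a by auto
  then have "\<forall>x\<in>insert a (supp \<eta>) - {a}. real (\<eta> x) = 0"
    using B by (subst (asm) sum_nonneg_eq_0_iff) auto
  then have "\<eta> = condensate N a" using a by (auto simp: condensate_def supp_def fun_eq_iff)
  then show "\<eta> \<in> condensates N" by (simp add: condensates_def)
qed (auto simp: condensates_def condensate_def)

text \<open>An occupied site \<open>a\<close> of a non-condensed configuration carries between 1 and
  N - 1 particles. Its row alone contributes \<eta>_a (N - \<eta>_a), which is at least N - 1 on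
  this range.\<close>

lemma quad_offdiag_ge:
  assumes \<eta>: "\<eta> \<in> configurations N" and "0 < N" "\<eta> \<notin> condensates N"
  shows "real N - 1 \<le> quad (\<lambda>a b. if a = b then 0 else 1) \<eta>"
proof -
  have fin: "finite (supp \<eta>)" by (rule finite_supp[OF \<eta>])
  have "supp \<eta> \<noteq> {}" using sum_configuration[OF \<eta> fin] \<open>0 < N\<close> by auto
  then obtain a where a: "a \<in> supp \<eta>" by blast
  then have "0 < \<eta> a" by (simp add: supp_def)
  moreover have "\<eta> a < N"
    using configuration_le[OF \<eta>, of a] condensates_iff[OF \<eta> \<open>0 < N\<close>] assms(3) by (auto simp: le_less)
  ultimately have "0 \<le> (real (\<eta> a) - 1) * (real N - real (\<eta> a) - 1)" by simp
  then have "real N - 1 \<le> real (\<eta> a) * (real N - real (\<eta> a))" by (simp add: algebra_simps)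
  also have "real N - real (\<eta> a) = (\<Sum>b\<in>supp \<eta> - {a}. real (\<eta> b))"
    using sum_configuration[OF \<eta> fin] sum.remove[OF fin a, of "\<lambda>x. real (\<eta> x)"] by simp
  also have "real (\<eta> a) * \<dots> = (\<Sum>b\<in>supp \<eta>. (if a = b then 0 else 1) * real (\<eta> a) * real (\<eta> b))"
    unfolding sum_distrib_left using fin by (intro sum.mono_neutral_cong_left) auto
  also have "\<dots> \<le> quad (\<lambda>a b. if a = b then 0 else 1) \<eta>"
    unfolding quad_def using fin a by (intro member_le_sum[where f = "\<lambda>a. \<Sum>b\<in>supp \<eta>. _ a b"] sum_nonneg) auto
  finally show ?thesis .
qed

context site_weights
begin

text \<open>The rate bound is of order N^2 / \<epsilon>. It may be used for fixed \<open>N\<close>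
  only, in error terms that vanish with a mesh or in almost sure statements.\<close>

lemma inclusion_chain:
  assumes "markov_semigroup (configurations N) P" "has_generator (configurations N) P (inclusion_generator c \<alpha> \<epsilon>)"
    and \<epsilon>: "0 < \<epsilon>"
  shows "bounded_chain (configurations N) P (inclusion_generator c \<alpha> \<epsilon>) inclusion_pairs (inclusion_rate \<epsilon>)
    (\<lambda>\<eta> (x, y). move \<eta> x y) (real N * (real d * (cm * (am + real N / \<epsilon>))))"
proof
  fix \<eta> :: "'v \<Rightarrow> nat" assume \<eta>: "\<eta> \<in> configurations N"
  show "inclusion_generator c \<alpha> \<epsilon> F \<eta> = (\<Sum>i\<in>inclusion_pairs \<eta>. inclusion_rate \<epsilon> \<eta> i * (F (case i of (x, y) \<Rightarrow> move \<eta> x y) - F \<eta>))" for F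
    by (rule inclusion_generator_eq[OF \<eta>])
  show "0 \<le> inclusion_rate \<epsilon> \<eta> i" for i
    using \<epsilon> c_nonneg \<alpha>_nonneg by (auto simp: inclusion_rate_def split: prod.splits)
  show "(case i of (x, y) \<Rightarrow> move \<eta> x y) \<in> configurations N" if "i \<in> inclusion_pairs \<eta>" for i
    using that move_in_configurations[OF \<eta>] by (auto simp: inclusion_pairs_def supp_def split: prod.splits)
  have "(\<Sum>i\<in>inclusion_pairs \<eta>. inclusion_rate \<epsilon> \<eta> i)
     = (\<Sum>x\<in>supp \<eta>. \<Sum>y\<in>nb x. c x y * real (\<eta> x) * (\<alpha> y + real (\<eta> y) / \<epsilon>))"
    unfolding inclusion_pairs_def inclusion_rate_def using finite_supp[OF \<eta>] finite_nb'
    by (subst sum.Sigma) auto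
  also have "\<dots> \<le> (\<Sum>x\<in>supp \<eta>. real (\<eta> x) * (real d * (cm * (am + real N / \<epsilon>))))"
  proof (rule sum_mono)
    fix x
    have "(\<Sum>y\<in>nb x. c x y * real (\<eta> x) * (\<alpha> y + real (\<eta> y) / \<epsilon>))
       = real (\<eta> x) * (\<Sum>y\<in>nb x. c x y * (\<alpha> y + real (\<eta> y) / \<epsilon>))"
      unfolding sum_distrib_left by (intro sum.cong refl) simp
    also have "\<dots> \<le> real (\<eta> x) * (real d * (cm * (am + real N / \<epsilon>)))"
      using \<epsilon> c_nonneg c_le \<alpha>_nonneg \<alpha>_le cm_nonneg configuration_le[OF \<eta>]
      by (intro mult_left_mono sum_nb_le mult_mono add_mono divide_right_mono mult_nonneg_nonneg add_nonneg_nonneg) auto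
    finally show "(\<Sum>y\<in>nb x. c x y * real (\<eta> x) * (\<alpha> y + real (\<eta> y) / \<epsilon>))
       \<le> real (\<eta> x) * (real d * (cm * (am + real N / \<epsilon>)))" .
  qed
  also have "\<dots> = real N * (real d * (cm * (am + real N / \<epsilon>)))"
    using sum_configuration[OF \<eta> finite_supp[OF \<eta>]] by (simp flip: sum_distrib_right)
  finally show "(\<Sum>i\<in>inclusion_pairs \<eta>. inclusion_rate \<epsilon> \<eta> i) \<le> real N * (real d * (cm * (am + real N / \<epsilon>)))" .
next
  show "0 \<le> real N * (real d * (cm * (am + real N / \<epsilon>)))"
    using \<epsilon> cm_nonneg am_nonneg by simp
qed (use assms countable_configurations in auto)

lemma limit_chain:
  assumes "markov_semigroup UNIV P" "has_generator UNIV P (limit_generator c \<alpha>)"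
  shows "bounded_chain UNIV P (limit_generator c \<alpha>) (\<lambda>z. case z of None \<Rightarrow> {} | Some x \<Rightarrow> nb x)
    (\<lambda>z y. case z of None \<Rightarrow> 0 | Some x \<Rightarrow> c x y * \<alpha> y) (\<lambda>z y. Some y) Q"
proof
  fix z :: "'v option"
  show "limit_generator c \<alpha> f z = (\<Sum>i\<in>(case z of None \<Rightarrow> {} | Some x \<Rightarrow> nb x).
      (case z of None \<Rightarrow> 0 | Some x \<Rightarrow> c x i * \<alpha> i) * (f (Some i) - f z))" for f
  proof (cases z)
    case (Some x)
    have "(\<Sum>\<^sub>\<infinity>y. c x y * \<alpha> y * (f (Some y) - f (Some x))) = (\<Sum>\<^sub>\<infinity>y\<in>nb x. c x y * \<alpha> y * (f (Some y) - f (Some x)))"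
      by (rule infsum_cong_neutral) (auto simp: nb_def)
    then show ?thesis using Some finite_nb'[of x] by (simp add: limit_generator_def)
  qed (simp add: limit_generator_def)
  show "(\<Sum>i\<in>(case z of None \<Rightarrow> {} | Some x \<Rightarrow> nb x). case z of None \<Rightarrow> 0 | Some x \<Rightarrow> c x i * \<alpha> i) \<le> Q"
    using sum_c\<alpha>_le Q_nonneg by (cases z) auto
qed (use assms c_nonneg \<alpha>_nonneg finite_nb' Q_nonneg in \<open>auto split: option.splits\<close>)

text \<open>Collected from \<open>expected_offdiag_le\<close>, with \<mu> = 4 Q + 1: the exponential
  is \<open>eT\<close>, the summand 1 comes from the bound on the linear part \<open>k\<close>, and
  t (\<mu> + Q) comes from the constant drift \<open>K\<close>.\<close>

definition non_condensation_const :: "real \<Rightarrow> real" where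
  "non_condensation_const t = exp ((4 * Q + 1) * t) * A * (1 + t * (4 * Q + 1 + Q))"

text \<open>
  On pairs of sites the generator acts on quadratic functions with a damping \<open>2 c\<^sub>a\<^sub>b / \<epsilon>\<close>, while a
  condensate at \<open>a\<close> feeds the pair \<open>a b\<close> at a rate proportional to \<open>c\<^sub>a\<^sub>b\<close>. The weight \<open>\<theta>\<close> below is a
  supersolution of the corresponding dual equation with initial value at least 1, and \<open>c\<^sub>a\<^sub>b \<theta>\<close> has a
  time integral of order \<open>\<epsilon>\<close>, uniformly in \<open>c\<^sub>a\<^sub>b \<ge> 0\<close>; the linear part \<open>k\<close> absorbs this integral.
\<close>

lemma expected_offdiag_le:
  assumes P: "markov_semigroup (configurations N) P" "has_generator (configurations N) P (inclusion_generator c \<alpha> \<epsilon>)"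
    and \<epsilon>: "0 < \<epsilon>" and T: "0 \<le> T"
  shows "measure_pmf.expectation (P T (condensate N x)) (quad (\<lambda>a b. if a = b then 0 else 1))
    \<le> \<epsilon> * (real N)\<^sup>2 * non_condensation_const T"
proof -
  interpret bounded_chain "configurations N" P "inclusion_generator c \<alpha> \<epsilon>" inclusion_pairs "inclusion_rate \<epsilon>"
    "\<lambda>\<eta> (x, y). move \<eta> x y" "real N * (real d * (cm * (am + real N / \<epsilon>)))"
    by (rule inclusion_chain[OF P \<epsilon>])
  \<comment> \<open>\<open>generator_quad_le\<close> creates pairs at rate 2 Q W with W = 2
    exp(\<mu> u), so \<mu> has to dominate 4 Q; the added 1 keeps \<mu> positive even if
    \<open>Q\<close> is 0.\<close>
  define \<mu> where "\<mu> = 4 * Q + 1"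
  have \<mu>: "0 < \<mu>" "4 * Q \<le> \<mu>" using Q_nonneg by (auto simp: \<mu>_def)
  define \<kappa> where "\<kappa> a b = 2 * c a b / \<epsilon>" for a b
  have \<kappa>: "0 \<le> \<kappa> a b" "\<kappa> a b \<le> 2 * cm / \<epsilon>" "\<epsilon> * \<kappa> a b = 2 * c a b" "\<kappa> a b = \<kappa> b a" for a b
    using c_nonneg[of a b] c_le[of a b] c_sym[of a b] \<epsilon> by (auto simp: \<kappa>_def divide_right_mono)
  \<comment> \<open>The amplitude is chosen so that \<open>g a b * exp (\<mu> * u)\<close> balances
    growth against damping: (\<mu> + \<kappa>) g = \<mu>. It follows that \<kappa> g is at most
    \<mu>, uniformly in \<kappa>.\<close>
  define g where "g a b = \<mu> / (\<mu> + \<kappa> a b)" for a b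
  have g: "0 \<le> g a b" "g a b \<le> 1" "(\<mu> + \<kappa> a b) * g a b = \<mu>" "\<kappa> a b * g a b \<le> \<mu>" for a b
  proof -
    have pos: "0 < \<mu> + \<kappa> a b" using \<mu> \<kappa>(1)[of a b] by linarith
    show "0 \<le> g a b" "g a b \<le> 1" "(\<mu> + \<kappa> a b) * g a b = \<mu>"
      using pos \<mu> \<kappa>(1)[of a b] by (auto simp: g_def)
    then show "\<kappa> a b * g a b \<le> \<mu>" using \<mu> by (simp add: distrib_right) (smt (verit) mult_nonneg_nonneg)
  qed
  \<comment> \<open>The first summand solves \<theta>' = \<mu> exp(\<mu> u) - \<kappa> \<theta>, but
    starts at \<open>g\<close>, which is small for large \<kappa>. The second adds initial value 1
    and decays at rate \<kappa> relative to exp(\<mu> u).\<close>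
  define \<theta> where "\<theta> u a b = (if a = b then 0 else g a b * exp (\<mu> * u) + exp ((\<mu> - \<kappa> a b) * u))" for u a b
  define \<theta>' where "\<theta>' u a b = (if a = b then 0 else g a b * (\<mu> * exp (\<mu> * u)) + (\<mu> - \<kappa> a b) * exp ((\<mu> - \<kappa> a b) * u))" for u a b
  define eT where "eT = exp (\<mu> * T)"
  \<comment> \<open>The time integral of the transient part \<kappa> exp(-\<kappa> u) of the source.
    It is at most 1 for every \<kappa>, which leaves \<open>k\<close> of order \<epsilon>; the
    stationary part \<kappa> g is at most \<mu> and is put into \<open>K\<close>.\<close>
  define k where "k u a = eT * \<epsilon> * (\<Sum>b\<in>nb a. \<alpha> b * (1 - exp (- \<kappa> a b * u)))" for u a
  define k' where "k' u a = eT * \<epsilon> * (\<Sum>b\<in>nb a. \<alpha> b * (\<kappa> a b * exp (- \<kappa> a b * u)))" for u a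
  have eT: "1 \<le> eT" using T \<mu> by (simp add: eT_def)
  have eu: "exp (\<mu> * u) \<le> eT" if "u \<le> T" for u using that \<mu> by (simp add: eT_def)
  have e\<kappa>: "exp (- \<kappa> a b * u) \<le> 1" "exp ((\<mu> - \<kappa> a b) * u) = exp (\<mu> * u) * exp (- \<kappa> a b * u)"
    if "0 \<le> u" for u a b
    using that \<kappa>(1)[of a b] by (auto simp: left_diff_distrib exp_diff exp_minus field_simps)
  have \<theta>: "0 \<le> \<theta> u a b" "\<theta> u a b \<le> 2 * exp (\<mu> * u)" "\<theta> u a b = \<theta> u b a" if "0 \<le> u" for u a b
  proof -
    have "g a b * exp (\<mu> * u) \<le> 1 * exp (\<mu> * u)" using g by (intro mult_right_mono) auto
    moreover have "exp (\<mu> * u) * exp (- \<kappa> a b * u) \<le> exp (\<mu> * u) * 1"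
      using e\<kappa>(1)[OF that] by (intro mult_left_mono) auto
    ultimately have "g a b * exp (\<mu> * u) + exp (\<mu> * u) * exp (- \<kappa> a b * u) \<le> 2 * exp (\<mu> * u)" by linarith
    then show "\<theta> u a b \<le> 2 * exp (\<mu> * u)" unfolding \<theta>_def e\<kappa>(2)[OF that] by simp
    show "0 \<le> \<theta> u a b" using g by (simp add: \<theta>_def)
    show "\<theta> u a b = \<theta> u b a" using \<kappa>(4)[of a b] by (simp add: \<theta>_def g_def)
  qed
  have k: "0 \<le> k u a" "k u a \<le> eT * \<epsilon> * A" if "0 \<le> u" for u a
  proof -
    show "0 \<le> k u a" unfolding k_def using e\<kappa>(1)[OF that] \<alpha>_nonneg eT \<epsilon>
      by (intro mult_nonneg_nonneg sum_nonneg) auto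
    have "(\<Sum>b\<in>nb a. \<alpha> b * (1 - exp (- \<kappa> a b * u))) \<le> (\<Sum>b\<in>nb a. \<alpha> b * 1)"
      using \<alpha>_nonneg by (intro sum_mono mult_left_mono) auto
    also have "\<dots> \<le> A" using sum_\<alpha>_le by simp
    finally show "k u a \<le> eT * \<epsilon> * A" unfolding k_def using eT \<epsilon> by (intro mult_left_mono) auto
  qed
  define F where "F u \<eta> = quad (\<theta> u) \<eta> + real N * lin (k u) \<eta>" for u and \<eta> :: "'v \<Rightarrow> nat"
  define F' where "F' u \<eta> = quad (\<theta>' u) \<eta> + real N * lin (k' u) \<eta>" for u and \<eta> :: "'v \<Rightarrow> nat"
  define K where "K = (real N)\<^sup>2 * (eT * \<epsilon> * A * (\<mu> + Q))"
  define C where "C = real N * (eT * \<epsilon> * (A * (2 * cm / \<epsilon>)\<^sup>2) * real N)"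
  define B where "B = 2 * eT * (real N)\<^sup>2 + real N * (eT * \<epsilon> * A * real N)"
  have F_bounds: "0 \<le> F u \<eta>" "F u \<eta> \<le> B" if u: "0 \<le> u" "u \<le> T" and \<eta>: "\<eta> \<in> configurations N" for u \<eta>
  proof -
    have "quad (\<lambda>_ _. 0) \<eta> \<le> quad (\<theta> u) \<eta>" "lin (\<lambda>_. 0) \<eta> \<le> lin (k u) \<eta>"
      using \<theta>[OF u(1)] k[OF u(1)] by (intro quad_mono lin_mono; simp)+
    then show "0 \<le> F u \<eta>" by (simp add: F_def quad_const[OF \<eta>] lin_const[OF \<eta>])
    have "quad (\<theta> u) \<eta> \<le> quad (\<lambda>_ _. 2 * eT) \<eta>" "lin (k u) \<eta> \<le> lin (\<lambda>_. eT * \<epsilon> * A) \<eta>"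
      using order_trans[OF \<theta>(2)[OF u(1)], of "2 * eT"] eu[OF u(2)] k[OF u(1)] by (intro quad_mono lin_mono; simp)+
    then have "quad (\<theta> u) \<eta> \<le> 2 * eT * (real N)\<^sup>2" "real N * lin (k u) \<eta> \<le> real N * (eT * \<epsilon> * A * real N)"
      unfolding quad_const[OF \<eta>] lin_const[OF \<eta>] by (auto intro!: mult_left_mono)
    then show "F u \<eta> \<le> B" unfolding F_def B_def by (rule add_mono)
  qed
  \<comment> \<open>As a function of u, \<theta> is a nonnegative combination of exponentials, hence
    convex and above its tangents. In contrast \<open>k\<close> is concave, and
    \<open>exp_minus_le_quadratic\<close> supplies the quadratic correction with \<kappa> at most 2
    cm / \<epsilon>. The size of \<open>C\<close> is harmless in
    \<open>sg_supersolution\<close>.\<close>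
  have tangent: "F u \<eta> + h * F' u \<eta> \<le> F (u + h) \<eta> + C * h\<^sup>2"
    if u: "0 \<le> u" "0 \<le> h" "u + h \<le> T" and \<eta>: "\<eta> \<in> configurations N" for u h \<eta>
  proof -
    have "\<theta> u a b + h * \<theta>' u a b \<le> \<theta> (u + h) a b" for a b
    proof (cases "a = b")
      case False
      have "g a b * (exp (\<mu> * u) + h * (\<mu> * exp (\<mu> * u))) \<le> g a b * exp (\<mu> * (u + h))"
        using g by (intro mult_left_mono exp_tangent_le) auto
      then show ?thesis using False exp_tangent_le[of "\<mu> - \<kappa> a b" u h]
        by (simp add: \<theta>_def \<theta>'_def algebra_simps)
    qed (simp add: \<theta>_def \<theta>'_def)
    then have "quad (\<lambda>a b. \<theta> u a b + h * \<theta>' u a b) \<eta> \<le> quad (\<theta> (u + h)) \<eta>" by (rule quad_mono)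
    then have q: "quad (\<theta> u) \<eta> + h * quad (\<theta>' u) \<eta> \<le> quad (\<theta> (u + h)) \<eta>" by (simp add: quad_add quad_cmult)
    have "k u a + h * k' u a \<le> k (u + h) a + eT * \<epsilon> * (A * (2 * cm / \<epsilon>)\<^sup>2) * h\<^sup>2" for a
    proof -
      have "\<alpha> b * (1 - exp (- \<kappa> a b * u)) + h * (\<alpha> b * (\<kappa> a b * exp (- \<kappa> a b * u)))
          \<le> \<alpha> b * (1 - exp (- \<kappa> a b * (u + h))) + \<alpha> b * ((2 * cm / \<epsilon>)\<^sup>2 * h\<^sup>2)" for b
      proof -
        let ?E = "exp (- \<kappa> a b * u)"
        have "exp (- \<kappa> a b * (u + h)) = ?E * exp (- (\<kappa> a b * h))" by (simp add: exp_add[symmetric] algebra_simps)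
        also have "\<dots> \<le> ?E * (1 - \<kappa> a b * h + (\<kappa> a b * h)\<^sup>2)"
          using \<kappa> u by (intro mult_left_mono exp_minus_le_quadratic) auto
        also have "\<dots> = ?E - h * (\<kappa> a b * ?E) + ?E * (\<kappa> a b * h)\<^sup>2" by (simp add: algebra_simps)
        also have "?E * (\<kappa> a b * h)\<^sup>2 \<le> 1 * ((2 * cm / \<epsilon>) * h)\<^sup>2"
          using e\<kappa>(1)[OF u(1)] \<kappa> u by (intro mult_mono power_mono mult_right_mono) auto
        finally have "(1 - ?E) + h * (\<kappa> a b * ?E) \<le> (1 - exp (- \<kappa> a b * (u + h))) + (2 * cm / \<epsilon>)\<^sup>2 * h\<^sup>2"
          unfolding power_mult_distrib mult_1 by linarith
        from mult_left_mono[OF this \<alpha>_nonneg[of b]] show ?thesis by (simp add: algebra_simps)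
      qed
      then have "(\<Sum>b\<in>nb a. \<alpha> b * (1 - exp (- \<kappa> a b * u)) + h * (\<alpha> b * (\<kappa> a b * exp (- \<kappa> a b * u))))
          \<le> (\<Sum>b\<in>nb a. \<alpha> b * (1 - exp (- \<kappa> a b * (u + h))) + \<alpha> b * ((2 * cm / \<epsilon>)\<^sup>2 * h\<^sup>2))"
        by (rule sum_mono)
      also have "\<dots> = (\<Sum>b\<in>nb a. \<alpha> b * (1 - exp (- \<kappa> a b * (u + h)))) + (\<Sum>b\<in>nb a. \<alpha> b) * ((2 * cm / \<epsilon>)\<^sup>2 * h\<^sup>2)"
        by (simp add: sum.distrib sum_distrib_right)
      also have "(\<Sum>b\<in>nb a. \<alpha> b) * ((2 * cm / \<epsilon>)\<^sup>2 * h\<^sup>2) \<le> A * ((2 * cm / \<epsilon>)\<^sup>2 * h\<^sup>2)"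
        using sum_\<alpha>_le by (intro mult_right_mono) auto
      finally have "(\<Sum>b\<in>nb a. \<alpha> b * (1 - exp (- \<kappa> a b * u))) + h * (\<Sum>b\<in>nb a. \<alpha> b * (\<kappa> a b * exp (- \<kappa> a b * u)))
         \<le> (\<Sum>b\<in>nb a. \<alpha> b * (1 - exp (- \<kappa> a b * (u + h)))) + A * ((2 * cm / \<epsilon>)\<^sup>2 * h\<^sup>2)"
        by (simp add: sum.distrib sum_distrib_left)
      from mult_left_mono[OF this, of "eT * \<epsilon>"] show ?thesis
        using eT \<epsilon> by (simp add: k_def k'_def algebra_simps)
    qed
    then have "lin (\<lambda>a. k u a + h * k' u a) \<eta> \<le> lin (\<lambda>a. k (u + h) a + eT * \<epsilon> * (A * (2 * cm / \<epsilon>)\<^sup>2) * h\<^sup>2) \<eta>"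
      by (rule lin_mono)
    then have "lin (k u) \<eta> + h * lin (k' u) \<eta> \<le> lin (k (u + h)) \<eta> + eT * \<epsilon> * (A * (2 * cm / \<epsilon>)\<^sup>2) * h\<^sup>2 * real N"
      by (simp only: lin_add lin_cmult lin_const[OF \<eta>])
    from mult_left_mono[OF this, of "real N"] q show ?thesis
      by (simp add: F_def F'_def C_def algebra_simps)
  qed
  have gen: "inclusion_generator c \<alpha> \<epsilon> (F u) \<eta> \<le> F' u \<eta> + K"
    if u: "0 \<le> u" "u \<le> T" and \<eta>: "\<eta> \<in> configurations N" for u \<eta>
  proof -
    have "inclusion_generator c \<alpha> \<epsilon> (F u) \<eta> = inclusion_generator c \<alpha> \<epsilon> (quad (\<theta> u)) \<eta>
        + real N * inclusion_generator c \<alpha> \<epsilon> (lin (k u)) \<eta>"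
      unfolding L_eq[OF \<eta>] F_def sum_distrib_left sum.distrib[symmetric]
      by (intro sum.cong refl) (simp add: algebra_simps)
    moreover have "inclusion_generator c \<alpha> \<epsilon> (quad (\<theta> u)) \<eta>
        \<le> quad (\<lambda>a b. if a = b then 0 else 2 * Q * (2 * exp (\<mu> * u)) - 2 * c a b / \<epsilon> * \<theta> u a b) \<eta>
          + 2 * real N * lin (\<lambda>a. \<Sum>b\<in>nb a. c a b * (\<alpha> b * \<theta> u a b)) \<eta>"
      by (rule generator_quad_le[OF \<eta> \<epsilon>]) (use \<theta>[OF u(1)] in \<open>simp_all add: \<theta>_def\<close>)
    moreover have "quad (\<lambda>a b. if a = b then 0 else 2 * Q * (2 * exp (\<mu> * u)) - 2 * c a b / \<epsilon> * \<theta> u a b) \<eta> \<le> quad (\<theta>' u) \<eta>"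
    proof (rule quad_mono)
      fix a b
      have "4 * Q * exp (\<mu> * u) \<le> \<mu> * exp (\<mu> * u)" using \<mu> by simp
      also have "\<dots> = (\<mu> + \<kappa> a b) * g a b * exp (\<mu> * u)" unfolding g(3) ..
      finally have "4 * Q * exp (\<mu> * u) \<le> \<mu> * (g a b * exp (\<mu> * u)) + \<kappa> a b * (g a b * exp (\<mu> * u))"
        by (simp add: algebra_simps)
      moreover have "0 \<le> \<mu> * exp ((\<mu> - \<kappa> a b) * u)" using \<mu> by simp
      ultimately show "(if a = b then 0 else 2 * Q * (2 * exp (\<mu> * u)) - 2 * c a b / \<epsilon> * \<theta> u a b) \<le> \<theta>' u a b"
        unfolding \<kappa>_def[symmetric] by (simp add: \<theta>_def \<theta>'_def algebra_simps)
    qed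
    \<comment> \<open>The factor 2 c(a,b) equals \<epsilon> \<kappa>(a,b). Thus the source is
      \<epsilon> \<kappa> \<theta>, bounded by \<epsilon> eT (\<kappa> g + \<kappa> exp(-\<kappa>
      u)): the second part is the derivative \<open>k'\<close>, the first is at most \<epsilon> eT
      \<mu>.\<close>
    moreover have a4: "2 * lin (\<lambda>a. \<Sum>b\<in>nb a. c a b * (\<alpha> b * \<theta> u a b)) \<eta> \<le> lin (k' u) \<eta> + real N * (eT * \<epsilon> * A * \<mu>)"
    proof -
      have "2 * (\<Sum>b\<in>nb a. c a b * (\<alpha> b * \<theta> u a b)) \<le> k' u a + eT * \<epsilon> * A * \<mu>" for a
      proof -
        have "2 * (c a b * (\<alpha> b * \<theta> u a b)) \<le> \<alpha> b * (eT * \<epsilon> * (\<kappa> a b * exp (- \<kappa> a b * u))) + \<alpha> b * (eT * \<epsilon> * \<mu>)" for b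
        proof -
          let ?E = "exp (- \<kappa> a b * u)"
          have "\<theta> u a b \<le> exp (\<mu> * u) * (g a b + ?E)"
            using e\<kappa>(2)[OF u(1), of a b] g(1)
            by (auto simp: \<theta>_def algebra_simps intro!: add_nonneg_nonneg mult_nonneg_nonneg)
          also have "\<dots> \<le> eT * (g a b + ?E)" using eu[OF u(2)] g(1)[of a b] by (intro mult_right_mono) auto
          finally have "\<epsilon> * \<kappa> a b * \<theta> u a b \<le> \<epsilon> * \<kappa> a b * (eT * (g a b + ?E))"
            using \<epsilon> \<kappa>(1) by (intro mult_left_mono) auto
          also have "\<dots> = \<epsilon> * eT * (\<kappa> a b * g a b) + eT * \<epsilon> * (\<kappa> a b * ?E)" by (simp add: algebra_simps)
          also have "\<epsilon> * eT * (\<kappa> a b * g a b) \<le> \<epsilon> * eT * \<mu>" using g eT \<epsilon> by (intro mult_left_mono) auto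
          finally have "2 * c a b * \<theta> u a b \<le> eT * \<epsilon> * (\<kappa> a b * ?E) + eT * \<epsilon> * \<mu>"
            unfolding \<kappa>(3) by (simp add: mult_ac)
          from mult_left_mono[OF this \<alpha>_nonneg[of b]] show ?thesis by (simp add: algebra_simps)
        qed
        then have "(\<Sum>b\<in>nb a. 2 * (c a b * (\<alpha> b * \<theta> u a b)))
          \<le> (\<Sum>b\<in>nb a. \<alpha> b * (eT * \<epsilon> * (\<kappa> a b * exp (- \<kappa> a b * u))) + \<alpha> b * (eT * \<epsilon> * \<mu>))"
          by (rule sum_mono)
        also have "\<dots> = k' u a + (\<Sum>b\<in>nb a. \<alpha> b) * (eT * \<epsilon> * \<mu>)"
          unfolding sum.distrib k'_def sum_distrib_left sum_distrib_right
          by (intro arg_cong2[where f = "(+)"] sum.cong refl) simp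
        also have "(\<Sum>b\<in>nb a. \<alpha> b) * (eT * \<epsilon> * \<mu>) \<le> A * (eT * \<epsilon> * \<mu>)"
          using sum_\<alpha>_le eT \<epsilon> \<mu> by (intro mult_right_mono) auto
        finally show ?thesis by (simp add: sum_distrib_left mult_ac)
      qed
      then have "lin (\<lambda>a. 2 * (\<Sum>b\<in>nb a. c a b * (\<alpha> b * \<theta> u a b))) \<eta> \<le> lin (\<lambda>a. k' u a + eT * \<epsilon> * A * \<mu>) \<eta>"
        by (rule lin_mono)
      then show ?thesis by (simp only: lin_add lin_cmult lin_const[OF \<eta>] mult_ac)
    qed
    \<comment> \<open>The corrector \<open>k\<close> is transported by the dynamics as well. By
      \<open>generator_lin\<close> only the \<alpha>-rates act on it, so the cost is
      \<open>Q\<close> times the supremum of \<open>k\<close>.\<close>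
    moreover have a5: "inclusion_generator c \<alpha> \<epsilon> (lin (k u)) \<eta> \<le> real N * (eT * \<epsilon> * A * Q)"
    proof -
      define D where "D = closure_set \<eta>"
      note D = closure_set[OF \<eta>, folded D_def]
      have "inclusion_generator c \<alpha> \<epsilon> (lin (k u)) \<eta> = (\<Sum>x\<in>D. \<Sum>y\<in>D. c x y * real (\<eta> x) * \<alpha> y * (k u y - k u x))"
        by (rule generator_lin[OF \<eta> D])
      also have "\<dots> \<le> (\<Sum>x\<in>D. \<Sum>y\<in>D. c x y * real (\<eta> x) * \<alpha> y * (eT * \<epsilon> * A))"
      proof (intro sum_mono mult_left_mono)
        fix x y show "k u y - k u x \<le> eT * \<epsilon> * A" using k[OF u(1), of x] k[OF u(1), of y] by linarith
        show "0 \<le> c x y * real (\<eta> x) * \<alpha> y" using c_nonneg \<alpha>_nonneg by simp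
      qed
      also have "\<dots> = (\<Sum>x\<in>D. real (\<eta> x) * (\<Sum>y\<in>D. c x y * \<alpha> y)) * (eT * \<epsilon> * A)"
        unfolding sum_distrib_right sum_distrib_left by (intro sum.cong refl) simp
      also have "\<dots> \<le> (\<Sum>x\<in>D. real (\<eta> x) * Q) * (eT * \<epsilon> * A)"
        using sum_c\<alpha>_le_B[OF D(1)] eT \<epsilon> A_nonneg by (intro mult_right_mono sum_mono mult_left_mono) auto
      also have "\<dots> = real N * (eT * \<epsilon> * A * Q)"
        using sum_configuration[OF \<eta> D(1,2)] by (simp flip: sum_distrib_right)
      finally show ?thesis .
    qed
    ultimately have "inclusion_generator c \<alpha> \<epsilon> (F u) \<eta>
      \<le> quad (\<theta>' u) \<eta> + real N * (lin (k' u) \<eta> + real N * (eT * \<epsilon> * A * \<mu>)) + real N * (real N * (eT * \<epsilon> * A * Q))"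
      using mult_left_mono[OF a4, of "real N"] mult_left_mono[OF a5, of "real N"] by linarith
    then show ?thesis by (simp add: F'_def K_def power2_eq_square algebra_simps)
  qed
  have x: "condensate N x \<in> configurations N" by (rule condensate_in_configurations)
  have U0: "0 \<le> quad (\<lambda>a b. if a = b then 0 else 1) \<eta>" "quad (\<lambda>a b. if a = b then 0 else 1) \<eta> \<le> F 0 \<eta>"
    if "\<eta> \<in> configurations N" for \<eta> :: "'v \<Rightarrow> nat"
  proof -
    have "quad (\<lambda>_ _. 0) \<eta> \<le> quad (\<lambda>a b. if a = b then 0 else 1) \<eta>" by (rule quad_mono) simp
    then show "0 \<le> quad (\<lambda>a b. if a = b then 0 else 1) \<eta>" by (simp add: quad_const[OF that])
    have "quad (\<lambda>a b. if a = b then 0 else 1) \<eta> \<le> quad (\<theta> 0) \<eta>" by (rule quad_mono) (simp add: \<theta>_def g)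
    moreover have "lin (k 0) \<eta> = 0" by (simp add: k_def lin_def)
    ultimately show "quad (\<lambda>a b. if a = b then 0 else 1) \<eta> \<le> F 0 \<eta>" by (simp add: F_def)
  qed
  have "sg T (quad (\<lambda>a b. if a = b then 0 else 1)) (condensate N x) \<le> sg T (F 0) (condensate N x)"
  proof (rule sg_mono[OF T x])
    fix \<eta> :: "'v \<Rightarrow> nat" assume \<eta>: "\<eta> \<in> configurations N"
    show "quad (\<lambda>a b. if a = b then 0 else 1) \<eta> \<le> F 0 \<eta>" by (rule U0(2)[OF \<eta>])
    then show "\<bar>quad (\<lambda>a b. if a = b then 0 else 1) \<eta>\<bar> \<le> B" "\<bar>F 0 \<eta>\<bar> \<le> B"
      using U0(1)[OF \<eta>] F_bounds[OF order_refl T \<eta>] by linarith+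
  qed
  also have "\<dots> \<le> F T (condensate N x) + K * T"
    using F_bounds tangent gen T x by (intro sg_supersolution[where B = B and F' = F' and C = C]) auto
  \<comment> \<open>At a condensate the quadratic part vanishes with the diagonal of \<theta>, so
    only the linear part, of order \<epsilon>, is left.\<close>
  also have "F T (condensate N x) \<le> real N * (eT * \<epsilon> * A * real N)"
    using k(2)[OF T, of x] by (auto simp: F_def quad_condensate lin_condensate \<theta>_def intro!: mult_left_mono mult_right_mono)
  finally show ?thesis unfolding sg_def
    by (simp add: K_def non_condensation_const_def eT_def \<mu>_def power2_eq_square algebra_simps)
qed

text \<open>Markov's inequality: off the condensates the pair count is at least N - 1, hence at
  least N / 2 for N \<ge> 2, against a mean of order \<epsilon> N^2.\<close>

lemma prob_non_condensed_le:
  assumes P: "markov_semigroup (configurations N) P" "has_generator (configurations N) P (inclusion_generator c \<alpha> \<epsilon>)"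
    and \<epsilon>: "0 < \<epsilon>" and T: "0 \<le> T" and N: "2 \<le> N"
  shows "measure_pmf.prob (P T (condensate N x)) (- condensates N) \<le> 2 * (\<epsilon> * real N) * non_condensation_const T"
proof -
  interpret bounded_chain "configurations N" P "inclusion_generator c \<alpha> \<epsilon>" inclusion_pairs "inclusion_rate \<epsilon>"
    "\<lambda>\<eta> (x, y). move \<eta> x y" "real N * (real d * (cm * (am + real N / \<epsilon>)))"
    by (rule inclusion_chain[OF P \<epsilon>])
  have x: "condensate N x \<in> configurations N" by (rule condensate_in_configurations)
  let ?U = "quad (\<lambda>a b. if a = b then 0 else 1) :: ('v \<Rightarrow> nat) \<Rightarrow> real"
  have U: "0 \<le> ?U \<eta>" "?U \<eta> \<le> (real N)\<^sup>2" if "\<eta> \<in> configurations N" for \<eta>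
    using quad_mono[of "\<lambda>_ _. 0" "\<lambda>a b. if a = b then 0 else 1" \<eta>] quad_mono[of "\<lambda>a b. if a = b then 0 else 1" "\<lambda>_ _. 1" \<eta>]
    by (auto simp: quad_const[OF that])
  have "(real N / 2) * measure_pmf.prob (P T (condensate N x)) (- condensates N)
      = sg T (\<lambda>\<eta>. (real N / 2) * indicator (- condensates N) \<eta>) (condensate N x)"
    by (simp add: sg_def)
  also have "\<dots> \<le> sg T ?U (condensate N x)"
  proof (rule sg_mono[OF T x])
    fix \<eta> :: "'v \<Rightarrow> nat" assume \<eta>: "\<eta> \<in> configurations N"
    show "(real N / 2) * indicator (- condensates N) \<eta> \<le> ?U \<eta>"
      using quad_offdiag_ge[OF \<eta>] U[OF \<eta>] N by (auto simp: indicator_def)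
    show "\<bar>?U \<eta>\<bar> \<le> (real N)\<^sup>2" using U[OF \<eta>] by simp
    show "\<bar>real N / 2 * indicator (- condensates N) \<eta>\<bar> \<le> real N / 2" by (simp add: indicator_def)
  qed
  also have "\<dots> \<le> \<epsilon> * (real N)\<^sup>2 * non_condensation_const T"
    unfolding sg_def by (rule expected_offdiag_le[OF P \<epsilon> T])
  finally have "real N * measure_pmf.prob (P T (condensate N x)) (- condensates N)
     \<le> real N * (2 * (\<epsilon> * real N) * non_condensation_const T)"
    by (simp add: power2_eq_square algebra_simps)
  then show ?thesis using N by simp
qed

end

section \<open>Linear duality\<close>

lemma (in bounded_chain) sg_sum:
  assumes "0 \<le> t" "z \<in> S" "\<And>i w. i \<in> J \<Longrightarrow> w \<in> S \<Longrightarrow> \<bar>f i w\<bar> \<le> B"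
  shows "sg t (\<lambda>w. \<Sum>i\<in>J. f i w) z = (\<Sum>i\<in>J. sg t (f i) z)"
  unfolding sg_def using assms by (intro Bochner_Integration.integral_sum integrable_P)

lemma (in bounded_chain) sg_indicator: "sg t (indicator A) z = measure_pmf.prob (P t z) A"
  by (simp add: sg_def)

context site_weights
begin

text \<open>The forward (Kolmogorov) operator of the limit chain on sites: by symmetry of
  \<open>c\<close>, \<open>c y z * \<alpha> y\<close> is the rate from \<open>z\<close> to
  \<open>y\<close> and \<open>c y z * \<alpha> z\<close> the rate from \<open>y\<close> to
  \<open>z\<close>.\<close>

definition flow :: "('v \<Rightarrow> real) \<Rightarrow> 'v \<Rightarrow> real" where
  "flow u y = (\<Sum>z\<in>nb y. c y z * (\<alpha> y * u z - \<alpha> z * u y))"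

lemma flow_diff: "flow u y - flow v y = flow (\<lambda>z. u z - v z) y"
  unfolding flow_def sum_subtractf[symmetric] by (intro sum.cong refl) (simp add: algebra_simps)

lemma abs_flow_le:
  assumes "\<And>z. \<bar>u z\<bar> \<le> B" shows "\<bar>flow u y\<bar> \<le> 2 * Q * B"
proof -
  have B: "0 \<le> B" using assms[of y] by linarith
  have "\<bar>flow u y\<bar> \<le> (\<Sum>z\<in>nb y. c y z * \<alpha> y * B + c y z * \<alpha> z * B)"
    unfolding flow_def
  proof (rule order_trans[OF sum_abs], rule sum_mono)
    fix z
    have "\<bar>\<alpha> y * u z - \<alpha> z * u y\<bar> \<le> \<alpha> y * \<bar>u z\<bar> + \<alpha> z * \<bar>u y\<bar>"
      using abs_triangle_ineq4[of "\<alpha> y * u z" "\<alpha> z * u y"] \<alpha>_nonneg by (simp add: abs_mult)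
    also have "\<dots> \<le> \<alpha> y * B + \<alpha> z * B" using assms \<alpha>_nonneg by (intro add_mono mult_left_mono)
    finally have "\<bar>c y z * (\<alpha> y * u z - \<alpha> z * u y)\<bar> \<le> c y z * (\<alpha> y * B + \<alpha> z * B)"
      using c_nonneg[of y z] by (simp add: abs_mult mult_left_mono)
    then show "\<bar>c y z * (\<alpha> y * u z - \<alpha> z * u y)\<bar> \<le> c y z * \<alpha> y * B + c y z * \<alpha> z * B"
      by (simp add: algebra_simps)
  qed
  also have "\<dots> = (\<Sum>z\<in>nb y. c y z * \<alpha> y) * B + (\<Sum>z\<in>nb y. c y z * \<alpha> z) * B"
    by (simp add: sum.distrib sum_distrib_right)
  also have "\<dots> \<le> Q * B + Q * B" using B sum_c\<alpha>_le sum_c\<alpha>_le' by (intro add_mono mult_right_mono)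
  finally show ?thesis by (simp add: mult_ac)
qed

text \<open>A discrete Gronwall argument for the difference \<open>w\<close>: in one step of length
  \<open>h\<close> its supremum over sites is multiplied by at most 1 + 2 Q h and increased by C
  h^2, so after n + 1 steps of length t / (n + 1) it is at most C t h exp(2 Q t). The two Taylor
  constants may differ, since only the limit of vanishing mesh matters. The induction runs over all
  sites at once because \<open>flow\<close> couples neighbours.\<close>

lemma flow_equation_unique:
  assumes "\<And>y. u 0 y = v 0 y" and t: "0 \<le> t"
    and u: "\<And>s h y. 0 \<le> s \<Longrightarrow> 0 \<le> h \<Longrightarrow> \<bar>u (s + h) y - u s y - h * flow (u s) y\<bar> \<le> D * h\<^sup>2"
    and v: "\<And>s h y. 0 \<le> s \<Longrightarrow> 0 \<le> h \<Longrightarrow> \<bar>v (s + h) y - v s y - h * flow (v s) y\<bar> \<le> D' * h\<^sup>2"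
  shows "u t y = v t y"
proof -
  define w where "w s y = u s y - v s y" for s y
  define C where "C = D + D'"
  have "0 \<le> D" "0 \<le> D'" using u[of 0 1 y] v[of 0 1 y] by auto
  then have C: "0 \<le> C" by (simp add: C_def)
  have step: "\<bar>w (s + h) y - w s y - h * flow (w s) y\<bar> \<le> C * h\<^sup>2" if "0 \<le> s" "0 \<le> h" for s h y
  proof -
    have "w (s + h) y - w s y - h * flow (w s) y
      = (u (s + h) y - u s y - h * flow (u s) y) - (v (s + h) y - v s y - h * flow (v s) y)"
      unfolding w_def flow_diff[symmetric] by (simp add: algebra_simps)
    then show ?thesis using u[OF that, of y] v[OF that, of y]
      unfolding C_def distrib_right by linarith
  qed
  have "\<bar>w t y\<bar> \<le> C * t\<^sup>2 * exp (2 * Q * t) * (1 / real (Suc n))" for n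
  proof -
    define h where "h = t / real (Suc n)"
    have h: "0 \<le> h" and T: "real (Suc n) * h = t" using t by (auto simp: h_def)
    have "\<bar>w (real k * h) y\<bar> \<le> real k * (C * h\<^sup>2) * (1 + 2 * Q * h) ^ k" for k y
    proof (induction k arbitrary: y)
      case 0
      then show ?case by (simp add: w_def assms(1))
    next
      case (Suc k)
      define b where "b = real k * (C * h\<^sup>2) * (1 + 2 * Q * h) ^ k"
      have b: "\<bar>w (real k * h) z\<bar> \<le> b" for z using Suc unfolding b_def .
      have "\<bar>h * flow (w (real k * h)) y\<bar> \<le> h * (2 * Q * b)"
        using abs_flow_le[of "w (real k * h)", OF b] h by (simp add: abs_mult mult_left_mono)
      then have "\<bar>w (real k * h + h) y\<bar> \<le> b + h * (2 * Q * b) + C * h\<^sup>2"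
        using step[of "real k * h" h y] h b[of y] by simp
      also have "\<dots> = (1 + 2 * Q * h) * b + C * h\<^sup>2 * 1" by (simp add: algebra_simps)
      also have "\<dots> \<le> (1 + 2 * Q * h) * b + C * h\<^sup>2 * (1 + 2 * Q * h) ^ Suc k"
        using C h Q_nonneg by (intro add_left_mono mult_left_mono one_le_power) auto
      also have "\<dots> = real (Suc k) * (C * h\<^sup>2) * (1 + 2 * Q * h) ^ Suc k"
        by (simp add: b_def algebra_simps)
      finally show ?case by (simp add: algebra_simps)
    qed
    from this[of "Suc n" y] have "\<bar>w t y\<bar> \<le> t * (C * h) * (1 + 2 * Q * h) ^ Suc n"
      unfolding T by (simp add: T[symmetric] power2_eq_square mult_ac)
    also have "(1 + 2 * Q * h) ^ Suc n \<le> exp (2 * Q * h) ^ Suc n"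
      using h Q_nonneg by (intro power_mono) auto
    also have "exp (2 * Q * h) ^ Suc n = exp (2 * Q * t)"
      unfolding exp_of_nat_mult[symmetric] T[symmetric] by (simp only: mult_ac)
    finally have "\<bar>w t y\<bar> \<le> t * (C * h) * exp (2 * Q * t)" using t C h by (simp add: mult_left_mono)
    then show ?thesis by (simp add: h_def power2_eq_square mult_ac)
  qed
  moreover have "(\<lambda>n. C * t\<^sup>2 * exp (2 * Q * t) * (1 / real (Suc n))) \<longlonglongrightarrow> C * t\<^sup>2 * exp (2 * Q * t) * 0"
    using LIMSEQ_inverse_real_of_nat by (intro tendsto_intros) (simp add: inverse_eq_divide)
  ultimately have "\<bar>w t y\<bar> \<le> C * t\<^sup>2 * exp (2 * Q * t) * 0"
    by (intro tendsto_lowerbound[where F = sequentially]) auto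
  then show ?thesis by (simp add: w_def)
qed

text \<open>Rewrites the backward generator applied to the indicator of a site in forward form;
  taking expectations then yields \<open>flow\<close> of the transition probabilities.\<close>

lemma limit_generator_indicator:
  "limit_generator c \<alpha> (indicator {Some y}) z = (\<Sum>w\<in>nb y. c y w * (\<alpha> y * indicator {Some w} z - \<alpha> w * indicator {Some y} z))"
proof (cases z)
  case (Some w)
  have "(\<Sum>\<^sub>\<infinity>i. c w i * \<alpha> i * (indicator {Some y} (Some i) - indicator {Some y} (Some w)))
     = (\<Sum>\<^sub>\<infinity>i\<in>insert y (nb w). c w i * \<alpha> i * (indicator {Some y} (Some i) - indicator {Some y} (Some w)))"
    by (rule infsum_cong_neutral) (auto simp: nb_def)
  also have "\<dots> = (\<Sum>i\<in>insert y (nb w). c w i * \<alpha> i * (indicator {Some y} (Some i) - indicator {Some y} (Some w)))"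
    using finite_nb' by simp
  also have "\<dots> = c w y * \<alpha> y - of_bool (w = y) * (\<Sum>i\<in>insert y (nb w). c w i * \<alpha> i)"
  proof -
    have "(\<Sum>i\<in>insert y (nb w). c w i * \<alpha> i * (indicator {Some y} (Some i) - indicator {Some y} (Some w)))
      = (\<Sum>i\<in>insert y (nb w). c w i * \<alpha> i * of_bool (i = y)) - (\<Sum>i\<in>insert y (nb w). c w i * \<alpha> i) * of_bool (w = y)"
      unfolding right_diff_distrib sum_subtractf sum_distrib_right
      by (intro arg_cong2[where f = "(-)"] sum.cong refl) (auto simp: indicator_def)
    also have "(\<Sum>i\<in>insert y (nb w). c w i * \<alpha> i * of_bool (i = y)) = c w y * \<alpha> y"
      using finite_nb' by (intro sum_of_bool_mult) auto
    finally show ?thesis by (simp add: mult_ac)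
  qed
  also have "\<dots> = (\<Sum>i\<in>insert w (nb y). c y i * (\<alpha> y * indicator {Some i} (Some w) - \<alpha> i * indicator {Some y} (Some w)))"
  proof -
    have "(\<Sum>i\<in>insert w (nb y). c y i * (\<alpha> y * indicator {Some i} (Some w) - \<alpha> i * indicator {Some y} (Some w)))
      = (\<Sum>i\<in>insert w (nb y). c y i * \<alpha> y * of_bool (i = w)) - (\<Sum>i\<in>insert w (nb y). c y i * \<alpha> i) * of_bool (w = y)"
      unfolding right_diff_distrib sum_subtractf sum_distrib_right
      by (intro arg_cong2[where f = "(-)"] sum.cong refl) (auto simp: indicator_def)
    also have "(\<Sum>i\<in>insert w (nb y). c y i * \<alpha> y * of_bool (i = w)) = c y w * \<alpha> y"
      using finite_nb' by (intro sum_of_bool_mult) auto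
    finally show ?thesis using c_sym[of y w] by auto
  qed
  also have "\<dots> = (\<Sum>i\<in>nb y. c y i * (\<alpha> y * indicator {Some i} (Some w) - \<alpha> i * indicator {Some y} (Some w)))"
    using finite_nb' by (intro sum.mono_neutral_right) (auto simp: c_nb)
  finally show ?thesis using Some by (simp add: limit_generator_def)
qed (simp add: limit_generator_def)

text \<open>
  First-order duality: the interaction drops out, so the mean occupation of a site solves the same
  linear system as the transition probabilities of the limiting chain.
\<close>

lemma mean_occupation_eq:
  assumes P: "markov_semigroup (configurations N) P" "has_generator (configurations N) P (inclusion_generator c \<alpha> \<epsilon>)"
    and P': "markov_semigroup UNIV P'" "has_generator UNIV P' (limit_generator c \<alpha>)"
    and \<epsilon>: "0 < \<epsilon>" and t: "0 \<le> t" and N: "0 < N"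
  shows "measure_pmf.expectation (P t (condensate N x)) (\<lambda>\<eta>. real (\<eta> y) / real N) = pmf (P' t (Some x)) (Some y)"
proof -
  interpret A: bounded_chain "configurations N" P "inclusion_generator c \<alpha> \<epsilon>" inclusion_pairs "inclusion_rate \<epsilon>"
    "\<lambda>\<eta> (x, y). move \<eta> x y" "real N * (real d * (cm * (am + real N / \<epsilon>)))"
    by (rule inclusion_chain[OF P \<epsilon>])
  interpret B: bounded_chain UNIV P' "limit_generator c \<alpha>" "\<lambda>z. case z of None \<Rightarrow> {} | Some x \<Rightarrow> nb x"
    "\<lambda>z y. case z of None \<Rightarrow> 0 | Some x \<Rightarrow> c x y * \<alpha> y" "\<lambda>z y. Some y" Q
    by (rule limit_chain[OF P'])
  have x: "condensate N x \<in> configurations N" by (rule condensate_in_configurations)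
  define f where "f y \<eta> = real (\<eta> y) / real N" for y and \<eta> :: "'v \<Rightarrow> nat"
  have f1: "\<bar>f y \<eta>\<bar> \<le> 1" if "\<eta> \<in> configurations N" for y \<eta>
    using configuration_le[OF that, of y] N by (simp add: f_def)
  define u where "u s y = A.sg s (f y) (condensate N x)" for s y
  define v where "v s y = B.sg s (indicator {Some y}) (Some x)" for s y
  \<comment> \<open>Both families start from the indicator of \<open>x\<close> and satisfy the flow
    equation, with Taylor constants built from the rate bound of the particle system on one side and
    from \<open>Q\<close> on the other.\<close>
  have "u t y = v t y"
  proof (rule flow_equation_unique[OF _ t])
    show "u 0 y = v 0 y" for y
      using N unfolding u_def v_def A.sg_0[OF x] B.sg_0[OF UNIV_I] by (simp add: f_def condensate_def indicator_def)
    have gen: "inclusion_generator c \<alpha> \<epsilon> (f y) \<eta> = (\<Sum>z\<in>nb y. c y z * (\<alpha> y * f z \<eta> - \<alpha> z * f y \<eta>))"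
      if \<eta>: "\<eta> \<in> configurations N" for y \<eta>
    proof -
      have "inclusion_generator c \<alpha> \<epsilon> (f y) \<eta> = inclusion_generator c \<alpha> \<epsilon> (lin (\<lambda>a. of_bool (a = y))) \<eta> / real N"
        unfolding A.L_eq[OF \<eta>] sum_divide_distrib
        by (intro sum.cong refl) (use A.m_in[OF \<eta>] \<eta> in \<open>auto simp: f_def lin_delta[where N = N] diff_divide_distrib right_diff_distrib\<close>)
      also have "\<dots> = (\<Sum>z\<in>nb y. c y z * (\<alpha> y * f z \<eta> - \<alpha> z * f y \<eta>))"
        unfolding generator_lin_delta[OF \<eta>] sum_divide_distrib
        by (intro sum.cong refl) (simp add: f_def diff_divide_distrib right_diff_distrib)
      finally show ?thesis .
    qed
    have Af: "A.sg s (inclusion_generator c \<alpha> \<epsilon> (f y)) (condensate N x) = flow (u s) y" if s: "0 \<le> s" for s y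
    proof -
      have b: "\<bar>c y z * (\<alpha> y * f z \<eta> - \<alpha> z * f y \<eta>)\<bar> \<le> cm * (am * 1 + am * 1)"
        if "\<eta> \<in> configurations N" for z \<eta>
      proof -
        have "\<bar>\<alpha> y * f z \<eta> - \<alpha> z * f y \<eta>\<bar> \<le> \<alpha> y * \<bar>f z \<eta>\<bar> + \<alpha> z * \<bar>f y \<eta>\<bar>"
          using abs_triangle_ineq4[of "\<alpha> y * f z \<eta>" "\<alpha> z * f y \<eta>"] \<alpha>_nonneg by (simp add: abs_mult)
        also have "\<dots> \<le> am * 1 + am * 1"
          using f1[OF that] \<alpha>_nonneg \<alpha>_le am_nonneg by (intro add_mono mult_mono) auto
        finally show ?thesis unfolding abs_mult using c_nonneg c_le cm_nonneg by (intro mult_mono) auto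
      qed
      have "A.sg s (inclusion_generator c \<alpha> \<epsilon> (f y)) (condensate N x)
         = A.sg s (\<lambda>\<eta>. \<Sum>z\<in>nb y. c y z * (\<alpha> y * f z \<eta> - \<alpha> z * f y \<eta>)) (condensate N x)"
        by (rule A.sg_cong[OF s x gen])
      also have "\<dots> = (\<Sum>z\<in>nb y. A.sg s (\<lambda>\<eta>. c y z * (\<alpha> y * f z \<eta> - \<alpha> z * f y \<eta>)) (condensate N x))"
        by (rule A.sg_sum[OF s x b])
      also have "\<dots> = flow (u s) y"
        unfolding flow_def
      proof (intro sum.cong refl)
        fix z
        have b': "\<bar>a * f z \<eta>\<bar> \<le> \<bar>a\<bar>" if "\<eta> \<in> configurations N" for a z \<eta>
          using f1[OF that, of z] by (simp add: abs_mult mult_left_le)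
        show "A.sg s (\<lambda>\<eta>. c y z * (\<alpha> y * f z \<eta> - \<alpha> z * f y \<eta>)) (condensate N x) = c y z * (\<alpha> y * u s z - \<alpha> z * u s y)"
          using A.sg_diff[OF s x, where f = "\<lambda>\<eta>. \<alpha> y * f z \<eta>" and B = "\<bar>\<alpha> y\<bar>"
              and g = "\<lambda>\<eta>. \<alpha> z * f y \<eta>" and B' = "\<bar>\<alpha> z\<bar>"] b'
          by (simp add: A.sg_cmult u_def)
      qed
      finally show ?thesis .
    qed
    show "\<bar>u (s + h) y - u s y - h * flow (u s) y\<bar> \<le> 4 * (real N * (real d * (cm * (am + real N / \<epsilon>))))\<^sup>2 * 1 * h\<^sup>2"
      if "0 \<le> s" "0 \<le> h" for s h y
      using A.sg_taylor_at[of "f y" 1 s h, OF f1 that x] unfolding Af[OF that(1)] u_def .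
    have i1: "\<bar>indicator {Some y} z :: real\<bar> \<le> 1" for y z by (simp add: indicator_def)
    have Bf: "B.sg s (limit_generator c \<alpha> (indicator {Some y})) (Some x) = flow (v s) y" if s: "0 \<le> s" for s y
    proof -
      have b: "\<bar>c y z * (\<alpha> y * indicator {Some z} w - \<alpha> z * indicator {Some y} w)\<bar> \<le> cm * am" for z w
      proof -
        have "\<bar>\<alpha> y * indicator {Some z} w - \<alpha> z * indicator {Some y} w\<bar> \<le> am"
          using \<alpha>_nonneg[of y] \<alpha>_nonneg[of z] \<alpha>_le[of y] \<alpha>_le[of z] by (auto simp: indicator_def)
        then show ?thesis unfolding abs_mult using c_nonneg c_le cm_nonneg by (intro mult_mono) auto
      qed
      have "B.sg s (limit_generator c \<alpha> (indicator {Some y})) (Some x)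
         = B.sg s (\<lambda>w. \<Sum>z\<in>nb y. c y z * (\<alpha> y * indicator {Some z} w - \<alpha> z * indicator {Some y} w)) (Some x)"
        by (rule B.sg_cong[OF s UNIV_I limit_generator_indicator])
      also have "\<dots> = (\<Sum>z\<in>nb y. B.sg s (\<lambda>w. c y z * (\<alpha> y * indicator {Some z} w - \<alpha> z * indicator {Some y} w)) (Some x))"
        by (rule B.sg_sum[OF s UNIV_I b])
      also have "\<dots> = flow (v s) y"
        unfolding flow_def
      proof (intro sum.cong refl)
        fix z
        have b': "\<bar>a * indicator {Some z} w\<bar> \<le> \<bar>a\<bar>" for a :: real and z and w :: "'v option"
          by (simp add: indicator_def)
        show "B.sg s (\<lambda>w. c y z * (\<alpha> y * indicator {Some z} w - \<alpha> z * indicator {Some y} w)) (Some x)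
            = c y z * (\<alpha> y * v s z - \<alpha> z * v s y)"
          using B.sg_diff[OF s UNIV_I, where f = "\<lambda>w. \<alpha> y * indicator {Some z} w" and B = "\<bar>\<alpha> y\<bar>"
              and g = "\<lambda>w. \<alpha> z * indicator {Some y} w" and B' = "\<bar>\<alpha> z\<bar>"] b'
          by (simp only: B.sg_cmult v_def UNIV_I)
      qed
      finally show ?thesis .
    qed
    show "\<bar>v (s + h) y - v s y - h * flow (v s) y\<bar> \<le> 4 * Q\<^sup>2 * 1 * h\<^sup>2" if "0 \<le> s" "0 \<le> h" for s h y
      using B.sg_taylor_at[of "indicator {Some y}" 1 s h "Some x", OF i1 that UNIV_I] unfolding Bf[OF that(1)] v_def .
  qed
  then show ?thesis by (simp add: u_def v_def A.sg_def f_def[abs_def] B.sg_indicator pmf.rep_eq)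
qed

text \<open>The indicator of the condensate at \<open>y\<close> lies below the fraction of particles
  at \<open>y\<close>, which lies below the same indicator plus the indicator of not being
  condensed. The mean of the middle term is the limit transition probability, by
  \<open>mean_occupation_eq\<close>.\<close>

lemma transition_estimate:
  assumes P: "markov_semigroup (configurations N) P" "has_generator (configurations N) P (inclusion_generator c \<alpha> \<epsilon>)"
    and P': "markov_semigroup UNIV P'" "has_generator UNIV P' (limit_generator c \<alpha>)"
    and \<epsilon>: "0 < \<epsilon>" and t: "0 \<le> t" and N: "2 \<le> N"
  shows "\<bar>pmf (P t (condensate N x)) (condensate N y) - pmf (P' t (Some x)) (Some y)\<bar>
    \<le> 2 * (\<epsilon> * real N) * non_condensation_const t"
proof -
  interpret bounded_chain "configurations N" P "inclusion_generator c \<alpha> \<epsilon>" inclusion_pairs "inclusion_rate \<epsilon>"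
    "\<lambda>\<eta> (x, y). move \<eta> x y" "real N * (real d * (cm * (am + real N / \<epsilon>)))"
    by (rule inclusion_chain[OF P \<epsilon>])
  have x: "condensate N x \<in> configurations N" by (rule condensate_in_configurations)
  let ?f = "\<lambda>\<eta>. real (\<eta> y) / real N" and ?i = "indicator {condensate N y} :: _ \<Rightarrow> real"
    and ?j = "indicator (- condensates N) :: _ \<Rightarrow> real"
  have f1: "\<bar>?f \<eta>\<bar> \<le> 1" if "\<eta> \<in> configurations N" for \<eta>
    using configuration_le[OF that, of y] N by simp
  have i1: "\<bar>?i \<eta>\<bar> \<le> 1" "\<bar>?j \<eta>\<bar> \<le> 1" for \<eta> by (auto simp: indicator_def)
  have m: "sg t ?f (condensate N x) = pmf (P' t (Some x)) (Some y)"
    unfolding sg_def using mean_occupation_eq[OF P P' \<epsilon> t] N by simp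
  have le: "?i \<eta> \<le> ?f \<eta>" "?f \<eta> \<le> ?i \<eta> + ?j \<eta>" if "\<eta> \<in> configurations N" for \<eta>
  proof -
    show "?i \<eta> \<le> ?f \<eta>" using N by (auto simp: indicator_def condensate_def)
    show "?f \<eta> \<le> ?i \<eta> + ?j \<eta>"
      using f1[OF that] by (auto simp: indicator_def condensates_def condensate_def split: if_splits)
  qed
  have "sg t ?i (condensate N x) \<le> sg t ?f (condensate N x)"
    by (rule sg_mono[OF t x i1(1) f1 le(1)])
  moreover have "sg t ?f (condensate N x) \<le> sg t (\<lambda>\<eta>. ?i \<eta> + ?j \<eta>) (condensate N x)"
  proof (rule sg_mono[OF t x f1 _ le(2)])
    show "\<bar>?i \<eta> + ?j \<eta>\<bar> \<le> 2" for \<eta> using i1[of \<eta>] by linarith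
  qed
  moreover have "sg t (\<lambda>\<eta>. ?i \<eta> + ?j \<eta>) (condensate N x) = sg t ?i (condensate N x) + sg t ?j (condensate N x)"
    by (rule sg_add[OF t x i1])
  ultimately show ?thesis
    using prob_non_condensed_le[OF P \<epsilon> t N, of x] unfolding m sg_indicator by (simp add: pmf.rep_eq)
qed

text \<open>No jump of the limit chain leads from a site to \<open>None\<close>, so the generator
  annihilates the indicator of \<open>None\<close>.\<close>

lemma limit_semigroup_None:
  assumes P': "markov_semigroup UNIV P'" "has_generator UNIV P' (limit_generator c \<alpha>)" and t: "0 \<le> t"
  shows "pmf (P' t (Some x)) None = 0"
proof -
  interpret bounded_chain UNIV P' "limit_generator c \<alpha>" "\<lambda>z. case z of None \<Rightarrow> {} | Some x \<Rightarrow> nb x"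
    "\<lambda>z y. case z of None \<Rightarrow> 0 | Some x \<Rightarrow> c x y * \<alpha> y" "\<lambda>z y. Some y" Q
    by (rule limit_chain[OF P'])
  have "sg t (indicator {None}) (Some x) \<le> indicator {None} (Some x) + 0 * t"
    by (rule sg_le_of_L_le[where B = 1]) (use t in \<open>auto simp: limit_generator_def indicator_def split: option.splits\<close>)
  then show ?thesis by (simp add: sg_indicator pmf.rep_eq measure_le_0_iff)
qed

text \<open>Dropping the return flow towards \<open>y\<close> leaves the outflow from
  \<open>y\<close>, which is at most \<open>Q\<close> times the fraction at \<open>y\<close>. The
  attraction cancels on this linear function, so the bound is free of \<open>N\<close> and
  \<epsilon>.\<close>

lemma escape_drift:
  assumes P: "markov_semigroup (configurations N) P" "has_generator (configurations N) P (inclusion_generator c \<alpha> \<epsilon>)"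
    and \<epsilon>: "0 < \<epsilon>" and t: "0 \<le> t" and N: "0 < N" and \<eta>: "\<eta> \<in> configurations N"
  shows "measure_pmf.expectation (P t \<eta>) (\<lambda>\<eta>. 1 - real (\<eta> y) / real N) \<le> 1 - real (\<eta> y) / real N + Q * t"
proof -
  interpret bounded_chain "configurations N" P "inclusion_generator c \<alpha> \<epsilon>" inclusion_pairs "inclusion_rate \<epsilon>"
    "\<lambda>\<eta> (x, y). move \<eta> x y" "real N * (real d * (cm * (am + real N / \<epsilon>)))"
    by (rule inclusion_chain[OF P \<epsilon>])
  let ?f = "\<lambda>\<eta>. 1 - real (\<eta> y) / real N"
  have "sg t ?f \<eta> \<le> ?f \<eta> + Q * t"
  proof (rule sg_le_of_L_le[OF _ _ t \<eta>])
    fix \<zeta> :: "'v \<Rightarrow> nat" assume \<zeta>: "\<zeta> \<in> configurations N"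
    show "\<bar>?f \<zeta>\<bar> \<le> 1" using configuration_le[OF \<zeta>, of y] N by simp
    have "inclusion_generator c \<alpha> \<epsilon> ?f \<zeta> = - (inclusion_generator c \<alpha> \<epsilon> (lin (\<lambda>a. of_bool (a = y))) \<zeta> / real N)"
      unfolding L_eq[OF \<zeta>] sum_divide_distrib sum_negf[symmetric]
      by (intro sum.cong refl) (use m_in[OF \<zeta>] \<zeta> in \<open>auto simp: lin_delta[where N = N] diff_divide_distrib right_diff_distrib\<close>)
    also have "\<dots> = (\<Sum>z\<in>nb y. c y z * (\<alpha> z * real (\<zeta> y) - \<alpha> y * real (\<zeta> z))) / real N"
      unfolding generator_lin_delta[OF \<zeta>] sum_divide_distrib sum_negf[symmetric]
      by (intro sum.cong refl) (simp add: diff_divide_distrib right_diff_distrib)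
    also have "\<dots> \<le> (\<Sum>z\<in>nb y. c y z * \<alpha> z * real N) / real N"
    proof (intro divide_right_mono sum_mono)
      fix z
      have "\<alpha> z * real (\<zeta> y) - \<alpha> y * real (\<zeta> z) \<le> \<alpha> z * real N"
        using mult_left_mono[OF of_nat_mono[OF configuration_le[OF \<zeta>, of y]] \<alpha>_nonneg[of z]]
          mult_nonneg_nonneg[OF \<alpha>_nonneg[of y] of_nat_0_le_iff[of "\<zeta> z"]] by linarith
      then show "c y z * (\<alpha> z * real (\<zeta> y) - \<alpha> y * real (\<zeta> z)) \<le> c y z * \<alpha> z * real N"
        unfolding mult.assoc using c_nonneg by (rule mult_left_mono)
    qed simp
    also have "\<dots> = (\<Sum>z\<in>nb y. c y z * \<alpha> z)" using N by (simp flip: sum_distrib_right)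
    finally show "inclusion_generator c \<alpha> \<epsilon> ?f \<zeta> \<le> Q" using sum_c\<alpha>_le[of y] by linarith
  qed
  then show ?thesis by (simp add: sg_def)
qed

end

section \<open>Realisations and hitting estimates\<close>

text \<open>Total probability in the form of an inequality: \<open>C\<close> is split along the
  countably many values of \<open>X\<close>. Here \<open>g\<close> bounds the conditional
  probability of \<open>C\<close> when \<open>p\<close> is the law of \<open>X\<close>; other
  factors may be included in \<open>g\<close>.\<close>

lemma (in prob_space) prob_le_pmf_expectation:
  assumes X: "X \<in> measurable M (count_space S)" and S: "countable S" and C: "C \<in> events"
    and p: "set_pmf p \<subseteq> S" and g: "\<And>w. w \<in> S \<Longrightarrow> 0 \<le> g w" "\<And>w. w \<in> S \<Longrightarrow> g w \<le> (B::real)"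
    and le: "\<And>w. w \<in> S \<Longrightarrow> prob (C \<inter> {\<omega>\<in>space M. X \<omega> = w}) \<le> g w * pmf p w"
  shows "prob C \<le> measure_pmf.expectation p g"
proof -
  let ?F = "\<lambda>w. C \<inter> {\<omega>\<in>space M. X \<omega> = w}"
  have F: "?F w \<in> events" if "w \<in> S" for w
  proof -
    have "X -` {w} \<inter> space M \<in> events" using X that by (intro measurable_sets) auto
    moreover have "?F w = C \<inter> (X -` {w} \<inter> space M)" by auto
    ultimately show ?thesis using C by simp
  qed
  have "C = (\<Union>w\<in>S. ?F w)"
    using sets.sets_into_space[OF C] measurable_space[OF X] by auto
  then have "emeasure M C = emeasure M (\<Union>w\<in>S. ?F w)" by simp
  also have "\<dots> = (\<integral>\<^sup>+w. emeasure M (?F w) \<partial>count_space S)"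
    using F S by (intro emeasure_UN_countable) (auto simp: disjoint_family_on_def)
  also have "\<dots> \<le> (\<integral>\<^sup>+w. ennreal (pmf p w) * ennreal (g w) \<partial>count_space S)"
    using le g by (intro nn_integral_mono) (auto simp: emeasure_eq_measure mult.commute simp flip: ennreal_mult)
  also have "\<dots> = (\<integral>\<^sup>+w. ennreal (pmf p w) * (ennreal (g w) * indicator S w) \<partial>count_space UNIV)"
    by (simp add: nn_integral_count_space_indicator mult.assoc)
  also have "\<dots> = (\<integral>\<^sup>+w. ennreal (g w) * indicator S w \<partial>measure_pmf p)"
    by (simp add: nn_integral_measure_pmf)
  also have "\<dots> = (\<integral>\<^sup>+w. ennreal (g w) \<partial>measure_pmf p)"
    using p by (intro nn_integral_cong_AE) (auto simp: AE_measure_pmf_iff indicator_def)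
  also have "\<dots> = ennreal (measure_pmf.expectation p g)"
  proof (rule nn_integral_eq_integral)
    show "integrable (measure_pmf p) g"
      using p g by (intro measure_pmf.integrable_const_bound[where B = B]) (auto simp: AE_measure_pmf_iff)
    show "AE w in measure_pmf p. 0 \<le> g w" using p g by (auto simp: AE_measure_pmf_iff)
  qed
  finally have "ennreal (prob C) \<le> ennreal (measure_pmf.expectation p g)" by (simp add: emeasure_eq_measure)
  moreover have "0 \<le> measure_pmf.expectation p g"
    using p g by (intro integral_nonneg_AE) (auto simp: AE_measure_pmf_iff)
  ultimately show ?thesis by simp
qed

text \<open>Singletons are open in the discrete topology, so right continuity means constancy on a
  right neighbourhood; likewise for left limits in the next lemma.\<close>

lemma cadlag_discrete_right:
  assumes "cadlag (\<lambda>t. discrete (f t))" "0 \<le> t"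
  obtains \<delta> where "0 < \<delta>" "\<And>u. t \<le> u \<Longrightarrow> u < t + \<delta> \<Longrightarrow> f u = f t"
proof -
  have "((\<lambda>t. discrete (f t)) \<longlongrightarrow> discrete (f t)) (at_right t)"
    using assms by (simp add: cadlag_def continuous_within)
  then have "\<forall>\<^sub>F u in at_right t. discrete (f u) \<in> {discrete (f t)}"
    by (rule topological_tendstoD) (auto simp: open_discrete)
  then obtain b where "b > t" "\<And>u. t < u \<Longrightarrow> u < b \<Longrightarrow> f u = f t"
    by (auto simp: eventually_at_right_field discrete_inject)
  then show ?thesis using that[of "b - t"] by (force simp: order_le_less)
qed

lemma cadlag_discrete_left:
  assumes "cadlag (\<lambda>t. discrete (f t))" "0 < t"
  obtains \<delta> z where "0 < \<delta>" "\<And>u. t - \<delta> < u \<Longrightarrow> u < t \<Longrightarrow> f u = z"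
proof -
  obtain l where "((\<lambda>t. discrete (f t)) \<longlongrightarrow> l) (at_left t)"
    using assms by (auto simp: cadlag_def)
  then have "\<forall>\<^sub>F u in at_left t. discrete (f u) \<in> {l}"
    by (rule topological_tendstoD) (auto simp: open_discrete)
  then obtain b where "b < t" "\<And>u. b < u \<Longrightarrow> u < t \<Longrightarrow> discrete (f u) = l"
    by (auto simp: eventually_at_left_field)
  then show ?thesis using that[of "t - b" "of_discrete l"] by (auto simp: discrete_inject of_discrete_inverse) (metis discrete_inverse UNIV_I)
qed

lemma cadlag_discreteI:
  assumes "\<And>t. 0 \<le> t \<Longrightarrow> \<exists>\<delta>>0. \<forall>u. t < u \<and> u < t + \<delta> \<longrightarrow> f u = f t"
    and "\<And>t. 0 < t \<Longrightarrow> \<exists>\<delta>>0. \<exists>z. \<forall>u. t - \<delta> < u \<and> u < t \<longrightarrow> f u = z"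
  shows "cadlag (\<lambda>t. discrete (f t))"
  unfolding cadlag_def
proof (intro conjI allI impI)
  fix t :: real assume "0 \<le> t"
  then obtain \<delta> where "\<delta> > 0" "\<forall>u. t < u \<and> u < t + \<delta> \<longrightarrow> f u = f t" using assms(1) by blast
  then have "\<forall>\<^sub>F u in at_right t. discrete (f u) = discrete (f t)"
    unfolding eventually_at_right_field by (intro exI[of _ "t + \<delta>"]) auto
  then show "continuous (at_right t) (\<lambda>t. discrete (f t))"
    unfolding continuous_within by (rule tendsto_eventually)
next
  fix t :: real assume "0 < t"
  then obtain \<delta> z where "\<delta> > 0" "\<forall>u. t - \<delta> < u \<and> u < t \<longrightarrow> f u = z" using assms(2) by blast
  then have "\<forall>\<^sub>F u in at_left t. discrete (f u) = discrete z"
    unfolding eventually_at_left_field by (intro exI[of _ "t - \<delta>"]) auto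
  then show "\<exists>l. ((\<lambda>t. discrete (f t)) \<longlongrightarrow> l) (at_left t)"
    by (intro exI[of _ "discrete z"] tendsto_eventually)
qed

text \<open>\<open>i\<close> is the first index whose grid time is at or after \<open>u\<close>. Its
  minimality, stated last, later keeps the index within the number of cells of a given
  interval.\<close>

lemma dyadic_approx:
  assumes "0 < h" "s \<le> u" "0 < \<delta>"
  shows "\<exists>j0. \<forall>j\<ge>j0. \<exists>i. u \<le> s + real i * (h / 2 ^ j) \<and> s + real i * (h / 2 ^ j) < u + \<delta>
    \<and> (\<forall>k. u \<le> s + real k * (h / 2 ^ j) \<longrightarrow> i \<le> k)"
proof -
  obtain j0 where j0: "h / \<delta> < 2 ^ j0" using real_arch_pow[of 2 "h / \<delta>"] by auto
  have "\<exists>i. u \<le> s + real i * (h / 2 ^ j) \<and> s + real i * (h / 2 ^ j) < u + \<delta>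
    \<and> (\<forall>k. u \<le> s + real k * (h / 2 ^ j) \<longrightarrow> i \<le> k)" if "j0 \<le> j" for j
  proof -
    define r where "r = h / 2 ^ j"
    have "h / \<delta> < 2 ^ j" using j0 that by (meson less_le_trans one_le_numeral power_increasing)
    then have r: "0 < r" "r < \<delta>" using assms by (auto simp: r_def field_simps)
    define i where "i = nat \<lceil>(u - s) / r\<rceil>"
    have i: "(u - s) / r \<le> real i" "real i < (u - s) / r + 1"
      using assms r by (auto simp: i_def of_nat_nat) linarith+
    have "u \<le> s + real i * r" "s + real i * r < u + \<delta>"
      using i r by (auto simp: field_simps)
    moreover have "i \<le> k" if "u \<le> s + real k * r" for k
    proof -
      have "(u - s) / r \<le> real k" using that r by (simp add: field_simps)
      then have "real i < real k + 1" using i by linarith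
      then show ?thesis by simp
    qed
    ultimately show ?thesis unfolding r_def by blast
  qed
  then show ?thesis by blast
qed

locale chain_realisation = bounded_chain S P L I r m R + prob_space M
  for S :: "'s set" and P L and I :: "'s \<Rightarrow> 'i set" and r m R and M :: "'w measure" +
  fixes X :: "real \<Rightarrow> 'w \<Rightarrow> 's" and x\<^sub>0 :: 's
  assumes X_measurable: "0 \<le> t \<Longrightarrow> X t \<in> measurable M (count_space S)"
    and X_cadlag: "\<omega> \<in> space M \<Longrightarrow> cadlag (\<lambda>t. discrete (X t \<omega>))"
    and X_0: "AE \<omega> in M. X 0 \<omega> = x\<^sub>0"
    and markov_property: "0 \<le> s \<Longrightarrow> 0 \<le> t \<Longrightarrow> A \<in> past M S X s \<Longrightarrow> x \<in> S \<Longrightarrow> y \<in> S \<Longrightarrow>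
      prob {\<omega>\<in>A. X s \<omega> = x \<and> X (s + t) \<omega> = y} = prob {\<omega>\<in>A. X s \<omega> = x} * pmf (P t x) y"
begin

lemma X_in: "0 \<le> t \<Longrightarrow> \<omega> \<in> space M \<Longrightarrow> X t \<omega> \<in> S"
  using measurable_space[OF X_measurable] by simp

lemma X_event: "0 \<le> t \<Longrightarrow> {\<omega>\<in>space M. X t \<omega> \<in> G} \<in> events"
proof -
  assume "0 \<le> t"
  have "X t -` (G \<inter> S) \<inter> space M \<in> events"
    using X_measurable[OF \<open>0 \<le> t\<close>] by (rule measurable_sets) simp
  moreover have "X t -` (G \<inter> S) \<inter> space M = {\<omega>\<in>space M. X t \<omega> \<in> G}"
    using X_in[OF \<open>0 \<le> t\<close>] by auto
  ultimately show ?thesis by simp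
qed

lemma X_event2: "0 \<le> t \<Longrightarrow> 0 \<le> u \<Longrightarrow> {\<omega>\<in>space M. X t \<omega> = X u \<omega>} \<in> events"
proof -
  assume t: "0 \<le> t" "0 \<le> u"
  have "{\<omega>\<in>space M. X t \<omega> = X u \<omega>} = (\<Union>w\<in>S. {\<omega>\<in>space M. X t \<omega> \<in> {w}} \<inter> {\<omega>\<in>space M. X u \<omega> \<in> {w}})"
    using X_in[OF t(2)] by auto
  also have "\<dots> \<in> events" using X_event t by (intro sets.countable_UN'' countable_states sets.Int)
  finally show ?thesis .
qed

lemma past_subset: "0 \<le> s \<Longrightarrow> past M S X s \<subseteq> events"
  unfolding past_def
proof (rule sets.sigma_sets_subset, rule subsetI)
  fix D assume "D \<in> {X u -` {z} \<inter> space M | u z. 0 \<le> u \<and> u \<le> s \<and> z \<in> S}"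
  then obtain u z where D: "D = X u -` {z} \<inter> space M" "0 \<le> u" "z \<in> S" by auto
  show "D \<in> events" unfolding D(1) by (rule measurable_sets[OF X_measurable[OF D(2)]]) (simp add: D)
qed

lemma past_mono:
  assumes "s \<le> t" "A \<in> past M S X s" shows "A \<in> past M S X t"
proof -
  have "past M S X s \<subseteq> past M S X t"
    unfolding past_def
  proof (rule sigma_sets_mono', rule subsetI)
    fix D assume "D \<in> {X u -` {z} \<inter> space M | u z. 0 \<le> u \<and> u \<le> s \<and> z \<in> S}"
    then obtain u z where D: "D = X u -` {z} \<inter> space M" "0 \<le> u" "u \<le> t" "z \<in> S"
      using assms(1) by auto
    show "D \<in> {X u -` {z} \<inter> space M | u z. 0 \<le> u \<and> u \<le> t \<and> z \<in> S}"
      by (rule CollectI, intro exI[of _ u] exI[of _ z]) (simp add: D)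
  qed
  then show ?thesis using assms(2) by (rule subsetD)
qed

lemma space_in_past: "space M \<in> past M S X s"
  unfolding past_def by (rule sigma_sets_top)

lemma past_X:
  assumes "0 \<le> s" "z \<in> S" "A \<in> past M S X s" shows "A \<inter> {\<omega>\<in>space M. X s \<omega> = z} \<in> past M S X s"
proof -
  let ?G = "{X u -` {z} \<inter> space M | u z. 0 \<le> u \<and> u \<le> s \<and> z \<in> S}"
  have sub: "?G \<subseteq> Pow (space M)" by auto
  have "X s -` {z} \<inter> space M \<in> sigma_sets (space M) ?G" 
    by (intro sigma_sets.Basic CollectI exI[of _ s] exI[of _ z]) (simp add: assms)
  then have "A \<inter> (X s -` {z} \<inter> space M) \<in> sigma_sets (space M) ?G" using assms(3) sets.Int[of A "sigma (space M) ?G"] unfolding past_def sets_measure_of[OF sub] by simp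
  moreover have "A \<inter> (X s -` {z} \<inter> space M) = A \<inter> {\<omega>\<in>space M. X s \<omega> = z}" by auto
  ultimately show ?thesis by (simp add: past_def)
qed

text \<open>The family \<open>V\<close> is evaluated at the grid time of the first hit, so it can
  express an event about the future after that time. This replaces the strong Markov property by the
  Markov property at deterministic times.\<close>

definition first_hit :: "'s set \<Rightarrow> (real \<Rightarrow> 'w set) \<Rightarrow> real \<Rightarrow> real \<Rightarrow> nat \<Rightarrow> 'w set" where
  "first_hit G V \<rho> s n = {\<omega>\<in>space M. \<exists>i\<le>n. X (s + real i * \<rho>) \<omega> \<in> G \<and> (\<forall>j<i. X (s + real j * \<rho>) \<omega> \<notin> G)
     \<and> \<omega> \<in> V (s + real i * \<rho>)}"

lemma first_hit_event:
  assumes "0 \<le> s" "0 \<le> \<rho>" "\<And>u. 0 \<le> u \<Longrightarrow> V u \<in> events"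
  shows "first_hit G V \<rho> s n \<in> events"
proof -
  let ?E = "\<lambda>i. {\<omega>\<in>space M. X (s + real i * \<rho>) \<omega> \<in> G}"
  have E: "?E i \<in> events" for i using assms by (intro X_event) simp
  have "first_hit G V \<rho> s n = (\<Union>i\<in>{..n}. (?E i - (\<Union>j\<in>{..<i}. ?E j)) \<inter> V (s + real i * \<rho>))"
    unfolding first_hit_def using sets.sets_into_space[OF assms(3)] by auto
  also have "\<dots> \<in> events" using E assms by (intro sets.finite_UN sets.Int sets.Diff) auto
  finally show ?thesis .
qed

text \<open>
  A supermartingale bound: while \<open>G\<close> has not been hit, \<open>f\<close> grows in mean by at most \<open>\<kappa>\<close> per step, and
  \<open>f \<ge> 1\<close> on \<open>G\<close>; after the hit, \<open>V\<close> has conditional probability at most \<open>q\<close>.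
\<close>

lemma prob_first_hit_le:
  assumes \<rho>: "0 \<le> \<rho>" and f: "\<And>w. w \<in> S \<Longrightarrow> 0 \<le> f w" "\<And>w. w \<in> S \<Longrightarrow> f w \<le> B" "\<And>w. w \<in> S \<Longrightarrow> w \<in> G \<Longrightarrow> 1 \<le> f w"
    and drift: "\<And>w. w \<in> S \<Longrightarrow> sg \<rho> f w \<le> f w + \<kappa>" and \<kappa>: "0 \<le> \<kappa>" and q: "0 \<le> q"
    and V: "\<And>u. 0 \<le> u \<Longrightarrow> V u \<in> events"
      "\<And>u A w. 0 \<le> u \<Longrightarrow> A \<in> past M S X u \<Longrightarrow> w \<in> S \<Longrightarrow> w \<in> G \<Longrightarrow>
        prob (A \<inter> {\<omega>\<in>space M. X u \<omega> = w} \<inter> V u) \<le> q * prob (A \<inter> {\<omega>\<in>space M. X u \<omega> = w})"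
    and s: "0 \<le> s" and A: "A \<in> past M S X s" and z: "z \<in> S"
  shows "prob (A \<inter> {\<omega>\<in>space M. X s \<omega> = z} \<inter> first_hit G V \<rho> s n)
    \<le> q * (f z + real n * \<kappa>) * prob (A \<inter> {\<omega>\<in>space M. X s \<omega> = z})"
  using s A z
proof (induction n arbitrary: s A z)
  \<comment> \<open>A start in \<open>G\<close> makes the hit index 0, so the event reduces to
    \<open>V s\<close>, and f(z) \<ge> 1 leaves room for the factor on the right.\<close>
  have hit: "prob (A \<inter> {\<omega>\<in>space M. X s \<omega> = z} \<inter> first_hit G V \<rho> s n)
    \<le> q * (f z + real n * \<kappa>) * prob (A \<inter> {\<omega>\<in>space M. X s \<omega> = z})"
    if s: "0 \<le> s" and A: "A \<in> past M S X s" and z: "z \<in> S" "z \<in> G" for n s A z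
  proof -
    let ?C = "A \<inter> {\<omega>\<in>space M. X s \<omega> = z}"
    have C: "?C \<in> events" using past_X[OF s z(1) A] past_subset[OF s] by blast
    have "?C \<inter> first_hit G V \<rho> s n \<subseteq> ?C \<inter> V s"
    proof
      fix \<omega> assume \<omega>: "\<omega> \<in> ?C \<inter> first_hit G V \<rho> s n"
      then obtain i where i: "\<forall>j<i. X (s + real j * \<rho>) \<omega> \<notin> G" "\<omega> \<in> V (s + real i * \<rho>)"
        by (auto simp: first_hit_def)
      have "i = 0" using i(1)[rule_format, of 0] \<omega> z by (cases i) auto
      then show "\<omega> \<in> ?C \<inter> V s" using \<omega> i by simp
    qed
    then have "prob (?C \<inter> first_hit G V \<rho> s n) \<le> prob (?C \<inter> V s)"
      using C V(1)[OF s] by (intro finite_measure_mono) auto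
    also have "\<dots> \<le> q * prob ?C" using V(2)[OF s A z] .
    also have "\<dots> \<le> q * (f z + real n * \<kappa>) * prob ?C"
    proof (rule mult_right_mono)
      have "1 \<le> f z + real n * \<kappa>" using f(3)[OF z] \<kappa> by (simp add: add_increasing2)
      then show "q \<le> q * (f z + real n * \<kappa>)" using q by (simp add: mult_le_cancel_left1)
    qed simp
    finally show ?thesis .
  qed
  {
    case 0
    show ?case
    proof (cases "z \<in> G")
      case True
      then show ?thesis by (rule hit[OF 0])
    next
      case False
      then have "A \<inter> {\<omega>\<in>space M. X s \<omega> = z} \<inter> first_hit G V \<rho> s 0 = {}" by (auto simp: first_hit_def)
      then show ?thesis using q f(1)[OF 0(3)] by (simp only: measure_empty) (simp add: measure_nonneg)
    qed
  next
    case (Suc n)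
    show ?case
    proof (cases "z \<in> G")
      case True
      then show ?thesis by (rule hit[OF Suc.prems])
    next
      case False
      let ?C = "A \<inter> {\<omega>\<in>space M. X s \<omega> = z}"
      have C: "?C \<in> past M S X (s + \<rho>)"
        using past_mono[OF _ past_X[OF Suc.prems(1,3,2)]] \<rho> by simp
      have C': "?C \<in> events" using C past_subset[of "s + \<rho>"] Suc.prems(1) \<rho> by auto
      have s\<rho>: "0 \<le> s + \<rho>" using Suc.prems(1) \<rho> by simp
      have fh: "first_hit G V \<rho> s (Suc n) \<in> events" "first_hit G V \<rho> (s + \<rho>) n \<in> events"
        by (rule first_hit_event[OF Suc.prems(1) \<rho> V(1)], assumption, rule first_hit_event[OF s\<rho> \<rho> V(1)], assumption)
      have sub: "?C \<inter> first_hit G V \<rho> s (Suc n) \<subseteq> first_hit G V \<rho> (s + \<rho>) n"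
      proof
        fix \<omega> assume \<omega>: "\<omega> \<in> ?C \<inter> first_hit G V \<rho> s (Suc n)"
        then obtain i where i: "i \<le> Suc n" "X (s + real i * \<rho>) \<omega> \<in> G" "\<forall>j<i. X (s + real j * \<rho>) \<omega> \<notin> G"
          "\<omega> \<in> V (s + real i * \<rho>)" by (auto simp: first_hit_def)
        have "i \<noteq> 0" using i(2) \<omega> False by (cases i) auto
        then obtain i' where i': "i = Suc i'" by (cases i) auto
        have eq: "s + real (Suc k) * \<rho> = s + \<rho> + real k * \<rho>" for k by (simp add: algebra_simps)
        have "X (s + \<rho> + real j * \<rho>) \<omega> \<notin> G" if "j < i'" for j
          using i(3)[rule_format, of "Suc j"] that i' unfolding eq by simp
        then show "\<omega> \<in> first_hit G V \<rho> (s + \<rho>) n"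
          using i(1,2,4) \<omega> unfolding i' eq first_hit_def by auto
      qed
      \<comment> \<open>Conditioning on the value at the next grid time: the induction hypothesis
        and the Markov property bound the probability by an expectation of \<open>f\<close> under
        \<open>P \<rho> z\<close>, which the drift assumption returns to f(z) + \<kappa>.\<close>
      have "prob (?C \<inter> first_hit G V \<rho> s (Suc n))
         \<le> measure_pmf.expectation (P \<rho> z) (\<lambda>w. prob ?C * (q * (f w + real n * \<kappa>)))"
      proof (rule prob_le_pmf_expectation[OF X_measurable[OF s\<rho>] countable_states])
        show "?C \<inter> first_hit G V \<rho> s (Suc n) \<in> events" by (rule sets.Int[OF C' fh(1)])
        show "set_pmf (P \<rho> z) \<subseteq> S" by (rule set_pmf_P[OF \<rho> Suc.prems(3)])
        fix w assume w: "w \<in> S"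
        show "0 \<le> prob ?C * (q * (f w + real n * \<kappa>))" using f(1)[OF w] q \<kappa> by simp
        show "prob ?C * (q * (f w + real n * \<kappa>)) \<le> prob ?C * (q * (B + real n * \<kappa>))"
          using f(2)[OF w] q by (intro mult_left_mono) auto
        have "prob (?C \<inter> first_hit G V \<rho> s (Suc n) \<inter> {\<omega>\<in>space M. X (s + \<rho>) \<omega> = w})
           \<le> prob (?C \<inter> {\<omega>\<in>space M. X (s + \<rho>) \<omega> = w} \<inter> first_hit G V \<rho> (s + \<rho>) n)"
          using sub C' fh X_event[OF s\<rho>, of "{w}"] by (intro finite_measure_mono) auto
        also have "\<dots> \<le> q * (f w + real n * \<kappa>) * prob (?C \<inter> {\<omega>\<in>space M. X (s + \<rho>) \<omega> = w})"
          by (rule Suc.IH[OF s\<rho> C w])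
        also have "prob (?C \<inter> {\<omega>\<in>space M. X (s + \<rho>) \<omega> = w}) = prob ?C * pmf (P \<rho> z) w"
        proof -
          have "A \<subseteq> space M" using Suc.prems(2) past_subset[OF Suc.prems(1)] sets.sets_into_space by blast
          then have "?C \<inter> {\<omega>\<in>space M. X (s + \<rho>) \<omega> = w} = {\<omega>\<in>A. X s \<omega> = z \<and> X (s + \<rho>) \<omega> = w}"
            "?C = {\<omega>\<in>A. X s \<omega> = z}" by auto
          then show ?thesis using markov_property[OF Suc.prems(1) \<rho> Suc.prems(2,3) w] by simp
        qed
        finally show "prob (?C \<inter> first_hit G V \<rho> s (Suc n) \<inter> {\<omega>\<in>space M. X (s + \<rho>) \<omega> = w})
           \<le> prob ?C * (q * (f w + real n * \<kappa>)) * pmf (P \<rho> z) w" by (simp add: mult_ac)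
      qed
      also have "\<dots> = prob ?C * (q * (sg \<rho> f z + real n * \<kappa>))"
      proof -
        have "\<bar>f w\<bar> \<le> B" if "w \<in> S" for w using f(1,2)[OF that] by simp
        then have "integrable (measure_pmf (P \<rho> z)) f" by (rule integrable_P[OF \<rho> Suc.prems(3)])
        then show ?thesis unfolding sg_def by simp
      qed
      also have "\<dots> \<le> prob ?C * (q * (f z + \<kappa> + real n * \<kappa>))"
        using drift[OF Suc.prems(3)] q by (intro mult_left_mono) auto
      finally show ?thesis by (simp add: algebra_simps)
    qed
  }
qed

lemma first_hit_UNIV:
  "first_hit G (\<lambda>_. space M) \<rho> s n = {\<omega>\<in>space M. \<exists>i\<le>n. X (s + real i * \<rho>) \<omega> \<in> G}"
proof -
  have "\<exists>i\<le>n. X (s + real i * \<rho>) \<omega> \<in> G \<and> (\<forall>j<i. X (s + real j * \<rho>) \<omega> \<notin> G)"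
    if "i \<le> n" "X (s + real i * \<rho>) \<omega> \<in> G" for i \<omega>
  proof (intro exI conjI allI impI)
    let ?Q = "\<lambda>i. X (s + real i * \<rho>) \<omega> \<in> G"
    show "(LEAST i. ?Q i) \<le> n" using Least_le[of ?Q i] that by simp
    show "?Q (LEAST i. ?Q i)" using that(2) by (rule LeastI)
    show "\<not> ?Q j" if "j < (LEAST i. ?Q i)" for j using not_less_Least[OF that] .
  qed
  then show ?thesis unfolding first_hit_def by auto
qed

end

lemma (in prob_space) prob_Int_UN_incseq_le:
  assumes E: "\<And>j. E j \<in> events" "incseq E" and C: "C \<in> events" and le: "\<And>j. prob (C \<inter> E j) \<le> b"
  shows "prob (C \<inter> (\<Union>j. E j)) \<le> b"
proof -
  have "(\<lambda>j. prob (C \<inter> E j)) \<longlonglongrightarrow> prob (\<Union>j. C \<inter> E j)"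
    using E C by (intro finite_Lim_measure_incseq) (auto simp: incseq_def)
  then have "prob (\<Union>j. C \<inter> E j) \<le> b" using le by (intro LIMSEQ_le_const2) auto
  then show ?thesis by (simp only: Int_UN_distrib)
qed

section \<open>Marginal laws, grid events and short-time bounds for a realised chain\<close>

context chain_realisation
begin

lemma prob_X_0: "prob {\<omega>\<in>space M. X 0 \<omega> = x\<^sub>0} = 1"
proof -
  have "{\<omega>\<in>space M. X 0 \<omega> = x\<^sub>0} \<in> events" using X_event[of 0 "{x\<^sub>0}"] by simp
  then show ?thesis using X_0 by (subst prob_eq_1) auto
qed

lemma x\<^sub>0_in: "x\<^sub>0 \<in> S"
proof -
  have "{\<omega>\<in>space M. X 0 \<omega> = x\<^sub>0} \<noteq> {}" using prob_X_0 by (metis measure_empty zero_neq_one)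
  then show ?thesis using X_in[of 0] by auto
qed

lemma prob_X:
  assumes "0 \<le> s" "w \<in> S" shows "prob {\<omega>\<in>space M. X s \<omega> = w} = pmf (P s x\<^sub>0) w"
proof -
  have "prob {\<omega>\<in>space M. X s \<omega> = w} = prob {\<omega>\<in>space M. X 0 \<omega> = x\<^sub>0 \<and> X (0 + s) \<omega> = w}"
  proof (rule prob_eq_AE)
    show "AE \<omega> in M. (X s \<omega> = w) = (X 0 \<omega> = x\<^sub>0 \<and> X (0 + s) \<omega> = w)" using X_0 by auto
    show "{\<omega> \<in> space M. X s \<omega> = w} \<in> events" using X_event[OF assms(1), of "{w}"] by simp
    show "{\<omega> \<in> space M. X 0 \<omega> = x\<^sub>0 \<and> X (0 + s) \<omega> = w} \<in> events"
      using sets.Int[OF X_event[of 0 "{x\<^sub>0}"] X_event[OF assms(1), of "{w}"]] by (simp add: Int_def conj_ac)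
  qed
  also have "\<dots> = pmf (P s x\<^sub>0) w"
    using markov_property[OF order_refl assms(1) space_in_past x\<^sub>0_in assms(2)] prob_X_0 by simp
  finally show ?thesis .
qed

text \<open>\<open>prob_le_pmf_expectation\<close> gives only one inequality; applied to
  \<open>G\<close> and to its complement it gives both.\<close>

lemma prob_X_in: "0 \<le> s \<Longrightarrow> prob {\<omega>\<in>space M. X s \<omega> \<in> G} = measure_pmf.prob (P s x\<^sub>0) G"
proof -
  assume s: "0 \<le> s"
  have "prob {\<omega>\<in>space M. X s \<omega> \<in> G} \<le> measure_pmf.prob (P s x\<^sub>0) G" for G
  proof -
    have "prob {\<omega>\<in>space M. X s \<omega> \<in> G} \<le> measure_pmf.expectation (P s x\<^sub>0) (indicator G)"
    proof (rule prob_le_pmf_expectation[OF X_measurable[OF s] countable_states X_event[OF s] set_pmf_P[OF s x\<^sub>0_in], where B = 1])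
      fix w assume w: "w \<in> S"
      have "{\<omega>\<in>space M. X s \<omega> \<in> G} \<inter> {\<omega>\<in>space M. X s \<omega> = w} = (if w \<in> G then {\<omega>\<in>space M. X s \<omega> = w} else {})"
        by auto
      then show "prob ({\<omega>\<in>space M. X s \<omega> \<in> G} \<inter> {\<omega>\<in>space M. X s \<omega> = w}) \<le> indicator G w * pmf (P s x\<^sub>0) w"
        using prob_X[OF s w] by simp
    qed (auto simp: indicator_def)
    then show ?thesis by simp
  qed
  note le = this
  have "prob {\<omega>\<in>space M. X s \<omega> \<in> - G} = 1 - prob {\<omega>\<in>space M. X s \<omega> \<in> G}"
  proof -
    have "{\<omega>\<in>space M. X s \<omega> \<in> - G} = space M - {\<omega>\<in>space M. X s \<omega> \<in> G}" by auto
    then show ?thesis using prob_compl[OF X_event[OF s, of G]] by simp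
  qed
  moreover have "measure_pmf.prob (P s x\<^sub>0) (- G) = 1 - measure_pmf.prob (P s x\<^sub>0) G"
    using measure_pmf.prob_compl[of G "P s x\<^sub>0"] by (simp add: Compl_eq_Diff_UNIV)
  ultimately show ?thesis using le[of G] le[of "- G"] by simp
qed

text \<open>Membership in the past is proved along with the product formula, because the next step
  applies the Markov property with the grid event itself as the past event.\<close>

lemma prob_grid:
  assumes h: "0 \<le> h" and z: "\<And>k. z k \<in> S"
  shows "prob {\<omega>\<in>space M. \<forall>k\<le>K. X (real k * h) \<omega> = z k} = of_bool (z 0 = x\<^sub>0) * (\<Prod>k<K. pmf (P h (z k)) (z (Suc k)))
    \<and> {\<omega>\<in>space M. \<forall>k\<le>K. X (real k * h) \<omega> = z k} \<in> past M S X (real K * h)"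
proof (induction K)
  case 0
  have "prob {\<omega>\<in>space M. X 0 \<omega> = z 0} = of_bool (z 0 = x\<^sub>0)"
    using prob_X[OF order_refl z[of 0]] P_0[OF x\<^sub>0_in] by simp
  moreover have "{\<omega>\<in>space M. X 0 \<omega> = z 0} \<in> past M S X 0"
    using past_X[OF order_refl z[of 0] space_in_past] by (simp add: Int_absorb1 Collect_conj_eq)
  ultimately show ?case by simp
next
  case (Suc K)
  let ?A = "{\<omega>\<in>space M. \<forall>k\<le>K. X (real k * h) \<omega> = z k}"
  have eq: "{\<omega>\<in>space M. \<forall>k\<le>Suc K. X (real k * h) \<omega> = z k} = {\<omega>\<in>?A. X (real K * h) \<omega> = z K \<and> X (real K * h + h) \<omega> = z (Suc K)}"
    by (auto simp: le_Suc_eq algebra_simps)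
  have A: "?A \<in> past M S X (real K * h)" using Suc by blast
  have "prob {\<omega>\<in>space M. \<forall>k\<le>Suc K. X (real k * h) \<omega> = z k} = prob {\<omega>\<in>?A. X (real K * h) \<omega> = z K} * pmf (P h (z K)) (z (Suc K))"
    unfolding eq using h by (intro markov_property A z) auto
  also have "{\<omega>\<in>?A. X (real K * h) \<omega> = z K} = ?A" by auto
  finally have 1: "prob {\<omega>\<in>space M. \<forall>k\<le>Suc K. X (real k * h) \<omega> = z k} = prob ?A * pmf (P h (z K)) (z (Suc K))" .
  have "{\<omega>\<in>space M. \<forall>k\<le>Suc K. X (real k * h) \<omega> = z k} = ?A \<inter> {\<omega>\<in>space M. X (real (Suc K) * h) \<omega> = z (Suc K)}"
    by (auto simp: le_Suc_eq)
  also have "\<dots> \<in> past M S X (real (Suc K) * h)"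
  proof (rule past_X)
    show "?A \<in> past M S X (real (Suc K) * h)"
      by (rule past_mono[OF _ A]) (use h in \<open>auto intro: mult_right_mono\<close>)
  qed (use h z in auto)
  finally show ?case using 1 Suc by simp
qed

lemma event_first_hit_UNIV:
  "0 \<le> u \<Longrightarrow> 0 \<le> \<rho> \<Longrightarrow> first_hit G (\<lambda>_. space M) \<rho> u n \<in> events"
  by (rule first_hit_event) auto

text \<open>Only dyadic times occur, which makes the event measurable; by right continuity it still
  detects any change of state during [u, u + \<delta>], see \<open>leaveI\<close>.\<close>

definition leave :: "real \<Rightarrow> real \<Rightarrow> 'w set" where
  "leave \<delta> u = {\<omega>\<in>space M. \<exists>j i. i \<le> 2 ^ j \<and> X (u + real i * (\<delta> / 2 ^ j)) \<omega> \<noteq> X u \<omega>}"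

lemma leaveI:
  assumes \<omega>: "\<omega> \<in> space M" and v: "0 \<le> u" "u \<le> v" "v \<le> u + \<delta>" "X v \<omega> \<noteq> X u \<omega>" and \<delta>: "0 < \<delta>"
  shows "\<omega> \<in> leave \<delta> u"
proof -
  obtain \<delta>' where \<delta>': "0 < \<delta>'" "\<And>t. v \<le> t \<Longrightarrow> t < v + \<delta>' \<Longrightarrow> X t \<omega> = X v \<omega>"
    using cadlag_discrete_right[OF X_cadlag[OF \<omega>], of v] v by auto
  obtain j0 i where i: "v \<le> u + real i * (\<delta> / 2 ^ j0)" "u + real i * (\<delta> / 2 ^ j0) < v + \<delta>'"
    "\<And>k. v \<le> u + real k * (\<delta> / 2 ^ j0) \<Longrightarrow> i \<le> k"
    using dyadic_approx[OF \<delta> v(2) \<delta>'(1)] by blast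
  have "i \<le> 2 ^ j0" by (rule i(3)) (use v in simp)
  moreover have "X (u + real i * (\<delta> / 2 ^ j0)) \<omega> \<noteq> X u \<omega>" using \<delta>'(2)[OF i(1,2)] v(4) by simp
  ultimately show ?thesis unfolding leave_def using \<omega> by blast
qed

lemma leave_event:
  assumes "0 \<le> u" "0 < \<delta>" shows "leave \<delta> u \<in> events"
proof -
  have "leave \<delta> u = (\<Union>j. \<Union>i\<in>{..2 ^ j}. space M - {\<omega>\<in>space M. X (u + real i * (\<delta> / 2 ^ j)) \<omega> = X u \<omega>})"
    by (auto simp: leave_def)
  also have "\<dots> \<in> events"
  proof -
    have "space M - {\<omega>\<in>space M. X (u + real i * (\<delta> / 2 ^ j)) \<omega> = X u \<omega>} \<in> events" for i j
      by (intro sets.Diff sets.top X_event2) (use assms in auto)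
    then have "(\<Union>i\<in>{..2 ^ j}. space M - {\<omega>\<in>space M. X (u + real i * (\<delta> / 2 ^ j)) \<omega> = X u \<omega>}) \<in> events" for j :: nat
      by (rule sets.finite_UN[OF finite_atMost])
    then show ?thesis by (rule sets.countable_UN''[OF countableI_type])
  qed
  finally show ?thesis .
qed

text \<open>The indicator of having left \<open>w\<close> has generator at most \<open>R\<close>, so
  2^j grid steps of length \<delta> / 2^j contribute R \<delta> for every j. The hitting events
  increase under dyadic refinement, and the bound passes to their union.\<close>

lemma prob_leave_le:
  assumes u: "0 \<le> u" and \<delta>: "0 < \<delta>" and A: "A \<in> past M S X u" and w: "w \<in> S"
  shows "prob (A \<inter> {\<omega>\<in>space M. X u \<omega> = w} \<inter> leave \<delta> u) \<le> R * \<delta> * prob (A \<inter> {\<omega>\<in>space M. X u \<omega> = w})"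
proof -
  let ?C = "A \<inter> {\<omega>\<in>space M. X u \<omega> = w}"
  let ?E = "\<lambda>j. first_hit (- {w}) (\<lambda>_. space M) (\<delta> / 2 ^ j) u (2 ^ j)"
  have C: "?C \<in> events" using past_X[OF u w A] past_subset[OF u] by blast
  have "?C \<inter> leave \<delta> u \<subseteq> ?C \<inter> (\<Union>j. ?E j)"
    unfolding first_hit_UNIV leave_def by auto
  then have "prob (?C \<inter> leave \<delta> u) \<le> prob (?C \<inter> (\<Union>j. ?E j))"
  proof (rule finite_measure_mono)
    have "?E j \<in> events" for j using \<delta> u by (intro event_first_hit_UNIV) auto
    then show "?C \<inter> (\<Union>j. ?E j) \<in> events" by (rule sets.Int[OF C sets.countable_UN''[OF countableI_type]])
  qed
  also have "\<dots> \<le> R * \<delta> * prob ?C"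
  proof (rule prob_Int_UN_incseq_le[OF _ _ C])
    show "?E j \<in> events" for j using \<delta> u by (intro event_first_hit_UNIV) auto
    show "incseq ?E"
    proof (rule incseq_SucI, rule subsetI)
      fix j \<omega> assume "\<omega> \<in> ?E j"
      then obtain i where i: "i \<le> 2 ^ j" "X (u + real i * (\<delta> / 2 ^ j)) \<omega> \<noteq> w" and \<omega>: "\<omega> \<in> space M"
        unfolding first_hit_UNIV by auto
      have "real (2 * i) * (\<delta> / 2 ^ Suc j) = real i * (\<delta> / 2 ^ j)" by (simp add: field_simps)
      then show "\<omega> \<in> ?E (Suc j)" unfolding first_hit_UNIV using i \<omega> by (auto intro!: exI[of _ "2 * i"])
    qed
    show "prob (?C \<inter> ?E j) \<le> R * \<delta> * prob ?C" for j
    proof -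
      let ?\<rho> = "\<delta> / 2 ^ j" and ?f = "indicator (- {w}) :: _ \<Rightarrow> real"
      have "prob (?C \<inter> ?E j) \<le> 1 * (?f w + real (2 ^ j) * (R * ?\<rho>)) * prob ?C"
      proof (rule prob_first_hit_le[OF _ _ _ _ _ _ _ _ _ u A w, where B = 1 and f = ?f and \<kappa> = "R * ?\<rho>"])
        fix z assume z: "z \<in> S"
        show "sg ?\<rho> ?f z \<le> ?f z + R * ?\<rho>"
        proof (rule sg_le_of_L_le[OF _ _ _ z, where B = 1])
          fix z' assume z': "z' \<in> S"
          have "L ?f z' \<le> (\<Sum>i\<in>I z'. r z' i * 1)"
            unfolding L_eq[OF z'] using r_nonneg[OF z'] by (intro sum_mono mult_left_mono) (auto simp: indicator_def)
          then show "L ?f z' \<le> R" using r_bound[OF z'] by simp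
        qed (use \<delta> in \<open>auto simp: indicator_def\<close>)
      next
        fix v A z assume v: "0 \<le> v" "A \<in> past M S X v" "z \<in> S"
        then have "A \<inter> {\<omega>\<in>space M. X v \<omega> = z} \<in> events" using past_X past_subset by blast
        then show "prob (A \<inter> {\<omega>\<in>space M. X v \<omega> = z} \<inter> space M) \<le> 1 * prob (A \<inter> {\<omega>\<in>space M. X v \<omega> = z})"
          by simp
      qed (use \<delta> R_nonneg in \<open>auto simp: indicator_def\<close>)
      then show ?thesis by simp
    qed
  qed
  finally show ?thesis .
qed

text \<open>For \<open>y\<close> in \<open>E\<close>, \<open>f y\<close> measures the distance from
  \<open>y\<close>: it is 0 at \<open>y\<close>, at least 1 on the rest of \<open>E\<close>, and
  grows in mean at most at rate \<open>q\<close>. So reaching another point of \<open>E\<close> has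
  probability at most q h, and conditionally on the point reached, so does a second change. The
  times u and v are arbitrary reals; the measurable event \<open>D\<close> that covers them is built
  from dyadic times.\<close>

lemma two_changes:
  assumes E: "E \<subseteq> S" and s: "0 \<le> s" and h: "0 < h" and q: "0 \<le> q"
    and f: "\<And>y w. y \<in> E \<Longrightarrow> w \<in> S \<Longrightarrow> 0 \<le> f y w" "\<And>y w. y \<in> E \<Longrightarrow> w \<in> S \<Longrightarrow> f y w \<le> (B::real)"
      "\<And>y. y \<in> E \<Longrightarrow> f y y = 0" "\<And>y w. y \<in> E \<Longrightarrow> w \<in> E \<Longrightarrow> w \<noteq> y \<Longrightarrow> 1 \<le> f y w"
    and drift: "\<And>t y w. 0 \<le> t \<Longrightarrow> y \<in> E \<Longrightarrow> w \<in> S \<Longrightarrow> sg t (f y) w \<le> f y w + q * t"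
  obtains D where "D \<in> events" "prob D \<le> (q * h)\<^sup>2"
    "\<And>\<omega> u v. \<omega> \<in> space M \<Longrightarrow> s \<le> u \<Longrightarrow> u < v \<Longrightarrow> v \<le> s + h \<Longrightarrow> X s \<omega> \<in> E \<Longrightarrow> X u \<omega> \<in> E \<Longrightarrow> X u \<omega> \<noteq> X s \<omega>
      \<Longrightarrow> X v \<omega> \<in> E \<Longrightarrow> X v \<omega> \<noteq> X u \<omega> \<Longrightarrow> \<omega> \<in> D"
proof -
  define \<rho> where "\<rho> j = h / 2 ^ j" for j :: nat
  have \<rho>: "0 < \<rho> j" "real (2 ^ j) * \<rho> j = h" for j using h by (auto simp: \<rho>_def)
  define t where "t j i = s + real i * \<rho> j" for j i
  have t: "0 \<le> t j i" for i j using s \<rho>(1)[of j] by (simp add: t_def)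
  define D where "D j = {\<omega>\<in>space M. X s \<omega> \<in> E \<and> (\<exists>i i'. i < i' \<and> i' \<le> 2 ^ j \<and> X (t j i) \<omega> \<in> E \<and> X (t j i) \<omega> \<noteq> X s \<omega>
    \<and> X (t j i') \<omega> \<in> E \<and> X (t j i') \<omega> \<noteq> X (t j i) \<omega>)}" for j
  have D_event: "D j \<in> events" for j
  proof -
    have "D j = {\<omega>\<in>space M. X s \<omega> \<in> E} \<inter> (\<Union>i'\<in>{..2 ^ j}. \<Union>i\<in>{..<i'}. {\<omega>\<in>space M. X (t j i) \<omega> \<in> E} \<inter> {\<omega>\<in>space M. X (t j i') \<omega> \<in> E}
       \<inter> (space M - {\<omega>\<in>space M. X (t j i) \<omega> = X s \<omega>}) \<inter> (space M - {\<omega>\<in>space M. X (t j i') \<omega> = X (t j i) \<omega>}))"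
      unfolding D_def by auto
    also have "\<dots> \<in> events"
      by (intro sets.Int sets.finite_UN sets.Diff sets.top X_event X_event2 t s finite_atMost finite_lessThan)
    finally show ?thesis .
  qed
  have inc: "incseq D"
  proof (rule incseq_SucI, rule subsetI)
    fix j \<omega> assume "\<omega> \<in> D j"
    then obtain i i' where *: "\<omega> \<in> space M" "X s \<omega> \<in> E" "i < i'" "i' \<le> 2 ^ j" "X (t j i) \<omega> \<in> E" "X (t j i) \<omega> \<noteq> X s \<omega>"
      "X (t j i') \<omega> \<in> E" "X (t j i') \<omega> \<noteq> X (t j i) \<omega>" by (auto simp: D_def)
    have eq: "t (Suc j) (2 * k) = t j k" for k by (simp add: t_def \<rho>_def)
    show "\<omega> \<in> D (Suc j)"
      unfolding D_def using * by (intro CollectI conjI exI[of _ "2 * i"] exI[of _ "2 * i'"]) (simp_all add: eq)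
  qed
  have D_bound: "prob ({\<omega>\<in>space M. X s \<omega> = w} \<inter> D j) \<le> (q * h)\<^sup>2 * pmf (P s x\<^sub>0) w" if w: "w \<in> S" for j w
  proof (cases "w \<in> E")
    case False
    then have "{\<omega>\<in>space M. X s \<omega> = w} \<inter> D j = {}" by (auto simp: D_def)
    then show ?thesis by simp
  next
    case wE: True
    define H where "H y u = first_hit (E - {y}) (\<lambda>_. space M) (\<rho> j) u (2 ^ j)" for y u
    have H: "H y u \<in> events" if "0 \<le> u" for y u
      unfolding H_def using that \<rho>(1)[of j] by (intro event_first_hit_UNIV) auto
    \<comment> \<open>After a hit at time \<open>u\<close> in the state \<open>y\<close>, a further
      point of \<open>E\<close> is visited within the next 2^j steps. This window of length
      \<open>h\<close> may run past s + h, which only enlarges the event to be bounded.\<close>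
    define V where "V u = (\<Union>y\<in>E. {\<omega>\<in>space M. X u \<omega> \<in> {y}} \<inter> H y u)" for u
    have hit: "prob (A \<inter> {\<omega>\<in>space M. X u \<omega> = z} \<inter> first_hit (E - {y}) V' (\<rho> j) u (2 ^ j))
        \<le> a * (f y z + real (2 ^ j) * (q * \<rho> j)) * prob (A \<inter> {\<omega>\<in>space M. X u \<omega> = z})"
      if y: "y \<in> E" and u: "0 \<le> u" and A: "A \<in> past M S X u" and z: "z \<in> S" and a: "0 \<le> a"
        and V': "\<And>u. 0 \<le> u \<Longrightarrow> V' u \<in> events" "\<And>u A w. 0 \<le> u \<Longrightarrow> A \<in> past M S X u \<Longrightarrow> w \<in> S \<Longrightarrow> w \<in> E - {y} \<Longrightarrow>
        prob (A \<inter> {\<omega>\<in>space M. X u \<omega> = w} \<inter> V' u) \<le> a * prob (A \<inter> {\<omega>\<in>space M. X u \<omega> = w})"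
      for u A z y V' a
    proof (rule prob_first_hit_le[OF _ _ _ _ _ _ a V' u A z])
      show "0 \<le> \<rho> j" "0 \<le> q * \<rho> j" using \<rho>(1)[of j] q by auto
      show "0 \<le> f y z'" "f y z' \<le> B" if "z' \<in> S" for z' using f(1,2)[OF y that] .
      show "1 \<le> f y z'" if "z' \<in> E - {y}" for z' using f(4)[OF y] that by blast
      show "sg (\<rho> j) (f y) z' \<le> f y z' + q * \<rho> j" if "z' \<in> S" for z'
        using drift[OF _ y that] \<rho>(1)[of j] by simp
    qed
    have V: "V u \<in> events" if "0 \<le> u" for u
      unfolding V_def using that E countable_states
      by (intro sets.countable_UN'' countable_subset[OF E] sets.Int X_event H) auto
    have V2: "prob (A \<inter> {\<omega>\<in>space M. X u \<omega> = y} \<inter> V u) \<le> q * h * prob (A \<inter> {\<omega>\<in>space M. X u \<omega> = y})"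
      if u: "0 \<le> u" and A: "A \<in> past M S X u" and y: "y \<in> E" for u A y
    proof -
      have yS: "y \<in> S" using y E by blast
      have C: "A \<inter> {\<omega>\<in>space M. X u \<omega> = y} \<in> events" using past_X[OF u yS A] past_subset[OF u] by blast
      have "A \<inter> {\<omega>\<in>space M. X u \<omega> = y} \<inter> V u \<subseteq> A \<inter> {\<omega>\<in>space M. X u \<omega> = y} \<inter> H y u"
        unfolding V_def by auto
      then have "prob (A \<inter> {\<omega>\<in>space M. X u \<omega> = y} \<inter> V u) \<le> prob (A \<inter> {\<omega>\<in>space M. X u \<omega> = y} \<inter> H y u)"
        using C H[OF u] by (intro finite_measure_mono) auto
      also have "\<dots> \<le> 1 * (f y y + real (2 ^ j) * (q * \<rho> j)) * prob (A \<inter> {\<omega>\<in>space M. X u \<omega> = y})"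
        unfolding H_def
      proof (rule hit[OF y u A yS])
        fix v A z assume v: "0 \<le> v" "A \<in> past M S X v" "z \<in> S"
        then have "A \<inter> {\<omega>\<in>space M. X v \<omega> = z} \<in> events" using past_X[OF v(1,3,2)] past_subset[OF v(1)] by blast
        then show "prob (A \<inter> {\<omega>\<in>space M. X v \<omega> = z} \<inter> space M) \<le> 1 * prob (A \<inter> {\<omega>\<in>space M. X v \<omega> = z})"
          by simp
      qed auto
      also have "\<dots> = q * h * prob (A \<inter> {\<omega>\<in>space M. X u \<omega> = y})"
        using \<rho>(2)[of j] f(3)[OF y] by (simp add: mult.left_commute)
      finally show ?thesis .
    qed
    have "{\<omega>\<in>space M. X s \<omega> = w} \<inter> D j \<subseteq> space M \<inter> {\<omega>\<in>space M. X s \<omega> = w} \<inter> first_hit (E - {w}) V (\<rho> j) s (2 ^ j)"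
    proof
      fix \<omega> assume "\<omega> \<in> {\<omega>\<in>space M. X s \<omega> = w} \<inter> D j"
      then obtain i i' where *: "\<omega> \<in> space M" "X s \<omega> = w" "i < i'" "i' \<le> 2 ^ j" "X (t j i) \<omega> \<in> E - {w}"
        "X (t j i') \<omega> \<in> E" "X (t j i') \<omega> \<noteq> X (t j i) \<omega>" by (auto simp: D_def)
      define i0 where "i0 = (LEAST i. X (t j i) \<omega> \<in> E - {w})"
      have i0: "X (t j i0) \<omega> \<in> E - {w}" "i0 \<le> i" "\<forall>k<i0. X (t j k) \<omega> \<notin> E - {w}"
        unfolding i0_def using LeastI[of "\<lambda>i. X (t j i) \<omega> \<in> E - {w}", OF *(5)] Least_le[of "\<lambda>i. X (t j i) \<omega> \<in> E - {w}", OF *(5)]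
        by (auto dest: not_less_Least)
      \<comment> \<open>The first hit \<open>i0\<close> of \<open>E - {w}\<close> may precede the
        given index \<open>i\<close>. If the states at \<open>i\<close> and \<open>i0\<close> agree,
        the second change is seen at \<open>i'\<close>; otherwise it is already seen at
        \<open>i\<close>.\<close>
      obtain l where l: "i0 < l" "l \<le> 2 ^ j" "X (t j l) \<omega> \<in> E" "X (t j l) \<omega> \<noteq> X (t j i0) \<omega>"
      proof (cases "X (t j i) \<omega> = X (t j i0) \<omega>")
        case True
        then show ?thesis using that[of i'] * i0 by auto
      next
        case False
        then have "i0 < i" using i0(2) by (cases "i0 = i") auto
        then show ?thesis using that[of i] * False by auto
      qed
      have tl: "t j i0 + (real l - real i0) * \<rho> j = t j l" by (simp add: t_def algebra_simps)
      have "\<omega> \<in> H (X (t j i0) \<omega>) (t j i0)"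
        unfolding H_def first_hit_UNIV using *(1) l by (auto intro!: exI[of _ "l - i0"] simp: of_nat_diff tl)
      then have "\<omega> \<in> V (t j i0)" unfolding V_def using i0(1) *(1) by auto
      then have "\<omega> \<in> first_hit (E - {w}) V (\<rho> j) s (2 ^ j)"
        unfolding first_hit_def using *(1,3,4) i0 by (auto simp: t_def intro!: exI[of _ i0])
      then show "\<omega> \<in> space M \<inter> {\<omega>\<in>space M. X s \<omega> = w} \<inter> first_hit (E - {w}) V (\<rho> j) s (2 ^ j)" using * by simp
    qed
    then have "prob ({\<omega>\<in>space M. X s \<omega> = w} \<inter> D j)
        \<le> prob (space M \<inter> {\<omega>\<in>space M. X s \<omega> = w} \<inter> first_hit (E - {w}) V (\<rho> j) s (2 ^ j))"
      using first_hit_event[OF s _ V, of "\<rho> j"] \<rho>(1)[of j] X_event[OF s, of "{w}"] by (intro finite_measure_mono) auto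
    also have "\<dots> \<le> q * h * (f w w + real (2 ^ j) * (q * \<rho> j)) * prob (space M \<inter> {\<omega>\<in>space M. X s \<omega> = w})"
      using q h V V2 by (intro hit[OF wE s space_in_past w]) auto
    also have "space M \<inter> {\<omega>\<in>space M. X s \<omega> = w} = {\<omega>\<in>space M. X s \<omega> = w}" by auto
    also have "q * h * (f w w + real (2 ^ j) * (q * \<rho> j)) * prob {\<omega>\<in>space M. X s \<omega> = w} = (q * h)\<^sup>2 * pmf (P s x\<^sub>0) w"
      using \<rho>(2)[of j] f(3)[OF wE] prob_X[OF s w] by (simp add: power2_eq_square mult.left_commute)
    finally show ?thesis .
  qed
  show ?thesis
  proof (rule that[of "\<Union>j. D j"])
    show UN: "(\<Union>j. D j) \<in> events" using D_event by blast
    have "prob (\<Union>j. D j) \<le> measure_pmf.expectation (P s x\<^sub>0) (\<lambda>_. (q * h)\<^sup>2)"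
    proof (rule prob_le_pmf_expectation[OF X_measurable[OF s] countable_states UN set_pmf_P[OF s x\<^sub>0_in], where B = "(q * h)\<^sup>2"])
      fix w assume w: "w \<in> S"
      have "prob ({\<omega>\<in>space M. X s \<omega> = w} \<inter> (\<Union>j. D j)) \<le> (q * h)\<^sup>2 * pmf (P s x\<^sub>0) w"
        using X_event[OF s, of "{w}"] by (intro prob_Int_UN_incseq_le[OF D_event inc _ D_bound[OF w]]) simp
      then show "prob ((\<Union>j. D j) \<inter> {\<omega>\<in>space M. X s \<omega> = w}) \<le> (q * h)\<^sup>2 * pmf (P s x\<^sub>0) w"
        by (simp only: Int_commute)
    qed auto
    then show "prob (\<Union>j. D j) \<le> (q * h)\<^sup>2" by simp
    fix \<omega> u v
    assume \<omega>: "\<omega> \<in> space M" and uv: "s \<le> u" "u < v" "v \<le> s + h" and XE: "X s \<omega> \<in> E" "X u \<omega> \<in> E" "X u \<omega> \<noteq> X s \<omega>"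
      "X v \<omega> \<in> E" "X v \<omega> \<noteq> X u \<omega>"
    obtain \<delta>1 where \<delta>1: "0 < \<delta>1" "\<And>t. u \<le> t \<Longrightarrow> t < u + \<delta>1 \<Longrightarrow> X t \<omega> = X u \<omega>"
      using cadlag_discrete_right[OF X_cadlag[OF \<omega>], of u] s uv by auto
    obtain \<delta>2 where \<delta>2: "0 < \<delta>2" "\<And>t. v \<le> t \<Longrightarrow> t < v + \<delta>2 \<Longrightarrow> X t \<omega> = X v \<omega>"
      using cadlag_discrete_right[OF X_cadlag[OF \<omega>], of v] s uv by auto
    \<comment> \<open>Capping the approximation by v - u keeps the grid time for \<open>u\<close>
      strictly before \<open>v\<close>, hence before the grid time for \<open>v\<close>.\<close>
    have "0 < min \<delta>1 (v - u)" using \<delta>1 uv by simp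
    from dyadic_approx[OF h uv(1) this] obtain j1 where j1: "\<forall>j\<ge>j1. \<exists>i. u \<le> s + real i * (h / 2 ^ j) \<and>
        s + real i * (h / 2 ^ j) < u + min \<delta>1 (v - u) \<and> (\<forall>k. u \<le> s + real k * (h / 2 ^ j) \<longrightarrow> i \<le> k)" ..
    have "s \<le> v" using uv by simp
    from dyadic_approx[OF h this \<delta>2(1)] obtain j2 where j2: "\<forall>j\<ge>j2. \<exists>i. v \<le> s + real i * (h / 2 ^ j) \<and>
        s + real i * (h / 2 ^ j) < v + \<delta>2 \<and> (\<forall>k. v \<le> s + real k * (h / 2 ^ j) \<longrightarrow> i \<le> k)" ..
    define j where "j = max j1 j2"
    obtain i where i: "u \<le> t j i" "t j i < u + min \<delta>1 (v - u)"
      using j1[rule_format, of j] by (auto simp: j_def t_def \<rho>_def)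
    obtain i' where i': "v \<le> t j i'" "t j i' < v + \<delta>2" "\<And>k. v \<le> t j k \<Longrightarrow> i' \<le> k"
      using j2[rule_format, of j] by (auto simp: j_def t_def \<rho>_def)
    have "i' \<le> 2 ^ j" by (rule i'(3)) (use uv \<rho>(2)[of j] in \<open>simp add: t_def\<close>)
    moreover have "i < i'"
    proof -
      have "t j i < t j i'" using i i' by simp
      then have "real i * \<rho> j < real i' * \<rho> j" by (simp add: t_def)
      then show ?thesis using \<rho>(1)[of j] by simp
    qed
    moreover have "X (t j i) \<omega> = X u \<omega>" "X (t j i') \<omega> = X v \<omega>" using \<delta>1(2)[of "t j i"] i \<delta>2(2)[of "t j i'"] i' by auto
    ultimately have "\<omega> \<in> D j"
      unfolding D_def using \<omega> XE by (intro CollectI conjI exI[of _ i] exI[of _ i']) simp_all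
    then show "\<omega> \<in> (\<Union>j. D j)" by blast
  qed
qed

end

section \<open>Occupation times and the order process\<close>

text \<open>The value at time t is the eventual value at grid times \<open>\<tau> n t\<close>, which
  lie strictly to the right of t and tend to it. Each grid approximation is put together from
  countably many measurable maps. The maximum with 0 is there because nothing is known about
  negative times.\<close>

lemma right_const_joint_measurable:
  fixes X :: "real \<Rightarrow> 'w \<Rightarrow> 's" and g :: "'s \<Rightarrow> real"
  assumes meas: "\<And>t. 0 \<le> t \<Longrightarrow> (\<lambda>\<omega>. g (X t \<omega>)) \<in> borel_measurable M"
    and cad: "\<And>\<omega>. \<omega> \<in> space M \<Longrightarrow> cadlag (\<lambda>t. discrete (X t \<omega>))"
  shows "(\<lambda>(\<omega>, t). g (X (max 0 t) \<omega>)) \<in> borel_measurable (M \<Otimes>\<^sub>M borel)"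
proof -
  define \<tau> where "\<tau> n t = real (Suc (nat \<lfloor>real (Suc n) * max 0 t\<rfloor>)) / real (Suc n)" for n and t :: real
  have \<tau>: "max 0 t < \<tau> n t" "\<tau> n t \<le> max 0 t + 1 / real (Suc n)" for n t
  proof -
    define a where "a = real (Suc n) * max 0 t"
    have a: "0 \<le> a" by (simp add: a_def)
    have fl: "of_int \<lfloor>a\<rfloor> \<le> a" "a < of_int \<lfloor>a\<rfloor> + 1" by linarith+
    have eq: "\<tau> n t = (of_int \<lfloor>a\<rfloor> + 1) / real (Suc n)" using a by (simp add: \<tau>_def a_def)
    have t: "max 0 t = a / real (Suc n)" by (simp add: a_def)
    show "max 0 t < \<tau> n t" unfolding eq t using fl by (intro divide_strict_right_mono) auto
    show "\<tau> n t \<le> max 0 t + 1 / real (Suc n)" unfolding eq t add_divide_distrib[symmetric] using fl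
      by (intro divide_right_mono) auto
  qed
  show ?thesis
  proof (rule borel_measurable_LIMSEQ_real)
    fix p assume "p \<in> space (M \<Otimes>\<^sub>M (borel :: real measure))"
    then obtain \<omega> t where p: "p = (\<omega>, t)" "\<omega> \<in> space M" by (auto simp: space_pair_measure)
    obtain \<delta> where \<delta>: "0 < \<delta>" "\<And>u. max 0 t \<le> u \<Longrightarrow> u < max 0 t + \<delta> \<Longrightarrow> X u \<omega> = X (max 0 t) \<omega>"
      using cadlag_discrete_right[OF cad[OF p(2)], of "max 0 t"] by auto
    obtain n0 where n0: "1 / real (Suc n0) < \<delta>" using \<delta>(1) by (metis nat_approx_posE)
    have "X (\<tau> n t) \<omega> = X (max 0 t) \<omega>" if "n0 \<le> n" for n
    proof (rule \<delta>(2))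
      have "1 / real (Suc n) \<le> 1 / real (Suc n0)" using that by (simp add: frac_le)
      then show "\<tau> n t < max 0 t + \<delta>" using \<tau>(2)[of n t] n0 by linarith
    qed (use \<tau>(1)[of t n] in simp)
    then have "\<forall>\<^sub>F n in sequentially. g (X (\<tau> n t) \<omega>) = g (X (max 0 t) \<omega>)"
      by (intro eventually_sequentiallyI[of n0]) simp
    then show "(\<lambda>n. case p of (\<omega>, t) \<Rightarrow> g (X (\<tau> n t) \<omega>)) \<longlonglongrightarrow> (case p of (\<omega>, t) \<Rightarrow> g (X (max 0 t) \<omega>))"
      unfolding p by (auto intro: tendsto_eventually)
  next
    fix n
    have 1: "(\<lambda>p. nat \<lfloor>real (Suc n) * max 0 (snd p)\<rfloor>) \<in> measurable (M \<Otimes>\<^sub>M (borel :: real measure)) (count_space UNIV)"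
      by measurable
    have 2: "(\<lambda>p. g (X (real (Suc k) / real (Suc n)) (fst p))) \<in> borel_measurable (M \<Otimes>\<^sub>M (borel :: real measure))" for k
      by (rule measurable_compose[OF measurable_fst meas]) simp
    have "(\<lambda>p. g (X (real (Suc (nat \<lfloor>real (Suc n) * max 0 (snd p)\<rfloor>)) / real (Suc n)) (fst p))) \<in> borel_measurable (M \<Otimes>\<^sub>M (borel :: real measure))"
      by (rule measurable_compose_countable[OF 2 1])
    then show "(\<lambda>p. case p of (\<omega>, t) \<Rightarrow> g (X (\<tau> n t) \<omega>)) \<in> borel_measurable (M \<Otimes>\<^sub>M borel)"
      by (simp add: \<tau>_def split_beta)
  qed
qed

section \<open>The occupation clock of a single path\<close>

definition occ :: "'s set \<Rightarrow> (real \<Rightarrow> 's) \<Rightarrow> real \<Rightarrow> real" where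
  "occ E f t = measure lborel {s\<in>{0..t}. f s \<in> E}"

lemma cadlag_sets_borel:
  assumes "cadlag (\<lambda>t. discrete (f t))"
  shows "{s. 0 \<le> s \<and> f s \<in> E} \<in> sets borel"
proof -
  \<comment> \<open>Joint measurability is applied with a one-point space in place of the
    probability space.\<close>
  have "(\<lambda>(\<omega>, t). indicator E (f (max 0 t)) :: real) \<in> borel_measurable (count_space (UNIV :: unit set) \<Otimes>\<^sub>M borel)"
    by (rule right_const_joint_measurable[where X = "\<lambda>t \<omega>. f t"]) (use assms in auto)
  from measurable_compose[OF measurable_Pair1'[of "()"] this]
  have [measurable]: "(\<lambda>t. indicator E (f (max 0 t)) :: real) \<in> borel_measurable borel" by simp
  have "{t. indicator E (f (max 0 t)) = (1::real)} \<inter> {0..} \<in> sets borel"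
    by measurable
  moreover have "{t. indicator E (f (max 0 t)) = (1::real)} \<inter> {0..} = {s. 0 \<le> s \<and> f s \<in> E}"
    by (auto simp: indicator_def max_def split: if_splits)
  ultimately show ?thesis by simp
qed

locale discrete_path =
  fixes f :: "real \<Rightarrow> 's" and E :: "'s set"
  assumes cad: "cadlag (\<lambda>t. discrete (f t))"
begin

abbreviation T :: "real \<Rightarrow> real" where "T \<equiv> occ E f"

lemma sets_E: "B \<in> sets borel \<Longrightarrow> B \<subseteq> {0..} \<Longrightarrow> {s\<in>B. f s \<in> E} \<in> sets lborel"
proof -
  assume B: "B \<in> sets borel" "B \<subseteq> {0..}"
  then have "{s\<in>B. f s \<in> E} = B \<inter> {s. 0 \<le> s \<and> f s \<in> E}" by auto
  then show ?thesis using cadlag_sets_borel[OF cad] B by simp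
qed

lemma fmeasurable_subset_Icc: "A \<subseteq> {a..b} \<Longrightarrow> A \<in> sets lborel \<Longrightarrow> A \<in> fmeasurable lborel" for a b :: real
  by (rule fmeasurableI2[of "{a..b}"]) (auto intro!: fmeasurableI simp: emeasure_lborel_Icc_eq)

lemma T_add:
  assumes "0 \<le> u" "u \<le> v"
  shows "T v = T u + measure lborel {s\<in>{u<..v}. f s \<in> E}"
proof -
  have eq: "{s\<in>{0..v}. f s \<in> E} = {s\<in>{0..u}. f s \<in> E} \<union> {s\<in>{u<..v}. f s \<in> E}" using assms by auto
  have "measure lborel {s\<in>{0..v}. f s \<in> E} = measure lborel {s\<in>{0..u}. f s \<in> E} + measure lborel {s\<in>{u<..v}. f s \<in> E}"
    unfolding eq
  proof (rule measure_Un3[THEN trans])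
    show "{s\<in>{0..u}. f s \<in> E} \<in> fmeasurable lborel" "{s\<in>{u<..v}. f s \<in> E} \<in> fmeasurable lborel"
      using assms by (intro fmeasurable_subset_Icc[of _ 0 v] sets_E; auto)+
    have "{s\<in>{0..u}. f s \<in> E} \<inter> {s\<in>{u<..v}. f s \<in> E} = {}" by auto
    then show "measure lborel {s\<in>{0..u}. f s \<in> E} + measure lborel {s\<in>{u<..v}. f s \<in> E}
      - measure lborel ({s\<in>{0..u}. f s \<in> E} \<inter> {s\<in>{u<..v}. f s \<in> E})
      = measure lborel {s\<in>{0..u}. f s \<in> E} + measure lborel {s\<in>{u<..v}. f s \<in> E}" by (simp only: measure_empty)
  qed
  then show ?thesis by (simp add: occ_def)
qed

lemma T_mono: "0 \<le> u \<Longrightarrow> u \<le> v \<Longrightarrow> T u \<le> T v"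
  using T_add[of u v] by simp

lemma T_nonneg: "0 \<le> T u"
  by (simp add: occ_def)

lemma T_0: "T 0 = 0"
proof -
  have "measure lborel {s\<in>{0..0}. f s \<in> E} \<le> measure lborel {0..(0::real)}"
    by (intro measure_mono_fmeasurable sets_E fmeasurable_subset_Icc[of _ 0 0]) auto
  then show ?thesis by (simp add: occ_def measure_le_0_iff)
qed

lemma T_le: assumes "0 \<le> u" "u \<le> v" shows "T v \<le> T u + (v - u)"
proof -
  have "measure lborel {s\<in>{u<..v}. f s \<in> E} \<le> measure lborel {u<..v}"
    using assms by (intro measure_mono_fmeasurable sets_E fmeasurable_subset_Icc[of _ u v]) auto
  then show ?thesis using assms T_add[OF assms] by simp
qed

lemma T_in:
  assumes "0 \<le> u" "u \<le> v" "\<And>s. u < s \<Longrightarrow> s < v \<Longrightarrow> f s \<in> E" shows "T v = T u + (v - u)"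
proof -
  have "measure lborel {u<..<v} \<le> measure lborel {s\<in>{u<..v}. f s \<in> E}"
    using assms by (intro measure_mono_fmeasurable fmeasurable_subset_Icc[of _ u v] sets_E) auto
  then have "v - u \<le> measure lborel {s\<in>{u<..v}. f s \<in> E}" using assms by simp
  then show ?thesis using T_le[OF assms(1,2)] T_add[OF assms(1,2)] by simp
qed

lemma T_out:
  assumes "0 \<le> u" "u \<le> v" "\<And>s. u < s \<Longrightarrow> s < v \<Longrightarrow> f s \<notin> E" shows "T v = T u"
proof -
  have "measure lborel {s\<in>{u<..v}. f s \<in> E} \<le> measure lborel {v..v}"
    using assms by (intro measure_mono_fmeasurable sets_E fmeasurable_subset_Icc[of _ v v]) force+
  then show ?thesis using T_add[OF assms(1,2)] by (simp add: measure_le_0_iff)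
qed

lemma right_in:
  assumes "0 \<le> u" "f u \<in> G" shows "\<exists>\<delta>>0. \<forall>s. u \<le> s \<and> s < u + \<delta> \<longrightarrow> f s \<in> G"
proof (rule cadlag_discrete_right[OF cad assms(1)])
  fix \<delta> assume "0 < \<delta>" and *: "\<And>s. u \<le> s \<Longrightarrow> s < u + \<delta> \<Longrightarrow> f s = f u"
  have "f s \<in> G" if "u \<le> s" "s < u + \<delta>" for s unfolding *[OF that] by (rule assms(2))
  then show ?thesis using \<open>0 < \<delta>\<close> by blast
qed

lemma T_increases:
  assumes "0 \<le> u" "f u \<in> E" "u < v" shows "T u < T v"
proof -
  obtain \<delta> where \<delta>: "0 < \<delta>" "\<forall>s. u \<le> s \<and> s < u + \<delta> \<longrightarrow> f s \<in> E" using right_in[OF assms(1,2)] by blast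
  define w where "w = min v (u + \<delta>)"
  have w: "u < w" "w \<le> v" "w \<le> u + \<delta>" using \<delta> assms by (auto simp: w_def)
  have "T w = T u + (w - u)" using w \<delta> assms by (intro T_in) auto
  moreover have "T w \<le> T v" using w assms by (intro T_mono) auto
  ultimately show ?thesis using w by simp
qed

lemma T_inj: "0 \<le> u \<Longrightarrow> 0 \<le> v \<Longrightarrow> f u \<in> E \<Longrightarrow> f v \<in> E \<Longrightarrow> T u = T v \<Longrightarrow> u = v"
  using T_increases[of u v] T_increases[of v u] by (cases u v rule: linorder_cases) auto

text \<open>\<open>u\<close> is the last time at which the clock shows \<open>t\<close>. The clock
  exceeds \<open>t\<close> immediately after \<open>u\<close>, and the path is constant just after
  \<open>u\<close>, so \<open>f u\<close> must lie in \<open>E\<close>. This identifies the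
  generalised inverse of the clock as a real time spent in \<open>E\<close>.\<close>

lemma T_attained:
  assumes t: "0 \<le> t" "0 \<le> s" "t < T s"
  shows "\<exists>u\<ge>0. f u \<in> E \<and> T u = t \<and> (\<forall>v>u. t < T v) \<and> (SUP v\<in>{v. 0 \<le> v \<and> T v \<le> t}. ereal v) = ereal u"
proof -
  define V where "V = {v. 0 \<le> v \<and> T v \<le> t}"
  have V0: "0 \<in> V" using t by (simp add: V_def T_0)
  have bdd: "v \<le> s" if "v \<in> V" for v
  proof (rule ccontr)
    assume "\<not> v \<le> s"
    then have "T s \<le> T v" using t by (intro T_mono) auto
    then show False using that t by (simp add: V_def)
  qed
  then have bdd': "bdd_above V" by (auto simp: bdd_above_def)
  define u where "u = Sup V"
  have u0: "0 \<le> u" unfolding u_def by (rule cSup_upper[OF V0 bdd'])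
  have above: "t < T v" if "u < v" for v
  proof (rule ccontr)
    assume "\<not> t < T v"
    then have "v \<in> V" using that u0 by (simp add: V_def)
    then show False using cSup_upper[OF _ bdd', of v] that by (simp add: u_def)
  qed
  have "T u \<le> t"
  proof (rule field_le_epsilon)
    fix e :: real assume "0 < e"
    then obtain v where v: "v \<in> V" "u - e < v" using less_cSup_iff[of V "u - e"] V0 bdd' by (auto simp: u_def)
    have "v \<le> u" unfolding u_def by (rule cSup_upper[OF v(1) bdd'])
    then have "T u \<le> T v + (u - v)" using v by (intro T_le) (auto simp: V_def)
    then show "T u \<le> t + e" using v by (simp add: V_def)
  qed
  moreover have "t \<le> T u"
  proof (rule field_le_epsilon)
    fix e :: real assume "0 < e"
    then show "t \<le> T u + e" using above[of "u + e"] T_le[of u "u + e"] u0 by simp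
  qed
  ultimately have Tu: "T u = t" by simp
  have fu: "f u \<in> E"
  proof (rule ccontr)
    assume "f u \<notin> E"
    then obtain \<delta> where \<delta>: "0 < \<delta>" "\<forall>s. u \<le> s \<and> s < u + \<delta> \<longrightarrow> f s \<in> - E" using right_in[OF u0, of "- E"] by blast
    have "T (u + \<delta>) = T u" using \<delta> u0 by (intro T_out) auto
    then show False using above[of "u + \<delta>"] \<delta> Tu by simp
  qed
  have "(SUP v\<in>V. ereal v) = ereal u"
  proof (rule antisym)
    show "(SUP v\<in>V. ereal v) \<le> ereal u" using cSup_upper[OF _ bdd'] by (intro SUP_least) (simp add: u_def)
    have "u \<in> V" using u0 Tu by (simp add: V_def)
    then show "ereal u \<le> (SUP v\<in>V. ereal v)" by (rule SUP_upper)
  qed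
  then show ?thesis using u0 fu Tu above unfolding V_def by blast
qed

text \<open>\<open>v\<close> is the first time at which the clock shows \<open>t\<close>. Just
  before \<open>v\<close> the path is constant, and its value lies in \<open>E\<close>, since
  otherwise the clock would have stopped before \<open>v\<close>.\<close>

lemma T_left_attained:
  assumes t: "0 < t" "0 \<le> s" "t \<le> T s"
  shows "\<exists>v \<delta> z. 0 < \<delta> \<and> \<delta> \<le> v \<and> T v = t \<and> z \<in> E \<and> (\<forall>u. v - \<delta> < u \<and> u < v \<longrightarrow> f u = z)"
proof -
  define V where "V = {v. 0 \<le> v \<and> t \<le> T v}"
  have V: "s \<in> V" "bdd_below V" using t by (auto simp: V_def bdd_below_def)
  define v where "v = Inf V"
  have v0: "0 \<le> v" unfolding v_def using V by (intro cInf_greatest) (auto simp: V_def)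
  have below: "T u < t" if "0 \<le> u" "u < v" for u
  proof (rule ccontr)
    assume "\<not> T u < t"
    then have "u \<in> V" using that by (simp add: V_def)
    then show False using cInf_lower[OF _ V(2), of u] that by (simp add: v_def)
  qed
  have "t \<le> T v"
  proof (rule field_le_epsilon)
    fix e :: real assume "0 < e"
    then obtain u where u: "u \<in> V" "u < v + e" using cInf_less_iff[of V "v + e"] V by (auto simp: v_def)
    have "v \<le> u" unfolding v_def by (rule cInf_lower[OF u(1) V(2)])
    then have "T u \<le> T v + (u - v)" using v0 by (intro T_le) auto
    then show "t \<le> T v + e" using u by (simp add: V_def)
  qed
  then have "v \<noteq> 0" using t T_0 by auto
  then have v: "0 < v" using v0 by simp
  have "T v \<le> t"
  proof (rule field_le_epsilon)
    fix e :: real assume "0 < e"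
    define u where "u = max 0 (v - e)"
    have u: "0 \<le> u" "u < v" "v - u \<le> e" using v \<open>0 < e\<close> by (auto simp: u_def)
    then show "T v \<le> t + e" using below[of u] T_le[of u v] by simp
  qed
  with \<open>t \<le> T v\<close> have Tv: "T v = t" by simp
  obtain \<delta> z where \<delta>: "0 < \<delta>" "\<And>u. v - \<delta> < u \<Longrightarrow> u < v \<Longrightarrow> f u = z" using cadlag_discrete_left[OF cad v] by auto
  define \<delta>' where "\<delta>' = min \<delta> v"
  have \<delta>': "0 < \<delta>'" "\<delta>' \<le> v" "\<And>u. v - \<delta>' < u \<Longrightarrow> u < v \<Longrightarrow> f u = z" using \<delta> v by (auto simp: \<delta>'_def)
  have "z \<in> E"
  proof (rule ccontr)
    assume z: "z \<notin> E"
    have "T v = T (v - \<delta>' / 2)" using \<delta>' z by (intro T_out) auto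
    moreover have "T (v - \<delta>' / 2) < t" using \<delta>' by (intro below) auto
    ultimately show False using Tv by simp
  qed
  then show ?thesis using \<delta>' Tv by blast
qed

end

section \<open>The order process of a single particle path\<close>

lemma condensate_inj: "0 < N \<Longrightarrow> condensate N x = condensate N y \<longleftrightarrow> x = y"
  by (auto simp: condensate_def fun_eq_iff split: if_splits)

definition site :: "nat \<Rightarrow> ('v \<Rightarrow> nat) \<Rightarrow> 'v" where "site N \<zeta> = (THE x. \<zeta> = condensate N x)"

lemma site_condensate: "0 < N \<Longrightarrow> site N (condensate N x) = x"
  by (simp add: site_def condensate_inj eq_commute[of x])

lemma LINT_indicator_eq_occ: "(LINT s:{0..t}|lborel. indicator E (f s)) = occ E f t"
proof -
  have "(\<lambda>s. indicator {0..t} s *\<^sub>R indicator E (f s)) = (indicator {s\<in>{0..t}. f s \<in> E} :: real \<Rightarrow> real)"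
    by (auto simp: indicator_def fun_eq_iff)
  then show ?thesis unfolding occ_def set_lebesgue_integral_def by simp
qed

lemma occupation_time_eq: "occupation_time N f t = occ (condensates N) f t"
  unfolding occupation_time_def by (rule LINT_indicator_eq_occ)

locale particle_path = discrete_path f "condensates N" for f :: "real \<Rightarrow> 'v \<Rightarrow> nat" and N +
  assumes N_pos: "0 < N"
begin

abbreviation y :: "real \<Rightarrow> 'v option" where "y \<equiv> order_process N f"

text \<open>The clock takes different values at different times spent in condensates. Hence the
  inverse of the clock at \<open>T u\<close>, itself such a time, can only be
  \<open>u\<close>.\<close>

lemma y_T:
  assumes "0 \<le> u" "f u \<in> condensates N" shows "y (T u) = Some (site N (f u))"
proof -
  have "T u < T (u + 1)" using assms by (intro T_increases) auto
  then obtain u' where u': "0 \<le> u'" "f u' \<in> condensates N" "T u' = T u"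
    "(SUP v\<in>{v. 0 \<le> v \<and> T v \<le> T u}. ereal v) = ereal u'"
    using T_attained[OF T_nonneg[of u], of "u + 1"] assms(1) by auto
  have "u' = u" by (rule T_inj[OF u'(1) assms(1) u'(2) assms(2) u'(3)])
  then show ?thesis using u'(4)
    by (simp add: order_process_def trace_process_def inverse_occupation_time_def occupation_time_eq condensate_site_def site_def)
qed

lemma y_None:
  assumes "\<And>s. 0 \<le> s \<Longrightarrow> T s \<le> t" shows "y t = None"
proof -
  have "{s. 0 \<le> s \<and> T s \<le> t} = {0..}" using assms by auto
  then have "inverse_occupation_time N f t = (SUP s\<in>{0..}. ereal s)"
    by (simp add: inverse_occupation_time_def occupation_time_eq)
  also have "\<dots> = \<infinity>"
  proof (rule SUP_PInfty)
    fix n :: nat show "\<exists>i\<in>{0..}. ereal (real n) \<le> ereal i" by (intro bexI[of _ "real n"]) auto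
  qed
  finally show ?thesis by (simp add: order_process_def trace_process_def condensate_site_def)
qed

lemma y_right_const:
  assumes t: "0 \<le> t" shows "\<exists>\<delta>>0. \<forall>u. t \<le> u \<and> u < t + \<delta> \<longrightarrow> y u = y t"
proof (cases "\<exists>s\<ge>0. t < T s")
  case True
  then obtain s where "0 \<le> s" "t < T s" by blast
  then obtain u where u: "0 \<le> u" "f u \<in> condensates N" "T u = t" using T_attained[OF t] by blast
  obtain \<delta> where \<delta>: "0 < \<delta>" "\<forall>s. u \<le> s \<and> s < u + \<delta> \<longrightarrow> f s \<in> {f u}" using right_in[OF u(1), of "{f u}"] by blast
  have "y w = y t" if "t \<le> w" "w < t + \<delta>" for w
  proof -
    define u' where "u' = u + (w - t)"
    have "f s \<in> condensates N" if "u < s" "s < u'" for s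
      using \<delta>(2)[rule_format, of s] that u(2) \<open>w < t + \<delta>\<close> by (auto simp: u'_def)
    then have "T u' = w" using T_in[of u u'] u that by (simp add: u'_def)
    moreover have fu': "f u' = f u" using \<delta>(2)[rule_format, of u'] that by (simp add: u'_def)
    ultimately show ?thesis using y_T[of u'] y_T[OF u(1,2)] u that unfolding fu' by (simp add: u'_def)
  qed
  then show ?thesis using \<delta>(1) by blast
next
  case False
  then have "T s \<le> t" if "0 \<le> s" for s using that by (meson not_less)
  then have "y u = None" if "t \<le> u" for u using that by (intro y_None) (meson order_trans)
  then show ?thesis using zero_less_one by (metis order_refl)
qed

text \<open>The second assumption excludes one situation: the total condensed time equals
  \<open>t\<close> but is approached without being attained.\<close>

lemma y_left_const:
  assumes t: "0 < t" and "(\<exists>s\<ge>0. t \<le> T s) \<or> (\<exists>t'<t. \<forall>s\<ge>0. T s \<le> t')"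
  shows "\<exists>\<delta>>0. \<exists>z. \<forall>u. t - \<delta> < u \<and> u < t \<longrightarrow> y u = z"
  using assms(2)
proof
  assume "\<exists>s\<ge>0. t \<le> T s"
  then obtain s where "0 \<le> s" "t \<le> T s" by blast
  then obtain v \<delta> z where v: "0 < \<delta>" "\<delta> \<le> v" "T v = t" "z \<in> condensates N" "\<forall>u. v - \<delta> < u \<and> u < v \<longrightarrow> f u = z"
    using T_left_attained[OF t] by blast
  have "y w = Some (site N z)" if "t - \<delta> < w" "w < t" for w
  proof -
    define u where "u = v - (t - w)"
    have u: "v - \<delta> < u" "u < v" "0 \<le> u" using that v by (auto simp: u_def)
    have "T v = T u + (v - u)" using u v by (intro T_in) auto
    then have "T u = w" using v by (simp add: u_def)
    then show ?thesis using y_T[of u] u v(4) v(5)[rule_format, of u] by simp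
  qed
  then show ?thesis using v(1) by blast
next
  assume "\<exists>t'<t. \<forall>s\<ge>0. T s \<le> t'"
  then obtain t' where t': "t' < t" "\<forall>s\<ge>0. T s \<le> t'" by blast
  have "y u = None" if "t' \<le> u" for u using that t'(2) by (intro y_None) (meson order_trans)
  then show ?thesis using t'(1) by (intro exI[of _ "t - t'"] conjI exI[of _ None]) auto
qed

lemma y_cadlagI:
  assumes "\<And>t. 0 < t \<Longrightarrow> (\<exists>s\<ge>0. t \<le> T s) \<or> (\<exists>t'<t. \<forall>s\<ge>0. T s \<le> t') \<or> (\<exists>\<delta>>0. \<exists>z. \<forall>u. t - \<delta> < u \<and> u < t \<longrightarrow> y u = z)"
  shows "cadlag (\<lambda>t. discrete (y t))"
proof (rule cadlag_discreteI)
  fix t :: real assume "0 \<le> t"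
  then show "\<exists>\<delta>>0. \<forall>u. t < u \<and> u < t + \<delta> \<longrightarrow> y u = y t" using y_right_const by (meson less_imp_le)
next
  fix t :: real assume "0 < t"
  then show "\<exists>\<delta>>0. \<exists>z. \<forall>u. t - \<delta> < u \<and> u < t \<longrightarrow> y u = z" using assms y_left_const by metis
qed

text \<open>A missing left limit forces the clock to increase towards a finite value that it never
  attains. It then increases after every time n, which requires a visit to a condensate after
  n.\<close>

lemma y_cadlag_or:
  assumes "\<not> cadlag (\<lambda>t. discrete (y t))"
  shows "(\<forall>n::nat. \<exists>u\<ge>real n. f u \<in> condensates N) \<and> (\<exists>K. \<forall>s\<ge>0. T s \<le> K)"
proof -
  obtain t where t: "0 < t" "\<And>s. 0 \<le> s \<Longrightarrow> T s < t" "\<And>t'. t' < t \<Longrightarrow> \<exists>s\<ge>0. t' < T s"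
    using y_cadlagI assms by (metis not_le)
  have "\<exists>u\<ge>real n. f u \<in> condensates N" for n :: nat
  proof (rule ccontr)
    assume no: "\<not> ?thesis"
    obtain s where s: "0 \<le> s" "T (real n) < T s" using t(3)[OF t(2)[of "real n"]] by auto
    show False
    proof (cases "s \<le> real n")
      case True
      then show ?thesis using T_mono[OF s(1) True] s by simp
    next
      case False
      then have "T s = T (real n)" using no by (intro T_out) auto
      then show ?thesis using s by simp
    qed
  qed
  then show ?thesis using t(2) by (meson less_imp_le)
qed

end

section \<open>Infinitely late visits accumulate infinite occupation time, almost surely\<close>

context chain_realisation
begin

lemma discrete_path: "\<omega> \<in> space M \<Longrightarrow> discrete_path (\<lambda>t. X t \<omega>)"
  using X_cadlag by unfold_locales

text \<open>If \<open>E\<close> is visited after \<open>s\<close> but collects less than \<delta> of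
  further occupation time, then the state at the first visit on a fine grid must be left within
  \<delta>. Conditionally on that visit this has probability at most R \<delta>, no matter how long
  the visit takes to occur.\<close>

lemma prob_short_stay:
  assumes \<delta>: "0 < \<delta>" and s: "0 \<le> s"
  obtains D where "D \<in> events" "prob D \<le> R * \<delta>"
    "\<And>\<omega> u K. \<omega> \<in> space M \<Longrightarrow> s \<le> u \<Longrightarrow> X u \<omega> \<in> E \<Longrightarrow> (\<And>v. s \<le> v \<Longrightarrow> occ E (\<lambda>t. X t \<omega>) v < occ E (\<lambda>t. X t \<omega>) s + \<delta>) \<Longrightarrow> \<omega> \<in> D"
proof -
  define \<rho> where "\<rho> j = \<delta> / 2 ^ j" for j :: nat
  have \<rho>: "0 < \<rho> j" "real (2 ^ j) * \<rho> j = \<delta>" for j using \<delta> by (auto simp: \<rho>_def)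
  \<comment> \<open>With j 2^j steps of length \<delta> / 2^j the grid reaches s + j \<delta>, so
    mesh and horizon improve together. The hitting bound is used with \<open>f = 1\<close> and
    \<kappa> = 0 and hence ignores the number of steps; the lower limit \<open>D\<close> of these
    events inherits it.\<close>
  define C where "C j = first_hit E (leave \<delta>) (\<rho> j) s (j * 2 ^ j)" for j
  have C: "C j \<in> events" for j
    unfolding C_def using s \<rho>(1)[of j] leave_event[OF _ \<delta>] by (intro first_hit_event) auto
  have C_le: "prob (C j) \<le> R * \<delta>" for j
  proof -
    have "prob (C j) \<le> measure_pmf.expectation (P s x\<^sub>0) (\<lambda>_. R * \<delta>)"
    proof (rule prob_le_pmf_expectation[OF X_measurable[OF s] countable_states C set_pmf_P[OF s x\<^sub>0_in], where B = "R * \<delta>"])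
      fix w assume w: "w \<in> S"
      have "prob (space M \<inter> {\<omega>\<in>space M. X s \<omega> = w} \<inter> first_hit E (leave \<delta>) (\<rho> j) s (j * 2 ^ j))
        \<le> R * \<delta> * (1 + real (j * 2 ^ j) * 0) * prob (space M \<inter> {\<omega>\<in>space M. X s \<omega> = w})"
        by (rule prob_first_hit_le[where f = "\<lambda>_. 1" and B = 1, OF _ _ _ _ _ _ _ _ _ s space_in_past w])
          (use \<rho>(1)[of j] R_nonneg \<delta> leave_event[OF _ \<delta>] prob_leave_le[OF _ \<delta>] in auto)
      moreover have "space M \<inter> {\<omega>\<in>space M. X s \<omega> = w} = {\<omega>\<in>space M. X s \<omega> = w}" by auto
      ultimately show "prob (C j \<inter> {\<omega>\<in>space M. X s \<omega> = w}) \<le> R * \<delta> * pmf (P s x\<^sub>0) w"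
        using prob_X[OF s w] by (simp add: C_def Int_commute)
    qed (use R_nonneg \<delta> in auto)
    then show ?thesis by simp
  qed
  define D where "D = (\<Union>k. \<Inter>j\<in>{k..}. C j)"
  show ?thesis
  proof (rule that[of D])
    have I: "(\<Inter>j\<in>{k..}. C j) \<in> events" for k using C by (intro sets.countable_INT') auto
    then show "D \<in> events" unfolding D_def by blast
    have "prob (space M \<inter> (\<Union>k. \<Inter>j\<in>{k..}. C j)) \<le> R * \<delta>"
    proof (rule prob_Int_UN_incseq_le[OF I _ sets.top])
      show "incseq (\<lambda>k. \<Inter>j\<in>{k..}. C j)" by (auto simp: incseq_def)
      fix k
      have "prob (space M \<inter> (\<Inter>j\<in>{k..}. C j)) \<le> prob (C k)" using C by (intro finite_measure_mono) auto
      then show "prob (space M \<inter> (\<Inter>j\<in>{k..}. C j)) \<le> R * \<delta>" using C_le[of k] by linarith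
    qed
    moreover have "space M \<inter> D = D" using sets.sets_into_space[OF \<open>D \<in> events\<close>] by auto
    ultimately show "prob D \<le> R * \<delta>" unfolding D_def by simp
    fix \<omega> u
    assume \<omega>: "\<omega> \<in> space M" and u: "s \<le> u" "X u \<omega> \<in> E"
      and short: "\<And>v. s \<le> v \<Longrightarrow> occ E (\<lambda>t. X t \<omega>) v < occ E (\<lambda>t. X t \<omega>) s + \<delta>"
    interpret discrete_path "\<lambda>t. X t \<omega>" E by (rule discrete_path[OF \<omega>])
    have u0: "0 \<le> u" using u s by simp
    obtain \<delta>' where \<delta>': "0 < \<delta>'" "\<forall>t. u \<le> t \<and> t < u + \<delta>' \<longrightarrow> X t \<omega> \<in> E" using right_in[OF u0 u(2)] by blast
    obtain j0 where j0: "\<forall>j\<ge>j0. \<exists>i. u \<le> s + real i * (\<delta> / 2 ^ j) \<and> s + real i * (\<delta> / 2 ^ j) < u + \<delta>'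
      \<and> (\<forall>k. u \<le> s + real k * (\<delta> / 2 ^ j) \<longrightarrow> i \<le> k)"
      using dyadic_approx[OF \<delta> u(1) \<delta>'(1)] by blast
    obtain k0 :: nat where k0: "(u - s) / \<delta> \<le> real k0" using real_arch_simple by blast
    have "\<omega> \<in> C j" if j: "max j0 k0 \<le> j" for j
    proof -
      obtain i where i: "u \<le> s + real i * \<rho> j" "s + real i * \<rho> j < u + \<delta>'" "\<forall>k. u \<le> s + real k * \<rho> j \<longrightarrow> i \<le> k"
        using j0[rule_format, of j] j unfolding \<rho>_def by auto
      have "(u - s) / \<delta> \<le> real j" using k0 j by (meson max.bounded_iff of_nat_mono order_trans)
      then have "u \<le> s + real j * \<delta>" using \<delta> by (simp add: field_simps)
      also have "real j * \<delta> = real (j * 2 ^ j) * \<rho> j" using \<rho>(2)[of j] by simp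
      finally have ij: "i \<le> j * 2 ^ j" using i(3) by blast
      have hit: "X (s + real i * \<rho> j) \<omega> \<in> E" using \<delta>'(2) i(1,2) by blast
      define i0 where "i0 = (LEAST i. X (s + real i * \<rho> j) \<omega> \<in> E)"
      have i0: "X (s + real i0 * \<rho> j) \<omega> \<in> E" "i0 \<le> i" "\<forall>k<i0. X (s + real k * \<rho> j) \<omega> \<notin> E"
        unfolding i0_def using LeastI[of "\<lambda>i. X (s + real i * \<rho> j) \<omega> \<in> E", OF hit] Least_le[of "\<lambda>i. X (s + real i * \<rho> j) \<omega> \<in> E", OF hit]
        by (auto dest: not_less_Least)
      define t where "t = s + real i0 * \<rho> j"
      have t: "s \<le> t" using \<rho>(1)[of j] by (simp add: t_def)
      have "\<omega> \<in> leave \<delta> t"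
      proof (rule ccontr)
        assume no: "\<omega> \<notin> leave \<delta> t"
        have stay: "X v \<omega> \<in> E" if "t \<le> v" "v \<le> t + \<delta>" for v
          using leaveI[OF \<omega> _ that _ \<delta>] no t s i0(1) unfolding t_def[symmetric] by force
        have "T (t + \<delta>) = T t + (t + \<delta> - t)" using stay t s \<delta> by (intro T_in) auto
        moreover have "T s \<le> T t" using t s by (intro T_mono)
        ultimately show False using short[of "t + \<delta>"] t \<delta> by simp
      qed
      then show ?thesis unfolding C_def first_hit_def using \<omega> i0 ij by (auto simp: t_def intro!: exI[of _ i0])
    qed
    then show "\<omega> \<in> D" unfolding D_def by (intro UN_I[of "max j0 k0"]) auto
  qed
qed

text \<open>If the clock is bounded, less than \<delta> of it remains after all large n; a visit
  after each such n then puts the path into all the corresponding events of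
  \<open>prob_short_stay\<close>. Their lower limit has probability at most R \<delta>, with
  \<delta> arbitrary and \<open>R\<close> fixed.\<close>

lemma AE_recurrent_occupation_unbounded:
  "AE \<omega> in M. \<not> ((\<forall>n::nat. \<exists>u\<ge>real n. X u \<omega> \<in> E) \<and> (\<exists>K. \<forall>s\<ge>0. occ E (\<lambda>t. X t \<omega>) s \<le> K))"
proof -
  have "\<exists>D\<in>events. prob D \<le> R * \<delta> \<and> (\<forall>\<omega>\<in>space M. (\<forall>n::nat. \<exists>u\<ge>real n. X u \<omega> \<in> E) \<and> (\<exists>K. \<forall>s\<ge>0. occ E (\<lambda>t. X t \<omega>) s \<le> K) \<longrightarrow> \<omega> \<in> D)"
    if \<delta>: "0 < \<delta>" for \<delta>
  proof -
    have "\<exists>D. D \<in> events \<and> prob D \<le> R * \<delta> \<and> (\<forall>\<omega>\<in>space M. \<forall>u. real n \<le> u \<longrightarrow> X u \<omega> \<in> E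
        \<longrightarrow> (\<forall>v\<ge>real n. occ E (\<lambda>t. X t \<omega>) v < occ E (\<lambda>t. X t \<omega>) (real n) + \<delta>) \<longrightarrow> \<omega> \<in> D)" for n :: nat
      using prob_short_stay[OF \<delta>, of "real n" E] by (metis of_nat_0_le_iff)
    then obtain C where C: "\<And>n. C n \<in> events" "\<And>n. prob (C n) \<le> R * \<delta>"
      "\<And>n \<omega> u. \<omega> \<in> space M \<Longrightarrow> real n \<le> u \<Longrightarrow> X u \<omega> \<in> E
        \<Longrightarrow> (\<forall>v\<ge>real n. occ E (\<lambda>t. X t \<omega>) v < occ E (\<lambda>t. X t \<omega>) (real n) + \<delta>) \<Longrightarrow> \<omega> \<in> C n" by metis
    define D where "D = (\<Union>k. \<Inter>n\<in>{k..}. C n)"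
    have I: "(\<Inter>n\<in>{k..}. C n) \<in> events" for k using C(1) by (intro sets.countable_INT') auto
    have De: "D \<in> events" unfolding D_def using I by blast
    have "prob (space M \<inter> (\<Union>k. \<Inter>n\<in>{k..}. C n)) \<le> R * \<delta>"
    proof (rule prob_Int_UN_incseq_le[OF I _ sets.top])
      show "incseq (\<lambda>k. \<Inter>n\<in>{k..}. C n)" by (auto simp: incseq_def)
      fix k
      have "prob (space M \<inter> (\<Inter>n\<in>{k..}. C n)) \<le> prob (C k)" using C(1) by (intro finite_measure_mono) auto
      then show "prob (space M \<inter> (\<Inter>n\<in>{k..}. C n)) \<le> R * \<delta>" using C(2)[of k] by linarith
    qed
    moreover have "space M \<inter> D = D" using sets.sets_into_space[OF De] by auto
    ultimately have Dp: "prob D \<le> R * \<delta>" unfolding D_def by simp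
    have "\<omega> \<in> D" if \<omega>: "\<omega> \<in> space M" and inf: "\<forall>n::nat. \<exists>u\<ge>real n. X u \<omega> \<in> E"
      and bdd: "\<forall>s\<ge>0. occ E (\<lambda>t. X t \<omega>) s \<le> K" for \<omega> K
    proof -
      interpret discrete_path "\<lambda>t. X t \<omega>" E by (rule discrete_path[OF \<omega>])
      have bdd': "bdd_above (range (\<lambda>n. T (real n)))" using bdd by (intro bdd_aboveI[of _ K]) auto
      define s where "s = (SUP n. T (real n))"
      obtain k where k: "s - \<delta> < T (real k)"
        using less_cSUP_iff[of UNIV "\<lambda>n. T (real n)" "s - \<delta>"] bdd' \<delta> by (auto simp: s_def)
      have "\<omega> \<in> C n" if n: "k \<le> n" for n
      proof -
        obtain u where "real n \<le> u" "X u \<omega> \<in> E" using inf by blast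
        moreover have "T v < T (real n) + \<delta>" if "real n \<le> v" for v
        proof -
          obtain m :: nat where m: "v \<le> real m" using real_arch_simple by blast
          have "T v \<le> T (real m)" using that m by (intro T_mono) auto
          also have "\<dots> \<le> s" unfolding s_def by (rule cSUP_upper[OF _ bdd']) simp
          finally have "T v \<le> s" .
          moreover have "T (real k) \<le> T (real n)" using n by (intro T_mono) auto
          ultimately show ?thesis using k by simp
        qed
        ultimately show ?thesis using C(3)[OF \<omega>] by blast
      qed
      then show ?thesis unfolding D_def by (intro UN_I[of k]) auto
    qed
    then show ?thesis using De Dp by blast
  qed
  then have "\<exists>D. \<forall>m::nat. D m \<in> events \<and> prob (D m) \<le> R * (1 / real (Suc m)) \<and> (\<forall>\<omega>\<in>space M. (\<forall>n::nat. \<exists>u\<ge>real n. X u \<omega> \<in> E) \<and> (\<exists>K. \<forall>s\<ge>0. occ E (\<lambda>t. X t \<omega>) s \<le> K) \<longrightarrow> \<omega> \<in> D m)"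
    by (intro choice allI) (metis of_nat_0_less_iff zero_less_Suc zero_less_divide_1_iff)
  then obtain D where D: "\<And>m::nat. D m \<in> events" "\<And>m. prob (D m) \<le> R * (1 / real (Suc m))"
    "\<And>m \<omega>. \<omega> \<in> space M \<Longrightarrow> (\<forall>n::nat. \<exists>u\<ge>real n. X u \<omega> \<in> E) \<and> (\<exists>K. \<forall>s\<ge>0. occ E (\<lambda>t. X t \<omega>) s \<le> K) \<Longrightarrow> \<omega> \<in> D m"
    by blast
  have De: "(\<Inter>m. D m) \<in> events" using D(1) by blast
  have "prob (\<Inter>m. D m) \<le> R * (1 / real (Suc m))" for m
  proof -
    have "prob (\<Inter>m. D m) \<le> prob (D m)" by (rule finite_measure_mono[OF _ D(1)]) blast
    then show ?thesis using D(2)[of m] by linarith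
  qed
  moreover have "(\<lambda>m. R * (1 / real (Suc m))) \<longlonglongrightarrow> R * 0"
    using LIMSEQ_inverse_real_of_nat by (intro tendsto_intros) (simp add: inverse_eq_divide)
  ultimately have "prob (\<Inter>m. D m) \<le> R * 0"
    by (intro tendsto_lowerbound[where F = sequentially]) auto
  then have "prob (\<Inter>m. D m) = 0" by (simp add: measure_le_0_iff)
  then have "(\<Inter>m. D m) \<in> null_sets M" using De by (simp add: null_sets_def emeasure_eq_measure)
  then show ?thesis by (rule AE_I') (use D(3) in blast)
qed

end

section \<open>Skorokhod neighbourhoods and discretized paths\<close>

text \<open>The continuous piecewise linear bijection with slope \<open>r\<close> on an interval of
  length \<open>d\<close> starting at \<open>a\<close> and slope 1 elsewhere, from which
  interpolating time changes are composed.\<close>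

definition knee :: "real \<Rightarrow> real \<Rightarrow> real \<Rightarrow> real \<Rightarrow> real" where
  "knee a d r s = (if s \<le> a then s else if s \<le> a + d then a + (s - a) * r else s + (d * r - d))"

lemma knee_inverse:
  assumes "0 < d" "0 < r" shows "knee a d r (knee a (d * r) (1 / r) s) = s"
proof -
  consider "s \<le> a" | "a < s" "s \<le> a + d * r" | "a + d * r < s" by linarith
  then show ?thesis
  proof cases
    case 2
    then have "knee a (d * r) (1 / r) s = a + (s - a) / r" by (simp add: knee_def)
    moreover have "0 < (s - a) / r" "(s - a) / r \<le> d" using 2 assms by (auto simp: field_simps)
    ultimately show ?thesis using assms by (simp add: knee_def)
  next
    case 3
    moreover have "0 < d * r" using assms by simp
    ultimately show ?thesis using assms by (simp add: knee_def)
  qed (simp add: knee_def)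
qed

lemma knee_strict_mono:
  assumes "0 < d" "0 < r" shows "strict_mono (knee a d r)"
proof (rule strict_monoI)
  fix x y :: real assume xy: "x < y"
  have dr: "0 < d * r" using assms by simp
  have 1: "a < z \<longrightarrow> 0 < (z - a) * r \<and> (z \<le> a + d \<longrightarrow> (z - a) * r \<le> d * r)" for z
    using assms by (auto intro!: mult_right_mono)
  have 2: "(x - a) * r < (y - a) * r" using xy assms by simp
  show "knee a d r x < knee a d r y"
    unfolding knee_def using xy dr 1[of x] 1[of y] 2 assms by (smt (verit))
qed

lemma knee_time_change:
  assumes "0 < d" "0 < r" "0 \<le> a" shows "knee a d r \<in> time_changes"
proof -
  have pos: "0 \<le> knee a d r s" if "0 \<le> s" "0 < d" "0 < r" for s d r
    using that assms(3) by (auto simp: knee_def) (smt (verit) mult_nonneg_nonneg)+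
  have "knee a d r ` {0..} = {0..}"
  proof
    show "knee a d r ` {0..} \<subseteq> {0..}" using pos assms by auto
    show "{0..} \<subseteq> knee a d r ` {0..}"
    proof
      fix s :: real assume s: "s \<in> {0..}"
      have "0 \<le> knee a (d * r) (1 / r) s" using s assms by (intro pos) auto
      then show "s \<in> knee a d r ` {0..}" using knee_inverse[OF assms(1,2), of a s] by (metis atLeast_iff image_eqI)
    qed
  qed
  moreover have "strict_mono_on {0..} (knee a d r)"
    using knee_strict_mono[OF assms(1,2)] by (auto simp: strict_mono_on_def strict_mono_def)
  ultimately show ?thesis by (simp add: time_changes_def)
qed

lemma time_changes_comp:
  assumes "l \<in> time_changes" "l' \<in> time_changes" shows "(\<lambda>s. l (l' s)) \<in> time_changes"
proof -
  have "l' s \<in> {0..}" if "s \<in> {0..}" for s using assms(2) that by (auto simp: time_changes_def)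
  note l' = this
  have sm: "strict_mono_on {0..} l" "strict_mono_on {0..} l'" using assms by (simp_all add: time_changes_def)
  have "strict_mono_on {0..} (\<lambda>s. l (l' s))"
  proof (rule strict_mono_onI)
    fix x y :: real assume xy: "x \<in> {0..}" "y \<in> {0..}" "x < y"
    show "l (l' x) < l (l' y)"
      by (rule strict_mono_onD[OF sm(1) l'[OF xy(1)] l'[OF xy(2)] strict_mono_onD[OF sm(2) xy]])
  qed
  moreover have "(\<lambda>s. l (l' s)) ` {0..} = l ` (l' ` {0..})" by auto
  ultimately show ?thesis using assms by (simp add: time_changes_def)
qed

text \<open>Induction over the nodes. Beyond b(n) the time change built so far has slope 1 and maps
  the next cell to an interval of length d = b(n+1) - b(n) starting at t(n); composing with a knee
  there stretches it to the prescribed length and leaves earlier nodes fixed.\<close>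

lemma time_change_interpolation:
  assumes "b 0 = (0::real)" "t 0 = (0::real)"
    and "\<And>k. k < n \<Longrightarrow> b k < b (Suc k)" "\<And>k. k < n \<Longrightarrow> t k < t (Suc k)"
    and "\<And>k. k \<le> n \<Longrightarrow> \<bar>b k - t k\<bar> < e"
  shows "\<exists>l\<in>time_changes. (\<forall>k\<le>n. l (b k) = t k) \<and> (\<forall>s\<ge>b n. l s = s + (t n - b n)) \<and> (\<forall>s\<ge>0. \<bar>l s - s\<bar> < e)"
  using assms(3-5)
proof (induction n)
  case 0
  have "(\<lambda>s. s) \<in> time_changes" by (simp add: time_changes_def strict_mono_on_def)
  then show ?case using assms(1,2) 0(3)[of 0] by (intro bexI[of _ "\<lambda>s. s"]) auto
next
  case (Suc n)
  obtain l where l: "l \<in> time_changes" "\<forall>k\<le>n. l (b k) = t k" "\<forall>s\<ge>b n. l s = s + (t n - b n)" "\<forall>s\<ge>0. \<bar>l s - s\<bar> < e"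
    using Suc.IH Suc.prems by auto
  note Suc_inc = Suc.prems(1,2)
  define d where "d = b (Suc n) - b n"
  define r where "r = (t (Suc n) - t n) / d"
  have d: "0 < d" and r: "0 < r" using Suc.prems(1,2)[of n] by (auto simp: d_def r_def)
  have dr: "d * r = t (Suc n) - t n" using d by (simp add: r_def)
  have mono: "b 0 \<le> b k \<and> t 0 \<le> t k \<and> (b k \<le> b n) \<and> t k \<le> t n" if "k \<le> n" for k
  proof -
    have "j \<le> n \<Longrightarrow> i \<le> j \<Longrightarrow> b i \<le> b j \<and> t i \<le> t j" for i j
    proof (induction j)
      case (Suc j)
      then show ?case using Suc_inc(1)[of j] Suc_inc(2)[of j] by (cases "i = Suc j") auto
    qed simp
    then show ?thesis using that by auto
  qed
  have tn: "0 \<le> t n" and bn: "0 \<le> b n" using mono[of n] assms(1,2) by auto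
  let ?l = "\<lambda>s. knee (t n) d r (l s)"
  have after: "?l s = s + (t (Suc n) - b (Suc n))" if "b (Suc n) \<le> s" for s
  proof -
    have ls: "l s = s + (t n - b n)" using l(3) that d by (simp add: d_def)
    show ?thesis
    proof (cases "s = b (Suc n)")
      case True
      then have "l s = t n + d" using ls by (simp add: d_def)
      then show ?thesis using d dr True by (simp add: knee_def)
    next
      case False
      then have "t n + d < l s" using ls that by (simp add: d_def)
      then show ?thesis using d dr ls by (simp add: knee_def d_def)
    qed
  qed
  have lmono: "l s \<le> l s'" if "0 \<le> s" "s \<le> s'" for s s'
  proof (cases "s = s'")
    case False
    have "strict_mono_on {0..} l" using l(1) by (simp add: time_changes_def)
    then have "l s < l s'" by (rule strict_mono_onD) (use that False in auto)
    then show ?thesis by simp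
  qed simp
  have before: "?l s = l s" if "0 \<le> s" "s \<le> b n" for s
  proof -
    have "l s \<le> t n" using lmono[OF that] l(2) by simp
    then show ?thesis by (simp add: knee_def)
  qed
  have "?l (b k) = t k" if "k \<le> Suc n" for k
  proof (cases "k = Suc n")
    case True
    then show ?thesis using after[of "b (Suc n)"] by simp
  next
    case False
    then show ?thesis using before[of "b k"] mono[of k] l(2) that assms(1) by simp
  qed
  moreover have "\<bar>?l s - s\<bar> < e" if "0 \<le> s" for s
  proof -
    consider "s \<le> b n" | "b n < s" "s < b (Suc n)" | "b (Suc n) \<le> s" by linarith
    then show ?thesis
    proof cases
      case 1
      then show ?thesis using before[OF that 1] l(4) that by simp
    next
      case 2
      \<comment> \<open>Between two nodes the deviation from the identity is affine, hence a convex
        combination of the deviations at the nodes, both below \<open>e\<close>.\<close>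
      define \<mu> where "\<mu> = (s - b n) / d"
      have \<mu>: "0 < \<mu>" "\<mu> < 1" using 2 d by (auto simp: \<mu>_def d_def)
      have sd: "s - b n = \<mu> * d" using d by (simp add: \<mu>_def)
      have ls: "l s = t n + (s - b n)" using l(3) 2 by simp
      have "?l s = t n + (s - b n) * r" using ls 2 by (simp add: knee_def d_def)
      also have "(s - b n) * r = \<mu> * (t (Suc n) - t n)" unfolding sd by (simp add: dr[symmetric])
      finally have "?l s - s = (1 - \<mu>) * (t n - b n) + \<mu> * (t (Suc n) - b (Suc n))"
        using sd unfolding d_def by (simp add: algebra_simps)
      also have "\<bar>\<dots>\<bar> \<le> (1 - \<mu>) * \<bar>t n - b n\<bar> + \<mu> * \<bar>t (Suc n) - b (Suc n)\<bar>"
        using \<mu> abs_triangle_ineq[of "(1 - \<mu>) * (t n - b n)" "\<mu> * (t (Suc n) - b (Suc n))"] by (simp add: abs_mult)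
      also have "\<dots> < (1 - \<mu>) * e + \<mu> * e"
        using \<mu> Suc.prems(3)[of n] Suc.prems(3)[of "Suc n"]
        by (intro add_strict_mono mult_strict_left_mono) (auto simp: abs_minus_commute)
      finally show ?thesis by (simp add: algebra_simps)
    next
      case 3
      then show ?thesis using after[OF 3] Suc.prems(3)[of "Suc n"] by (simp add: abs_minus_commute)
    qed
  qed
  moreover have "?l \<in> time_changes" by (rule time_changes_comp[OF knee_time_change[OF d r tn] l(1)])
  ultimately show ?case using after by (intro bexI[of _ ?l]) auto
qed

text \<open>The interpolating time change carries each interval of constancy of \<open>f\<close> to
  the interval on which \<open>g\<close> has the same value, so the two paths agree exactly and only
  the times differ.\<close>

lemma matching_time_change:
  assumes b0: "b 0 = (0::real)" "t 0 = (0::real)"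
    and inc: "\<And>k. k < n \<Longrightarrow> b k < b (Suc k)" "\<And>k. k < n \<Longrightarrow> t k < t (Suc k)"
    and close: "\<And>k. k \<le> n \<Longrightarrow> \<bar>b k - t k\<bar> < e"
    and f: "\<And>k s. k < n \<Longrightarrow> b k \<le> s \<Longrightarrow> s < b (Suc k) \<Longrightarrow> f s = z k"
    and g: "\<And>k s. k < n \<Longrightarrow> t k \<le> s \<Longrightarrow> s < t (Suc k) \<Longrightarrow> g s = z k"
    and T: "T < b n"
  shows "\<exists>l\<in>time_changes. \<forall>s\<in>{0..T}. \<bar>l s - s\<bar> < e \<and> f s = g (l s)"
proof -
  obtain l where l: "l \<in> time_changes" "\<forall>k\<le>n. l (b k) = t k" "\<forall>s\<ge>0. \<bar>l s - s\<bar> < e"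
    using time_change_interpolation[of b t n e, OF b0 inc close] by auto
  have "f s = g (l s)" if s: "0 \<le> s" "s \<le> T" for s
  proof -
    have "\<exists>k<n. b k \<le> s \<and> s < b (Suc k)"
    proof -
      define k where "k = (LEAST k. s < b k)"
      have k: "s < b k" "k \<le> n" unfolding k_def using LeastI[of "\<lambda>k. s < b k" n] Least_le[of "\<lambda>k. s < b k" n] s T by auto
      then obtain k' where k': "k = Suc k'" using s b0 by (cases k) auto
      have "\<not> s < b k'" using not_less_Least[of k' "\<lambda>k. s < b k"] k' by (simp add: k_def)
      then show ?thesis using k k' by (intro exI[of _ k']) auto
    qed
    then obtain k where k: "k < n" "b k \<le> s" "s < b (Suc k)" by blast
    have bk: "0 \<le> b k"
    proof -
      have "b 0 \<le> b j" if "j \<le> n" for j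
        using that by (induction j) (use inc(1) in \<open>auto intro: order_trans less_imp_le simp: Suc_le_eq\<close>)
      then show ?thesis using k b0 by simp
    qed
    have sm: "strict_mono_on {0..} l" using l(1) by (simp add: time_changes_def)
    have "l s < l (b (Suc k))" by (rule strict_mono_onD[OF sm]) (use s bk k in auto)
    moreover have "l (b k) \<le> l s"
      using strict_mono_onD[OF sm, of "b k" s] bk k s by (cases "b k = s") auto
    ultimately have "g (l s) = z k" using l(2) k by (intro g) auto
    then show ?thesis using f[OF k] by simp
  qed
  then show ?thesis using l by (intro bexI[of _ l]) auto
qed

lemma cadlag_restrict:
  assumes "cadlag f" shows "cadlag (restrict f {0..})"
  unfolding cadlag_def
proof (intro conjI allI impI)
  fix t :: real assume t: "0 \<le> t"
  have "(f \<longlongrightarrow> f t) (at_right t)" using assms t by (simp add: cadlag_def continuous_within)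
  moreover have "\<forall>\<^sub>F s in at_right t. f s = restrict f {0..} s"
    using t by (auto simp: eventually_at_filter)
  ultimately have "(restrict f {0..} \<longlongrightarrow> f t) (at_right t)" by (rule Lim_transform_eventually)
  then show "continuous (at_right t) (restrict f {0..})" using t by (simp add: continuous_within)
next
  fix t :: real assume t: "0 < t"
  then obtain l where "(f \<longlongrightarrow> l) (at_left t)" using assms by (auto simp: cadlag_def)
  moreover have "\<forall>\<^sub>F s in at_left t. f s = restrict f {0..} s"
    using eventually_at_left_real[OF t] by eventually_elim auto
  ultimately have "(restrict f {0..} \<longlongrightarrow> l) (at_left t)" by (rule Lim_transform_eventually)
  then show "\<exists>l. (restrict f {0..} \<longlongrightarrow> l) (at_left t)" ..
qed

lemma path_at_skorokhod_of: "cadlag f \<Longrightarrow> 0 \<le> t \<Longrightarrow> path_at (skorokhod_of f) t = f t"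
  unfolding skorokhod_of_def by (subst Abs_skorokhod_inverse) (auto simp: cadlag_restrict)

lemma matching_skorokhod_nbhd:
  assumes "b 0 = (0::real)" "t 0 = (0::real)"
    and "\<And>k. k < n \<Longrightarrow> b k < b (Suc k)" "\<And>k. k < n \<Longrightarrow> t k < t (Suc k)"
    and "\<And>k. k \<le> n \<Longrightarrow> \<bar>b k - t k\<bar> < e"
    and "\<And>k s. k < n \<Longrightarrow> b k \<le> s \<Longrightarrow> s < b (Suc k) \<Longrightarrow> path_at f s = z k"
    and "\<And>k s. k < n \<Longrightarrow> t k \<le> s \<Longrightarrow> s < t (Suc k) \<Longrightarrow> path_at g s = z k"
    and "T < b n" and e: "0 < e"
  shows "f \<in> skorokhod_nbhd g T e"
proof -
  obtain l where "l \<in> time_changes" "\<forall>s\<in>{0..T}. \<bar>l s - s\<bar> < e \<and> path_at f s = path_at g (l s)"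
    using matching_time_change[of b t n e "path_at f" z "path_at g" T] assms by blast
  then show ?thesis unfolding skorokhod_nbhd_def using e by (intro CollectI bexI[of _ l]) auto
qed

text \<open>The time changes are composed. The inner one may move \<open>T\<close> forward by up to
  \<open>e1\<close>, so the outer neighbourhood has to control the paths up to T + e1.\<close>

lemma skorokhod_nbhd_trans:
  assumes g1: "g1 \<in> skorokhod_nbhd g0 T0 e0" and g2: "g2 \<in> skorokhod_nbhd g1 T1 e1"
    and T: "T \<le> T1" "T + e1 \<le> T0"
  shows "g2 \<in> skorokhod_nbhd g0 T (e0 + e1)"
proof -
  obtain l0 where l0: "l0 \<in> time_changes" "\<forall>t\<in>{0..T0}. \<bar>l0 t - t\<bar> < e0 \<and> dist (path_at g1 t) (path_at g0 (l0 t)) < e0"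
    using g1 by (auto simp: skorokhod_nbhd_def)
  obtain l1 where l1: "l1 \<in> time_changes" "\<forall>t\<in>{0..T1}. \<bar>l1 t - t\<bar> < e1 \<and> dist (path_at g2 t) (path_at g1 (l1 t)) < e1"
    using g2 by (auto simp: skorokhod_nbhd_def)
  have "\<bar>l0 (l1 t) - t\<bar> < e0 + e1 \<and> dist (path_at g2 t) (path_at g0 (l0 (l1 t))) < e0 + e1" if t: "t \<in> {0..T}" for t
  proof -
    have 1: "\<bar>l1 t - t\<bar> < e1" "dist (path_at g2 t) (path_at g1 (l1 t)) < e1" using l1(2) t T by auto
    have "l1 t \<in> {0..}" using l1(1) t by (auto simp: time_changes_def)
    then have "l1 t \<in> {0..T0}" using 1(1) t T by auto
    then have 2: "\<bar>l0 (l1 t) - l1 t\<bar> < e0" "dist (path_at g1 (l1 t)) (path_at g0 (l0 (l1 t))) < e0" using l0(2) by auto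
    show ?thesis using 1 2 dist_triangle[of "path_at g2 t" "path_at g0 (l0 (l1 t))" "path_at g1 (l1 t)"] by linarith
  qed
  then show ?thesis unfolding skorokhod_nbhd_def
    by (intro CollectI bexI[OF _ time_changes_comp[OF l0(1) l1(1)]] ballI)
qed

text \<open>Induction over the reals: left limits show that the supremum of the attainable end
  points is attainable, and right continuity extends a partition beyond it, so the end points cannot
  be bounded by \<open>T\<close>.\<close>

lemma cadlag_partition:
  assumes cad: "cadlag (\<lambda>t. discrete (f t))" and T: "0 \<le> T"
  shows "\<exists>n s. s 0 = 0 \<and> (\<forall>k<n. s k < s (Suc k)) \<and> (\<forall>k<n. \<forall>t. s k \<le> t \<and> t < s (Suc k) \<longrightarrow> f t = f (s k)) \<and> T < s n"
proof -
  define A where "A = {u::real. \<exists>n s. s 0 = 0 \<and> (\<forall>k<n. s k < s (Suc k)) \<and> (\<forall>k<n. \<forall>t. s k \<le> t \<and> t < s (Suc k) \<longrightarrow> f t = f (s k)) \<and> s n = u}"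
  have extend: "v \<in> A" if u: "u \<in> A" "u < v" "\<And>t. u \<le> t \<Longrightarrow> t < v \<Longrightarrow> f t = f u" for u v
  proof -
    obtain n s where s: "s 0 = 0" "\<forall>k<n. s k < s (Suc k)" "\<forall>k<n. \<forall>t. s k \<le> t \<and> t < s (Suc k) \<longrightarrow> f t = f (s k)" "s n = u"
      using u(1) by (auto simp: A_def)
    define s' where "s' = s(Suc n := v)"
    have s': "s' k = s k" if "k \<le> n" for k using that by (simp add: s'_def)
    have "s' (Suc n) = v" by (simp add: s'_def)
    moreover have "s' k < s' (Suc k)" if "k < Suc n" for k
      using that s(2,4) s' u(2) \<open>s' (Suc n) = v\<close> by (cases "k = n") auto
    moreover have "f t = f (s' k)" if "k < Suc n" "s' k \<le> t" "t < s' (Suc k)" for k t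
    proof (cases "k = n")
      case True
      then have "s' k = u" using s' s(4) by simp
      then show ?thesis using u(3)[of t] that True \<open>s' (Suc n) = v\<close> by simp
    next
      case False
      then have "k < n" "s' k = s k" "s' (Suc k) = s (Suc k)" using that(1) s' by auto
      then show ?thesis using s(3)[rule_format, of k t] that by simp
    qed
    moreover have "s' 0 = 0" using s' s(1) by simp
    ultimately show ?thesis unfolding A_def by (intro CollectI exI[of _ "Suc n"] exI[of _ s']) blast
  qed
  have A0: "0 \<in> A" unfolding A_def by (intro CollectI exI[of _ 0] exI[of _ "\<lambda>_. 0"]) auto
  have "\<exists>u\<in>A. T < u"
  proof (rule ccontr)
    assume no: "\<not> (\<exists>u\<in>A. T < u)"
    then have bdd: "bdd_above A" by (auto simp: bdd_above_def not_less)
    define c where "c = Sup A"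
    have c0: "0 \<le> c" unfolding c_def by (rule cSup_upper[OF A0 bdd])
    have "c \<in> A"
    proof (cases "c = 0")
      case False
      then have "0 < c" using c0 by simp
      then obtain \<delta> z where \<delta>: "0 < \<delta>" "\<And>u. c - \<delta> < u \<Longrightarrow> u < c \<Longrightarrow> f u = z"
        using cadlag_discrete_left[OF cad] by blast
      obtain u where u: "u \<in> A" "c - \<delta> < u" using less_cSup_iff[of A "c - \<delta>"] A0 bdd \<delta>(1) by (auto simp: c_def)
      have "u \<le> c" unfolding c_def by (rule cSup_upper[OF u(1) bdd])
      show ?thesis
      proof (cases "u = c")
        case False
        then have uc: "u < c" using \<open>u \<le> c\<close> by simp
        show ?thesis
        proof (rule extend[OF u(1) uc])
          fix t assume "u \<le> t" "t < c"
          then have "f t = z" "f u = z" using \<delta>(2)[of t] \<delta>(2)[of u] u(2) uc by auto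
          then show "f t = f u" by simp
        qed
      qed (use u in simp)
    qed (use A0 in simp)
    show False
    proof (rule cadlag_discrete_right[OF cad c0])
      fix \<delta> assume \<delta>: "0 < \<delta>" "\<And>u. c \<le> u \<Longrightarrow> u < c + \<delta> \<Longrightarrow> f u = f c"
      have "c + \<delta> \<in> A" by (rule extend[OF \<open>c \<in> A\<close> _ \<delta>(2)]) (use \<delta>(1) in auto)
      then have "c + \<delta> \<le> c" unfolding c_def by (rule cSup_upper[OF _ bdd])
      then show False using \<delta>(1) by simp
    qed
  qed
  then show ?thesis unfolding A_def by blast
qed

text \<open>Freezing the index at \<open>K\<close> makes the path depend on the finitely many values
  z(0), ..., z(K) only; \<open>step_path_cong\<close> and measurability rest on this.\<close>

definition step_path :: "real \<Rightarrow> nat \<Rightarrow> (nat \<Rightarrow> 's) \<Rightarrow> 's discrete skorokhod" where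
  "step_path h K z = skorokhod_of (\<lambda>t. discrete (z (min K (nat \<lfloor>t / h\<rfloor>))))"

lemma step_path_at:
  assumes h: "0 < h" and t: "real k * h \<le> t" "t < real (Suc k) * h" and k: "k < K"
  shows "path_at (step_path h K z) t = discrete (z k)"
proof -
  have fl: "nat \<lfloor>t / h\<rfloor> = k" if "real k * h \<le> t" "t < real (Suc k) * h" for k t
  proof -
    have "\<lfloor>t / h\<rfloor> = int k" using that h by (intro floor_unique) (auto simp: field_simps)
    then show ?thesis by simp
  qed
  have ex: "\<exists>k. real k * h \<le> t \<and> t < real (Suc k) * h" if "0 \<le> t" for t
  proof -
    have "0 \<le> t / h" using that h by simp
    then have "real (nat \<lfloor>t / h\<rfloor>) = of_int \<lfloor>t / h\<rfloor>" by simp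
    then have "real (nat \<lfloor>t / h\<rfloor>) \<le> t / h" "t / h < real (Suc (nat \<lfloor>t / h\<rfloor>))" by linarith+
    then show ?thesis using h by (intro exI[of _ "nat \<lfloor>t / h\<rfloor>"]) (simp add: field_simps)
  qed
  have cad: "cadlag (\<lambda>t. discrete (z (min K (nat \<lfloor>t / h\<rfloor>))))"
  proof (rule cadlag_discreteI)
    fix t :: real assume "0 \<le> t"
    then obtain k where k: "real k * h \<le> t" "t < real (Suc k) * h" using ex by blast
    then show "\<exists>\<delta>>0. \<forall>u. t < u \<and> u < t + \<delta> \<longrightarrow> z (min K (nat \<lfloor>u / h\<rfloor>)) = z (min K (nat \<lfloor>t / h\<rfloor>))"
      using fl[of k] by (intro exI[of _ "real (Suc k) * h - t"]) auto
  next
    fix t :: real assume t: "0 < t"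
    then obtain k where k: "real k * h \<le> t" "t < real (Suc k) * h" using ex[of t] by auto
    show "\<exists>\<delta>>0. \<exists>w. \<forall>u. t - \<delta> < u \<and> u < t \<longrightarrow> z (min K (nat \<lfloor>u / h\<rfloor>)) = w"
    proof (cases "t = real k * h")
      case True
      then obtain k' where k': "k = Suc k'" using t by (cases k) auto
      have "nat \<lfloor>u / h\<rfloor> = k'" if "t - h < u" "u < t" for u
        using that True k' by (intro fl) (auto simp: algebra_simps)
      then show ?thesis using h by (intro exI[of _ h]) auto
    next
      case False
      then show ?thesis using fl[of k] k by (intro exI[of _ "t - real k * h"] conjI exI[of _ "z (min K k)"]) auto
    qed
  qed
  have "0 \<le> t" using t(1) h by (meson mult_nonneg_nonneg of_nat_0_le_iff less_imp_le order_trans)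
  then show ?thesis unfolding step_path_def using path_at_skorokhod_of[OF cad] fl[OF t] k by simp
qed

lemma step_path_cong: "(\<And>k. k \<le> K \<Longrightarrow> z k = z' k) \<Longrightarrow> step_path h K z = step_path h K z'"
  unfolding step_path_def by simp

definition approx_path :: "nat \<Rightarrow> (real \<Rightarrow> 's) \<Rightarrow> 's discrete skorokhod" where
  "approx_path n f = step_path (1 / 2 ^ n) (n * 2 ^ n) (\<lambda>k. f (real k * (1 / 2 ^ n)))"

text \<open>Once the mesh is below every interval length of a partition of \<open>f\<close> and
  below \<open>e\<close>, moving each jump to the next grid time preserves the order of the jumps
  and shifts them by less than \<open>e\<close>. Both directions are stated because
  \<open>skorokhod_nbhd\<close> is not symmetric: one serves to enter \<open>inner_part\<close>, the
  other to return from it.\<close>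

lemma approx_path_converges:
  assumes cad: "cadlag (\<lambda>t. discrete (f t))" and T: "0 \<le> T" and e: "0 < e"
  shows "\<forall>\<^sub>F n in sequentially. approx_path n f \<in> skorokhod_nbhd (skorokhod_of (\<lambda>t. discrete (f t))) T e
    \<and> skorokhod_of (\<lambda>t. discrete (f t)) \<in> skorokhod_nbhd (approx_path n f) T e"
proof -
  obtain m s where s: "s 0 = 0" "\<And>k. k < m \<Longrightarrow> s k < s (Suc k)"
    "\<And>k t. k < m \<Longrightarrow> s k \<le> t \<Longrightarrow> t < s (Suc k) \<Longrightarrow> f t = f (s k)" and sm: "T < s m"
    using cadlag_partition[OF cad T] by blast
  have s0: "0 \<le> s k" if "k \<le> m" for k
    using that by (induction k) (use s(1,2) in \<open>auto intro: order_trans less_imp_le simp: Suc_le_eq\<close>)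
  have ev: "\<forall>\<^sub>F n in sequentially. 1 / 2 ^ n < a" if "0 < a" for a :: real
  proof -
    have "(\<lambda>n. (1 / 2) ^ n :: real) \<longlonglongrightarrow> 0" by (intro LIMSEQ_power_zero) simp
    then have "\<forall>\<^sub>F n in sequentially. (1 / 2) ^ n < a" using that by (rule order_tendstoD)
    then show ?thesis by (simp add: power_one_over)
  qed
  have "\<forall>\<^sub>F n in sequentially. \<forall>k\<in>{..<m}. 1 / 2 ^ n < s (Suc k) - s k"
    using ev s(2) by (intro eventually_ball_finite) auto
  moreover have "\<forall>\<^sub>F n in sequentially. 1 / 2 ^ n < e" using ev e by blast
  moreover have "\<forall>\<^sub>F n in sequentially. s m + 1 \<le> real n"
    using eventually_ge_at_top[of "nat \<lceil>s m + 1\<rceil>"] by eventually_elim linarith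
  ultimately show ?thesis
  proof eventually_elim
    case (elim n)
    define h :: real where "h = 1 / 2 ^ n"
    have h: "0 < h" "h \<le> 1" "h < e" using elim(2) by (auto simp: h_def)
    define i where "i k = nat \<lceil>s k / h\<rceil>" for k
    define t where "t k = real (i k) * h" for k
    \<comment> \<open>\<open>t k\<close> is the first grid time at or after \<open>s k\<close>. The
      third fact turns this around: a grid time before \<open>t k\<close> is already before
      \<open>s k\<close>, so the sampled value belongs to the right interval.\<close>
    have i: "s k \<le> t k" "t k < s k + h" "\<And>j. real j * h < t k \<Longrightarrow> real j * h < s k" if "k \<le> m" for k
    proof -
      have "0 \<le> s k / h" using s0[OF that] h by simp
      then have c: "s k / h \<le> real (i k)" "real (i k) < s k / h + 1"
      proof -
        have "real (i k) = of_int \<lceil>s k / h\<rceil>" using \<open>0 \<le> s k / h\<close> by (simp add: i_def)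
        then show "s k / h \<le> real (i k)" "real (i k) < s k / h + 1" by linarith+
      qed
      then show "s k \<le> t k" "t k < s k + h" using h by (auto simp: t_def field_simps)
      show "real j * h < s k" if "real j * h < t k" for j
      proof -
        have "real j + 1 \<le> real (i k)" using that h by (simp add: t_def)
        then have "real j < s k / h" using c(2) by linarith
        then show ?thesis using h by (simp add: field_simps)
      qed
    qed
    have t0: "t 0 = 0" by (simp add: t_def i_def s(1))
    have t_inc: "t k < t (Suc k)" if "k < m" for k
    proof -
      have "h < s (Suc k) - s k" using elim(1) that by (simp add: h_def)
      then show ?thesis using i(2)[of k] i(1)[of "Suc k"] that by simp
    qed
    have t_mono: "t k \<le> t m" if "k \<le> m" for k
      using that by (induction k rule: inc_induct) (use t_inc in \<open>auto intro: order_trans less_imp_le\<close>)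
    have close: "\<bar>s k - t k\<bar> < e" "\<bar>t k - s k\<bar> < e" if "k \<le> m" for k
      using i(1,2)[OF that] h by auto
    let ?z = "\<lambda>k. discrete (f (s k))"
    have p: "path_at (skorokhod_of (\<lambda>t. discrete (f t))) u = ?z k" if "k < m" "s k \<le> u" "u < s (Suc k)" for k u
    proof -
      have "0 \<le> u" using s0[of k] that by simp
      then show ?thesis using path_at_skorokhod_of[OF cad] s(3)[OF that] by simp
    qed
    have q: "path_at (approx_path n f) u = ?z k" if k: "k < m" "t k \<le> u" "u < t (Suc k)" for k u
    proof -
      have u0: "0 \<le> u" using s0[of k] i(1)[of k] that by simp
      define j where "j = nat \<lfloor>u / h\<rfloor>"
      have "0 \<le> u / h" using u0 h by simp
      then have j: "real j * h \<le> u" "u < real (Suc j) * h"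
      proof -
        have "real j = of_int \<lfloor>u / h\<rfloor>" using \<open>0 \<le> u / h\<close> by (simp add: j_def)
        then have "real j \<le> u / h" "u / h < real (Suc j)" by linarith+
        then show "real j * h \<le> u" "u < real (Suc j) * h" using h(1) by (auto simp: field_simps)
      qed
      have "real (i k) * h < real (Suc j) * h" using k(2) j(2) by (simp add: t_def)
      then have "real (i k) < real (Suc j)" using h by simp
      then have "t k \<le> real j * h" unfolding t_def using h by (intro mult_right_mono) auto
      then have 1: "s k \<le> real j * h" using i(1)[of k] k by simp
      have 2: "real j * h < s (Suc k)" using i(3)[of "Suc k" j] j(1) k by simp
      have "real j * h < t m" using j(1) k t_mono[of "Suc k"] by simp
      also have "\<dots> \<le> s m + 1" using i(2)[of m] h by simp
      also have "\<dots> \<le> real n" by (rule elim(3))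
      also have "\<dots> = real (n * 2 ^ n) * h" by (simp add: h_def)
      finally have "real j < real (n * 2 ^ n)" using h(1) by (simp only: mult_less_cancel_right_pos)
      then have "j < n * 2 ^ n" by (simp only: of_nat_less_iff)
      then have "path_at (approx_path n f) u = discrete (f (real j * h))"
        unfolding approx_path_def h_def[symmetric] using step_path_at[OF h(1) j] by blast
      then show ?thesis using s(3)[OF k(1) 1 2] by simp
    qed
    have Tm: "T < t m" using sm i(1)[of m] by simp
    show ?case
    proof
      show "approx_path n f \<in> skorokhod_nbhd (skorokhod_of (\<lambda>t. discrete (f t))) T e"
        by (rule matching_skorokhod_nbhd[OF t0 s(1) t_inc s(2) close(2) q p Tm e])
      show "skorokhod_of (\<lambda>t. discrete (f t)) \<in> skorokhod_nbhd (approx_path n f) T e"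
        by (rule matching_skorokhod_nbhd[OF s(1) t0 s(2) t_inc close(1) p q sm e])
    qed
  qed
qed

text \<open>The paths that lie in \<open>U\<close> with a margin, quantified by one index. No
  measurability of this set is claimed: it is applied only to grid paths, where any condition on
  finitely many values in a countable type is an event.\<close>

definition inner_part :: "'a::metric_space skorokhod set \<Rightarrow> nat \<Rightarrow> 'a skorokhod set" where
  "inner_part U m = {g. skorokhod_nbhd g (real (Suc m)) (1 / real (Suc m)) \<subseteq> U}"

lemma skorokhod_nbhd_mono: "T' \<le> T \<Longrightarrow> e \<le> e' \<Longrightarrow> skorokhod_nbhd g T e \<subseteq> skorokhod_nbhd g T' e'"
proof
  fix f assume T: "T' \<le> T" "e \<le> e'" and "f \<in> skorokhod_nbhd g T e"
  then obtain l where l: "l \<in> time_changes" "\<forall>t\<in>{0..T}. \<bar>l t - t\<bar> < e \<and> dist (path_at f t) (path_at g (l t)) < e"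
    unfolding skorokhod_nbhd_def by auto
  have "\<bar>l t - t\<bar> < e' \<and> dist (path_at f t) (path_at g (l t)) < e'" if "t \<in> {0..T'}" for t
    using l(2)[rule_format, of t] that T by auto
  then show "f \<in> skorokhod_nbhd g T' e'" unfolding skorokhod_nbhd_def
    by (intro CollectI bexI[OF _ l(1)] ballI)
qed

text \<open>Half of the radius \<open>e\<close> is spent on the discretization and half on the
  margin, with one extra unit of horizon for the composed time change. Together with
  \<open>approx_path_in_inner\<close>, membership in \<open>U\<close> becomes a condition on the
  sequence of grid paths.\<close>

lemma open_approx_path:
  assumes cad: "cadlag (\<lambda>t. discrete (f t))" and U: "open U" and f: "skorokhod_of (\<lambda>t. discrete (f t)) \<in> U"
  shows "\<exists>m. \<forall>\<^sub>F n in sequentially. approx_path n f \<in> inner_part U m"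
proof -
  let ?p = "skorokhod_of (\<lambda>t. discrete (f t))"
  obtain T e where Te: "0 < T" "0 < e" "skorokhod_nbhd ?p T e \<subseteq> U"
    using U f unfolding open_skorokhod_def by blast
  obtain m :: nat where m: "max T (2 / e) \<le> real m" using real_arch_simple by blast
  have m': "T \<le> real (Suc m)" "1 / real (Suc m) \<le> e / 2" "1 / real (Suc m) \<le> 1"
    using m Te by (auto simp: field_simps)
  have "\<forall>\<^sub>F n in sequentially. approx_path n f \<in> skorokhod_nbhd ?p (T + 1) (e / 2)"
    using approx_path_converges[OF cad, of "T + 1" "e / 2"] Te by (auto elim: eventually_mono)
  then have "\<forall>\<^sub>F n in sequentially. approx_path n f \<in> inner_part U m"
  proof eventually_elim
    case (elim n)
    have "g \<in> U" if "g \<in> skorokhod_nbhd (approx_path n f) (real (Suc m)) (1 / real (Suc m))" for g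
    proof -
      have "g \<in> skorokhod_nbhd ?p T (e / 2 + 1 / real (Suc m))"
        by (rule skorokhod_nbhd_trans[OF elim that m'(1)]) (use m' in simp)
      also have "\<dots> \<subseteq> skorokhod_nbhd ?p T e" using m' by (intro skorokhod_nbhd_mono) auto
      finally show ?thesis using Te(3) by blast
    qed
    then show ?case by (auto simp: inner_part_def)
  qed
  then show ?thesis ..
qed

lemma approx_path_in_inner:
  assumes cad: "cadlag (\<lambda>t. discrete (f t))" and ev: "\<forall>\<^sub>F n in sequentially. approx_path n f \<in> inner_part U m"
  shows "skorokhod_of (\<lambda>t. discrete (f t)) \<in> U"
proof -
  have "\<forall>\<^sub>F n in sequentially. skorokhod_of (\<lambda>t. discrete (f t)) \<in> skorokhod_nbhd (approx_path n f) (real (Suc m)) (1 / real (Suc m))"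
    using approx_path_converges[OF cad, of "real (Suc m)" "1 / real (Suc m)"] by (auto elim: eventually_mono)
  with ev have "\<forall>\<^sub>F n in sequentially. skorokhod_of (\<lambda>t. discrete (f t)) \<in> U"
    by eventually_elim (auto simp: inner_part_def)
  then show ?thesis by simp
qed

text \<open>The values at the first K + 1 grid times form a list over a countable type, and the
  event is a countable union over the admissible lists.\<close>

lemma grid_event:
  fixes X :: "real \<Rightarrow> 'w \<Rightarrow> 's::countable"
  assumes meas: "\<And>t x. 0 \<le> t \<Longrightarrow> {\<omega>\<in>space M. X t \<omega> = x} \<in> sets M" and h: "0 \<le> h"
    and \<phi>: "\<And>z z'. (\<And>k. k \<le> K \<Longrightarrow> z k = z' k) \<Longrightarrow> \<phi> z = \<phi> z'"
  shows "{\<omega>\<in>space M. \<phi> (\<lambda>k::nat. X (real k * h) \<omega>)} \<in> sets M"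
proof -
  have "{\<omega>\<in>space M. \<phi> (\<lambda>k. X (real k * h) \<omega>)}
     = (\<Union>zs\<in>{zs. \<phi> (\<lambda>k. zs ! k)}. \<Inter>k\<in>{..K}. {\<omega>\<in>space M. X (real k * h) \<omega> = zs ! k})" (is "?A = ?B")
  proof
    show "?A \<subseteq> ?B"
    proof
      fix \<omega> assume \<omega>: "\<omega> \<in> ?A"
      define zs where "zs = map (\<lambda>k. X (real k * h) \<omega>) [0..<Suc K]"
      have zs: "zs ! k = X (real k * h) \<omega>" if "k \<le> K" for k
        using that by (simp add: zs_def nth_map_upt del: upt_Suc)
      have "\<phi> (\<lambda>k. zs ! k)" using \<phi>[of "\<lambda>k. zs ! k" "\<lambda>k. X (real k * h) \<omega>"] zs \<omega> by simp
      then show "\<omega> \<in> ?B" using \<omega> zs by (intro UN_I[of zs]) auto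
    qed
    show "?B \<subseteq> ?A"
    proof
      fix \<omega> assume "\<omega> \<in> ?B"
      then obtain zs where zs: "\<phi> (\<lambda>k. zs ! k)" "\<And>k. k \<le> K \<Longrightarrow> \<omega> \<in> space M \<and> X (real k * h) \<omega> = zs ! k" by auto
      then have "\<phi> (\<lambda>k. X (real k * h) \<omega>)" using \<phi>[of "\<lambda>k. zs ! k" "\<lambda>k. X (real k * h) \<omega>"] by auto
      then show "\<omega> \<in> ?A" using zs(2)[of 0] by simp
    qed
  qed
  also have "\<dots> \<in> sets M"
  proof (rule sets.countable_UN'')
    show "(\<Inter>k\<in>{..K}. {\<omega>\<in>space M. X (real k * h) \<omega> = zs ! k}) \<in> sets M" for zs
      using meas h by (intro sets.finite_INT) auto
  qed auto
  finally show ?thesis .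
qed

lemma approx_path_event:
  fixes X :: "real \<Rightarrow> 'w \<Rightarrow> 's::countable"
  assumes meas: "\<And>t x. 0 \<le> t \<Longrightarrow> {\<omega>\<in>space M. X t \<omega> = x} \<in> sets M"
  shows "{\<omega>\<in>space M. approx_path n (\<lambda>t. X t \<omega>) \<in> V} \<in> sets M"
  unfolding approx_path_def
proof (rule grid_event[OF meas, where \<phi> = "\<lambda>z. step_path (1 / 2 ^ n) (n * 2 ^ n) z \<in> V" and K = "n * 2 ^ n"])
  show "(step_path (1 / 2 ^ n) (n * 2 ^ n) z \<in> V) = (step_path (1 / 2 ^ n) (n * 2 ^ n) z' \<in> V)"
    if "\<And>k. k \<le> n * 2 ^ n \<Longrightarrow> z k = z' k" for z z' :: "nat \<Rightarrow> 's"
    using step_path_cong[of "n * 2 ^ n" z z'] that by simp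
qed auto

text \<open>Preimages of open sets suffice. On cadlag paths such a preimage is described by
  countably many grid events, through \<open>open_approx_path\<close> and
  \<open>approx_path_in_inner\<close>; all other outcomes are sent to one fixed path, which is why
  the cadlag set itself has to be measurable.\<close>

lemma skorokhod_of_measurable:
  fixes X :: "real \<Rightarrow> 'w \<Rightarrow> 's::countable"
  assumes meas: "\<And>t x. 0 \<le> t \<Longrightarrow> {\<omega>\<in>space M. X t \<omega> = x} \<in> sets M"
    and C: "{\<omega>\<in>space M. cadlag (\<lambda>t. discrete (X t \<omega>))} \<in> sets M"
  shows "(\<lambda>\<omega>. skorokhod_of (\<lambda>t. discrete (X t \<omega>))) \<in> borel_measurable M"
proof (rule borel_measurableI)
  fix U :: "'s discrete skorokhod set" assume U: "open U"
  let ?p = "\<lambda>\<omega>. skorokhod_of (\<lambda>t. discrete (X t \<omega>))"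
  let ?C = "{\<omega>\<in>space M. cadlag (\<lambda>t. discrete (X t \<omega>))}"
  let ?A = "{\<omega>\<in>space M. \<exists>m. \<exists>k. \<forall>n\<in>{k..}. approx_path n (\<lambda>t. X t \<omega>) \<in> inner_part U m}"
  have "?A = (\<Union>m. \<Union>k. \<Inter>n\<in>{k..}. {\<omega>\<in>space M. approx_path n (\<lambda>t. X t \<omega>) \<in> inner_part U m})" by auto
  also have "\<dots> \<in> sets M"
  proof (rule sets.countable_UN''[OF countableI_type], rule sets.countable_UN''[OF countableI_type])
    show "(\<Inter>n\<in>{k..}. {\<omega>\<in>space M. approx_path n (\<lambda>t. X t \<omega>) \<in> inner_part U m}) \<in> sets M" for m k
      using approx_path_event[OF meas] by (intro sets.countable_INT') auto
  qed
  finally have A: "?A \<in> sets M" .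
  have cadlag_case: "?p \<omega> \<in> U \<longleftrightarrow> \<omega> \<in> ?A" if "\<omega> \<in> ?C" for \<omega>
  proof -
    have cad: "cadlag (\<lambda>t. discrete (X t \<omega>))" "\<omega> \<in> space M" using that by auto
    have "?p \<omega> \<in> U \<longleftrightarrow> (\<exists>m. \<forall>\<^sub>F n in sequentially. approx_path n (\<lambda>t. X t \<omega>) \<in> inner_part U m)"
      using open_approx_path[OF cad(1) U] approx_path_in_inner[OF cad(1)] by metis
    also have "\<dots> \<longleftrightarrow> \<omega> \<in> ?A" using cad(2) by (auto simp: eventually_sequentially)
    finally show ?thesis .
  qed
  let ?q = "Abs_skorokhod (restrict (\<lambda>_. undefined) {0..}) :: 's discrete skorokhod"
  have other: "?p \<omega> = ?q" if "\<omega> \<in> space M - ?C" for \<omega>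
    using that by (simp add: skorokhod_of_def)
  have "?p -` U \<inter> space M = (?C \<inter> ?A) \<union> (if ?q \<in> U then space M - ?C else {})"
  proof (rule set_eqI)
    fix \<omega>
    show "\<omega> \<in> ?p -` U \<inter> space M \<longleftrightarrow> \<omega> \<in> (?C \<inter> ?A) \<union> (if ?q \<in> U then space M - ?C else {})"
      using cadlag_case[of \<omega>] other[of \<omega>] by (cases "\<omega> \<in> ?C"; cases "?q \<in> U"; auto)
  qed
  also have "\<dots> \<in> sets M" using A C by auto
  finally show "?p -` U \<inter> space M \<in> sets M" .
qed

text \<open>A function with values in [0, 1] differs by at most 1 / m from the average of the
  indicators of its open level sets {f > i / m}, which transfers lower bounds from open sets to
  integrals. Index 0 is left out because nothing is assumed about the particle system without
  particles.\<close>

lemma weakly_convergesI: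
  fixes \<mu> :: "nat \<Rightarrow> 'a::topological_space measure"
  assumes \<mu>: "\<And>n. 0 < n \<Longrightarrow> prob_space (\<mu> n) \<and> sets (\<mu> n) = sets borel" and \<nu>: "prob_space \<nu>" "sets \<nu> = sets borel"
    and le: "\<And>U \<delta>. open U \<Longrightarrow> 0 < \<delta> \<Longrightarrow> \<forall>\<^sub>F n in sequentially. measure \<nu> U - \<delta> \<le> measure (\<mu> n) U"
  shows "weakly_converges \<mu> \<nu>"
proof -
  have lower: "\<forall>\<^sub>F n in sequentially. (\<integral>z. f z \<partial>\<nu>) - \<delta> \<le> (\<integral>z. f z \<partial>\<mu> n)"
    if f: "continuous_on UNIV f" "\<And>z. 0 \<le> f z" "\<And>z. f z \<le> 1" and \<delta>: "0 < \<delta>" for f :: "'a \<Rightarrow> real" and \<delta>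
  proof -
    obtain m :: nat where m: "0 < m" "1 / real m < \<delta> / 2" using \<delta> by (metis half_gt_zero nat_approx_posE zero_less_Suc)
    define U where "U i = {z. real i / real m < f z}" for i :: nat
    have U: "open (U i)" for i
      unfolding U_def using f(1) by (intro open_Collect_less continuous_on_const)
    define g where "g z = (\<Sum>i\<in>{1..m}. indicator (U i) z / real m)" for z
    have g: "g z \<le> f z" "f z \<le> g z + 1 / real m" for z
    proof -
      define k where "k = nat \<lceil>real m * f z\<rceil>"
      have c: "real m * f z \<le> real k" "real k < real m * f z + 1"
      proof -
        have "real k = of_int \<lceil>real m * f z\<rceil>" using f(2)[of z] by (simp add: k_def)
        then show "real m * f z \<le> real k" "real k < real m * f z + 1" by linarith+
      qed
      have km: "k \<le> m" unfolding k_def using f(3)[of z] m(1) by (auto simp: nat_le_iff ceiling_le_iff mult_left_le)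
      have iff: "z \<in> U i \<longleftrightarrow> i < k" if "i \<in> {1..m}" for i
      proof -
        have "z \<in> U i \<longleftrightarrow> real i < real m * f z" using m(1) by (simp add: U_def field_simps)
        also have "\<dots> \<longleftrightarrow> i < k"
        proof
          assume "real i < real m * f z"
          then show "i < k" using c(1) by linarith
        next
          assume "i < k"
          then have "real i + 1 \<le> real k" by simp
          then show "real i < real m * f z" using c(2) by linarith
        qed
        finally show ?thesis .
      qed
      have "g z = (\<Sum>i\<in>{1..m}. (if i < k then 1 / real m else 0))"
        unfolding g_def by (intro sum.cong refl) (auto simp: iff indicator_def)
      also have "\<dots> = (\<Sum>i\<in>{1..m} \<inter> {i. i < k}. 1 / real m)" by (subst sum.inter_restrict) auto
      also have "{1..m} \<inter> {i. i < k} = {1..<k}" using km by auto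
      finally have g: "g z = real (k - 1) / real m" by simp
      show "g z \<le> f z"
      proof -
        have "real (k - 1) \<le> real m * f z" using c f(2)[of z] m(1) by (cases k) auto
        then show ?thesis using m(1) by (simp add: g field_simps)
      qed
      show "f z \<le> g z + 1 / real m"
      proof -
        have "real m * f z \<le> real (k - 1) + 1" using c by (cases k) auto
        then show ?thesis using m(1) by (simp add: g field_simps)
      qed
    qed
    have g_int: "(\<integral>z. g z \<partial>\<rho>) = (\<Sum>i\<in>{1..m}. measure \<rho> (U i) / real m)" and g_able: "integrable \<rho> g" and f_able: "integrable \<rho> f"
      if \<rho>: "prob_space \<rho>" "sets \<rho> = sets borel" for \<rho>
    proof -
      interpret prob_space \<rho> by (rule \<rho>(1))
      have Us: "U i \<in> events" for i using U \<rho>(2) by simp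
      have sp: "space \<rho> = UNIV" using sets_eq_imp_space_eq[OF \<rho>(2)] by simp
      have int: "integrable \<rho> (\<lambda>z. indicator (U i) z / real m)" for i
        using Us by (intro integrable_divide_zero integrable_real_indicator) (auto simp: emeasure_eq_measure)
      then show "integrable \<rho> g" unfolding g_def by (intro Bochner_Integration.integrable_sum)
      show "(\<integral>z. g z \<partial>\<rho>) = (\<Sum>i\<in>{1..m}. measure \<rho> (U i) / real m)"
        unfolding g_def using int by (subst Bochner_Integration.integral_sum) (auto simp: sp)
      have "f \<in> borel_measurable \<rho>"
        using borel_measurable_continuous_onI[OF f(1)] measurable_cong_sets[OF \<rho>(2) refl] by blast
      then show "integrable \<rho> f" using f(2,3) by (intro integrable_const_bound[where B = 1]) auto
    qed
    have "\<forall>\<^sub>F n in sequentially. \<forall>i\<in>{1..m}. measure \<nu> (U i) - \<delta> / 2 \<le> measure (\<mu> n) (U i)"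
      using le[OF U] \<delta> by (intro eventually_ball_finite) auto
    then show ?thesis using eventually_gt_at_top[of 0]
    proof eventually_elim
      case (elim n)
      note \<mu>n = \<mu>[OF elim(2), THEN conjunct1] \<mu>[OF elim(2), THEN conjunct2]
      have "(\<integral>z. f z \<partial>\<nu>) \<le> (\<integral>z. g z + 1 / real m \<partial>\<nu>)"
      proof -
        interpret prob_space \<nu> by (rule \<nu>(1))
        show ?thesis using g(2) f_able[OF \<nu>] g_able[OF \<nu>] by (intro integral_mono) auto
      qed
      also have "\<dots> = (\<integral>z. g z \<partial>\<nu>) + 1 / real m"
      proof -
        interpret prob_space \<nu> by (rule \<nu>(1))
        show ?thesis using g_able[OF \<nu>] by (simp add: prob_space)
      qed
      also have "(\<integral>z. g z \<partial>\<nu>) \<le> (\<Sum>i\<in>{1..m}. measure (\<mu> n) (U i) / real m + \<delta> / 2 / real m)"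
        unfolding g_int[OF \<nu>] add_divide_distrib[symmetric]
      proof (intro sum_mono divide_right_mono)
        fix i assume "i \<in> {1..m}"
        from bspec[OF elim(1) this] show "measure \<nu> (U i) \<le> measure (\<mu> n) (U i) + \<delta> / 2" by simp
      qed simp
      also have "\<dots> = (\<integral>z. g z \<partial>\<mu> n) + \<delta> / 2"
        unfolding g_int[OF \<mu>n] sum.distrib using m(1) by simp
      also have "(\<integral>z. g z \<partial>\<mu> n) \<le> (\<integral>z. f z \<partial>\<mu> n)"
        using g(1) f_able[OF \<mu>n] g_able[OF \<mu>n] by (intro integral_mono) auto
      finally show ?case using m(2) by linarith
    qed
  qed
  show ?thesis unfolding weakly_converges_def
  proof (intro allI impI)
    fix f :: "'a \<Rightarrow> real" assume f: "continuous_on UNIV f \<and> bounded (range f)"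
    then obtain B where B: "\<And>z. \<bar>f z\<bar> \<le> B" by (auto simp: bounded_iff)
    define b where "b = B + 1"
    have b: "0 < b" "\<bar>f z\<bar> \<le> b" for z using B[of z] by (auto simp: b_def)
    \<comment> \<open>Rescaling f and -f into [0, 1] turns the lower bound for integrals into a
      lower and an upper bound for the integral of \<open>f\<close>.\<close>
    define F where "F s z = (1 + s * (f z / b)) / 2" for s z
    have F: "continuous_on UNIV (F s)" "0 \<le> F s z" "F s z \<le> 1" if "s = 1 \<or> s = -1" for s z
    proof -
      show "continuous_on UNIV (F s)" unfolding F_def using f b(1) by (intro continuous_intros) auto
      have "- 1 \<le> f z / b" "f z / b \<le> 1" using b(1) b(2)[of z] by (auto simp: field_simps abs_le_iff)
      then show "0 \<le> F s z" "F s z \<le> 1" using that by (auto simp: F_def)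
    qed
    have Fint: "(\<integral>z. F s z \<partial>\<rho>) = (1 + s * ((\<integral>z. f z \<partial>\<rho>) / b)) / 2" if \<rho>: "prob_space \<rho>" "sets \<rho> = sets borel" for s \<rho>
    proof -
      interpret prob_space \<rho> by (rule \<rho>(1))
      have "f \<in> borel_measurable \<rho>"
        using borel_measurable_continuous_onI[of f] f measurable_cong_sets[OF \<rho>(2) refl] by blast
      then have "integrable \<rho> f" using b(2) by (intro integrable_const_bound[where B = b]) auto
      then show ?thesis unfolding F_def by (simp add: prob_space)
    qed
    show "(\<lambda>n. \<integral>z. f z \<partial>\<mu> n) \<longlonglongrightarrow> (\<integral>z. f z \<partial>\<nu>)"
    proof (rule tendstoI)
      fix e :: real assume e: "0 < e"
      define \<delta> where "\<delta> = e / (4 * b)"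
      have \<delta>: "0 < \<delta>" "\<delta> * (4 * b) = e" using e b(1) by (auto simp: \<delta>_def)
      have "\<forall>\<^sub>F n in sequentially. (\<integral>z. F 1 z \<partial>\<nu>) - \<delta> \<le> (\<integral>z. F 1 z \<partial>\<mu> n)"
        by (rule lower[OF F \<delta>(1)]) auto
      moreover have "\<forall>\<^sub>F n in sequentially. (\<integral>z. F (-1) z \<partial>\<nu>) - \<delta> \<le> (\<integral>z. F (-1) z \<partial>\<mu> n)"
        by (rule lower[OF F \<delta>(1)]) auto
      ultimately show "\<forall>\<^sub>F n in sequentially. dist (\<integral>z. f z \<partial>\<mu> n) (\<integral>z. f z \<partial>\<nu>) < e"
        using eventually_gt_at_top[of 0]
      proof eventually_elim
        case (elim n)
        note \<mu>n = \<mu>[OF elim(3), THEN conjunct1] \<mu>[OF elim(3), THEN conjunct2]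
        have lin: "(1 + 1 * x) / 2 - \<delta> \<le> (1 + 1 * y) / 2 \<Longrightarrow> x - y \<le> 2 * \<delta>"
          "(1 + - 1 * x) / 2 - \<delta> \<le> (1 + - 1 * y) / 2 \<Longrightarrow> y - x \<le> 2 * \<delta>" for x y :: real by (simp_all add: field_simps)
        have 1: "(\<integral>z. f z \<partial>\<nu>) / b - (\<integral>z. f z \<partial>\<mu> n) / b \<le> 2 * \<delta>"
          using elim(1) unfolding Fint[OF \<nu>] Fint[OF \<mu>n] by (rule lin(1))
        have 2: "(\<integral>z. f z \<partial>\<mu> n) / b - (\<integral>z. f z \<partial>\<nu>) / b \<le> 2 * \<delta>"
          using elim(2) unfolding Fint[OF \<nu>] Fint[OF \<mu>n] by (rule lin(2))
        have "\<bar>(\<integral>z. f z \<partial>\<mu> n) - (\<integral>z. f z \<partial>\<nu>)\<bar> \<le> 2 * \<delta> * b"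
          using 1 2 b(1) by (auto simp: abs_le_iff diff_divide_distrib[symmetric] pos_divide_le_eq)
        also have "\<dots> < e" using \<delta>(2) e by simp
        finally show ?case by (simp add: dist_real_def)
      qed
    qed
  qed
qed

section \<open>Measurability of the order process\<close>

lemma (in discrete_path) fmeasurable_E: "{s\<in>{0..t}. f s \<in> E} \<in> fmeasurable lborel"
proof (rule fmeasurable_subset_Icc[of _ 0 t])
  show "{s\<in>{0..t}. f s \<in> E} \<in> sets lborel" by (rule sets_E) auto
qed auto

lemma (in discrete_path) occ_compl:
  assumes "0 \<le> t" shows "T t + occ (- E) f t = t"
proof -
  interpret C: discrete_path f "- E" using cad by unfold_locales
  have "measure lborel ({s\<in>{0..t}. f s \<in> E} \<union> {s\<in>{0..t}. f s \<in> - E})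
      = measure lborel {s\<in>{0..t}. f s \<in> E} + measure lborel {s\<in>{0..t}. f s \<in> - E}"
  proof (rule measure_Un3[THEN trans])
    show "{s\<in>{0..t}. f s \<in> E} \<in> fmeasurable lborel" by (rule fmeasurable_E)
    show "{s\<in>{0..t}. f s \<in> - E} \<in> fmeasurable lborel" by (rule C.fmeasurable_E)
    have "{s\<in>{0..t}. f s \<in> E} \<inter> {s\<in>{0..t}. f s \<in> - E} = {}" by auto
    then show "measure lborel {s\<in>{0..t}. f s \<in> E} + measure lborel {s\<in>{0..t}. f s \<in> - E}
      - measure lborel ({s\<in>{0..t}. f s \<in> E} \<inter> {s\<in>{0..t}. f s \<in> - E})
      = measure lborel {s\<in>{0..t}. f s \<in> E} + measure lborel {s\<in>{0..t}. f s \<in> - E}" by (simp only: measure_empty)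
  qed
  moreover have "{s\<in>{0..t}. f s \<in> E} \<union> {s\<in>{0..t}. f s \<in> - E} = {0..t}" by auto
  ultimately show ?thesis using assms by (simp add: occ_def)
qed

context chain_realisation
begin

lemma joint_measurable: "(\<lambda>(\<omega>, t). indicator E (X (max 0 t) \<omega>) :: real) \<in> borel_measurable (M \<Otimes>\<^sub>M borel)"
proof (rule right_const_joint_measurable[where X = X and g = "indicator E"])
  fix t :: real assume "0 \<le> t"
  have "(\<lambda>\<omega>. indicator E (X t \<omega>) :: real) = indicator {\<omega>. X t \<omega> \<in> E}" by (auto simp: indicator_def fun_eq_iff)
  moreover have "{\<omega>. X t \<omega> \<in> E} \<inter> space M = {\<omega>\<in>space M. X t \<omega> \<in> E}" by auto
  ultimately show "(\<lambda>\<omega>. indicator E (X t \<omega>) :: real) \<in> borel_measurable M"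
    using X_event[OF \<open>0 \<le> t\<close>, of E] by (simp add: borel_measurable_indicator_iff)
qed (rule X_cadlag)

lemma occ_indicator: "(indicator {0..t} s :: real) * indicator E (X (max 0 s) \<omega>) = indicator {s\<in>{0..t}. X s \<omega> \<in> E} s"
  by (auto simp: indicator_def)

lemma joint_measurable': "(\<lambda>(\<omega>, s). indicator {s\<in>{0..t}. X s \<omega> \<in> E} s :: real) \<in> borel_measurable (M \<Otimes>\<^sub>M lborel)"
proof -
  have [measurable]: "(\<lambda>(\<omega>, t). indicator E (X (max 0 t) \<omega>) :: real) \<in> borel_measurable (M \<Otimes>\<^sub>M lborel)"
    using joint_measurable[of E] measurable_cong_sets[OF sets_pair_measure_cong[OF refl sets_lborel] refl] by blast
  have "(\<lambda>p. (indicator {0..t} (snd p) :: real) * (case p of (\<omega>, t) \<Rightarrow> indicator E (X (max 0 t) \<omega>))) \<in> borel_measurable (M \<Otimes>\<^sub>M lborel)"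
    by measurable
  moreover have "(\<lambda>p. (indicator {0..t} (snd p) :: real) * (case p of (\<omega>, t) \<Rightarrow> indicator E (X (max 0 t) \<omega>)))
     = (\<lambda>(\<omega>, s). indicator {s\<in>{0..t}. X s \<omega> \<in> E} s)"
    by (intro ext) (simp only: occ_indicator split_beta)
  ultimately show ?thesis by simp
qed

lemma occ_measurable: "(\<lambda>\<omega>. occ E (\<lambda>s. X s \<omega>) t) \<in> borel_measurable M"
proof -
  have "(\<lambda>\<omega>. \<integral>s. indicator {s\<in>{0..t}. X s \<omega> \<in> E} s \<partial>lborel :: real) \<in> borel_measurable M"
    using joint_measurable'[of t E] by (rule lborel.borel_measurable_lebesgue_integral)
  then show ?thesis by (simp add: occ_def)
qed

text \<open>Tonelli: the mean occupation time is the time integral of the fixed-time probabilities.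
  This is where joint measurability in time and \<omega> enters.\<close>

lemma expected_occ_le:
  assumes t: "0 \<le> t" and b: "\<And>s. 0 \<le> s \<Longrightarrow> s \<le> t \<Longrightarrow> prob {\<omega>\<in>space M. X s \<omega> \<in> E} \<le> b"
  shows "integrable M (\<lambda>\<omega>. occ E (\<lambda>s. X s \<omega>) t)" "(\<integral>\<omega>. occ E (\<lambda>s. X s \<omega>) t \<partial>M) \<le> t * b"
proof -
  interpret P: pair_sigma_finite M lborel by unfold_locales
  have b0: "0 \<le> b" using b[of 0] t measure_nonneg order_trans by (metis order_refl)
  have occ0: "0 \<le> occ E (\<lambda>s. X s \<omega>) t" for \<omega> by (simp add: occ_def)
  have occ_t: "occ E (\<lambda>s. X s \<omega>) t \<le> t" if "\<omega> \<in> space M" for \<omega>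
  proof -
    interpret discrete_path "\<lambda>s. X s \<omega>" E by (rule discrete_path[OF that])
    show ?thesis using T_le[of 0 t] t T_0 by simp
  qed
  show int: "integrable M (\<lambda>\<omega>. occ E (\<lambda>s. X s \<omega>) t)"
    by (rule integrable_const_bound[where B = t]) (use occ0 occ_t occ_measurable in auto)
  have meas: "(\<lambda>(\<omega>, s). indicator {s\<in>{0..t}. X s \<omega> \<in> E} s :: ennreal) \<in> borel_measurable (M \<Otimes>\<^sub>M lborel)"
  proof -
    have "(\<lambda>p. ennreal (case p of (\<omega>, s) \<Rightarrow> indicator {s\<in>{0..t}. X s \<omega> \<in> E} s)) \<in> borel_measurable (M \<Otimes>\<^sub>M lborel)"
      using joint_measurable'[of t E] by measurable
    moreover have "(\<lambda>p. ennreal (case p of (\<omega>, s) \<Rightarrow> indicator {s\<in>{0..t}. X s \<omega> \<in> E} s))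
      = (\<lambda>(\<omega>, s). indicator {s\<in>{0..t}. X s \<omega> \<in> E} s)"
      by (auto simp: fun_eq_iff indicator_def)
    ultimately show ?thesis by simp
  qed
  have "ennreal (\<integral>\<omega>. occ E (\<lambda>s. X s \<omega>) t \<partial>M) = (\<integral>\<^sup>+\<omega>. ennreal (occ E (\<lambda>s. X s \<omega>) t) \<partial>M)"
    using int occ0 by (intro nn_integral_eq_integral[symmetric]) auto
  also have "\<dots> = (\<integral>\<^sup>+\<omega>. (\<integral>\<^sup>+s. indicator {s\<in>{0..t}. X s \<omega> \<in> E} s \<partial>lborel) \<partial>M)"
  proof (rule nn_integral_cong)
    fix \<omega> assume "\<omega> \<in> space M"
    then interpret discrete_path "\<lambda>s. X s \<omega>" E by (rule discrete_path)
    have "{s\<in>{0..t}. X s \<omega> \<in> E} \<in> fmeasurable lborel" by (rule fmeasurable_E)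
    then have "emeasure lborel {s\<in>{0..t}. X s \<omega> \<in> E} = ennreal (occ E (\<lambda>s. X s \<omega>) t)" "{s\<in>{0..t}. X s \<omega> \<in> E} \<in> sets lborel"
      unfolding occ_def by (auto simp: fmeasurable_def emeasure_eq_ennreal_measure less_top[symmetric])
    then show "ennreal (occ E (\<lambda>s. X s \<omega>) t) = (\<integral>\<^sup>+s. indicator {s\<in>{0..t}. X s \<omega> \<in> E} s \<partial>lborel)"
      by (simp only: nn_integral_indicator)
  qed
  also have "\<dots> = (\<integral>\<^sup>+s. (\<integral>\<^sup>+\<omega>. indicator {s\<in>{0..t}. X s \<omega> \<in> E} s \<partial>M) \<partial>lborel)"
    using P.Fubini[OF meas] by simp
  also have "\<dots> \<le> (\<integral>\<^sup>+s. ennreal b * indicator {0..t} s \<partial>lborel)"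
  proof (rule nn_integral_mono)
    fix s :: real
    show "(\<integral>\<^sup>+\<omega>. indicator {s\<in>{0..t}. X s \<omega> \<in> E} s \<partial>M) \<le> ennreal b * indicator {0..t} s"
    proof (cases "s \<in> {0..t}")
      case True
      have "(\<integral>\<^sup>+\<omega>. indicator {s\<in>{0..t}. X s \<omega> \<in> E} s \<partial>M) = (\<integral>\<^sup>+\<omega>. indicator {\<omega>\<in>space M. X s \<omega> \<in> E} \<omega> \<partial>M)"
        using True by (intro nn_integral_cong) (auto simp: indicator_def)
      also have "\<dots> = ennreal (prob {\<omega>\<in>space M. X s \<omega> \<in> E})"
        using X_event[of s E] True by (simp add: emeasure_eq_measure)
      also have "\<dots> \<le> ennreal b" using b[of s] True by (intro ennreal_leI) auto
      finally show ?thesis using True by simp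
    next
      case False
      have "indicator {s\<in>{0..t}. X s \<omega> \<in> E} s = (0::ennreal)" for \<omega> using False by (auto simp: indicator_def)
      then show ?thesis by simp
    qed
  qed
  also have "\<dots> = ennreal (t * b)"
    using t b0 by (simp add: nn_integral_cmult ennreal_mult mult.commute)
  finally show "(\<integral>\<omega>. occ E (\<lambda>s. X s \<omega>) t \<partial>M) \<le> t * b" using t b0 by simp
qed

lemma X_random_time_event:
  assumes [measurable]: "\<rho> \<in> borel_measurable M" and \<rho>: "\<And>\<omega>. 0 \<le> \<rho> \<omega>"
  shows "{\<omega>\<in>space M. X (\<rho> \<omega>) \<omega> = z} \<in> events"
proof -
  have "(\<lambda>\<omega>. (\<omega>, \<rho> \<omega>)) \<in> measurable M (M \<Otimes>\<^sub>M borel)" by measurable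
  from measurable_compose[OF this joint_measurable[of "{z}"]]
  have [measurable]: "(\<lambda>\<omega>. indicator {z} (X (max 0 (\<rho> \<omega>)) \<omega>) :: real) \<in> borel_measurable M" by simp
  have "{\<omega>\<in>space M. indicator {z} (X (max 0 (\<rho> \<omega>)) \<omega>) = (1::real)} \<in> events" by measurable
  moreover have "{\<omega>\<in>space M. indicator {z} (X (max 0 (\<rho> \<omega>)) \<omega>) = (1::real)} = {\<omega>\<in>space M. X (\<rho> \<omega>) \<omega> = z}"
    using \<rho> by (auto simp: indicator_def max_absorb2)
  ultimately show ?thesis by simp
qed

end

locale particle_process = chain_realisation S P L I r m R M X x\<^sub>0
  for S :: "('v::countable \<Rightarrow> nat) set" and P L and I :: "('v \<Rightarrow> nat) \<Rightarrow> 'i set" and r m R and M :: "'w measure" and X x\<^sub>0 +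
  fixes N :: nat
  assumes N_pos: "0 < N"
begin

abbreviation T :: "'w \<Rightarrow> real \<Rightarrow> real" where "T \<omega> \<equiv> occ (condensates N) (\<lambda>s. X s \<omega>)"
abbreviation Y :: "real \<Rightarrow> 'w \<Rightarrow> 'v option" where "Y t \<omega> \<equiv> order_process N (\<lambda>s. X s \<omega>) t"

lemma particle_path: "\<omega> \<in> space M \<Longrightarrow> particle_path (\<lambda>t. X t \<omega>) N"
  using X_cadlag N_pos by unfold_locales

text \<open>Where the clock passes \<open>t\<close>, the order process reads off the site at the
  random time \<rho>, the last time at which the clock shows \<open>t\<close>; so it remains to see
  that \<rho> is measurable. Whether the clock passes \<open>t\<close> is tested at integer times
  only.\<close>

lemma Y_event:
  assumes t: "0 \<le> t" shows "{\<omega>\<in>space M. Y t \<omega> = w} \<in> events"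
proof -
  define Ex where "Ex \<omega> = (\<exists>n::nat. t < T \<omega> (real n))" for \<omega>
  define \<rho> where "\<rho> \<omega> = (if \<omega> \<in> space M \<and> Ex \<omega> then real_of_ereal (SUP v\<in>{v. 0 \<le> v \<and> T \<omega> v \<le> t}. ereal v) else 0)" for \<omega>
  note [measurable] = occ_measurable[of "condensates N"]
  have Ex_event: "{\<omega>\<in>space M. Ex \<omega>} \<in> events" unfolding Ex_def by measurable
  have att: "0 \<le> \<rho> \<omega>" "X (\<rho> \<omega>) \<omega> \<in> condensates N" "T \<omega> (\<rho> \<omega>) = t" "\<And>v. \<rho> \<omega> < v \<Longrightarrow> t < T \<omega> v"
    if \<omega>: "\<omega> \<in> space M" and ex: "Ex \<omega>" for \<omega>
  proof -
    interpret p: particle_path "\<lambda>t. X t \<omega>" N by (rule particle_path[OF \<omega>])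
    obtain n :: nat where "t < T \<omega> (real n)" using ex by (auto simp: Ex_def)
    then obtain u where u: "u \<ge> 0" "X u \<omega> \<in> condensates N" "T \<omega> u = t" "\<forall>v>u. t < T \<omega> v"
      "(SUP v\<in>{v. 0 \<le> v \<and> T \<omega> v \<le> t}. ereal v) = ereal u"
      using p.T_attained[OF t of_nat_0_le_iff] by blast
    have "\<rho> \<omega> = u" using u(5) \<omega> ex by (simp add: \<rho>_def)
    then show "0 \<le> \<rho> \<omega>" "X (\<rho> \<omega>) \<omega> \<in> condensates N" "T \<omega> (\<rho> \<omega>) = t" "\<And>v. \<rho> \<omega> < v \<Longrightarrow> t < T \<omega> v" using u by auto
  qed
  have \<rho>0: "0 \<le> \<rho> \<omega>" for \<omega> using att(1)[of \<omega>] by (cases "\<omega> \<in> space M \<and> Ex \<omega>") (auto simp: \<rho>_def)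
  have "\<rho> \<in> borel_measurable M"
    unfolding borel_measurable_iff_ge
  proof
    fix a :: real
    show "{\<omega>\<in>space M. a \<le> \<rho> \<omega>} \<in> events"
    proof (cases "a \<le> 0")
      case True
      then have "{\<omega>\<in>space M. a \<le> \<rho> \<omega>} = space M" using \<rho>0 order_trans by auto
      then show ?thesis by simp
    next
      case False
      \<comment> \<open>The generalised inverse is compared with \<open>a\<close> through the clock
        at the deterministic time \<open>a\<close>, which is measurable.\<close>
      have "a \<le> \<rho> \<omega> \<longleftrightarrow> Ex \<omega> \<and> T \<omega> a \<le> t" if \<omega>: "\<omega> \<in> space M" for \<omega>
      proof (cases "Ex \<omega>")
        case True
        interpret p: particle_path "\<lambda>t. X t \<omega>" N by (rule particle_path[OF \<omega>])
        have "T \<omega> a \<le> t" if "a \<le> \<rho> \<omega>" using p.T_mono[of a "\<rho> \<omega>"] that False att(3)[OF \<omega> True] by simp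
        moreover have "a \<le> \<rho> \<omega>" if "T \<omega> a \<le> t" using att(4)[OF \<omega> True, of a] that by force
        ultimately show ?thesis using True by blast
      qed (use False in \<open>simp add: \<rho>_def\<close>)
      then have "{\<omega>\<in>space M. a \<le> \<rho> \<omega>} = {\<omega>\<in>space M. Ex \<omega>} \<inter> {\<omega>\<in>space M. T \<omega> a \<le> t}" by auto
      also have "\<dots> \<in> events" by (rule sets.Int[OF Ex_event]) measurable
      finally show ?thesis .
    qed
  qed
  then have \<rho>_event: "{\<omega>\<in>space M. X (\<rho> \<omega>) \<omega> = z} \<in> events" for z using \<rho>0 by (rule X_random_time_event)
  have Y_eq: "Y t \<omega> = (if Ex \<omega> then Some (site N (X (\<rho> \<omega>) \<omega>)) else None)" if \<omega>: "\<omega> \<in> space M" for \<omega>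
  proof -
    interpret p: particle_path "\<lambda>t. X t \<omega>" N by (rule particle_path[OF \<omega>])
    show ?thesis
    proof (cases "Ex \<omega>")
      case True
      then show ?thesis using p.y_T[OF att(1,2)[OF \<omega> True]] att(3)[OF \<omega> True] by simp
    next
      case False
      have "T \<omega> s \<le> t" if "0 \<le> s" for s
      proof -
        obtain n :: nat where "s \<le> real n" using real_arch_simple by blast
        then have "T \<omega> s \<le> T \<omega> (real n)" using that by (intro p.T_mono)
        also have "\<dots> \<le> t" using False by (simp add: Ex_def not_less)
        finally show ?thesis .
      qed
      then show ?thesis using False p.y_None by simp
    qed
  qed
  show ?thesis
  proof (cases w)
    case None
    have "{\<omega>\<in>space M. Y t \<omega> = w} = space M - {\<omega>\<in>space M. Ex \<omega>}" using Y_eq None by auto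
    then show ?thesis using Ex_event by auto
  next
    case (Some x)
    have "{\<omega>\<in>space M. Y t \<omega> = w} = {\<omega>\<in>space M. Ex \<omega>} \<inter> {\<omega>\<in>space M. X (\<rho> \<omega>) \<omega> = condensate N x}"
    proof -
      have "Y t \<omega> = w \<longleftrightarrow> Ex \<omega> \<and> X (\<rho> \<omega>) \<omega> = condensate N x" if \<omega>: "\<omega> \<in> space M" for \<omega>
      proof (cases "Ex \<omega>")
        case True
        then obtain x' where "X (\<rho> \<omega>) \<omega> = condensate N x'" using att(2)[OF \<omega> True] by (auto simp: condensates_def)
        then show ?thesis using True Y_eq[OF \<omega>] Some N_pos by (simp add: site_condensate condensate_inj)
      qed (use Y_eq[OF \<omega>] Some in auto)
      then show ?thesis by blast
    qed
    also have "\<dots> \<in> events" by (rule sets.Int[OF Ex_event \<rho>_event])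
    finally show ?thesis .
  qed
qed

text \<open>A left limit can fail only at the total condensed time b. For finite b, the conditions
  on \<open>q\<close> say that it lies within 1 / (k + 1) below b; since the order process is
  constant to the right of each time, checking rationals is enough. The right-hand side involves
  only countable quantifiers.\<close>

lemma cadlag_Y_iff:
  assumes \<omega>: "\<omega> \<in> space M"
  shows "cadlag (\<lambda>t. discrete (Y t \<omega>)) \<longleftrightarrow> (\<forall>K::nat. \<exists>n::nat. real K < T \<omega> (real n)) \<or>
    (\<exists>k::nat. \<exists>z. \<forall>q::rat. 0 \<le> q \<longrightarrow> (\<exists>n::nat. real_of_rat q < T \<omega> (real n)) \<longrightarrow>
      (\<forall>n::nat. T \<omega> (real n) \<le> real_of_rat q + 1 / real (Suc k)) \<longrightarrow> Y (real_of_rat q) \<omega> = z)"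
    (is "?c \<longleftrightarrow> ?unb \<or> (\<exists>k z. ?P k z)")
proof -
  interpret p: particle_path "\<lambda>t. X t \<omega>" N by (rule particle_path[OF \<omega>])
  have reals: "(\<exists>n::nat. a < T \<omega> (real n)) \<longleftrightarrow> (\<exists>s\<ge>0. a < T \<omega> s)" for a
  proof
    assume "\<exists>s\<ge>0. a < T \<omega> s"
    then obtain s where s: "0 \<le> s" "a < T \<omega> s" by blast
    obtain n :: nat where "s \<le> real n" using real_arch_simple by blast
    then show "\<exists>n::nat. a < T \<omega> (real n)" using p.T_mono[OF s(1)] s(2) by (meson less_le_trans)
  qed (use of_nat_0_le_iff in blast)
  show ?thesis
  proof (cases ?unb)
    case True
    have ?c
    proof (rule p.y_cadlagI)
      fix t :: real assume "0 < t"
      obtain K :: nat where "t \<le> real K" using real_arch_simple by blast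
      moreover obtain s where "0 \<le> s" "real K < T \<omega> s" using True reals by blast
      ultimately show "(\<exists>s\<ge>0. t \<le> T \<omega> s) \<or> (\<exists>t'<t. \<forall>s\<ge>0. T \<omega> s \<le> t')
          \<or> (\<exists>\<delta>>0. \<exists>z. \<forall>u. t - \<delta> < u \<and> u < t \<longrightarrow> Y u \<omega> = z)"
        by (meson less_imp_le order_trans)
    qed
    then show ?thesis using True by simp
  next
    case False
    then obtain K :: nat where K: "\<And>n::nat. T \<omega> (real n) \<le> real K" by (auto simp: not_less)
    define b where "b = (SUP n::nat. T \<omega> (real n))"
    have bdd: "bdd_above (range (\<lambda>n::nat. T \<omega> (real n)))" using K by (intro bdd_aboveI[of _ "real K"]) auto
    have Tb: "T \<omega> s \<le> b" if "0 \<le> s" for s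
    proof -
      obtain n :: nat where "s \<le> real n" using real_arch_simple by blast
      then have "T \<omega> s \<le> T \<omega> (real n)" using that by (intro p.T_mono)
      also have "\<dots> \<le> b" unfolding b_def by (rule cSUP_upper[OF _ bdd]) simp
      finally show ?thesis .
    qed
    have below: "(\<exists>n::nat. a < T \<omega> (real n)) \<longleftrightarrow> a < b" for a
      unfolding b_def by (subst less_cSUP_iff[OF _ bdd]) auto
    have above: "(\<forall>n::nat. T \<omega> (real n) \<le> a) \<longleftrightarrow> b \<le> a" for a
      using below[of a] by (auto simp: not_less[symmetric])
    have b0: "0 \<le> b" using Tb[of 0] p.T_0 by simp
    show ?thesis
    proof
      assume c: ?c
      have "\<exists>k z. ?P k z"
      proof (cases "b = 0")
        case True
        \<comment> \<open>With b = 0 no nonnegative rational lies below b, so the condition holds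
          vacuously.\<close>
        have "?P 0 None" unfolding below above True by (simp flip: of_rat_less)
        then show ?thesis by blast
      next
        case False
        then obtain \<delta> z where \<delta>: "0 < \<delta>" "\<And>u. b - \<delta> < u \<Longrightarrow> u < b \<Longrightarrow> Y u \<omega> = z"
          using cadlag_discrete_left[OF c, of b] b0 by auto
        obtain k where k: "1 / real (Suc k) < \<delta>" using \<delta>(1) by (metis nat_approx_posE)
        have "?P k z"
        proof (intro allI impI)
          fix q :: rat
          assume "\<exists>n::nat. real_of_rat q < T \<omega> (real n)" "\<forall>n::nat. T \<omega> (real n) \<le> real_of_rat q + 1 / real (Suc k)"
          then have "real_of_rat q < b" "b \<le> real_of_rat q + 1 / real (Suc k)" unfolding below above .
          then show "Y (real_of_rat q) \<omega> = z" using k by (intro \<delta>(2)) auto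
        qed
        then show ?thesis by blast
      qed
      then show "?unb \<or> (\<exists>k z. ?P k z)" ..
    next
      assume "?unb \<or> (\<exists>k z. ?P k z)"
      then obtain k z where "?P k z" using False by blast
      then have P: "\<And>q::rat. 0 \<le> q \<Longrightarrow> real_of_rat q < b \<Longrightarrow> b \<le> real_of_rat q + 1 / real (Suc k) \<Longrightarrow> Y (real_of_rat q) \<omega> = z"
        unfolding below above by blast
      show ?c
      proof (rule p.y_cadlagI)
        fix t :: real assume t: "0 < t"
        consider "b < t" | "t < b" | "t = b" by linarith
        then show "(\<exists>s\<ge>0. t \<le> T \<omega> s) \<or> (\<exists>t'<t. \<forall>s\<ge>0. T \<omega> s \<le> t')
          \<or> (\<exists>\<delta>>0. \<exists>z. \<forall>u. t - \<delta> < u \<and> u < t \<longrightarrow> Y u \<omega> = z)"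
        proof cases
          case 1
          then show ?thesis using Tb by blast
        next
          case 2
          then show ?thesis using below[of t] reals[of t] by (meson less_imp_le)
        next
          case 3
          define \<delta> where "\<delta> = min t (1 / real (Suc k))"
          have "Y u \<omega> = z" if u: "t - \<delta> < u" "u < t" for u
          proof -
            have "0 \<le> u" using u by (auto simp: \<delta>_def)
            then obtain \<delta>' where \<delta>': "0 < \<delta>'" "\<forall>v. u \<le> v \<and> v < u + \<delta>' \<longrightarrow> Y v \<omega> = Y u \<omega>" using p.y_right_const by blast
            have "u < min t (u + \<delta>')" using u \<delta>' by simp
            then obtain q where q: "u < real_of_rat q" "real_of_rat q < min t (u + \<delta>')" using of_rat_dense by blast
            have "Y (real_of_rat q) \<omega> = z"
            proof (rule P)
              have "0 < real_of_rat q" using q \<open>0 \<le> u\<close> by linarith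
              then show "0 \<le> q" by simp
              show "real_of_rat q < b" "b \<le> real_of_rat q + 1 / real (Suc k)" using q u 3 by (auto simp: \<delta>_def)
            qed
            moreover have "Y (real_of_rat q) \<omega> = Y u \<omega>" using \<delta>'(2)[rule_format, of "real_of_rat q"] q by simp
            ultimately show ?thesis by simp
          qed
          then have "\<forall>u. t - \<delta> < u \<and> u < t \<longrightarrow> Y u \<omega> = z" by simp
          moreover have "0 < \<delta>" using t by (simp add: \<delta>_def)
          ultimately have "\<exists>\<delta>>0. \<exists>z. \<forall>u. t - \<delta> < u \<and> u < t \<longrightarrow> Y u \<omega> = z"
            by (intro exI[of _ \<delta>] conjI exI[of _ z])
          then show ?thesis by (intro disjI2)
        qed
      qed
    qed
  qed
qed

lemma cadlag_Y_event: "{\<omega>\<in>space M. cadlag (\<lambda>t. discrete (Y t \<omega>))} \<in> events"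
proof -
  note [measurable] = occ_measurable[of "condensates N"]
  define W where "W k z q = {\<omega>\<in>space M. (\<exists>n::nat. real_of_rat q < T \<omega> (real n)) \<longrightarrow>
    (\<forall>n::nat. T \<omega> (real n) \<le> real_of_rat q + 1 / real (Suc k)) \<longrightarrow> Y (real_of_rat q) \<omega> = z}" for k :: nat and z q
  have eq: "{\<omega>\<in>space M. cadlag (\<lambda>t. discrete (Y t \<omega>))}
    = {\<omega>\<in>space M. \<forall>K::nat. \<exists>n::nat. real K < T \<omega> (real n)} \<union> (\<Union>k. \<Union>z. \<Inter>q\<in>{q. 0 \<le> q}. W k z q)" (is "?A = ?B")
  proof (rule set_eqI)
    fix \<omega>
    show "\<omega> \<in> ?A \<longleftrightarrow> \<omega> \<in> ?B"
    proof (cases "\<omega> \<in> space M")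
      case True
      then show ?thesis unfolding W_def using cadlag_Y_iff[OF True] by simp
    next
      case False
      then have "\<omega> \<notin> W k z 0" for k z by (simp add: W_def)
      then have "\<omega> \<notin> (\<Inter>q\<in>{q. 0 \<le> q}. W k z q)" for k z by auto
      then show ?thesis using False by simp
    qed
  qed
  have W: "W k z q \<in> events" if "0 \<le> q" for k z q
  proof -
    have 2: "{\<omega>\<in>space M. \<exists>n::nat. real_of_rat q < T \<omega> (real n)} \<in> events"
      "{\<omega>\<in>space M. \<forall>n::nat. T \<omega> (real n) \<le> real_of_rat q + 1 / real (Suc k)} \<in> events" by measurable
    have "W k z q = (space M - {\<omega>\<in>space M. \<exists>n::nat. real_of_rat q < T \<omega> (real n)})
        \<union> (space M - {\<omega>\<in>space M. \<forall>n::nat. T \<omega> (real n) \<le> real_of_rat q + 1 / real (Suc k)})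
        \<union> {\<omega>\<in>space M. Y (real_of_rat q) \<omega> = z}"
      unfolding W_def by blast
    also have "\<dots> \<in> events" using that by (intro sets.Un sets.Diff sets.top 2 Y_event) simp
    finally show ?thesis .
  qed
  have 1: "{\<omega>\<in>space M. \<forall>K::nat. \<exists>n::nat. real K < T \<omega> (real n)} \<in> events" by measurable
  have 4: "(\<Inter>q\<in>{q. 0 \<le> q}. W k z q) \<in> events" for k z
  proof (rule sets.countable_INT')
    show "{q::rat. 0 \<le> q} \<noteq> {}" by auto
    show "(\<lambda>q. W k z q) ` {q. 0 \<le> q} \<subseteq> events" using W by auto
  qed simp
  show ?thesis unfolding eq by (intro sets.Un 1 sets.countable_UN''[OF countableI_type] 4)
qed

lemma Y_measurable: "(\<lambda>\<omega>. skorokhod_of (\<lambda>t. discrete (Y t \<omega>))) \<in> borel_measurable M"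
  by (rule skorokhod_of_measurable[OF Y_event cadlag_Y_event])

lemma AE_cadlag_Y: "AE \<omega> in M. cadlag (\<lambda>t. discrete (Y t \<omega>))"
  using AE_recurrent_occupation_unbounded[of "condensates N"] AE_space
proof eventually_elim
  case (elim \<omega>)
  interpret p: particle_path "\<lambda>t. X t \<omega>" N by (rule particle_path[OF elim(2)])
  show ?case using p.y_cadlag_or elim(1) by blast
qed

end

section \<open>Comparison of the order process with the step path of its grid values\<close>

context particle_path
begin

text \<open>
  If the path is condensed at all grid times and visits at most one new condensate between consecutive
  grid times, then the order process jumps once per cell where the grid values differ; the jump of the
  discretized path occurs at the end of that cell.
\<close>

lemma y_near_step_path:
  assumes h: "0 < h" and z: "\<And>k. k \<le> K \<Longrightarrow> f (real k * h) = condensate N (z k)"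
    and single: "\<And>k u v. k < K \<Longrightarrow> real k * h \<le> u \<Longrightarrow> u < v \<Longrightarrow> v \<le> real k * h + h \<Longrightarrow>
      f u \<in> condensates N \<Longrightarrow> f u \<noteq> f (real k * h) \<Longrightarrow> f v \<in> condensates N \<Longrightarrow> f v = f u"
    and out: "occ (- condensates N) f (real K * h) < \<delta>"
    and cad_y: "cadlag (\<lambda>t. discrete (y t))"
    and e: "h + \<delta> \<le> e" and T': "T' + h + \<delta> \<le> real K * h"
  shows "skorokhod_of (\<lambda>t. discrete (y t)) \<in> skorokhod_nbhd (step_path h K (\<lambda>k. Some (z k))) T' e"
proof -
  have E: "condensate N x \<in> condensates N" for x by (simp add: condensates_def)
  have ex: "\<exists>c. real k * h < c \<and> c \<le> real k * h + h \<and> f c = condensate N (z (Suc k))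
      \<and> (\<forall>u. real k * h \<le> u \<and> u < c \<and> f u \<in> condensates N \<longrightarrow> f u = condensate N (z k))
      \<and> (\<forall>u. c \<le> u \<and> u \<le> real k * h + h \<and> f u \<in> condensates N \<longrightarrow> f u = condensate N (z (Suc k)))" if k: "k < K" for k
  proof -
    define a where "a = real k * h"
    have a0: "0 \<le> a" using h by (simp add: a_def)
    have fa: "f a = condensate N (z k)" using z[of k] k by (simp add: a_def)
    have fb: "f (a + h) = condensate N (z (Suc k))" using z[of "Suc k"] k by (simp add: a_def algebra_simps)
    note sg = single[OF k, folded a_def, unfolded fa]
    show ?thesis
    proof (cases "z (Suc k) = z k")
      \<comment> \<open>With equal values at both ends, a visit to another condensate would be
        followed by a return at the end of the cell, a second change. The cut can be placed at the
        end of the cell.\<close>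
      case True
      have A1: "f u = condensate N (z k)" if "a \<le> u" "u < a + h" "f u \<in> condensates N" for u
      proof (rule ccontr)
        assume ne: "f u \<noteq> condensate N (z k)"
        have "f (a + h) = f u" by (rule sg[OF that(1,2) order_refl that(3) ne]) (simp add: fb E)
        then show False using fb True ne by simp
      qed
      have A2: "f u = condensate N (z (Suc k))" if "a + h \<le> u" "u \<le> a + h" for u
      proof -
        have "u = a + h" using that by simp
        then show ?thesis using fb by simp
      qed
      have "a < a + h" using h by simp
      then show ?thesis using A1 A2 fb unfolding a_def[symmetric] by (intro exI[of _ "a + h"]) blast
    next
      case False
      have ne: "condensate N (z (Suc k)) \<noteq> condensate N (z k)" using False N_pos by (simp add: condensate_inj)
      \<comment> \<open>The cut is the first visit to the new condensate; the infimum is attained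
        because the path is constant to the right of it. A different condensate before the cut, or
        after it, would be a second change.\<close>
      define V where "V = {u. a \<le> u \<and> u \<le> a + h \<and> f u = condensate N (z (Suc k))}"
      have V: "a + h \<in> V" "bdd_below V" using fb h by (auto simp: V_def bdd_below_def)
      define c where "c = Inf V"
      have c1: "c \<le> a + h" unfolding c_def by (rule cInf_lower[OF V])
      have c2: "a \<le> c" unfolding c_def using V(1) by (intro cInf_greatest) (auto simp: V_def)
      have fc: "f c = condensate N (z (Suc k))"
      proof (rule ccontr)
        assume "f c \<noteq> condensate N (z (Suc k))"
        then have "f c \<in> - {condensate N (z (Suc k))}" by simp
        then obtain d where d: "0 < d" "\<forall>s. c \<le> s \<and> s < c + d \<longrightarrow> f s \<in> - {condensate N (z (Suc k))}"
          using right_in[of c] a0 c2 by (meson order_trans)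
        obtain u where u: "u \<in> V" "u < c + d" using cInf_less_iff[of V "c + d"] V d(1) by (auto simp: c_def)
        have "c \<le> u" unfolding c_def by (rule cInf_lower[OF u(1) V(2)])
        then show False using d(2) u by (auto simp: V_def)
      qed
      have c3: "a < c" using c2 fc fa ne by (cases "a = c") auto
      have "f u = condensate N (z k)" if u: "a \<le> u" "u < c" "f u \<in> condensates N" for u
      proof (rule ccontr)
        assume n: "f u \<noteq> condensate N (z k)"
        have "f c = f u" by (rule sg[OF u(1,2) c1 u(3) n]) (simp add: fc E)
        then have "u \<in> V" using u c1 fc by (simp add: V_def)
        then have "c \<le> u" unfolding c_def by (rule cInf_lower[OF _ V(2)])
        then show False using u by simp
      qed
      moreover have "f u = condensate N (z (Suc k))" if u: "c \<le> u" "u \<le> a + h" "f u \<in> condensates N" for u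
      proof (cases "c = u")
        case False
        then have "c < u" using u by simp
        have "f u = f c" by (rule sg[OF c2 \<open>c < u\<close> u(2) _ _ u(3)]) (use fc E ne in auto)
        then show ?thesis using fc by simp
      qed (use fc in simp)
      ultimately show ?thesis using c1 c3 fc unfolding a_def[symmetric] by blast
    qed
  qed
  define cut where "cut k c \<longleftrightarrow> real k * h < c \<and> c \<le> real k * h + h \<and> f c = condensate N (z (Suc k))
      \<and> (\<forall>u. real k * h \<le> u \<and> u < c \<and> f u \<in> condensates N \<longrightarrow> f u = condensate N (z k))
      \<and> (\<forall>u. c \<le> u \<and> u \<le> real k * h + h \<and> f u \<in> condensates N \<longrightarrow> f u = condensate N (z (Suc k)))" for k c
  define c where "c k = (SOME c. cut k c)" for k
  have cut: "cut k (c k)" if "k < K" for k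
    unfolding c_def using ex[OF that] unfolding cut_def[symmetric] by (rule someI_ex)
  have c: "real k * h < c k" "c k \<le> real k * h + h" "f (c k) = condensate N (z (Suc k))"
    "\<And>u. real k * h \<le> u \<Longrightarrow> u < c k \<Longrightarrow> f u \<in> condensates N \<Longrightarrow> f u = condensate N (z k)"
    "\<And>u. c k \<le> u \<Longrightarrow> u \<le> real k * h + h \<Longrightarrow> f u \<in> condensates N \<Longrightarrow> f u = condensate N (z (Suc k))"
    if "k < K" for k
    using cut[OF that] unfolding cut_def by blast+
  define C where "C k = (case k of 0 \<Rightarrow> 0 | Suc k \<Rightarrow> c k)" for k
  have C0: "C 0 = 0" and CS: "C (Suc k) = c k" for k by (simp_all add: C_def)
  have fC: "f (C k) = condensate N (z k)" if "k \<le> K" for k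
    using that z[of 0] c(3) by (cases k) (auto simp: C0 CS)
  have C_le: "C k \<le> real k * h" if "k \<le> K" for k
    using that c(2) by (cases k) (auto simp: C0 CS algebra_simps)
  have C_gt: "real k * h - h < C k" if "k \<le> K" for k
    using that c(1) h by (cases k) (auto simp: C0 CS algebra_simps)
  have C_nonneg: "0 \<le> C k" if "k \<le> K" for k
  proof (cases k)
    case (Suc k')
    have "0 \<le> real k' * h" using h by simp
    then show ?thesis using c(1)[of k'] that Suc by (simp add: CS)
  qed (simp add: C0)
  have C_inc: "C k < C (Suc k)" if "k < K" for k
    using C_le[of k] c(1)[OF that] that by (simp add: CS)
  have TC_inc: "T (C k) < T (C (Suc k))" if "k < K" for k
    using that C_nonneg[of k] C_inc[OF that] fC[of k] E by (intro T_increases) auto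
  have out_mono: "u - T u \<le> real K * h - T (real K * h)" if "0 \<le> u" "u \<le> real K * h" for u
    using T_le[OF that] by linarith
  have outK: "real K * h - T (real K * h) < \<delta>" using out occ_compl[of "real K * h"] h by simp
  \<comment> \<open>\<open>C k\<close> precedes the grid time k h by less than \<open>h\<close>, and
    the clock lags behind real time by the time spent outside, which is less than \<delta>.\<close>
  have close: "\<bar>T (C k) - real k * h\<bar> < h + \<delta>" if "k \<le> K" for k
  proof -
    have "real k * h \<le> real K * h" using that h by (intro mult_right_mono) auto
    then have "C k - T (C k) < \<delta>" using out_mono[of "C k"] C_nonneg[OF that] C_le[OF that] outK by linarith
    moreover have "T (C k) \<le> C k" using T_le[of 0 "C k"] C_nonneg[OF that] T_0 by simp
    ultimately show ?thesis using C_le[OF that] C_gt[OF that] by linarith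
  qed
  \<comment> \<open>A clock value in this range is attained at a condensed time \<open>u\<close>.
    Monotonicity of the clock, strict at condensed times, places \<open>u\<close> between the two
    cuts, where only the condensate at \<open>z k\<close> is visited.\<close>
  have yv: "y s = Some (z k)" if k: "k < K" and s: "T (C k) \<le> s" "s < T (C (Suc k))" for k s
  proof -
    have s0: "0 \<le> s" using s(1) T_nonneg order_trans by blast
    obtain u where u: "0 \<le> u" "f u \<in> condensates N" "T u = s"
      using T_attained[OF s0 C_nonneg[of "Suc k"] s(2)] k by auto
    have u1: "C k \<le> u"
    proof (rule ccontr)
      assume "\<not> C k \<le> u"
      then have "T u < T (C k)" using u by (intro T_increases) auto
      then show False using u(3) s(1) by simp
    qed
    have u2: "u < C (Suc k)"
    proof (rule ccontr)
      assume "\<not> u < C (Suc k)"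
      then have "T (C (Suc k)) \<le> T u" using C_nonneg[of "Suc k"] k by (intro T_mono) auto
      then show False using u(3) s(2) by simp
    qed
    have "f u = condensate N (z k)"
    proof (cases "u \<le> real k * h")
      case True
      show ?thesis
      proof (cases k)
        case 0
        then have "u = 0" using True u(1) by simp
        then show ?thesis using z[of 0] 0 by simp
      next
        case (Suc k')
        then show ?thesis using c(5)[of k' u] k True u1 u(2) by (simp add: CS algebra_simps)
      qed
    next
      case False
      then show ?thesis using c(4)[OF k, of u] u2 u(2) by (simp add: CS)
    qed
    then show ?thesis using y_T[OF u(1,2)] u(3) N_pos by (simp add: site_condensate)
  qed
  have "0 < e"
    using e h out measure_nonneg[of lborel "{s\<in>{0..real K * h}. f s \<in> - condensates N}"] unfolding occ_def by linarith
  show ?thesis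
  proof (rule matching_skorokhod_nbhd[where b = "\<lambda>k. T (C k)" and t = "\<lambda>k. real k * h" and n = K and z = "\<lambda>k. discrete (Some (z k))"])
    show "T (C 0) = 0" "real 0 * h = 0" by (simp_all add: C0 T_0)
    show "T (C k) < T (C (Suc k))" if "k < K" for k by (rule TC_inc[OF that])
    show "real k * h < real (Suc k) * h" for k using h by simp
    show "\<bar>T (C k) - real k * h\<bar> < e" if "k \<le> K" for k using close[OF that] e by linarith
    show "path_at (skorokhod_of (\<lambda>t. discrete (y t))) s = discrete (Some (z k))"
      if "k < K" "T (C k) \<le> s" "s < T (C (Suc k))" for k s
      using path_at_skorokhod_of[OF cad_y, of s] yv[OF that] order_trans[OF T_nonneg that(2)] by simp
    show "path_at (step_path h K (\<lambda>k. Some (z k))) s = discrete (Some (z k))"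
      if "k < K" "real k * h \<le> s" "s < real (Suc k) * h" for k s
      by (rule step_path_at[OF h that(2,3,1)])
    show "T' < T (C K)" using close[of K] T' by linarith
  qed fact
qed

end

section \<open>Convergence of the order process\<close>

text \<open>\<open>markov_chain\<close> hides the semigroup behind an existential quantifier; here
  it is a parameter, so that transition probabilities can be compared across
  \<open>N\<close>.\<close>

definition realises :: "'w measure \<Rightarrow> 's set \<Rightarrow> (real \<Rightarrow> 's \<Rightarrow> 's pmf) \<Rightarrow> (real \<Rightarrow> 'w \<Rightarrow> 's) \<Rightarrow> 's \<Rightarrow> bool" where
  "realises M S P X x\<^sub>0 \<longleftrightarrow> prob_space M \<and>
     (\<forall>t\<ge>0. X t \<in> measurable M (count_space S)) \<and>
     (\<forall>\<omega>\<in>space M. cadlag (\<lambda>t. discrete (X t \<omega>))) \<and>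
     (AE \<omega> in M. X 0 \<omega> = x\<^sub>0) \<and>
     (\<forall>s\<ge>0. \<forall>t\<ge>0. \<forall>A\<in>past M S X s. \<forall>x\<in>S. \<forall>y\<in>S.
        measure M {\<omega>\<in>A. X s \<omega> = x \<and> X (s + t) \<omega> = y} = measure M {\<omega>\<in>A. X s \<omega> = x} * pmf (P t x) y)"

lemma markov_chain_realises:
  "markov_chain M S L X x\<^sub>0 \<Longrightarrow> \<exists>P. markov_semigroup S P \<and> has_generator S P L \<and> realises M S P X x\<^sub>0"
  unfolding markov_chain_def realises_def by (elim conjE exE) (intro exI conjI; assumption)

lemma chain_realisationI:
  assumes "bounded_chain S P L I r m R" "realises M S P X x\<^sub>0"
  shows "chain_realisation S P L I r m R M X x\<^sub>0"
proof -
  interpret bounded_chain S P L I r m R by (rule assms(1))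
  interpret prob_space M using assms(2) by (simp add: realises_def)
  note * = assms(2)[unfolded realises_def, THEN conjunct2]
  show ?thesis
  proof unfold_locales
    fix t :: real assume "0 \<le> t"
    then show "X t \<in> measurable M (count_space S)" using *[THEN conjunct1] by simp
  next
    fix \<omega> assume "\<omega> \<in> space M"
    then show "cadlag (\<lambda>t. discrete (X t \<omega>))" using *[THEN conjunct2, THEN conjunct1] by simp
  next
    show "AE \<omega> in M. X 0 \<omega> = x\<^sub>0" by (rule *[THEN conjunct2, THEN conjunct2, THEN conjunct1])
  next
    fix s t :: real and A x y assume "0 \<le> s" "0 \<le> t" "A \<in> past M S X s" "x \<in> S" "y \<in> S"
    then show "prob {\<omega>\<in>A. X s \<omega> = x \<and> X (s + t) \<omega> = y} = prob {\<omega>\<in>A. X s \<omega> = x} * pmf (P t x) y"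
      using *[THEN conjunct2, THEN conjunct2, THEN conjunct2] by simp
  qed
qed

lemma nth_differ:
  assumes "length xs = n" "length ys = n" "xs \<noteq> ys"
  obtains k where "k < n" "xs ! k \<noteq> ys ! k"
  using assms by (auto simp: list_eq_iff_nth_eq)

context site_weights
begin

lemma non_condensation_const_mono:
  assumes "0 \<le> s" "s \<le> t" shows "non_condensation_const s \<le> non_condensation_const t"
proof -
  have "exp ((4 * Q + 1) * s) * A * (1 + s * (4 * Q + 1 + Q)) \<le> exp ((4 * Q + 1) * t) * A * (1 + t * (4 * Q + 1 + Q))"
    using assms Q_nonneg A_nonneg
    by (intro mult_mono add_left_mono mult_right_mono mult_left_mono mult_nonneg_nonneg add_nonneg_nonneg) auto
  then show ?thesis by (simp only: non_condensation_const_def)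
qed

lemma inclusion_particle_process:
  assumes "markov_semigroup (configurations N) P" "has_generator (configurations N) P (inclusion_generator c \<alpha> \<epsilon>)"
    and "0 < \<epsilon>" "0 < N" "realises M (configurations N) P X (condensate N x)"
  shows "particle_process (configurations N) P (inclusion_generator c \<alpha> \<epsilon>) inclusion_pairs (inclusion_rate \<epsilon>)
    (\<lambda>\<eta> (x, y). move \<eta> x y) (real N * (real d * (cm * (am + real N / \<epsilon>)))) M X (condensate N x) N"
proof -
  interpret chain_realisation "configurations N" P "inclusion_generator c \<alpha> \<epsilon>" inclusion_pairs "inclusion_rate \<epsilon>"
    "\<lambda>\<eta> (x, y). move \<eta> x y" "real N * (real d * (cm * (am + real N / \<epsilon>)))" M X "condensate N x"
    by (rule chain_realisationI[OF inclusion_chain[OF assms(1-3)] assms(5)])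
  show ?thesis using assms(4) by unfold_locales
qed

text \<open>The fixed-time bound increases with time, so its value at \<open>t\<close> controls the
  whole interval and is integrated over it.\<close>

lemma expected_time_outside_le:
  assumes P: "markov_semigroup (configurations N) P" "has_generator (configurations N) P (inclusion_generator c \<alpha> \<epsilon>)"
    and \<epsilon>: "0 < \<epsilon>" and N: "2 \<le> N" and real: "realises M (configurations N) P X (condensate N x)" and t: "0 \<le> t"
  shows "integrable M (\<lambda>\<omega>. occ (- condensates N) (\<lambda>s. X s \<omega>) t)"
    "(\<integral>\<omega>. occ (- condensates N) (\<lambda>s. X s \<omega>) t \<partial>M) \<le> t * (2 * (\<epsilon> * real N) * non_condensation_const t)"
proof -
  interpret particle_process "configurations N" P "inclusion_generator c \<alpha> \<epsilon>" inclusion_pairs "inclusion_rate \<epsilon>"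
    "\<lambda>\<eta> (x, y). move \<eta> x y" "real N * (real d * (cm * (am + real N / \<epsilon>)))" M X "condensate N x" N
    by (rule inclusion_particle_process[OF P \<epsilon> _ real]) (use N in simp)
  have "prob {\<omega>\<in>space M. X s \<omega> \<in> - condensates N} \<le> 2 * (\<epsilon> * real N) * non_condensation_const t"
    if s: "0 \<le> s" "s \<le> t" for s
  proof -
    have "prob {\<omega>\<in>space M. X s \<omega> \<in> - condensates N} \<le> 2 * (\<epsilon> * real N) * non_condensation_const s"
      unfolding prob_X_in[OF s(1)] by (rule prob_non_condensed_le[OF P \<epsilon> s(1) N])
    also have "\<dots> \<le> 2 * (\<epsilon> * real N) * non_condensation_const t"
      using \<epsilon> non_condensation_const_mono[OF s] by (intro mult_left_mono) auto
    finally show ?thesis .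
  qed
  from expected_occ_le[OF t this] show "integrable M (\<lambda>\<omega>. occ (- condensates N) (\<lambda>s. X s \<omega>) t)"
    "(\<integral>\<omega>. occ (- condensates N) (\<lambda>s. X s \<omega>) t \<partial>M) \<le> t * (2 * (\<epsilon> * real N) * non_condensation_const t)" by auto
qed

text \<open>If the grid values form a string of \<open>F\<close>, the order process lies in
  \<open>U\<close> except on three events: a cell with two changes, a time of at least 1 / (2 (j +
  1)) spent outside the condensates up to \<tau>, and a null set of non-cadlag paths. The subtracted
  terms bound the first two.\<close>

lemma order_process_estimate:
  assumes P: "markov_semigroup (configurations N) P" "has_generator (configurations N) P (inclusion_generator c \<alpha> \<epsilon>)"
    and \<epsilon>: "0 < \<epsilon>" and N: "2 \<le> N" and real: "realises M (configurations N) P X (condensate N x)"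
    and U: "open U" and h: "0 < h" "h \<le> 1 / (2 * real (Suc j))" and K: "real K * h = \<tau>" "real j + 3 \<le> \<tau>"
    and F: "finite F" "\<And>zs. zs \<in> F \<Longrightarrow> length zs = Suc K \<and> step_path h K (\<lambda>k. Some (zs ! k)) \<in> inner_part U j"
  shows "(\<Sum>zs\<in>F. of_bool (zs ! 0 = x) * (\<Prod>k<K. pmf (P h (condensate N (zs ! k))) (condensate N (zs ! Suc k))))
      - real K * (Q * h)\<^sup>2 - 2 * real (Suc j) * (\<tau> * (2 * (\<epsilon> * real N) * non_condensation_const \<tau>))
    \<le> measure (path_law M (\<lambda>t \<omega>. order_process N (\<lambda>s. X s \<omega>) t)) U"
proof -
  interpret particle_process "configurations N" P "inclusion_generator c \<alpha> \<epsilon>" inclusion_pairs "inclusion_rate \<epsilon>"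
    "\<lambda>\<eta> (x, y). move \<eta> x y" "real N * (real d * (cm * (am + real N / \<epsilon>)))" M X "condensate N x" N
    by (rule inclusion_particle_process[OF P \<epsilon> _ real]) (use N in simp)
  have N0: "0 < N" using N by simp
  have cond: "condensate N y \<in> configurations N" "condensate N y \<in> condensates N" for y
    by (auto simp: condensate_in_configurations condensates_def)
  have E: "condensates N \<subseteq> configurations N" using cond by (auto simp: condensates_def)
  \<comment> \<open>Half of the radius 1 / (j + 1) from \<open>inner_part\<close> is left for the
    time outside, the other half for \<open>h\<close>. Markov's inequality with this \<delta>
    produces the factor 2 (j + 1).\<close>
  define \<delta> where "\<delta> = 1 / (2 * real (Suc j))"
  have \<delta>: "0 < \<delta>" "h + \<delta> \<le> 1 / real (Suc j)" "\<delta> \<le> 1" "h \<le> 1"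
  proof -
    have "\<delta> + \<delta> = 1 / real (Suc j)" and \<delta>: "0 < \<delta>" "\<delta> \<le> 1" by (simp_all add: \<delta>_def field_simps)
    moreover have "h \<le> \<delta>" using h(2) by (simp only: \<delta>_def)
    ultimately show "h + \<delta> \<le> 1 / real (Suc j)" "h \<le> 1" by linarith+
    show "0 < \<delta>" "\<delta> \<le> 1" by fact+
  qed
  define p where "p \<omega> = skorokhod_of (\<lambda>t. discrete (Y t \<omega>))" for \<omega>
  have p: "p \<in> borel_measurable M" unfolding p_def by (rule Y_measurable)
  define G where "G zs = {\<omega>\<in>space M. \<forall>k\<le>K. X (real k * h) \<omega> = condensate N (zs ! k)}" for zs
  have G: "G zs \<in> events" "prob (G zs) = of_bool (zs ! 0 = x) * (\<Prod>k<K. pmf (P h (condensate N (zs ! k))) (condensate N (zs ! Suc k)))" for zs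
  proof -
    have *: "prob (G zs) = of_bool (condensate N (zs ! 0) = condensate N x) * (\<Prod>k<K. pmf (P h (condensate N (zs ! k))) (condensate N (zs ! Suc k)))
      \<and> G zs \<in> past M (configurations N) X (real K * h)"
      unfolding G_def by (rule prob_grid) (use h cond in auto)
    then show "prob (G zs) = of_bool (zs ! 0 = x) * (\<Prod>k<K. pmf (P h (condensate N (zs ! k))) (condensate N (zs ! Suc k)))"
      by (simp add: condensate_inj[OF N0])
    have "0 \<le> real K * h" using h by simp
    then show "G zs \<in> events" using * past_subset by blast
  qed
  have disj: "disjoint_family_on G F"
    unfolding disjoint_family_on_def
  proof (intro ballI impI)
    fix zs zs' assume zs: "zs \<in> F" "zs' \<in> F" "zs \<noteq> zs'"
    then obtain k where "k < Suc K" "zs ! k \<noteq> zs' ! k" by (elim nth_differ[rotated 2]) (use F(2) in auto)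
    then show "G zs \<inter> G zs' = {}" using condensate_inj[OF N0, of "zs ! k" "zs' ! k"] by (auto simp: G_def less_Suc_eq_le)
  qed
  have two: "\<exists>D. D \<in> events \<and> prob D \<le> (Q * h)\<^sup>2 \<and> (\<forall>\<omega> u v. \<omega> \<in> space M \<longrightarrow> real k * h \<le> u \<longrightarrow> u < v \<longrightarrow> v \<le> real k * h + h
      \<longrightarrow> X (real k * h) \<omega> \<in> condensates N \<longrightarrow> X u \<omega> \<in> condensates N \<longrightarrow> X u \<omega> \<noteq> X (real k * h) \<omega>
      \<longrightarrow> X v \<omega> \<in> condensates N \<longrightarrow> X v \<omega> \<noteq> X u \<omega> \<longrightarrow> \<omega> \<in> D)" for k
  \<comment> \<open>The fraction of particles away from the site of \<open>y\<close> vanishes at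
    \<open>y\<close>, equals 1 at every other condensate, and drifts at rate at most
    \<open>Q\<close> by \<open>escape_drift\<close>.\<close>
  proof (rule two_changes[where E = "condensates N" and s = "real k * h" and h = h and q = Q and B = 1
        and f = "\<lambda>y w. 1 - real (w (site N y)) / real N"])
    show "0 \<le> real k * h" using h by simp
    fix y w :: "'v \<Rightarrow> nat" assume y: "y \<in> condensates N"
    then obtain a where a: "y = condensate N a" "site N y = a" unfolding condensates_def by (auto simp: site_condensate[OF N0])
    show "1 - real (y (site N y)) / real N = 0" unfolding a(2) using N0 by (simp add: a(1) condensate_def)
    show "1 \<le> 1 - real (w (site N y)) / real N" if "w \<in> condensates N" "w \<noteq> y"
      unfolding a(2) using that by (auto simp: a(1) condensates_def condensate_def)
    show "0 \<le> 1 - real (w (site N y)) / real N" "1 - real (w (site N y)) / real N \<le> 1" if "w \<in> configurations N"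
      using configuration_le[OF that, of "site N y"] N0 by auto
    show "sg t (\<lambda>w. 1 - real (w (site N y)) / real N) w \<le> 1 - real (w (site N y)) / real N + Q * t"
      if "0 \<le> t" "w \<in> configurations N" for t
      unfolding sg_def by (rule escape_drift[OF P \<epsilon> that(1) N0 that(2)])
  next
    fix D assume "D \<in> events" "prob D \<le> (Q * h)\<^sup>2"
      "\<And>\<omega> u v. \<omega> \<in> space M \<Longrightarrow> real k * h \<le> u \<Longrightarrow> u < v \<Longrightarrow> v \<le> real k * h + h \<Longrightarrow> X (real k * h) \<omega> \<in> condensates N
        \<Longrightarrow> X u \<omega> \<in> condensates N \<Longrightarrow> X u \<omega> \<noteq> X (real k * h) \<omega> \<Longrightarrow> X v \<omega> \<in> condensates N \<Longrightarrow> X v \<omega> \<noteq> X u \<omega> \<Longrightarrow> \<omega> \<in> D"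
    then show ?thesis by (intro exI[of _ D]) simp
  qed (use E h Q_nonneg in auto)
  define bad where "bad k D \<longleftrightarrow> D \<in> events \<and> prob D \<le> (Q * h)\<^sup>2 \<and> (\<forall>\<omega> u v. \<omega> \<in> space M \<longrightarrow> real k * h \<le> u \<longrightarrow> u < v \<longrightarrow> v \<le> real k * h + h
      \<longrightarrow> X (real k * h) \<omega> \<in> condensates N \<longrightarrow> X u \<omega> \<in> condensates N \<longrightarrow> X u \<omega> \<noteq> X (real k * h) \<omega>
      \<longrightarrow> X v \<omega> \<in> condensates N \<longrightarrow> X v \<omega> \<noteq> X u \<omega> \<longrightarrow> \<omega> \<in> D)" for k D
  define D where "D k = (SOME D. bad k D)" for k
  have D: "bad k (D k)" for k unfolding D_def using two[of k] unfolding bad_def[symmetric] by (rule someI_ex)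
  have D_event: "D k \<in> events" and D_prob: "prob (D k) \<le> (Q * h)\<^sup>2" for k using D[of k] by (simp_all add: bad_def)
  define Out where "Out = {\<omega>\<in>space M. \<delta> \<le> occ (- condensates N) (\<lambda>s. X s \<omega>) \<tau>}"
  have \<tau>: "0 \<le> \<tau>" using K by simp
  have Out_event: "Out \<in> events" unfolding Out_def using occ_measurable[of "- condensates N" \<tau>] by measurable
  have Out_prob: "prob Out \<le> 2 * real (Suc j) * (\<tau> * (2 * (\<epsilon> * real N) * non_condensation_const \<tau>))"
  proof -
    have "prob Out \<le> (\<integral>\<omega>. occ (- condensates N) (\<lambda>s. X s \<omega>) \<tau> \<partial>M) / \<delta>"
      unfolding Out_def by (rule integral_Markov_inequality_measure[where A = "space M"])
        (use expected_time_outside_le(1)[OF P \<epsilon> N real \<tau>] \<delta>(1) in \<open>auto simp: occ_def\<close>)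
    also have "\<dots> \<le> (\<tau> * (2 * (\<epsilon> * real N) * non_condensation_const \<tau>)) / \<delta>"
      by (rule divide_right_mono[OF expected_time_outside_le(2)[OF P \<epsilon> N real \<tau>]]) (use \<delta>(1) in simp)
    finally show ?thesis by (simp add: \<delta>_def mult_ac)
  qed
  have good: "p \<omega> \<in> U" if \<omega>: "\<omega> \<in> space M" and cad: "cadlag (\<lambda>t. discrete (Y t \<omega>))" and zs: "zs \<in> F" "\<omega> \<in> G zs"
    and nD: "\<And>k. k < K \<Longrightarrow> \<omega> \<notin> D k" and nO: "\<omega> \<notin> Out" for \<omega> zs
  proof -
    interpret pp: particle_path "\<lambda>t. X t \<omega>" N by (rule particle_path[OF \<omega>])
    have grid: "X (real k * h) \<omega> = condensate N (zs ! k)" if "k \<le> K" for k using zs(2) that by (simp add: G_def)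
    have "p \<omega> \<in> skorokhod_nbhd (step_path h K (\<lambda>k. Some (zs ! k))) (real (Suc j)) (1 / real (Suc j))"
      unfolding p_def
    proof (rule pp.y_near_step_path[OF h(1)])
      show "X (real k * h) \<omega> = condensate N (zs ! k)" if "k \<le> K" for k by (rule grid[OF that])
      show "X v \<omega> = X u \<omega>"
        if "k < K" "real k * h \<le> u" "u < v" "v \<le> real k * h + h" "X u \<omega> \<in> condensates N" "X u \<omega> \<noteq> X (real k * h) \<omega>" "X v \<omega> \<in> condensates N" for k u v
      proof (rule ccontr)
        assume "X v \<omega> \<noteq> X u \<omega>"
        moreover have "X (real k * h) \<omega> \<in> condensates N" using grid[of k] that(1) cond by simp
        moreover have "\<forall>\<omega> u v. \<omega> \<in> space M \<longrightarrow> real k * h \<le> u \<longrightarrow> u < v \<longrightarrow> v \<le> real k * h + h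
          \<longrightarrow> X (real k * h) \<omega> \<in> condensates N \<longrightarrow> X u \<omega> \<in> condensates N \<longrightarrow> X u \<omega> \<noteq> X (real k * h) \<omega>
          \<longrightarrow> X v \<omega> \<in> condensates N \<longrightarrow> X v \<omega> \<noteq> X u \<omega> \<longrightarrow> \<omega> \<in> D k"
          using D[of k] unfolding bad_def by (elim conjE)
        ultimately have "\<omega> \<in> D k" using \<omega> that by simp
        then show False using nD that(1) by blast
      qed
      show "occ (- condensates N) (\<lambda>t. X t \<omega>) (real K * h) < \<delta>" using nO \<omega> by (simp add: Out_def K(1))
      \<comment> \<open>The horizon j + 3 exceeds the j + 1 of \<open>inner_part\<close> by 2, which
        covers \<open>h\<close> and \<delta>, each at most 1.\<close>
      show "real (Suc j) + h + \<delta> \<le> real K * h" unfolding K(1) using K(2) \<delta> by simp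
    qed (use cad \<delta> in auto)
    then show ?thesis using F(2)[OF zs(1)] by (auto simp: inner_part_def)
  qed
  let ?R = "(p -` U \<inter> space M) \<union> ((\<Union>k\<in>{..<K}. D k) \<union> Out)"
  have pU: "p -` U \<inter> space M \<in> events" using p U by (intro measurable_sets[OF p]) simp
  have DU: "(\<Union>k\<in>{..<K}. D k) \<in> events" using D_event by (intro sets.finite_UN) auto
  have R: "?R \<in> events" using pU DU Out_event by (intro sets.Un)
  have "(\<Sum>zs\<in>F. prob (G zs)) = prob (\<Union>zs\<in>F. G zs)"
    by (rule finite_measure_finite_Union[symmetric, OF F(1) _ disj]) (use G(1) in blast)
  also have "\<dots> \<le> prob ?R"
  proof (rule finite_measure_mono_AE[OF _ R])
    show "AE \<omega> in M. \<omega> \<in> (\<Union>zs\<in>F. G zs) \<longrightarrow> \<omega> \<in> ?R"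
      using AE_cadlag_Y AE_space
    proof eventually_elim
      case (elim \<omega>)
      show ?case
      proof
        assume "\<omega> \<in> (\<Union>zs\<in>F. G zs)"
        then obtain zs where zs: "zs \<in> F" "\<omega> \<in> G zs" by blast
        show "\<omega> \<in> ?R"
        proof (rule ccontr)
          assume n: "\<omega> \<notin> ?R"
          have "p \<omega> \<in> U" by (rule good[OF elim(2,1) zs]) (use n in auto)
          then show False using n elim(2) by auto
        qed
      qed
    qed
  qed
  also have "\<dots> \<le> prob (p -` U \<inter> space M) + prob ((\<Union>k\<in>{..<K}. D k) \<union> Out)"
    using pU DU Out_event by (intro measure_Un_le sets.Un)
  also have "prob ((\<Union>k\<in>{..<K}. D k) \<union> Out) \<le> prob (\<Union>k\<in>{..<K}. D k) + prob Out"
    using DU Out_event by (intro measure_Un_le)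
  also have "prob (\<Union>k\<in>{..<K}. D k) \<le> (\<Sum>k\<in>{..<K}. prob (D k))"
    using D_event by (intro finite_measure_subadditive_finite) auto
  also have "(\<Sum>k\<in>{..<K}. prob (D k)) \<le> real K * (Q * h)\<^sup>2"
    using sum_bounded_above[of "{..<K}" "\<lambda>k. prob (D k)" "(Q * h)\<^sup>2"] D_prob by simp
  finally have "(\<Sum>zs\<in>F. prob (G zs)) \<le> prob (p -` U \<inter> space M) + (real K * (Q * h)\<^sup>2 + prob Out)" by simp
  moreover have "measure (path_law M (\<lambda>t \<omega>. order_process N (\<lambda>s. X s \<omega>) t)) U = prob (p -` U \<inter> space M)"
    unfolding path_law_def p_def[symmetric] using p U by (intro measure_distr) auto
  ultimately show ?thesis using Out_prob unfolding G(2) by linarith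
qed

text \<open>The parameters are fixed in order, from the limit chain alone: first \<open>j\<close>,
  by continuity from below along the events that all late grid paths lie in
  \<open>inner_part U j\<close>; then the mesh, fine enough for \<open>h\<close> and for the
  two-change error; finally a finite set of strings that carries enough of the probability.\<close>

lemma limit_path_approx:
  assumes P': "markov_semigroup UNIV P'" "has_generator UNIV P' (limit_generator c \<alpha>)"
    and real': "realises M' UNIV P' Y (Some x)" and U: "open U" and \<delta>: "0 < \<delta>"
  shows "\<exists>j h K F. 0 < h \<and> h \<le> 1 / (2 * real (Suc j)) \<and> real j + 3 \<le> real K * h \<and> real K * (Q * h)\<^sup>2 \<le> \<delta> \<and> finite F
    \<and> (\<forall>zs\<in>F. length zs = Suc K \<and> step_path h K (\<lambda>k. Some (zs ! k)) \<in> inner_part U j)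
    \<and> measure (path_law M' Y) U - \<delta> \<le> (\<Sum>zs\<in>F. of_bool (zs ! 0 = x) * (\<Prod>k<K. pmf (P' h (Some (zs ! k))) (Some (zs ! Suc k))))"
proof -
  interpret chain_realisation UNIV P' "limit_generator c \<alpha>" "\<lambda>z. case z of None \<Rightarrow> {} | Some x \<Rightarrow> nb x"
    "\<lambda>z y. case z of None \<Rightarrow> 0 | Some x \<Rightarrow> c x y * \<alpha> y" "\<lambda>z y. Some y" Q M' Y "Some x"
    by (rule chain_realisationI[OF limit_chain[OF P'] real'])
  have Y_event: "{\<omega>\<in>space M'. Y t \<omega> = z} \<in> events" if "0 \<le> t" for t z
    using X_event[OF that, of "{z}"] by simp
  define p where "p \<omega> = skorokhod_of (\<lambda>t. discrete (Y t \<omega>))" for \<omega>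
  have "{\<omega>\<in>space M'. cadlag (\<lambda>t. discrete (Y t \<omega>))} = space M'" using X_cadlag by auto
  then have p: "p \<in> borel_measurable M'"
    unfolding p_def using skorokhod_of_measurable[of M' Y, OF Y_event] by simp
  have law: "measure (path_law M' Y) U = prob (p -` U \<inter> space M')"
    unfolding path_law_def p_def[symmetric] using p U by (intro measure_distr) auto
  have inner_mono: "inner_part U j \<subseteq> inner_part U k" if "j \<le> k" for j k
  proof -
    have "skorokhod_nbhd g (real (Suc k)) (1 / real (Suc k)) \<subseteq> skorokhod_nbhd g (real (Suc j)) (1 / real (Suc j))"
      for g :: "'v option discrete skorokhod"
      using that by (intro skorokhod_nbhd_mono) (auto simp: frac_le)
    then show ?thesis unfolding inner_part_def by (meson Collect_mono order_trans)
  qed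
  define A where "A j = {\<omega>\<in>space M'. \<forall>n\<in>{j..}. approx_path n (\<lambda>t. Y t \<omega>) \<in> inner_part U j}" for j
  have A_event: "A j \<in> events" for j
  proof -
    have "A j = (\<Inter>n\<in>{j..}. {\<omega>\<in>space M'. approx_path n (\<lambda>t. Y t \<omega>) \<in> inner_part U j})" by (auto simp: A_def)
    also have "\<dots> \<in> events"
    proof (rule sets.countable_INT')
      show "(\<lambda>n. {\<omega>\<in>space M'. approx_path n (\<lambda>t. Y t \<omega>) \<in> inner_part U j}) ` {j..} \<subseteq> events"
        using approx_path_event[of M' Y, OF Y_event] by auto
    qed auto
    finally show ?thesis .
  qed
  have A_inc: "incseq A"
  proof (rule incseq_SucI, rule subsetI)
    fix j \<omega> assume "\<omega> \<in> A j"
    then show "\<omega> \<in> A (Suc j)" using inner_mono[of j "Suc j"] by (auto simp: A_def)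
  qed
  have A_UN: "(\<Union>j. A j) = p -` U \<inter> space M'"
  proof (rule set_eqI)
    fix \<omega>
    show "\<omega> \<in> (\<Union>j. A j) \<longleftrightarrow> \<omega> \<in> p -` U \<inter> space M'"
    proof
      assume "\<omega> \<in> (\<Union>j. A j)"
      then obtain j where j: "\<omega> \<in> space M'" "\<forall>n\<in>{j..}. approx_path n (\<lambda>t. Y t \<omega>) \<in> inner_part U j" by (auto simp: A_def)
      have "\<forall>\<^sub>F n in sequentially. approx_path n (\<lambda>t. Y t \<omega>) \<in> inner_part U j"
        using j(2) by (intro eventually_sequentiallyI[of j]) auto
      then have "p \<omega> \<in> U" unfolding p_def by (rule approx_path_in_inner[OF X_cadlag[OF j(1)]])
      then show "\<omega> \<in> p -` U \<inter> space M'" using j(1) by simp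
    next
      assume \<omega>: "\<omega> \<in> p -` U \<inter> space M'"
      then have "\<exists>m. \<forall>\<^sub>F n in sequentially. approx_path n (\<lambda>t. Y t \<omega>) \<in> inner_part U m"
        using open_approx_path[OF X_cadlag U] by (simp add: p_def)
      then obtain m k where mk: "\<And>n. k \<le> n \<Longrightarrow> approx_path n (\<lambda>t. Y t \<omega>) \<in> inner_part U m"
        by (auto simp: eventually_sequentially)
      have "\<omega> \<in> A (max m k)" unfolding A_def using \<omega> mk inner_mono[of m "max m k"] by auto
      then show "\<omega> \<in> (\<Union>j. A j)" by blast
    qed
  qed
  have "(\<lambda>j. prob (A j)) \<longlonglongrightarrow> prob (\<Union>j. A j)"
    using A_event A_inc by (intro finite_Lim_measure_incseq) auto
  then have "\<forall>\<^sub>F j in sequentially. prob (p -` U \<inter> space M') - \<delta> / 2 < prob (A j)"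
    unfolding A_UN using \<delta> by (intro order_tendstoD) auto
  then obtain j where j: "prob (p -` U \<inter> space M') - \<delta> / 2 < prob (A j)"
    by (meson eventually_happens sequentially_bot)
  \<comment> \<open>With mesh 2^(-n) and horizon n, K h = n, so the two-change error K (Q h)^2
    equals Q^2 n 2^(-n).\<close>
  have "(\<lambda>n. Q\<^sup>2 * (real n * (1 / 2) ^ n)) \<longlonglongrightarrow> Q\<^sup>2 * 0"
    by (intro tendsto_mult tendsto_const powser_times_n_limit_0) simp
  then have e1: "\<forall>\<^sub>F n in sequentially. Q\<^sup>2 * (real n * (1 / 2) ^ n) < \<delta>"
    using \<delta> by (intro order_tendstoD) auto
  have "(\<lambda>n. (1 / 2) ^ n :: real) \<longlonglongrightarrow> 0" by (intro LIMSEQ_power_zero) simp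
  then have e2: "\<forall>\<^sub>F n in sequentially. (1 / 2) ^ n < 1 / (2 * real (Suc j))" by (rule order_tendstoD) simp
  have "\<forall>\<^sub>F n in sequentially. Q\<^sup>2 * (real n * (1 / 2) ^ n) < \<delta> \<and> (1 / 2) ^ n < 1 / (2 * real (Suc j)) \<and> j + 3 \<le> n"
    by (rule eventually_conj[OF e1 eventually_conj[OF e2 eventually_ge_at_top]])
  then have "\<exists>n. Q\<^sup>2 * (real n * (1 / 2) ^ n) < \<delta> \<and> (1 / 2) ^ n < 1 / (2 * real (Suc j)) \<and> j + 3 \<le> n"
    by (rule eventually_happens'[OF sequentially_bot])
  then obtain n where n: "Q\<^sup>2 * (real n * (1 / 2) ^ n) < \<delta>" "(1 / 2) ^ n < 1 / (2 * real (Suc j))" "j + 3 \<le> n"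
    by (elim exE conjE)
  define h :: real where "h = 1 / 2 ^ n"
  define K where "K = n * 2 ^ n"
  have h: "0 < h" "h \<le> 1 / (2 * real (Suc j))" using n(2) by (auto simp: h_def power_one_over)
  have Kh: "real K * h = real n" by (simp add: K_def h_def)
  have KQ: "real K * (Q * h)\<^sup>2 \<le> \<delta>"
  proof -
    have "real K * (Q * h)\<^sup>2 = (real K * h) * (Q\<^sup>2 * h)" by (simp add: power2_eq_square mult_ac)
    also have "\<dots> = Q\<^sup>2 * (real n * (1 / 2) ^ n)" unfolding Kh by (simp add: h_def power_one_over mult_ac)
    finally show ?thesis using n(1) by simp
  qed
  define Z where "Z = {zs. length zs = Suc K \<and> step_path h K (\<lambda>k. Some (zs ! k)) \<in> inner_part U j}"
  define G where "G zs = {\<omega>\<in>space M'. \<forall>k\<le>K. Y (real k * h) \<omega> = Some (zs ! k)}" for zs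
  have G: "G zs \<in> events" "prob (G zs) = of_bool (zs ! 0 = x) * (\<Prod>k<K. pmf (P' h (Some (zs ! k))) (Some (zs ! Suc k)))" for zs
  proof -
    have *: "prob (G zs) = of_bool (Some (zs ! 0) = Some x) * (\<Prod>k<K. pmf (P' h (Some (zs ! k))) (Some (zs ! Suc k)))
      \<and> G zs \<in> past M' UNIV Y (real K * h)"
      unfolding G_def by (rule prob_grid) (use h in auto)
    then show "prob (G zs) = of_bool (zs ! 0 = x) * (\<Prod>k<K. pmf (P' h (Some (zs ! k))) (Some (zs ! Suc k)))" by simp
    have "0 \<le> real K * h" using h by simp
    then show "G zs \<in> events" using * past_subset by blast
  qed
  have GZ: "(\<Union>zs\<in>Z. G zs) \<in> events" using G(1) by (intro sets.countable_UN'') auto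
  \<comment> \<open>Strings are taken over sites, so the cemetery has to be excluded at the grid
    times; the limit chain started at a site almost surely avoids it there.\<close>
  have not_None: "AE \<omega> in M'. \<forall>k\<in>{..K}. Y (real k * h) \<omega> \<noteq> None"
  proof (rule AE_ball_countable[THEN iffD2], simp, rule ballI)
    fix k
    have kh: "0 \<le> real k * h" using h by simp
    have "prob {\<omega>\<in>space M'. Y (real k * h) \<omega> = None} = 0"
      using prob_X[OF kh UNIV_I, of None] limit_semigroup_None[OF P' kh] by simp
    then show "AE \<omega> in M'. Y (real k * h) \<omega> \<noteq> None"
      using Y_event[OF kh, of None] by (intro AE_I[where N = "{\<omega>\<in>space M'. Y (real k * h) \<omega> = None}"]) (auto simp: emeasure_eq_measure)
  qed
  have "prob (A j) \<le> prob (\<Union>zs\<in>Z. G zs)"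
  proof (rule finite_measure_mono_AE[OF _ GZ])
    show "AE \<omega> in M'. \<omega> \<in> A j \<longrightarrow> \<omega> \<in> (\<Union>zs\<in>Z. G zs)"
      using not_None AE_space
    proof eventually_elim
      case (elim \<omega>)
      show ?case
      proof
        assume "\<omega> \<in> A j"
        then have a: "approx_path n (\<lambda>t. Y t \<omega>) \<in> inner_part U j" using n(3) by (simp add: A_def)
        define zs where "zs = map (\<lambda>k. the (Y (real k * h) \<omega>)) [0..<Suc K]"
        have zs: "Y (real k * h) \<omega> = Some (zs ! k)" if "k \<le> K" for k
        proof -
          have "zs ! k = the (Y (real k * h) \<omega>)" using that by (simp add: zs_def nth_map_upt del: upt_Suc)
          moreover have "Y (real k * h) \<omega> \<noteq> None" using elim(1) that by simp
          ultimately show ?thesis by simp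
        qed
        have "approx_path n (\<lambda>t. Y t \<omega>) = step_path h K (\<lambda>k. Some (zs ! k))"
          unfolding approx_path_def h_def[symmetric] K_def[symmetric] by (rule step_path_cong) (rule zs)
        then have "zs \<in> Z" using a by (simp add: Z_def zs_def)
        moreover have "\<omega> \<in> G zs" using zs elim(2) by (simp add: G_def)
        ultimately show "\<omega> \<in> (\<Union>zs\<in>Z. G zs)" by blast
      qed
    qed
  qed
  then have Zp: "prob (p -` U \<inter> space M') - \<delta> / 2 < prob (\<Union>zs\<in>Z. G zs)" using j by simp
  \<comment> \<open>Finite pieces exhaust the countable set of strings, which allows the limit in
    \<open>N\<close> to be taken inside the sum over \<open>F\<close> later.\<close>
  define F where "F i = Z \<inter> (from_nat :: nat \<Rightarrow> 'v list) ` {..i}" for i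
  have F_fin: "finite (F i)" for i by (simp add: F_def)
  have "(\<Union>i. \<Union>zs\<in>F i. G zs) = (\<Union>zs\<in>Z. G zs)"
  proof
    show "(\<Union>zs\<in>Z. G zs) \<subseteq> (\<Union>i. \<Union>zs\<in>F i. G zs)"
    proof
      fix \<omega> assume "\<omega> \<in> (\<Union>zs\<in>Z. G zs)"
      then obtain zs where zs: "zs \<in> Z" "\<omega> \<in> G zs" by blast
      have "zs \<in> from_nat ` {..to_nat zs}" by (rule image_eqI[of _ _ "to_nat zs"]) auto
      then have "zs \<in> F (to_nat zs)" using zs by (simp add: F_def)
      then show "\<omega> \<in> (\<Union>i. \<Union>zs\<in>F i. G zs)" using zs by blast
    qed
  qed (auto simp: F_def)
  moreover have "(\<lambda>i. prob (\<Union>zs\<in>F i. G zs)) \<longlonglongrightarrow> prob (\<Union>i. \<Union>zs\<in>F i. G zs)"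
  proof (rule finite_Lim_measure_incseq)
    show "range (\<lambda>i. \<Union>zs\<in>F i. G zs) \<subseteq> events" using G(1) F_fin by (auto intro!: sets.finite_UN)
    show "incseq (\<lambda>i. \<Union>zs\<in>F i. G zs)" unfolding incseq_def F_def by fastforce
  qed
  ultimately have "\<forall>\<^sub>F i in sequentially. prob (p -` U \<inter> space M') - \<delta> / 2 < prob (\<Union>zs\<in>F i. G zs)"
    using Zp by (intro order_tendstoD) auto
  then obtain i where i: "prob (p -` U \<inter> space M') - \<delta> / 2 < prob (\<Union>zs\<in>F i. G zs)"
    using eventually_happens'[OF sequentially_bot] by blast
  have "disjoint_family_on G (F i)"
    unfolding disjoint_family_on_def
  proof (intro ballI impI)
    fix zs zs' assume zs: "zs \<in> F i" "zs' \<in> F i" "zs \<noteq> zs'"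
    then have "length zs = Suc K" "length zs' = Suc K" by (auto simp: F_def Z_def)
    then obtain k where "k < Suc K" "zs ! k \<noteq> zs' ! k" using zs(3) by (rule nth_differ)
    then show "G zs \<inter> G zs' = {}" by (auto simp: G_def less_Suc_eq_le)
  qed
  then have "prob (\<Union>zs\<in>F i. G zs) = (\<Sum>zs\<in>F i. prob (G zs))"
    by (rule finite_measure_finite_Union[OF F_fin, rotated]) (use G(1) in blast)
  then have "measure (path_law M' Y) U - \<delta> \<le> (\<Sum>zs\<in>F i. of_bool (zs ! 0 = x) * (\<Prod>k<K. pmf (P' h (Some (zs ! k))) (Some (zs ! Suc k))))"
    unfolding law G(2)[symmetric] using i \<delta> by simp
  moreover have "\<forall>zs\<in>F i. length zs = Suc K \<and> step_path h K (\<lambda>k. Some (zs ! k)) \<in> inner_part U j"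
    by (auto simp: F_def Z_def)
  moreover have "real j + 3 \<le> real K * h" unfolding Kh using n(3) by simp
  ultimately show ?thesis using h KQ F_fin by blast
qed

end

lemma site_weights_exist:
  assumes "uniformly_locally_finite E" "admissible_weights E c \<alpha>"
  shows "\<exists>d cm am. site_weights c \<alpha> d cm am"
proof -
  have w: "\<forall>x y. c x y = c y x" "\<forall>x y. if {x, y} \<in> E then c x y > 0 else c x y = 0" "\<forall>x. 0 < \<alpha> x"
    by (insert assms(2)[unfolded admissible_weights_def], (elim conjE, assumption)+)
  note sym = w(1)[rule_format] and pos = w(2)[THEN spec, THEN spec] and \<alpha> = w(3)[rule_format]
  have bdd: "bdd_above (range (\<lambda>(x, y). c x y))" "bdd_above (range \<alpha>)"
    by (insert assms(2)[unfolded admissible_weights_def], (elim conjE, assumption)+)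
  have c: "0 \<le> c x y" "c x y \<noteq> 0 \<longleftrightarrow> {x, y} \<in> E" for x y
    using pos[of x y] by (auto split: if_splits)
  have nb: "{y. c x y \<noteq> 0} = nbrs E x" for x using c(2) by (simp add: nbrs_def)
  obtain d where d: "\<forall>x. finite (nbrs E x) \<and> card (nbrs E x) \<le> d"
    using assms(1) by (auto simp only: uniformly_locally_finite_def)
  obtain cm where cm: "\<forall>z\<in>range (\<lambda>(x, y). c x y). z \<le> cm"
    using bdd(1) by (auto simp only: bdd_above_def)
  have "c x y \<le> cm" for x y
    using bspec[OF cm, OF rangeI[of _ "(x, y)"]] by simp
  moreover obtain am where am: "\<forall>z\<in>range \<alpha>. z \<le> am"
    using bdd(2) by (auto simp only: bdd_above_def)
  moreover have "0 \<le> \<alpha> x" "\<alpha> x \<le> am" for x using \<alpha>[of x] am by auto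
  ultimately have "site_weights c \<alpha> d cm am"
    unfolding site_weights_def nb using d sym c(1) by simp
  then show ?thesis by blast
qed

text \<open>For N \<ge> 3 the logarithm is at least 1, so the given null sequence dominates.\<close>

lemma tendsto_mult_of_ln:
  assumes \<epsilon>: "\<And>N. N > 0 \<Longrightarrow> \<epsilon> N > 0" and lim: "(\<lambda>N. \<epsilon> N * real N * ln (real N)) \<longlonglongrightarrow> 0"
  shows "(\<lambda>N. \<epsilon> N * real N) \<longlonglongrightarrow> 0"
proof (rule tendsto_sandwich[OF _ _ tendsto_const lim])
  show "\<forall>\<^sub>F N in sequentially. 0 \<le> \<epsilon> N * real N"
    using eventually_gt_at_top[of 0] by eventually_elim (use \<epsilon> in \<open>simp add: less_imp_le\<close>)
  show "\<forall>\<^sub>F N in sequentially. \<epsilon> N * real N \<le> \<epsilon> N * real N * ln (real N)"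
    using eventually_ge_at_top[of 3]
  proof eventually_elim
    case (elim N)
    have "exp 1 \<le> real N" using exp_le elim by linarith
    then have "1 \<le> ln (real N)" using elim by (subst ln_ge_iff) auto
    moreover have "0 \<le> \<epsilon> N * real N" using \<epsilon>[of N] elim by simp
    ultimately show ?case using mult_left_mono[of 1 "ln (real N)" "\<epsilon> N * real N"] by simp
  qed
qed

theorem theorem1p9:
  fixes E :: "'v::countable set set"
    and c :: "'v \<Rightarrow> 'v \<Rightarrow> real" and \<alpha> :: "'v \<Rightarrow> real" and \<epsilon> :: "nat \<Rightarrow> real"
    and x :: 'v
    and M :: "nat \<Rightarrow> 'w measure" and \<eta> :: "nat \<Rightarrow> real \<Rightarrow> 'w \<Rightarrow> 'v \<Rightarrow> nat"
    and M' :: "'u measure" and Y :: "real \<Rightarrow> 'u \<Rightarrow> 'v option"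
  assumes "connected_graph E" and "uniformly_locally_finite E"
    and "admissible_weights E c \<alpha>"
    and "\<And>N. N > 0 \<Longrightarrow> \<epsilon> N > 0"
    and "(\<lambda>N. \<epsilon> N * real N * ln (real N)) \<longlonglongrightarrow> 0"
    and "\<And>N. N > 0 \<Longrightarrow>
           markov_chain (M N) (configurations N) (inclusion_generator c \<alpha> (\<epsilon> N)) (\<eta> N) (condensate N x)"
    and "markov_chain M' UNIV (limit_generator c \<alpha>) Y (Some x)"
  shows "weakly_converges
           (\<lambda>N. path_law (M N) (\<lambda>t \<omega>. order_process N (\<lambda>s. \<eta> N s \<omega>) t)) (path_law M' Y)
       \<and> (\<forall>T::real. T > 0 \<longrightarrow>
            (\<lambda>N. \<integral>\<omega>. (LINT t:{0..T}|lborel. indicator (- condensates N) (\<eta> N t \<omega>)) \<partial>M N)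
              \<longlonglongrightarrow> (0::real))"
proof -
  obtain d cm am where "site_weights c \<alpha> d cm am" using site_weights_exist[OF assms(2,3)] by blast
  then interpret site_weights c \<alpha> d cm am .
  obtain P' where P': "markov_semigroup UNIV P'" "has_generator UNIV P' (limit_generator c \<alpha>)" and real': "realises M' UNIV P' Y (Some x)"
    using markov_chain_realises[OF assms(7)] by blast
  \<comment> \<open>One semigroup is fixed for each \<open>N\<close>, so that its transition
    probabilities form a sequence whose limit can be stated.\<close>
  define PN where "PN N = (SOME P. markov_semigroup (configurations N) P \<and> has_generator (configurations N) P (inclusion_generator c \<alpha> (\<epsilon> N))
      \<and> realises (M N) (configurations N) P (\<eta> N) (condensate N x))" for N
  have PN: "markov_semigroup (configurations N) (PN N)" "has_generator (configurations N) (PN N) (inclusion_generator c \<alpha> (\<epsilon> N))"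
    "realises (M N) (configurations N) (PN N) (\<eta> N) (condensate N x)" if "0 < N" for N
    using someI_ex[OF markov_chain_realises[OF assms(6)[OF that]]] unfolding PN_def by auto
  note \<epsilon> = assms(4)
  have \<epsilon>N: "(\<lambda>N. \<epsilon> N * real N) \<longlonglongrightarrow> 0" by (rule tendsto_mult_of_ln[OF assms(4,5)])
  have small: "(\<lambda>N. a * (2 * (\<epsilon> N * real N) * b)) \<longlonglongrightarrow> 0" for a b
  proof -
    have "(\<lambda>N. a * (2 * (\<epsilon> N * real N) * b)) \<longlonglongrightarrow> a * (2 * 0 * b)"
      by (intro tendsto_mult tendsto_const \<epsilon>N)
    then show ?thesis by simp
  qed
  have trans: "(\<lambda>N. pmf (PN N h (condensate N y)) (condensate N z)) \<longlonglongrightarrow> pmf (P' h (Some y)) (Some z)" if h: "0 \<le> h" for h y z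
  proof (rule LIM_zero_cancel, rule Lim_null_comparison)
    show "\<forall>\<^sub>F N in sequentially. norm (pmf (PN N h (condensate N y)) (condensate N z) - pmf (P' h (Some y)) (Some z))
        \<le> 1 * (2 * (\<epsilon> N * real N) * non_condensation_const h)"
      using eventually_ge_at_top[of 2]
    proof eventually_elim
      case (elim N)
      then have "0 < N" by simp
      show ?case using transition_estimate[OF PN(1,2)[OF \<open>0 < N\<close>] P' \<epsilon>[OF \<open>0 < N\<close>] h elim, of y z] by simp
    qed
  qed (rule small)
  show ?thesis
  proof (intro conjI allI impI)
    show "weakly_converges (\<lambda>N. path_law (M N) (\<lambda>t \<omega>. order_process N (\<lambda>s. \<eta> N s \<omega>) t)) (path_law M' Y)"
    proof (rule weakly_convergesI)
      fix N :: nat assume N: "0 < N"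
      interpret particle_process "configurations N" "PN N" "inclusion_generator c \<alpha> (\<epsilon> N)" inclusion_pairs "inclusion_rate (\<epsilon> N)"
        "\<lambda>\<eta> (x, y). move \<eta> x y" "real N * (real d * (cm * (am + real N / \<epsilon> N)))" "M N" "\<eta> N" "condensate N x" N
        by (rule inclusion_particle_process[OF PN(1,2)[OF N] \<epsilon>[OF N] N PN(3)[OF N]])
      show "prob_space (path_law (M N) (\<lambda>t \<omega>. order_process N (\<lambda>s. \<eta> N s \<omega>) t))
        \<and> sets (path_law (M N) (\<lambda>t \<omega>. order_process N (\<lambda>s. \<eta> N s \<omega>) t)) = sets borel"
        unfolding path_law_def using prob_space_distr[OF Y_measurable] by simp
    next
      interpret B: chain_realisation UNIV P' "limit_generator c \<alpha>" "\<lambda>z. case z of None \<Rightarrow> {} | Some x \<Rightarrow> nb x"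
        "\<lambda>z y. case z of None \<Rightarrow> 0 | Some x \<Rightarrow> c x y * \<alpha> y" "\<lambda>z y. Some y" Q M' Y "Some x"
        by (rule chain_realisationI[OF limit_chain[OF P'] real'])
      have "{\<omega>\<in>space M'. cadlag (\<lambda>t. discrete (Y t \<omega>))} = space M'" using B.X_cadlag by auto
      moreover have "{\<omega>\<in>space M'. Y t \<omega> = z} \<in> sets M'" if "0 \<le> t" for t z using B.X_event[OF that, of "{z}"] by simp
      ultimately have "(\<lambda>\<omega>. skorokhod_of (\<lambda>t. discrete (Y t \<omega>))) \<in> borel_measurable M'"
        using skorokhod_of_measurable[of M' Y] by simp
      then show "prob_space (path_law M' Y)" unfolding path_law_def by (rule B.prob_space_distr)
      show "sets (path_law M' Y) = sets borel" by (simp add: path_law_def)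
    next
      fix U :: "'v option discrete skorokhod set" and \<delta> :: real
      assume U: "open U" and \<delta>: "0 < \<delta>"
      \<comment> \<open>Four errors of at most \<delta> / 4 each: restriction to the strings in
        \<open>F\<close>, two changes in one cell, convergence of the transition probabilities, and
        time spent outside the condensates. The first two are settled here, independently of
        \<open>N\<close>.\<close>
      obtain j h K F where *: "0 < h" "h \<le> 1 / (2 * real (Suc j))" "real j + 3 \<le> real K * h" "real K * (Q * h)\<^sup>2 \<le> \<delta> / 4" "finite F"
        "\<forall>zs\<in>F. length zs = Suc K \<and> step_path h K (\<lambda>k. Some (zs ! k)) \<in> inner_part U j"
        "measure (path_law M' Y) U - \<delta> / 4 \<le> (\<Sum>zs\<in>F. of_bool (zs ! 0 = x) * (\<Prod>k<K. pmf (P' h (Some (zs ! k))) (Some (zs ! Suc k))))"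
        using limit_path_approx[OF P' real' U, of "\<delta> / 4"] \<delta> by auto
      define \<tau> where "\<tau> = real K * h"
      let ?s' = "\<Sum>zs\<in>F. of_bool (zs ! 0 = x) * (\<Prod>k<K. pmf (P' h (Some (zs ! k))) (Some (zs ! Suc k)))"
      let ?s = "\<lambda>N. \<Sum>zs\<in>F. of_bool (zs ! 0 = x) * (\<Prod>k<K. pmf (PN N h (condensate N (zs ! k))) (condensate N (zs ! Suc k)))"
      let ?r = "\<lambda>N. 2 * real (Suc j) * (\<tau> * (2 * (\<epsilon> N * real N) * non_condensation_const \<tau>))"
      have "?s \<longlonglongrightarrow> ?s'"
        using *(1) by (intro tendsto_sum tendsto_mult tendsto_const tendsto_prod trans) simp
      then have e1: "\<forall>\<^sub>F N in sequentially. ?s' - \<delta> / 4 < ?s N" by (rule order_tendstoD(1)) (use \<delta> in simp)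
      have "?r \<longlonglongrightarrow> 0" using small[of "2 * real (Suc j) * \<tau>" "non_condensation_const \<tau>"] by (simp only: mult.assoc)
      then have e2: "\<forall>\<^sub>F N in sequentially. ?r N < \<delta> / 4" by (rule order_tendstoD(2)) (use \<delta> in simp)
      show "\<forall>\<^sub>F N in sequentially. measure (path_law M' Y) U - \<delta> \<le> measure (path_law (M N) (\<lambda>t \<omega>. order_process N (\<lambda>s. \<eta> N s \<omega>) t)) U"
        using e1 e2 eventually_ge_at_top[of 2]
      proof eventually_elim
        case (elim N)
        then have N: "0 < N" by simp
        have "?s N - real K * (Q * h)\<^sup>2 - ?r N \<le> measure (path_law (M N) (\<lambda>t \<omega>. order_process N (\<lambda>s. \<eta> N s \<omega>) t)) U"
          by (rule order_process_estimate[OF PN(1,2)[OF N] \<epsilon>[OF N] elim(3) PN(3)[OF N] U *(1,2) \<tau>_def[symmetric] _ *(5)])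
            (use * in \<open>auto simp: \<tau>_def\<close>)
        then show ?case using elim(1,2) *(4,7) by linarith
      qed
    qed
  next
    fix T :: real assume T: "T > 0"
    show "(\<lambda>N. \<integral>\<omega>. (LINT t:{0..T}|lborel. indicator (- condensates N) (\<eta> N t \<omega>)) \<partial>M N) \<longlonglongrightarrow> (0::real)"
      unfolding LINT_indicator_eq_occ
    proof (rule tendsto_sandwich[OF _ _ tendsto_const small])
      show "\<forall>\<^sub>F N in sequentially. 0 \<le> (\<integral>\<omega>. occ (- condensates N) (\<lambda>t. \<eta> N t \<omega>) T \<partial>M N)"
        by (intro always_eventually allI integral_nonneg) (simp add: occ_def)
      show "\<forall>\<^sub>F N in sequentially. (\<integral>\<omega>. occ (- condensates N) (\<lambda>t. \<eta> N t \<omega>) T \<partial>M N) \<le> T * (2 * (\<epsilon> N * real N) * non_condensation_const T)"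
        using eventually_ge_at_top[of 2]
      proof eventually_elim
        case (elim N)
        then have N: "0 < N" by simp
        show ?case using expected_time_outside_le(2)[OF PN(1,2)[OF N] \<epsilon>[OF N] elim PN(3)[OF N], of T] T by simp
      qed
    qed
  qed
qed

end
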